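(* Consider a sequence (indexed by $N\to\infty$) of non-Gaussian mixed linear models as described in the context. Suppose that (i) $\sigma_t^2>0$ and $0<\operatorname{var}(\alpha_{t1}^2)<\infty$ for $0\le t\le s$; (ii) $|x_i|$ and $\|z_{it}\|_1$, $1\le t\le s$, $1\le i\le N$, are bounded (uniformly in $i,N$); (iii) there is a sequence of diagonal matrices $G=\operatorname{diag}(g_0,\dots,g_s)$ with $g_j>0$, $0\le j\le s$, such that $G^{-1}\mathcal GG^{-1}$ is bounded from above as well as from below, and $\lambda_{\min}(X'V^{-1}X)\to\infty$; (iv) for $0\le j,k\le s$, $(g_jg_k)^{-1}\sum_{l=1}^Lh_l|c_{j,k,l}|$ is bounded and $(g_jg_k)^{-2}\sum_{l_1,l_2=1}^Lh_{l_1,l_2}|c_{j,k,l_1}c_{j,k,l_2}|\to0$; (v) for $0\le j,k\le s$, $(g_jg_k)^{-1}g_{j,k}(\delta)\to0$ and $(g_jg_k)^{-1}\sum_{l=1}^Lh_ld_{j,k,l}(\delta)\to0$, uniformly in $N$, as $\delta\to0$. Then the POQUIM $\hat{\mathcal I}_1$ and the POQUIM estimator $\hat\Sigma_{\mathrm R}$ are both consistent, i.e. $\mathcal I_1^{-1/2}\hat{\mathcal I}_1\mathcal I_1^{-1/2}\to I_{s+1}$ and $\Sigma_{\mathrm R}^{-1/2}\hat\Sigma_{\mathrm R}\Sigma_{\mathrm R}^{-1/2}\to I_{s+1}$ in probability.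
   Context: Model (for each $N$): $y=X\beta+Z_1\alpha_1+\cdots+Z_s\alpha_s+\varepsilon$, where $y$ is $N\times1$, $X$ ($N\times p$, rank $p$) and $Z_t$ ($N\times m_t$) are known real matrices, $\beta\in\mathbb R^p$ is unknown, $\alpha_t$ is an $m_t\times1$ vector of random effects, $\varepsilon$ an $N\times1$ vector of errors. The vectors $\alpha_1,\dots,\alpha_s,\varepsilon$ are independent; the components of $\alpha_t$ are i.i.d. with mean $0$, variance $\sigma_t^2$; the components of $\varepsilon$ are i.i.d. with mean $0$, variance $\sigma_0^2$. No normality is assumed. Put $\alpha_0=\varepsilon$, $Z_0=I$ ($N\times N$ identity), $m_0=N$; $\lambda=\sigma_0^2$, $\gamma_t=\sigma_t^2/\sigma_0^2$, $\gamma_0=1$; $\theta=(\theta_0,\dots,\theta_s)'=(\lambda,\gamma_1,\dots,\gamma_s)'$, with parameter space $\Theta=\{\lambda>0,\gamma_t\ge0\}$; $u=y-X\beta$. The number $s$, the true $\theta$ and the component distributions of $\alpha_0,\dots,\alpha_s$ do not depend on $N$; the other quantities (matrices, dimensions, $L$, $g_j$, etc.) may depend on $N$, the subscript $N$ being suppressed. Notation. $x_i'$ is the $i$th row of $X$; $z_{it}'$ is the $i$th row of $Z_t$. $|\cdot|$ is the Euclidean norm of a vector (cardinality for sets), $\|a\|_1=\sum_l|a_l|$, $a_1\cdot a_2\cdots a_k=\sum_la_{1l}\cdots a_{kl}$. For matrices $\|M\|=\{\lambda_{\max}(M'M)\}^{1/2}$; a sequence of matrices $M$ is bounded from above if $\|M\|$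 is bounded, and bounded from below if $\|M^{-1}\|$ is bounded. An estimator $\hat M$ of a positive definite matrix $M$ is consistent if $M^{-1/2}\hat MM^{-1/2}-I\to0$ in probability. "With $\theta$ replaced by $\tilde\theta$" means the same formula evaluated at $\tilde\theta$. $V=\lambda(I+\gamma_1Z_1Z_1'+\cdots+\gamma_sZ_sZ_s')$, $P=V^{-1}-V^{-1}X(X'V^{-1}X)^{-1}X'V^{-1}$. Gaussian restricted log-likelihood: $l_{\mathrm R}(\theta)=c-\frac12\{\log|T'VT|+y'Py\}$ ($|\cdot|$ here determinant), $T$ any $N\times(N-p)$ matrix of rank $N-p$ with $T'X=0$. $\partial l_{\mathrm R}/\partial\theta_j=u'B_ju-\mathrm E(u'B_ju)$ with $B_0=(2\lambda)^{-1}P$, $B_j=(\lambda/2)PZ_jZ_j'P$ ($1\le j\le s$); $B_{j,i_1,i_2}$ is the $(i_1,i_2)$ entry of $B_j$. $\mathcal I_1=\operatorname{Var}(\partial l_{\mathrm R}/\partial\theta)$ and $\mathcal I_2=\mathrm E(\partial^2l_{\mathrm R}/\partial\theta\partial\theta')$ at the true parameters and under the true distribution; $\Sigma_{\mathrm R}=\mathcal I_2^{-1}\mathcal I_1\mathcal I_2^{-1}$. $\mathcal G=(\mathcal G_{j,k})_{0\le j,k\le s}$, $\mathcal G_{j,k}=2\operatorname{tr}(B_jVB_kV)$; one has $\mathcal I_2=-\mathcal G$, which depends only on $\theta$ (and the design). $\kappa_t=\mathrm E(\alpha_{t1}^4)-3\sigma_t^4$; $\Gamma(i_1,i_2)=\sum_{t=0}^s\gamma_t(z_{i_1t}\cdot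 z_{i_2t})$. $f(i_1,\dots,i_4)=\sum_{t=0}^s\kappa_t\,z_{i_1t}\cdot z_{i_2t}\cdot z_{i_3t}\cdot z_{i_4t}$ is regarded as a linear function of $\kappa=(\kappa_t)_{0\le t\le s}$, i.e. identified with its coefficient vector; $f_1,\dots,f_L$ are the distinct nonzero functions arising for $(i_1,\dots,i_4)\in\{1,\dots,N\}^4$. $h_l=|\{(i_1,\dots,i_4):f(i_1,\dots,i_4)=f_l\}|$ and $$c_{j,k,l}=\frac1{h_l}\sum_{f(i_1,\dots,i_4)=f_l}B_{j,i_1,i_2}B_{k,i_3,i_4},\qquad c_{j,k}(i_1,\dots,i_4)=c_{j,k,l}\ \text{ if } f(i_1,\dots,i_4)=f_l.$$ Let $w_i'=(z_{i0}',z_{i1}',\dots,z_{is}')$ and let $d_i$ be the $0/1$ vector of the same dimension whose components equal $1$ exactly where $w_i$ is nonzero. $h_{l_1,l_2}$ is the number of $(i_1,\dots,i_8)$ with $f(i_1,\dots,i_4)=f_{l_1}$, $f(i_5,\dots,i_8)=f_{l_2}$ and $(d_{i_1}+\cdots+d_{i_4})\cdot(d_{i_5}+\cdots+d_{i_8})\ne0$. For $\delta>0$, $g_{j,k}(\delta)=\sup_{\tilde\theta\in\Theta,|\tilde\theta-\theta|\le\delta}|\tilde{\mathcal G}_{j,k}-\mathcal G_{j,k}|$ and $d_{j,k,l}(\delta)=\sup_{\tilde\theta\in\Theta,|\tilde\theta-\theta|\le\delta}|\tilde c_{j,k,l}-c_{j,k,l}|$, where $\tilde{\mathcal G}$, $\tilde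 c_{j,k,l}$ are $\mathcal G$, $c_{j,k,l}$ with $\theta$ replaced by $\tilde\theta$. Estimators. $\hat\theta\in\Theta$ is the REML estimator: the maximizer of $l_{\mathrm R}$ over $\Theta$ for balanced data, and a sieved maximizer (maximizer over a suitable sequence of sieve subsets of $\Theta$, in the sense of Jiang, Ann. Statist. 25 (1997) 1781–1803) for unbalanced data. By that earlier work, $\sigma_t^2>0$ ($0\le t\le s$) and the first part of (iii) guarantee $\hat\theta\to\theta$ in probability; this known consistency is to be taken as part of what "REML estimator" means here. $\hat V$, $\hat c_{j,k}$, $\hat B_j$, $\hat\Gamma$, etc. denote the quantities with $\theta$ replaced by $\hat\theta$; $\hat\beta=(X'\hat V^{-1}X)^{-1}X'\hat V^{-1}y$; $\hat u_i=y_i-x_i'\hat\beta$. The POQUIM is $\hat{\mathcal I}_1=(\hat{\mathcal I}_{1,1,jk}+\hat{\mathcal I}_{1,2,jk})_{0\le j,k\le s}$ with $$\hat{\mathcal I}_{1,1,jk}=\sum_{f(i_1,\dots,i_4)\ne0}\hat c_{j,k}(i_1,\dots,i_4)\hat u_{i_1}\hat u_{i_2}\hat u_{i_3}\hat u_{i_4},$$ $$\hat{\mathcal I}_{1,2,jk}=2\operatorname{tr}(\hat B_j\hat V\hat B_k\hat V)-3\hat\lambda^2\sum_{f(i_1,\dots,i_4)\ne0}\hat c_{j,k}(i_1,\dots,i_4)\hat\Gamma(i_1,i_3)\hat\Gamma(i_2,i_4).$$ $\hat{\mathcal I}_2$ is $\mathcal I_2$ with $\theta$ replaced by $\hat\theta$,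 and the POQUIM estimator of $\Sigma_{\mathrm R}$ is $\hat\Sigma_{\mathrm R}=\hat{\mathcal I}_2^{-1}\hat{\mathcal I}_1\hat{\mathcal I}_2^{-1}$ (defined when $\hat{\mathcal I}_2$ is invertible, arbitrarily otherwise). *)

theory Defs
  imports
    "HOL-Probability.Probability"
    "Jordan_Normal_Form.Determinant"
    "Jordan_Normal_Form.Char_Poly"
    "Jordan_Normal_Form.Gauss_Jordan_Elimination"
    "Jordan_Normal_Form.DL_Rank"
begin

(* The sample size and the numbers of effects vary along the sequence of models, so all matrices
   and vectors are those of Jordan_Normal_Form; the homonymous names and the clashing notation
   of HOL-Analysis are switched off. *)
unbundle no vec_syntax and no inner_syntax
hide_const (open) Determinants.det Finite_Cartesian_Product.vec Finite_Cartesian_Product.mat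
  Finite_Cartesian_Product.row Finite_Cartesian_Product.column Cartesian_Space.rank

section \<open>Matrices\<close>

definition vec_norm2 :: "real vec \<Rightarrow> real" where
  "vec_norm2 v = sqrt (v \<bullet> v)"

definition vec_norm1 :: "real vec \<Rightarrow> real" where
  "vec_norm1 v = (\<Sum>l<dim_vec v. \<bar>v $ l\<bar>)"

definition mat_trace :: "real mat \<Rightarrow> real" where
  "mat_trace A = (\<Sum>i<dim_row A. A $$ (i, i))"

(* Unspecified if A is singular. *)
definition mat_inv :: "real mat \<Rightarrow> real mat" where
  "mat_inv A = the (mat_inverse A)"

(* Only used for real symmetric matrices of positive dimension, where the set of (real)
   eigenvalues is finite and nonempty. *)
definition lambda_max :: "real mat \<Rightarrow> real" where
  "lambda_max A = Max {k. eigenvalue A k}"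

definition lambda_min :: "real mat \<Rightarrow> real" where
  "lambda_min A = Min {k. eigenvalue A k}"

definition mat_norm :: "real mat \<Rightarrow> real" where
  "mat_norm A = sqrt (lambda_max (transpose_mat A * A))"

definition bounded_from_above :: "(nat \<Rightarrow> real mat) \<Rightarrow> bool" where
  "bounded_from_above A \<longleftrightarrow> Bseq (\<lambda>n. mat_norm (A n))"

definition bounded_from_below :: "(nat \<Rightarrow> real mat) \<Rightarrow> bool" where
  "bounded_from_below A \<longleftrightarrow> (\<forall>n. invertible_mat (A n)) \<and> Bseq (\<lambda>n. mat_norm (mat_inv (A n)))"

definition positive_definite :: "real mat \<Rightarrow> bool" where
  "positive_definite A \<longleftrightarrow> square_mat A \<and> transpose_mat A = A \<and>
     (\<forall>v \<in> carrier_vec (dim_row A). v \<noteq> 0\<^sub>v (dim_row A) \<longrightarrow> v \<bullet> (A *\<^sub>v v) > 0)"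

definition mat_inv_sqrt :: "real mat \<Rightarrow> real mat" where
  "mat_inv_sqrt A = (THE B. dim_row B = dim_row A \<and> positive_definite B \<and> B * B = mat_inv A)"

section \<open>Convergence in probability\<close>

(* The n-th model may live on its own probability space M n.  Outer probability coincides with
   probability on measurable events; without it, non-measurable events would
   have measure 0 by convention.  Measurability of the estimators is thus not needed. *)
definition prob_tends_to_0 :: "(nat \<Rightarrow> 'a measure) \<Rightarrow> (nat \<Rightarrow> 'a \<Rightarrow> bool) \<Rightarrow> bool" where
  "prob_tends_to_0 M E \<longleftrightarrow> (\<lambda>n. outer_measure_of (M n) {\<omega> \<in> space (M n). E n \<omega>}) \<longlonglongrightarrow> 0"

definition tends_to_0_in_prob :: "(nat \<Rightarrow> 'a measure) \<Rightarrow> (nat \<Rightarrow> 'a \<Rightarrow> real) \<Rightarrow> bool" where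
  "tends_to_0_in_prob M R \<longleftrightarrow> (\<forall>\<epsilon>>0. prob_tends_to_0 M (\<lambda>n \<omega>. \<bar>R n \<omega>\<bar> > \<epsilon>))"

(* Positive definiteness is part of the notion, so that mat_inv_sqrt is meaningful. *)
definition consistent_estimator ::
  "(nat \<Rightarrow> 'a measure) \<Rightarrow> (nat \<Rightarrow> real mat) \<Rightarrow> (nat \<Rightarrow> 'a \<Rightarrow> real mat) \<Rightarrow> bool" where
  "consistent_estimator M A Ahat \<longleftrightarrow>
     (\<forall>n. positive_definite (A n)) \<and>
     tends_to_0_in_prob M (\<lambda>n \<omega>.
       mat_norm (mat_inv_sqrt (A n) * Ahat n \<omega> * mat_inv_sqrt (A n) - 1\<^sub>m (dim_row (A n))))"

section \<open>The mixed linear model\<close>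

(* y = X beta + Z_1 alpha_1 + ... + Z_s alpha_s + epsilon: s, X, and t |-> Z_t for 1 <= t <= s.
   Observations and components of vectors are numbered from 0. *)
record lmm_design =
  nranef :: nat
  Xmat :: "real mat"
  ranef_mat :: "nat \<Rightarrow> real mat"

definition nobs :: "lmm_design \<Rightarrow> nat" where
  "nobs d = dim_row (Xmat d)"

definition nfix :: "lmm_design \<Rightarrow> nat" where
  "nfix d = dim_col (Xmat d)"

definition Zmat :: "lmm_design \<Rightarrow> nat \<Rightarrow> real mat" where
  "Zmat d t = (if t = 0 then 1\<^sub>m (nobs d) else ranef_mat d t)"

definition nlev :: "lmm_design \<Rightarrow> nat \<Rightarrow> nat" where
  "nlev d t = dim_col (Zmat d t)"

definition valid_design :: "lmm_design \<Rightarrow> bool" where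
  "valid_design d \<longleftrightarrow> nfix d \<ge> 1 \<and> vec_space.rank (nobs d) (Xmat d) = nfix d \<and>
     (\<forall>t\<in>{1..nranef d}. dim_row (ranef_mat d t) = nobs d)"

(* alpha t l is component l of the vector alpha_t, with alpha_0 = epsilon. *)
definition response :: "lmm_design \<Rightarrow> real vec \<Rightarrow> (nat \<Rightarrow> nat \<Rightarrow> real) \<Rightarrow> real vec" where
  "response d \<beta> \<alpha> = vec (nobs d) (\<lambda>i.
     (Xmat d *\<^sub>v \<beta>) $ i + (\<Sum>t\<le>nranef d. (Zmat d t *\<^sub>v vec (nlev d t) (\<alpha> t)) $ i))"

(* D t is the common distribution of the components of alpha_t. *)
definition random_effects ::
  "'a measure \<Rightarrow> lmm_design \<Rightarrow> (nat \<Rightarrow> real measure) \<Rightarrow> (nat \<Rightarrow> nat \<Rightarrow> 'a \<Rightarrow> real) \<Rightarrow> bool" where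
  "random_effects M d D \<alpha> \<longleftrightarrow>
     prob_space M \<and>
     prob_space.indep_vars M (\<lambda>t. \<Pi>\<^sub>M l\<in>{..<nlev d t}. borel)
       (\<lambda>t \<omega>. \<lambda>l\<in>{..<nlev d t}. \<alpha> t l \<omega>) {..nranef d} \<and>
     (\<forall>t\<le>nranef d.
        prob_space.indep_vars M (\<lambda>l. borel) (\<alpha> t) {..<nlev d t} \<and>
        (\<forall>l<nlev d t. distr M borel (\<alpha> t l) = D t))"

definition centred_square_integrable :: "real measure \<Rightarrow> bool" where
  "centred_square_integrable D \<longleftrightarrow> prob_space D \<and> sets D = sets borel \<and>
     integrable D (\<lambda>x. x) \<and> integrable D (\<lambda>x. x\<^sup>2) \<and> (\<integral>x. x \<partial>D) = 0"

definition variance_of :: "'a measure \<Rightarrow> ('a \<Rightarrow> real) \<Rightarrow> real" where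
  "variance_of M X = (\<integral>\<omega>. (X \<omega> - (\<integral>\<omega>'. X \<omega>' \<partial>M))\<^sup>2 \<partial>M)"

definition finite_variance :: "'a measure \<Rightarrow> ('a \<Rightarrow> real) \<Rightarrow> bool" where
  "finite_variance M X \<longleftrightarrow> integrable M X \<and> integrable M (\<lambda>\<omega>. (X \<omega> - (\<integral>\<omega>'. X \<omega>' \<partial>M))\<^sup>2)"

definition covariance_of :: "'a measure \<Rightarrow> ('a \<Rightarrow> real) \<Rightarrow> ('a \<Rightarrow> real) \<Rightarrow> real" where
  "covariance_of M X Y =
     (\<integral>\<omega>. (X \<omega> - (\<integral>\<omega>'. X \<omega>' \<partial>M)) * (Y \<omega> - (\<integral>\<omega>'. Y \<omega>' \<partial>M)) \<partial>M)"

(* (lambda, gamma_1, ..., gamma_s) *)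
definition true_theta :: "nat \<Rightarrow> (nat \<Rightarrow> real measure) \<Rightarrow> real vec" where
  "true_theta s D = vec (s + 1) (\<lambda>t. if t = 0 then variance_of (D 0) (\<lambda>x. x)
     else variance_of (D t) (\<lambda>x. x) / variance_of (D 0) (\<lambda>x. x))"

definition param_space :: "nat \<Rightarrow> real vec set" where
  "param_space s = {\<theta> \<in> carrier_vec (s + 1). \<theta> $ 0 > 0 \<and> (\<forall>t\<in>{1..s}. \<theta> $ t \<ge> 0)}"

definition gam :: "real vec \<Rightarrow> nat \<Rightarrow> real" where
  "gam \<theta> t = (if t = 0 then 1 else \<theta> $ t)"

definition Vmat :: "lmm_design \<Rightarrow> real vec \<Rightarrow> real mat" where
  "Vmat d \<theta> = \<theta> $ 0 \<cdot>\<^sub>m (1\<^sub>m (nobs d) + mat (nobs d) (nobs d)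
     (\<lambda>ij. \<Sum>t=1..nranef d. \<theta> $ t * (Zmat d t * transpose_mat (Zmat d t)) $$ ij))"

definition Pmat :: "lmm_design \<Rightarrow> real vec \<Rightarrow> real mat" where
  "Pmat d \<theta> = (let Vi = mat_inv (Vmat d \<theta>); X = Xmat d in
     Vi - Vi * X * mat_inv (transpose_mat X * Vi * X) * transpose_mat X * Vi)"

definition Bmat :: "lmm_design \<Rightarrow> real vec \<Rightarrow> nat \<Rightarrow> real mat" where
  "Bmat d \<theta> j = (if j = 0 then (1 / (2 * \<theta> $ 0)) \<cdot>\<^sub>m Pmat d \<theta>
     else (\<theta> $ 0 / 2) \<cdot>\<^sub>m (Pmat d \<theta> * Zmat d j * transpose_mat (Zmat d j) * Pmat d \<theta>))"

definition Gmat :: "lmm_design \<Rightarrow> real vec \<Rightarrow> real mat" where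
  "Gmat d \<theta> = mat (nranef d + 1) (nranef d + 1)
     (\<lambda>(j, k). 2 * mat_trace (Bmat d \<theta> j * Vmat d \<theta> * Bmat d \<theta> k * Vmat d \<theta>))"

section \<open>Restricted likelihood and information\<close>

definition reml_contrast :: "lmm_design \<Rightarrow> real mat \<Rightarrow> bool" where
  "reml_contrast d T \<longleftrightarrow> T \<in> carrier_mat (nobs d) (nobs d - nfix d) \<and>
     vec_space.rank (nobs d) T = nobs d - nfix d \<and>
     transpose_mat T * Xmat d = 0\<^sub>m (nobs d - nfix d) (nfix d)"

(* c is an arbitrary constant, and another admissible T changes the function only by a constant. *)
definition reml_loglik :: "lmm_design \<Rightarrow> real \<Rightarrow> real mat \<Rightarrow> real vec \<Rightarrow> real vec \<Rightarrow> real" where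
  "reml_loglik d c T y \<theta> =
     c - 1/2 * (ln (det (transpose_mat T * Vmat d \<theta> * T)) + y \<bullet> (Pmat d \<theta> *\<^sub>v y))"

definition partial_deriv :: "nat \<Rightarrow> (real vec \<Rightarrow> real) \<Rightarrow> real vec \<Rightarrow> real" where
  "partial_deriv j F \<theta> = deriv (\<lambda>x. F (\<theta> |\<^sub>v j \<mapsto> x)) (\<theta> $ j)"

definition score_variance ::
  "'a measure \<Rightarrow> nat \<Rightarrow> ('a \<Rightarrow> real vec \<Rightarrow> real) \<Rightarrow> real vec \<Rightarrow> real mat" where
  "score_variance M s l \<theta> = mat (s + 1) (s + 1) (\<lambda>(j, k).
     covariance_of M (\<lambda>\<omega>. partial_deriv j (l \<omega>) \<theta>) (\<lambda>\<omega>. partial_deriv k (l \<omega>) \<theta>))"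

definition expected_hessian ::
  "'a measure \<Rightarrow> nat \<Rightarrow> ('a \<Rightarrow> real vec \<Rightarrow> real) \<Rightarrow> real vec \<Rightarrow> real mat" where
  "expected_hessian M s l \<theta> = mat (s + 1) (s + 1) (\<lambda>(j, k).
     \<integral>\<omega>. partial_deriv j (partial_deriv k (l \<omega>)) \<theta> \<partial>M)"

section \<open>The partially observed information\<close>

type_synonym quad = "nat \<times> nat \<times> nat \<times> nat"

definition quads :: "lmm_design \<Rightarrow> quad set" where
  "quads d = {..<nobs d} \<times> {..<nobs d} \<times> {..<nobs d} \<times> {..<nobs d}"

(* Coefficient vector of f(i_1,...,i_4) as a linear function of (kappa_0,...,kappa_s). *)
fun fcoef :: "lmm_design \<Rightarrow> quad \<Rightarrow> real vec" where
  "fcoef d (i1, i2, i3, i4) = vec (nranef d + 1) (\<lambda>t. \<Sum>l<nlev d t.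
     Zmat d t $$ (i1, l) * Zmat d t $$ (i2, l) * Zmat d t $$ (i3, l) * Zmat d t $$ (i4, l))"

(* {f_1,...,f_L}.  Objects carrying the index l of f_l are below indexed by the value f_l itself. *)
definition fvals :: "lmm_design \<Rightarrow> real vec set" where
  "fvals d = fcoef d ` quads d - {0\<^sub>v (nranef d + 1)}"

definition fclass :: "lmm_design \<Rightarrow> real vec \<Rightarrow> quad set" where
  "fclass d \<phi> = {q \<in> quads d. fcoef d q = \<phi>}"

definition hcount :: "lmm_design \<Rightarrow> real vec \<Rightarrow> nat" where
  "hcount d \<phi> = card (fclass d \<phi>)"

definition ccoef :: "lmm_design \<Rightarrow> real vec \<Rightarrow> nat \<Rightarrow> nat \<Rightarrow> real vec \<Rightarrow> real" where
  "ccoef d \<theta> j k \<phi> = 1 / real (hcount d \<phi>) *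
     (\<Sum>(i1, i2, i3, i4)\<in>fclass d \<phi>. Bmat d \<theta> j $$ (i1, i2) * Bmat d \<theta> k $$ (i3, i4))"

(* Component of d_i at position l of block t, where w_i is the concatenation of z_i0,...,z_is. *)
definition dind :: "lmm_design \<Rightarrow> nat \<Rightarrow> nat \<Rightarrow> nat \<Rightarrow> nat" where
  "dind d i t l = (if Zmat d t $$ (i, l) \<noteq> 0 then 1 else 0)"

fun dsum :: "lmm_design \<Rightarrow> quad \<Rightarrow> nat \<Rightarrow> nat \<Rightarrow> nat" where
  "dsum d (i1, i2, i3, i4) t l = dind d i1 t l + dind d i2 t l + dind d i3 t l + dind d i4 t l"

definition hcount2 :: "lmm_design \<Rightarrow> real vec \<Rightarrow> real vec \<Rightarrow> nat" where
  "hcount2 d \<phi>1 \<phi>2 = card {(q1, q2) \<in> fclass d \<phi>1 \<times> fclass d \<phi>2.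
     (\<Sum>t\<le>nranef d. \<Sum>l<nlev d t. dsum d q1 t l * dsum d q2 t l) \<noteq> 0}"

definition param_nbhd :: "nat \<Rightarrow> real vec \<Rightarrow> real \<Rightarrow> real vec set" where
  "param_nbhd s \<theta> \<delta> = {\<theta>' \<in> param_space s. vec_norm2 (\<theta>' - \<theta>) \<le> \<delta>}"

(* The suprema below may be infinite, hence meaningless as reals, for large delta; for
   delta < lambda they are over compact sets.  They are only used in the limit delta -> 0. *)
definition gdev :: "lmm_design \<Rightarrow> real vec \<Rightarrow> nat \<Rightarrow> nat \<Rightarrow> real \<Rightarrow> real" where
  "gdev d \<theta> j k \<delta> =
     (SUP \<theta>'\<in>param_nbhd (nranef d) \<theta> \<delta>. \<bar>Gmat d \<theta>' $$ (j, k) - Gmat d \<theta> $$ (j, k)\<bar>)"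

definition cdev :: "lmm_design \<Rightarrow> real vec \<Rightarrow> nat \<Rightarrow> nat \<Rightarrow> real vec \<Rightarrow> real \<Rightarrow> real" where
  "cdev d \<theta> j k \<phi> \<delta> =
     (SUP \<theta>'\<in>param_nbhd (nranef d) \<theta> \<delta>. \<bar>ccoef d \<theta>' j k \<phi> - ccoef d \<theta> j k \<phi>\<bar>)"

definition beta_gls :: "lmm_design \<Rightarrow> real vec \<Rightarrow> real vec \<Rightarrow> real vec" where
  "beta_gls d \<theta> y = (let Vi = mat_inv (Vmat d \<theta>); X = Xmat d in
     mat_inv (transpose_mat X * Vi * X) * transpose_mat X * Vi *\<^sub>v y)"

definition residual :: "lmm_design \<Rightarrow> real vec \<Rightarrow> real vec \<Rightarrow> real vec" where
  "residual d \<theta> y = y - Xmat d *\<^sub>v beta_gls d \<theta> y"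

definition Gamma_fn :: "lmm_design \<Rightarrow> real vec \<Rightarrow> nat \<Rightarrow> nat \<Rightarrow> real" where
  "Gamma_fn d \<theta> i1 i2 = (\<Sum>t\<le>nranef d. gam \<theta> t * (row (Zmat d t) i1 \<bullet> row (Zmat d t) i2))"

definition nonzero_quads :: "lmm_design \<Rightarrow> quad set" where
  "nonzero_quads d = {q \<in> quads d. fcoef d q \<noteq> 0\<^sub>v (nranef d + 1)}"

definition I11_hat :: "lmm_design \<Rightarrow> real vec \<Rightarrow> real vec \<Rightarrow> nat \<Rightarrow> nat \<Rightarrow> real" where
  "I11_hat d \<theta> y j k = (let u = residual d \<theta> y in
     \<Sum>(i1, i2, i3, i4)\<in>nonzero_quads d.
       ccoef d \<theta> j k (fcoef d (i1, i2, i3, i4)) * u $ i1 * u $ i2 * u $ i3 * u $ i4)"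

definition I12_hat :: "lmm_design \<Rightarrow> real vec \<Rightarrow> nat \<Rightarrow> nat \<Rightarrow> real" where
  "I12_hat d \<theta> j k =
     2 * mat_trace (Bmat d \<theta> j * Vmat d \<theta> * Bmat d \<theta> k * Vmat d \<theta>) -
     3 * (\<theta> $ 0)\<^sup>2 * (\<Sum>(i1, i2, i3, i4)\<in>nonzero_quads d.
       ccoef d \<theta> j k (fcoef d (i1, i2, i3, i4)) * Gamma_fn d \<theta> i1 i3 * Gamma_fn d \<theta> i2 i4)"

definition poquim :: "lmm_design \<Rightarrow> real vec \<Rightarrow> real vec \<Rightarrow> real mat" where
  "poquim d \<theta> y = mat (nranef d + 1) (nranef d + 1)
     (\<lambda>(j, k). I11_hat d \<theta> y j k + I12_hat d \<theta> j k)"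

(* Under the model with parameter theta the expected Hessian of the restricted log-likelihood
   is - Gmat d theta, whatever the distributions of the random effects; this is what
   "evaluated at an estimate" refers to. *)
definition I2_at :: "lmm_design \<Rightarrow> real vec \<Rightarrow> real mat" where
  "I2_at d \<theta> = - Gmat d \<theta>"

end

theory Submission
  imports Defs
begin

text \<open>The score components are centred quadratic forms in \<open>u = y - X \<beta>\<close>, so \<open>I1\<close> involves the
  moments of order four of \<open>u\<close>: grouping the index quadruples by the value of \<open>f\<close>, where the kurtoses enter,
  gives \<open>I1\<close> as the expectation of the expression of which the POQUIM is the empirical version.  Its error has three sources.
  Replacing \<open>\<theta>\<close> by its estimate is controlled uniformly near \<open>\<theta>\<close> by the moduli in (v).  Replacing \<open>u\<close> by residuals
  costs a fitted value whose fourth moment is small uniformly in the row and in the covariance parameters: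
  iterating a resolvent identity bounds it by finitely many linear forms in \<open>u\<close>, and
  the variance of each is at most a constant times \<open>x'(X'V\<^sup>-\<^sup>1X)\<^sup>-\<^sup>1x\<close>.  Replacing products of four components of \<open>u\<close> by their
  expectations is a weak law; after truncation only pairs of quadruples sharing a random effect contribute to the variance,
  and those are counted by \<open>hcount2\<close> in (iv).  Finally \<open>I1\<close> lies between constant multiples of the
  Gaussian information \<open>Gmat\<close>, the lower one because \<open>\<kappa>\<^sub>t + 2 \<sigma>\<^sub>t\<^sup>4 = var (\<alpha>\<^sub>t\<^sup>2) > 0\<close>; after scaling by \<open>G\<close> the entrywise
  convergence becomes convergence in norm, and both estimators are continuous functions of the scaled matrices.\<close>

text \<open>The estimate of the parameter is an arbitrary function of the data, so no expectation
  can be taken once it is plugged in. On the event that the estimate is \<delta>-close to the truth,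
  every error is therefore dominated by one integrable variable that does not involve the estimate,
  and Markov's inequality needs only the mean of that variable. The obstacle is uniformity in N: the
  norms of the matrices \<open>Z Z'\<close> may grow, so V at a nearby parameter need not be close
  to V in operator norm. It is close relative to V itself, because \<open>\<sigma>\<^sub>t\<close>
  times \<open>S t\<close> is below V in the order of quadratic forms. In the norm given by
  \<open>a' V a\<close> the maps \<open>a \<mapsto> P (S t a)\<close> have norm at most
  \<open>1 / \<sigma>\<^sub>t\<close>, and the number of iterations of the resolvent identity may
  depend on N. Only fourth moments being available, products of four factors are compared through
  sums of fourth powers with a free weight e. The constants are fixed in the order e, truncation
  level, \<delta>, sample size.\<close>

no_notation matrix_vector_mult (infixl "*v" 70)
notation mult_mat_vec (infixl "*v" 70)

section \<open>Norms and inverses of real matrices\<close>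

lemma scalar_prod_lessThan: "v \<bullet> w = (\<Sum>i<dim_vec w. v $ i * w $ i)" by (simp add: scalar_prod_def lessThan_atLeast0)

lemma scalar_prod_self_nonneg: "(v :: real vec) \<bullet> v \<ge> 0" by (simp add: scalar_prod_def sum_nonneg)

lemma vec_norm2_L2_set: "vec_norm2 v = L2_set (\<lambda>i. v $ i) {..<dim_vec v}"
  by (simp add: vec_norm2_def L2_set_def scalar_prod_lessThan power2_eq_square)

lemma vec_norm2_nonneg [simp]: "vec_norm2 v \<ge> 0" by (simp add: vec_norm2_def scalar_prod_self_nonneg)

lemma vec_norm2_sq: "vec_norm2 v * vec_norm2 v = v \<bullet> v" by (simp add: vec_norm2_def scalar_prod_self_nonneg)

lemma vec_norm2_power2: "(vec_norm2 v)\<^sup>2 = v \<bullet> v" by (simp add: power2_eq_square vec_norm2_sq)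

lemma scalar_prod_le_norm:
  assumes "v \<in> carrier_vec n" "w \<in> carrier_vec n"
  shows "\<bar>v \<bullet> w\<bar> \<le> vec_norm2 v * vec_norm2 w"
proof -
  have "\<bar>v \<bullet> w\<bar> \<le> (\<Sum>i<n. \<bar>v $ i\<bar> * \<bar>w $ i\<bar>)"
    using assms unfolding scalar_prod_lessThan by (auto simp: abs_mult[symmetric] intro!: sum_abs)
  also have "\<dots> \<le> L2_set (\<lambda>i. v $ i) {..<n} * L2_set (\<lambda>i. w $ i) {..<n}" by (rule L2_set_mult_ineq)
  finally show ?thesis using assms by (simp add: vec_norm2_L2_set)
qed

lemma vec_norm2_triangle:
  assumes "v \<in> carrier_vec n" "w \<in> carrier_vec n"
  shows "vec_norm2 (v + w) \<le> vec_norm2 v + vec_norm2 w"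
proof -
  have "vec_norm2 (v + w) = L2_set (\<lambda>i. v $ i + w $ i) {..<n}" using assms unfolding vec_norm2_L2_set L2_set_def by simp
  also have "\<dots> \<le> L2_set (\<lambda>i. v $ i) {..<n} + L2_set (\<lambda>i. w $ i) {..<n}" by (rule L2_set_triangle_ineq)
  finally show ?thesis using assms by (simp add: vec_norm2_L2_set)
qed

lemma vec_norm2_smult: "vec_norm2 (k \<cdot>\<^sub>v v) = \<bar>k\<bar> * vec_norm2 v" unfolding vec_norm2_L2_set L2_set_def
  by (simp add: power_mult_distrib flip: sum_distrib_left) (simp add: real_sqrt_mult)

lemma vec_norm2_uminus: "vec_norm2 (- v) = vec_norm2 v" unfolding vec_norm2_L2_set L2_set_def by simp

lemma vec_norm2_diff_triangle:
  assumes "v \<in> carrier_vec n" "w \<in> carrier_vec n"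
  shows "vec_norm2 (v - w) \<le> vec_norm2 v + vec_norm2 w"
proof -
  have "v - w = v + - w" using assms by auto
  then show ?thesis using vec_norm2_triangle[of v n "- w"] assms by (simp add: vec_norm2_uminus)
qed

lemma vec_norm2_eq_0:
  assumes "v \<in> carrier_vec n"
  shows "vec_norm2 v = 0 \<longleftrightarrow> v = 0\<^sub>v n"
proof
  assume "vec_norm2 v = 0"
  then have "\<forall>i<n. v $ i = 0" using assms by (auto simp: vec_norm2_L2_set L2_set_eq_0_iff)
  then show "v = 0\<^sub>v n" using assms by (intro eq_vecI) auto
qed (simp add: vec_norm2_L2_set L2_set_def)

lemma scalar_prod_self_eq_0:
  assumes "(v :: real vec) \<in> carrier_vec n"
  shows "v \<bullet> v = 0 \<longleftrightarrow> v = 0\<^sub>v n" using vec_norm2_eq_0[OF assms] vec_norm2_sq[of v] by (metis mult_eq_0_iff)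

lemma vec_norm2_zero [simp]: "vec_norm2 (0\<^sub>v n) = 0" by (simp add: vec_norm2_L2_set L2_set_def)

lemma vec_norm2_unit [simp]: "i < n \<Longrightarrow> vec_norm2 (unit_vec n i) = 1" by (simp add: vec_norm2_def)

lemma abs_index_le_vec_norm2: "i < dim_vec v \<Longrightarrow> \<bar>v $ i\<bar> \<le> vec_norm2 v" unfolding vec_norm2_L2_set L2_set_def
  by (rule real_le_rsqrt, simp add: member_le_sum[of i "{..<dim_vec v}" "\<lambda>i. (v $ i)\<^sup>2"])

lemma vec_norm2_le_sum: "vec_norm2 v \<le> (\<Sum>i<dim_vec v. \<bar>v $ i\<bar>)" unfolding vec_norm2_L2_set by (rule L2_set_le_sum_abs)

text \<open>\<open>mat_inv\<close> is read off the result of Gauss-Jordan elimination. A one-sided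
  inverse of a square matrix is two-sided and unique, so exhibiting any right inverse identifies
  it.\<close>

lemma mat_inv_eqI:
  assumes A: "(A :: real mat) \<in> carrier_mat n n" and B: "B \<in> carrier_mat n n" and AB: "A * B = 1\<^sub>m n"
  shows "mat_inv A = B"
proof -
  have BA: "B * A = 1\<^sub>m n" by (rule mat_mult_left_right_inverse[OF A B AB])
  show ?thesis
  proof (cases "mat_inverse A")
    case None
    from mat_inverse(1)[OF A None, of undefined] have "A \<notin> Units (ring_mat TYPE(real) n undefined)" .
    then show ?thesis using A B AB BA by (auto simp: Units_def ring_mat_def)
  next
    case (Some C)
    from mat_inverse(2)[OF A Some] have C: "C \<in> carrier_mat n n" "C * A = 1\<^sub>m n" by auto
    have "C = C * (A * B)" using C AB by simp
    also have "\<dots> = (C * A) * B" using A B C by (intro assoc_mult_mat[symmetric]) auto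
    also have "\<dots> = B" using C B by simp
    finally show ?thesis using Some by (simp add: mat_inv_def)
  qed
qed

lemma invertible_mat_iff:
  assumes A: "(A :: real mat) \<in> carrier_mat n n"
  shows "invertible_mat A \<longleftrightarrow> (\<exists>B\<in>carrier_mat n n. A * B = 1\<^sub>m n)"
proof
  assume "invertible_mat A"
  then obtain B where B: "A * B = 1\<^sub>m n" "B * A = 1\<^sub>m (dim_row B)" using A unfolding invertible_mat_def inverts_mat_def by auto
  have "dim_col B = n" using arg_cong[OF B(1), of dim_col] by simp
  moreover have "dim_row B = n" using arg_cong[OF B(2), of dim_col] A by simp
  ultimately show "\<exists>B\<in>carrier_mat n n. A * B = 1\<^sub>m n" using B(1) by auto
next
  assume "\<exists>B\<in>carrier_mat n n. A * B = 1\<^sub>m n"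
  then obtain B where "B \<in> carrier_mat n n" "A * B = 1\<^sub>m n" by auto
  with mat_mult_left_right_inverse[OF A this] A show "invertible_mat A" unfolding invertible_mat_def inverts_mat_def by auto
qed

lemma mat_inv:
  assumes "(A :: real mat) \<in> carrier_mat n n" "invertible_mat A"
  shows mat_inv_carrier: "mat_inv A \<in> carrier_mat n n"
    and mat_inv_right: "A * mat_inv A = 1\<^sub>m n"
    and mat_inv_left: "mat_inv A * A = 1\<^sub>m n"
proof -
  obtain B where B: "B \<in> carrier_mat n n" "A * B = 1\<^sub>m n" using assms invertible_mat_iff by blast
  have "mat_inv A = B" using mat_inv_eqI assms(1) B by blast
  then show "mat_inv A \<in> carrier_mat n n" "A * mat_inv A = 1\<^sub>m n" "mat_inv A * A = 1\<^sub>m n"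
    using B mat_mult_left_right_inverse[OF assms(1) B] by auto
qed

lemma invertible_matI_inj:
  assumes A: "(A :: real mat) \<in> carrier_mat n n"
    and inj: "\<And>v. v \<in> carrier_vec n \<Longrightarrow> A *v v = 0\<^sub>v n \<Longrightarrow> v = 0\<^sub>v n"
  shows "invertible_mat A"
proof -
  have "det A \<noteq> 0" using det_0_iff_vec_prod_zero[OF A] inj by blast
  from det_non_zero_imp_unit[OF A this, of undefined]
  have "\<exists>B\<in>carrier_mat n n. A * B = 1\<^sub>m n" by (auto simp: Units_def ring_mat_def)
  then show ?thesis using invertible_mat_iff[OF A] by simp
qed

text \<open>An upper bound for the operator norm, as a relation: sums and products can be estimated
  before \<open>mat_norm\<close>, which is defined by an eigenvalue, is understood. The clause
  \<open>0 \<le> r\<close> does not follow from the rest when there are no columns.\<close>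

definition opbound :: "real mat \<Rightarrow> real \<Rightarrow> bool" where
  "opbound A r \<longleftrightarrow> 0 \<le> r \<and> (\<forall>v\<in>carrier_vec (dim_col A). vec_norm2 (A *v v) \<le> r * vec_norm2 v)"

lemma opboundD: "opbound A r \<Longrightarrow> A \<in> carrier_mat m n \<Longrightarrow> v \<in> carrier_vec n \<Longrightarrow>
    vec_norm2 (A *v v) \<le> r * vec_norm2 v" by (auto simp: opbound_def)

text \<open>The sum of the row norms, by Cauchy-Schwarz in each row; the added 1 makes it positive.
  It serves wherever only finiteness matters and the bound may depend on N.\<close>

lemma opbound_exists: "\<exists>r>0. opbound A r"
proof -
  define r where "r = (\<Sum>i<dim_row A. vec_norm2 (row A i)) + 1"
  have r: "r > 0" unfolding r_def by (simp add: add_nonneg_pos sum_nonneg)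
  have "vec_norm2 (A *v v) \<le> r * vec_norm2 v" if v: "v \<in> carrier_vec (dim_col A)" for v
  proof -
    have "vec_norm2 (A *v v) \<le> (\<Sum>i<dim_row A. \<bar>row A i \<bullet> v\<bar>)" using vec_norm2_le_sum[of "A *v v"] by simp
    also have "\<dots> \<le> (\<Sum>i<dim_row A. vec_norm2 (row A i) * vec_norm2 v)"
      by (intro sum_mono scalar_prod_le_norm[of _ "dim_col A"]) (use v in auto)
    also have "\<dots> \<le> r * vec_norm2 v" by (simp add: r_def sum_distrib_right distrib_right)
    finally show ?thesis .
  qed
  then show ?thesis using r unfolding opbound_def by force
qed

lemma opbound_mult:
  assumes "(A :: real mat) \<in> carrier_mat k m" "B \<in> carrier_mat m n" "opbound A r" "opbound B r'"
  shows "opbound (A * B) (r * r')" unfolding opbound_def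
proof (intro conjI ballI)
  show "0 \<le> r * r'" using assms unfolding opbound_def by simp
  fix v :: "real vec" assume "v \<in> carrier_vec (dim_col (A * B))"
  then have v: "v \<in> carrier_vec n" using assms by simp
  have "vec_norm2 (A *v (B *v v)) \<le> r * vec_norm2 (B *v v)" by (rule opboundD[OF assms(3,1)]) (use assms v in auto)
  also have "\<dots> \<le> r * (r' * vec_norm2 v)"
    by (intro mult_left_mono opboundD[OF assms(4,2)] v) (use assms in \<open>auto simp: opbound_def\<close>)
  finally show "vec_norm2 (A * B *v v) \<le> r * r' * vec_norm2 v" using assms(1,2) v by simp
qed

lemma opbound_add:
  assumes "(A :: real mat) \<in> carrier_mat m n" "B \<in> carrier_mat m n" "opbound A r" "opbound B r'"
  shows "opbound (A + B) (r + r')" unfolding opbound_def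
proof (intro conjI ballI)
  show "0 \<le> r + r'" using assms unfolding opbound_def by simp
  fix v :: "real vec" assume "v \<in> carrier_vec (dim_col (A + B))"
  then have v: "v \<in> carrier_vec n" using assms by simp
  have "vec_norm2 (A *v v + B *v v) \<le> vec_norm2 (A *v v) + vec_norm2 (B *v v)"
    by (rule vec_norm2_triangle[of _ m]) (use assms v in auto)
  also have "\<dots> \<le> r * vec_norm2 v + r' * vec_norm2 v" by (intro add_mono opboundD[OF assms(3,1)] opboundD[OF assms(4,2)] v)
  finally show "vec_norm2 ((A + B) *v v) \<le> (r + r') * vec_norm2 v"
    using assms(1,2) v by (simp add: add_mult_distrib_mat_vec algebra_simps)
qed

lemma opbound_smult:
  assumes "opbound A r"
  shows "opbound (k \<cdot>\<^sub>m A) (\<bar>k\<bar> * r)" unfolding opbound_def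
proof (intro conjI ballI)
  show "0 \<le> \<bar>k\<bar> * r" using assms unfolding opbound_def by simp
  fix v :: "real vec" assume "v \<in> carrier_vec (dim_col (k \<cdot>\<^sub>m A))"
  then have v: "v \<in> carrier_vec (dim_col A)" by simp
  have "k \<cdot>\<^sub>m A *v v = k \<cdot>\<^sub>v (A *v v)" using v by (intro eq_vecI) (auto simp: row_smult)
  then show "vec_norm2 (k \<cdot>\<^sub>m A *v v) \<le> \<bar>k\<bar> * r * vec_norm2 v"
    using assms v by (auto simp: vec_norm2_smult opbound_def mult.assoc intro!: mult_left_mono)
qed

lemma opbound_entry:
  assumes "(A :: real mat) \<in> carrier_mat m n" "opbound A r" "i < m" "j < n"
  shows "\<bar>A $$ (i, j)\<bar> \<le> r"
proof -
  have "\<bar>A $$ (i, j)\<bar> = \<bar>(A *v unit_vec n j) $ i\<bar>" using assms by (auto simp: row_def)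
  also have "\<dots> \<le> vec_norm2 (A *v unit_vec n j)" by (rule abs_index_le_vec_norm2) (use assms in auto)
  also have "\<dots> \<le> r * vec_norm2 (unit_vec n j)" by (rule opboundD[OF assms(2,1)]) auto
  finally show ?thesis using assms by simp
qed

text \<open>Crude, but later m and n are either \<open>s + 1\<close>, which is fixed, or the bound
  only has to be finite.\<close>

lemma opbound_of_entries:
  assumes A: "(A :: real mat) \<in> carrier_mat m n" and ent: "\<And>i j. i < m \<Longrightarrow> j < n \<Longrightarrow> \<bar>A $$ (i, j)\<bar> \<le> e"
    and e: "0 \<le> e"
  shows "opbound A (real m * real n * e)" unfolding opbound_def
proof (intro conjI ballI)
  show "0 \<le> real m * real n * e" using e by simp
  fix v :: "real vec" assume "v \<in> carrier_vec (dim_col A)"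
  then have v: "v \<in> carrier_vec n" using A by simp
  have "vec_norm2 (A *v v) \<le> (\<Sum>i<m. \<bar>row A i \<bullet> v\<bar>)" using vec_norm2_le_sum[of "A *v v"] A by simp
  also have "\<dots> \<le> (\<Sum>i<m. (real n * e) * vec_norm2 v)"
  proof (rule sum_mono)
    fix i assume "i \<in> {..<m}"
    then have i: "i < m" by simp
    have "\<bar>row A i \<bullet> v\<bar> \<le> vec_norm2 (row A i) * vec_norm2 v" by (rule scalar_prod_le_norm[of _ n]) (use A v in auto)
    also have "vec_norm2 (row A i) \<le> (\<Sum>j<n. \<bar>row A i $ j\<bar>)" using vec_norm2_le_sum[of "row A i"] A i by simp
    also have "\<dots> \<le> (\<Sum>j<n. e)" by (intro sum_mono) (use A i ent in auto)
    finally show "\<bar>row A i \<bullet> v\<bar> \<le> (real n * e) * vec_norm2 v" by (simp add: mult_right_mono)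
  qed
  finally show "vec_norm2 (A *v v) \<le> real m * real n * e * vec_norm2 v" by (simp add: mult.assoc)
qed

section \<open>Positive semidefinite matrices\<close>

lemma sym_mat_scalar_prod:
  assumes "(A :: real mat) \<in> carrier_mat n n" "A\<^sup>T = A" "v \<in> carrier_vec n" "w \<in> carrier_vec n"
  shows "(A *v v) \<bullet> w = v \<bullet> (A *v w)" using transpose_vec_mult_scalar[OF assms(1,4,3)] assms(2) by simp

lemma quadratic_nonneg_imp_discriminant:
  fixes a b c :: real
  assumes nn: "\<And>t. 0 \<le> a + 2 * t * b + t\<^sup>2 * c"
  shows "b\<^sup>2 \<le> a * c"
proof (cases "c = 0")
  case True
  have "b = 0"
  proof (rule ccontr)
    assume "b \<noteq> 0"
    \<comment> \<open>With c = 0 the polynomial is affine in t; at this point its value is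
      -1.\<close>
    have "0 \<le> a + 2 * (- (a + 1) / (2 * b)) * b" using nn[of "- (a + 1) / (2 * b)"] True by simp
    then show False using \<open>b \<noteq> 0\<close> by (simp add: field_simps)
  qed
  then show ?thesis using True by simp
next
  case False
  have "c \<ge> 0"
  proof (rule ccontr)
    assume "\<not> c \<ge> 0"
    then have c: "c < 0" by simp
    have a: "a \<ge> 0" using nn[of 0] by simp
    \<comment> \<open>Here \<open>t\<^sup>2 * c = - (a + 1)\<close>; adding the inequalities at t
      and -t removes the linear term and leaves -2.\<close>
    define t where "t = sqrt ((a + 1) / (- c))"
    have "(a + 1) / (- c) \<ge> 0" using a c by (intro divide_nonneg_nonneg) auto
    then have "t\<^sup>2 = (a + 1) / (- c)" by (simp add: t_def del: divide_minus_right)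
    then have "t\<^sup>2 * c = - (a + 1)" using c by simp
    then show False using nn[of t] nn[of "- t"] by simp
  qed
  then have c: "c > 0" using False by simp
  have "0 \<le> a + 2 * (- b / c) * b + (- b / c)\<^sup>2 * c" by (rule nn)
  also have "\<dots> = a - b\<^sup>2 / c" using c by (simp add: field_simps power2_eq_square)
  finally show ?thesis using c by (simp add: field_simps)
qed

lemma psd_cauchy_schwarz:
  assumes A: "(A :: real mat) \<in> carrier_mat n n" "A\<^sup>T = A"
    and psd: "\<And>v. v \<in> carrier_vec n \<Longrightarrow> 0 \<le> v \<bullet> (A *v v)"
    and v: "v \<in> carrier_vec n" and w: "w \<in> carrier_vec n"
  shows "(v \<bullet> (A *v w))\<^sup>2 \<le> (v \<bullet> (A *v v)) * (w \<bullet> (A *v w) :: real)"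
proof (rule quadratic_nonneg_imp_discriminant)
  fix t :: real
  have Av: "A *v v \<in> carrier_vec n" "A *v w \<in> carrier_vec n" using A v w by auto
  have "w \<bullet> (A *v v) = v \<bullet> (A *v w)" using sym_mat_scalar_prod[OF A v w] comm_scalar_prod[OF w Av(1)] by simp
  then have "(v + t \<cdot>\<^sub>v w) \<bullet> (A *v (v + t \<cdot>\<^sub>v w)) =
    v \<bullet> (A *v v) + 2 * t * (v \<bullet> (A *v w)) + t\<^sup>2 * (w \<bullet> (A *v w))" using A v w Av
    by (simp add: mult_add_distrib_mat_vec mult_mat_vec add_scalar_prod_distrib[of _ n]
        scalar_prod_add_distrib[of _ n] power2_eq_square algebra_simps)
  then show "0 \<le> v \<bullet> (A *v v) + 2 * t * (v \<bullet> (A *v w)) + t\<^sup>2 * (w \<bullet> (A *v w))"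
    using psd[of "v + t \<cdot>\<^sub>v w"] v w by simp
qed

text \<open>This is \<open>A A \<le> K A\<close> in the order of quadratic forms, by Cauchy-Schwarz
  in the A-form for the vectors v and \<open>A v\<close>: one factor \<open>|A v|\<^sup>2\<close>
  cancels. It takes the place of diagonalization when form bounds are turned into norm
  bounds.\<close>

lemma psd_norm_sq_le:
  assumes A: "(A :: real mat) \<in> carrier_mat n n" "A\<^sup>T = A"
    and psd: "\<And>v. v \<in> carrier_vec n \<Longrightarrow> 0 \<le> v \<bullet> (A *v v)"
    and K: "\<And>v. v \<in> carrier_vec n \<Longrightarrow> v \<bullet> (A *v v) \<le> K * (v \<bullet> v)"
    and v: "v \<in> carrier_vec n"
  shows "(A *v v) \<bullet> (A *v v) \<le> K * (v \<bullet> (A *v v))"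
proof -
  let ?w = "A *v v"
  have w: "?w \<in> carrier_vec n" using A v by simp
  have "(?w \<bullet> ?w)\<^sup>2 \<le> (v \<bullet> ?w) * (?w \<bullet> (A *v ?w))"
    using psd_cauchy_schwarz[OF A psd v w] sym_mat_scalar_prod[OF A v w] by simp
  also have "\<dots> \<le> (v \<bullet> ?w) * (K * (?w \<bullet> ?w))" by (intro mult_left_mono K w psd v)
  finally have *: "(?w \<bullet> ?w) * (?w \<bullet> ?w) \<le> (K * (v \<bullet> ?w)) * (?w \<bullet> ?w)"
    by (simp add: power2_eq_square algebra_simps)
  show ?thesis
  proof (cases "?w \<bullet> ?w = 0")
    case True
    then have "?w = 0\<^sub>v n" using scalar_prod_self_eq_0 w by blast
    then have "v \<bullet> ?w = 0" using v by simp
    then show ?thesis using True by simp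
  next
    case False
    then have "?w \<bullet> ?w > 0" using scalar_prod_self_nonneg[of ?w] by linarith
    then show ?thesis using * by simp
  qed
qed

lemma quad_le_opbound:
  assumes "(A :: real mat) \<in> carrier_mat n n" "opbound A r" "v \<in> carrier_vec n"
  shows "\<bar>v \<bullet> (A *v v)\<bar> \<le> r * (v \<bullet> v)"
proof -
  have "\<bar>v \<bullet> (A *v v)\<bar> \<le> vec_norm2 v * vec_norm2 (A *v v)" by (rule scalar_prod_le_norm[of _ n]) (use assms in auto)
  also have "\<dots> \<le> vec_norm2 v * (r * vec_norm2 v)" by (intro mult_left_mono opboundD[OF assms(2,1,3)]) auto
  also have "\<dots> = r * (v \<bullet> v)" by (simp flip: vec_norm2_sq)
  finally show ?thesis .
qed

text \<open>A lower eigenvalue bound without eigenvectors: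
  \<open>|v|\<^sup>2 \<le> L\<^sup>2 |A v|\<^sup>2\<close>, and \<open>psd_norm_sq_le\<close> bounds
  \<open>|A v|\<^sup>2\<close> by K times the form.\<close>

lemma psd_invertible_lower:
  assumes A: "(A :: real mat) \<in> carrier_mat n n" "A\<^sup>T = A"
    and psd: "\<And>v. v \<in> carrier_vec n \<Longrightarrow> 0 \<le> v \<bullet> (A *v v)"
    and K: "K > 0" "\<And>v. v \<in> carrier_vec n \<Longrightarrow> v \<bullet> (A *v v) \<le> K * (v \<bullet> v)"
    and L: "L > 0" "\<And>v. v \<in> carrier_vec n \<Longrightarrow> vec_norm2 v \<le> L * vec_norm2 (A *v v)"
    and v: "v \<in> carrier_vec n"
  shows "v \<bullet> v \<le> L\<^sup>2 * K * (v \<bullet> (A *v v))"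
proof -
  have "v \<bullet> v = (vec_norm2 v)\<^sup>2" by (simp add: vec_norm2_power2)
  also have "\<dots> \<le> (L * vec_norm2 (A *v v))\<^sup>2" by (intro power_mono L v) simp
  also have "\<dots> = L\<^sup>2 * ((A *v v) \<bullet> (A *v v))" by (simp add: power_mult_distrib vec_norm2_power2)
  also have "\<dots> \<le> L\<^sup>2 * (K * (v \<bullet> (A *v v)))" by (intro mult_left_mono psd_norm_sq_le[OF A psd K(2) v]) auto
  finally show ?thesis by (simp add: mult.assoc)
qed

lemma inverse_lower:
  assumes A: "(A :: real mat) \<in> carrier_mat n n" and B: "B \<in> carrier_mat n n" "B * A = 1\<^sub>m n" and L: "opbound B L"
    and v: "v \<in> carrier_vec n"
  shows "vec_norm2 v \<le> L * vec_norm2 (A *v v)"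
proof -
  have "v = B *v (A *v v)" using A B v by (simp flip: assoc_mult_mat_vec)
  then have "vec_norm2 v = vec_norm2 (B *v (A *v v))" by simp
  also have "\<dots> \<le> L * vec_norm2 (A *v v)" by (rule opboundD[OF L B(1)]) (use A v in auto)
  finally show ?thesis .
qed

section \<open>Extreme eigenvalues and the Rayleigh quotient\<close>

lemma finite_eigenvalues:
  assumes A: "(A :: real mat) \<in> carrier_mat n n"
  shows "finite {k. eigenvalue A k}"
proof -
  have "char_poly A \<noteq> 0" using degree_monic_char_poly[OF A] by auto
  then show ?thesis using poly_roots_finite eigenvalue_root_char_poly[OF A] by simp
qed

lemma minus_smult_one_mult_vec:
  assumes A: "(A :: real mat) \<in> carrier_mat n n" and v: "v \<in> carrier_vec n"
  shows "(t \<cdot>\<^sub>m 1\<^sub>m n - A) *v v = t \<cdot>\<^sub>v v - A *v v"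
proof -
  have "(t \<cdot>\<^sub>m 1\<^sub>m n - A) *v v = (t \<cdot>\<^sub>m 1\<^sub>m n) *v v - A *v v"
    by (rule minus_mult_distrib_mat_vec) (use A v in auto)
  also have "(t \<cdot>\<^sub>m 1\<^sub>m n) *v v = t \<cdot>\<^sub>v v" using v by (intro eq_vecI) (auto simp: row_smult)
  finally show ?thesis .
qed

text \<open>If t is the supremum of the Rayleigh quotient, then tI - A is positive semidefinite but not
  bounded away from 0, hence singular; so t is an eigenvalue.\<close>

lemma max_eigenvalue_exists:
  assumes A: "(A :: real mat) \<in> carrier_mat n n" "A\<^sup>T = A" and n: "n > 0"
  shows "\<exists>t. eigenvalue A t \<and> (\<forall>v\<in>carrier_vec n. v \<bullet> (A *v v) \<le> t * (v \<bullet> v))"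
proof -
  define U where "U = {t::real. \<forall>v\<in>carrier_vec n. v \<bullet> (A *v v) \<le> t * (v \<bullet> v)}"
  obtain r where r: "r > 0" "opbound A r" using opbound_exists by blast
  have "r \<in> U" using quad_le_opbound[OF A(1) r(2)] by (force simp: U_def)
  define e where "e = unit_vec n 0 \<bullet> (A *v unit_vec n 0)"
  have low: "e \<le> t" if "t \<in> U" for t using that n unfolding U_def e_def by (auto dest!: bspec[of _ _ "unit_vec n 0"])
  then have bdd: "bdd_below U" by (intro bdd_belowI)
  define t where "t = Inf U"
  have tU: "v \<bullet> (A *v v) \<le> t * (v \<bullet> v)" if v: "v \<in> carrier_vec n" for v
  proof (cases "v \<bullet> v = 0")
    case True
    then show ?thesis using v scalar_prod_self_eq_0[OF v] A by simp
  next
    case False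
    then have p: "v \<bullet> v > 0" using scalar_prod_self_nonneg[of v] by simp
    have "v \<bullet> (A *v v) / (v \<bullet> v) \<le> t" unfolding t_def
      by (rule cInf_greatest) (use \<open>r \<in> U\<close> p v in \<open>auto simp: U_def field_simps\<close>)
    then show ?thesis using p by (simp add: field_simps)
  qed
  define B where "B = t \<cdot>\<^sub>m 1\<^sub>m n - A"
  have B: "B \<in> carrier_mat n n" unfolding B_def using A(1) by (intro minus_carrier_mat)
  have Bsym: "B\<^sup>T = B" using A unfolding B_def by (intro eq_matI) (auto, metis carrier_matD index_transpose_mat(1))
  have Bv: "v \<bullet> (B *v v) = t * (v \<bullet> v) - v \<bullet> (A *v v)" if "v \<in> carrier_vec n" for v unfolding B_def using that A
    by (subst minus_smult_one_mult_vec) (auto simp: scalar_prod_minus_distrib[of _ n])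
  have "\<not> invertible_mat B"
  proof
    assume inv: "invertible_mat B"
    obtain K where K: "K > 0" "opbound B K" using opbound_exists by blast
    obtain L where L: "L > 0" "opbound (mat_inv B) L" using opbound_exists by blast
    have "v \<bullet> v \<le> L\<^sup>2 * K * (v \<bullet> (B *v v))" if v: "v \<in> carrier_vec n" for v
      apply (rule psd_invertible_lower[OF B Bsym _ K(1) _ L(1) _ v]) using Bv tU quad_le_opbound[OF B K(2)]
        inverse_lower[OF B mat_inv_carrier[OF B inv] mat_inv_left[OF B inv] L(2)] by force+
    then have "t - 1 / (L\<^sup>2 * K) \<in> U" unfolding U_def using K L by (auto simp: Bv field_simps)
    then have "t \<le> t - 1 / (L\<^sup>2 * K)" unfolding t_def by (rule cInf_lower[OF _ bdd])
    then show False using K L by (simp add: field_simps)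
  qed
  then obtain v where v: "v \<in> carrier_vec n" "B *v v = 0\<^sub>v n" "v \<noteq> 0\<^sub>v n" using invertible_matI_inj[OF B] by blast
  have "t \<cdot>\<^sub>v v - A *v v = 0\<^sub>v n" using v minus_smult_one_mult_vec[OF A(1) v(1)] by (simp add: B_def)
  then have "A *v v = t \<cdot>\<^sub>v v"
    using A v(1) by (intro eq_vecI) (auto dest!: arg_cong[where f="\<lambda>x. x $ _"] simp: vec_eq_iff)
  then have "eigenvalue A t" using v A unfolding eigenvalue_def eigenvector_def by auto
  then show ?thesis using tU by blast
qed

lemma eigenvalue_le_Rayleigh:
  assumes A: "(A :: real mat) \<in> carrier_mat n n" and k: "eigenvalue A k"
    and t: "\<And>v. v \<in> carrier_vec n \<Longrightarrow> v \<bullet> (A *v v) \<le> t * (v \<bullet> v)"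
  shows "(k :: real) \<le> t"
proof -
  obtain v where v: "v \<in> carrier_vec n" "v \<noteq> 0\<^sub>v n" "A *v v = k \<cdot>\<^sub>v v"
    using k A unfolding eigenvalue_def eigenvector_def by auto
  have "k * (v \<bullet> v) \<le> t * (v \<bullet> v)" using t[OF v(1)] v by simp
  moreover have "v \<bullet> v > 0" using scalar_prod_self_nonneg[of v] scalar_prod_self_eq_0[OF v(1)] v(2) by linarith
  ultimately show ?thesis by simp
qed

text \<open>\<open>max_eigenvalue_exists\<close> supplies one eigenvalue that dominates the Rayleigh
  quotient, and every eigenvalue is a value of that quotient; hence the \<open>Max\<close> of the
  definition is this one.\<close>

lemma lambda_max_Rayleigh:
  assumes A: "(A :: real mat) \<in> carrier_mat n n" "A\<^sup>T = A" and n: "n > 0"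
  shows lambda_max_ge: "v \<in> carrier_vec n \<Longrightarrow> v \<bullet> (A *v v) \<le> lambda_max A * (v \<bullet> v)"
    and lambda_max_le: "(\<And>v. v \<in> carrier_vec n \<Longrightarrow> v \<bullet> (A *v v) \<le> c * (v \<bullet> v)) \<Longrightarrow> lambda_max A \<le> c"
proof -
  obtain t where t: "eigenvalue A t" "\<And>v. v\<in>carrier_vec n \<Longrightarrow> v \<bullet> (A *v v) \<le> t * (v \<bullet> v)"
    using max_eigenvalue_exists[OF A n] by blast
  have "lambda_max A = t" unfolding lambda_max_def
    by (rule Max_eqI) (use finite_eigenvalues[OF A(1)] t eigenvalue_le_Rayleigh[OF A(1)] in auto)
  then show "v \<in> carrier_vec n \<Longrightarrow> v \<bullet> (A *v v) \<le> lambda_max A * (v \<bullet> v)"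
    "(\<And>v. v \<in> carrier_vec n \<Longrightarrow> v \<bullet> (A *v v) \<le> c * (v \<bullet> v)) \<Longrightarrow> lambda_max A \<le> c"
    using t eigenvalue_le_Rayleigh[OF A(1) t(1)] by auto
qed

text \<open>Apply the result on the maximum to -A: its eigenvalue t makes -t an eigenvalue of A, and
  the \<open>Min\<close> of the definition lies below -t.\<close>

lemma lambda_min_ge:
  assumes A: "(A :: real mat) \<in> carrier_mat n n" "A\<^sup>T = A" and n: "n > 0" and v: "v \<in> carrier_vec n"
  shows "lambda_min A * (v \<bullet> v) \<le> v \<bullet> (A *v v)"
proof -
  have nA: "- A \<in> carrier_mat n n" "transpose_mat (- A) = - A" using A by (auto simp: transpose_uminus)
  obtain t where t: "eigenvalue (- A) t" "\<And>v. v\<in>carrier_vec n \<Longrightarrow> v \<bullet> (- A *v v) \<le> t * (v \<bullet> v)"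
    using max_eigenvalue_exists[OF nA n] by blast
  obtain w where w: "w \<in> carrier_vec n" "w \<noteq> 0\<^sub>v n" "- A *v w = t \<cdot>\<^sub>v w"
    using t(1) A unfolding eigenvalue_def eigenvector_def by auto
  have "- (A *v w) = t \<cdot>\<^sub>v w" using w A by simp
  then have "A *v w = - (t \<cdot>\<^sub>v w)" by (metis uminus_uminus_vec)
  then have "A *v w = (- t) \<cdot>\<^sub>v w" by (auto simp: vec_eq_iff)
  then have "eigenvalue A (- t)" using w A unfolding eigenvalue_def eigenvector_def by auto
  then have "lambda_min A \<le> - t" unfolding lambda_min_def by (intro Min_le finite_eigenvalues[OF A(1)]) auto
  then have "lambda_min A * (v \<bullet> v) \<le> - t * (v \<bullet> v)" by (intro mult_right_mono scalar_prod_self_nonneg)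
  also have "\<dots> \<le> v \<bullet> (A *v v)" using t(2)[OF v] A v by simp
  finally show ?thesis .
qed

text \<open>\<open>mat_norm\<close> is the least \<open>opbound\<close>, because
  \<open>|A v|\<^sup>2\<close> is the quadratic form of \<open>A\<^sup>T A\<close>. All later
  statements about \<open>mat_norm\<close> are reduced to \<open>opbound\<close> through it. A
  column is needed for the set of eigenvalues to be nonempty.\<close>

lemma mat_norm_opbound:
  assumes A: "(A :: real mat) \<in> carrier_mat m n" and n: "n > 0"
  shows opbound_mat_norm: "opbound A (mat_norm A)"
    and mat_norm_le: "opbound A r \<Longrightarrow> mat_norm A \<le> r"
proof -
  let ?S = "A\<^sup>T * A"
  have S: "?S \<in> carrier_mat n n" "?S\<^sup>T = ?S" using A by (auto simp: transpose_mult[of _ n m])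
  have Sv: "v \<bullet> (?S *v v) = (vec_norm2 (A *v v))\<^sup>2" if v: "v \<in> carrier_vec n" for v
  proof -
    have "v \<bullet> (?S *v v) = v \<bullet> (A\<^sup>T *v (A *v v))" using A v by (subst assoc_mult_mat_vec) auto
    also have "\<dots> = (A\<^sup>T *v (A *v v)) \<bullet> v" by (rule comm_scalar_prod[of _ n]) (use A v in auto)
    also have "\<dots> = (A *v v) \<bullet> (A *v v)" by (rule transpose_vec_mult_scalar) (use A v in auto)
    finally show ?thesis by (simp add: vec_norm2_power2)
  qed
  have le: "(vec_norm2 (A *v v))\<^sup>2 \<le> lambda_max ?S * (vec_norm2 v)\<^sup>2" if "v \<in> carrier_vec n" for v
    using lambda_max_ge[OF S n that] Sv[OF that] by (simp add: vec_norm2_power2)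
  have nn: "0 \<le> lambda_max ?S" using le[of "unit_vec n 0"] n
    by (metis mult.right_neutral one_power2 order_trans unit_vec_carrier vec_norm2_unit zero_le_power2)
  show "opbound A (mat_norm A)" unfolding opbound_def mat_norm_def
  proof (intro conjI ballI)
    fix v :: "real vec" assume "v \<in> carrier_vec (dim_col A)"
    then have "v \<in> carrier_vec n" using A by simp
    from le[OF this] show "vec_norm2 (A *v v) \<le> sqrt (lambda_max ?S) * vec_norm2 v"
      by (metis real_le_rsqrt real_sqrt_abs real_sqrt_mult abs_of_nonneg vec_norm2_nonneg)
  qed (use nn in simp)
  show "mat_norm A \<le> r" if r: "opbound A r"
  proof -
    have "lambda_max ?S \<le> r\<^sup>2"
    proof (rule lambda_max_le[OF S n])
      fix v :: "real vec" assume v: "v \<in> carrier_vec n"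
      have "(vec_norm2 (A *v v))\<^sup>2 \<le> (r * vec_norm2 v)\<^sup>2" by (intro power_mono opboundD[OF r A v]) simp
      then show "v \<bullet> (?S *v v) \<le> r\<^sup>2 * (v \<bullet> v)" by (simp add: Sv[OF v] power_mult_distrib vec_norm2_power2)
    qed
    then have "sqrt (lambda_max ?S) \<le> sqrt (r\<^sup>2)" by (rule real_sqrt_le_mono)
    also have "\<dots> = r" using r by (simp add: opbound_def)
    finally show ?thesis by (simp add: mat_norm_def)
  qed
qed

section \<open>Square roots\<close>

lemma sym_mat_index:
  assumes "A\<^sup>T = A" "A \<in> carrier_mat n n" "i < n" "j < n"
  shows "A $$ (j, i) = A $$ (i, j)" using arg_cong[OF assms(1), of "\<lambda>M. M $$ (i, j)"] assms(2-) by simp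

lemma mult_mat_zero_vec: "(A :: real mat) \<in> carrier_mat m n \<Longrightarrow> A *v 0\<^sub>v n = 0\<^sub>v m" by (intro eq_vecI) auto

lemma zero_mat_mult_vec: "(v :: real vec) \<in> carrier_vec n \<Longrightarrow> 0\<^sub>m m n *v v = 0\<^sub>v m" by (intro eq_vecI) auto

lemma opbound_mono: "opbound A r \<Longrightarrow> r \<le> r' \<Longrightarrow> opbound A r'"
  unfolding opbound_def by (meson mult_right_mono order_trans vec_norm2_nonneg)

lemma one_smult_mat [simp]: "(1 :: real) \<cdot>\<^sub>m A = A" by (intro eq_matI) auto

lemma positive_definite_iff:
  assumes "A \<in> carrier_mat n n"
  shows "positive_definite A \<longleftrightarrow> A\<^sup>T = A \<and>
    (\<forall>v\<in>carrier_vec n. v \<noteq> 0\<^sub>v n \<longrightarrow> v \<bullet> (A *v v) > 0)"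
  using assms by (auto simp: positive_definite_def)

lemma positive_definite_invertible:
  assumes A: "A \<in> carrier_mat n n" and pd: "positive_definite A"
  shows "invertible_mat A"
proof (rule invertible_matI_inj[OF A])
  fix v assume v: "v \<in> carrier_vec n" "A *v v = 0\<^sub>v n"
  then have "v \<bullet> (A *v v) = 0" by simp
  then show "v = 0\<^sub>v n" using pd v unfolding positive_definite_iff[OF A] by force
qed

lemma positive_definite_nonneg:
  assumes A: "A \<in> carrier_mat n n" and pd: "positive_definite A" and v: "v \<in> carrier_vec n"
  shows "0 \<le> v \<bullet> (A *v v)"
proof (cases "v = 0\<^sub>v n")
  case True
  then show ?thesis using A by simp
next
  case False
  then show ?thesis using pd v unfolding positive_definite_iff[OF A] by force
qed

lemma transpose_mat_inv:
  assumes A: "(A :: real mat) \<in> carrier_mat n n" "A\<^sup>T = A" "invertible_mat A"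
  shows "transpose_mat (mat_inv A) = mat_inv A"
proof -
  note I = mat_inv_carrier[OF A(1,3)]
  have "transpose_mat (mat_inv A * A) = A * transpose_mat (mat_inv A)" using transpose_mult[OF I A(1)] A(2) by simp
  then have "A * transpose_mat (mat_inv A) = 1\<^sub>m n" using mat_inv_left[OF A(1,3)] by simp
  from mat_inv_eqI[OF A(1) _ this] I show ?thesis by simp
qed

lemma positive_definite_mat_inv:
  assumes A: "A \<in> carrier_mat n n" and pd: "positive_definite A"
  shows "positive_definite (mat_inv A)"
proof -
  have sym: "A\<^sup>T = A" using pd unfolding positive_definite_iff[OF A] by blast
  note inv = positive_definite_invertible[OF A pd]
  note I = mat_inv_carrier[OF A inv]
  have "v \<bullet> (mat_inv A *v v) > 0" if v: "v \<in> carrier_vec n" "v \<noteq> 0\<^sub>v n" for v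
  proof -
    let ?w = "mat_inv A *v v"
    have w: "?w \<in> carrier_vec n" using I v by simp
    have v_eq: "A *v ?w = v" using A I v by (simp add: mat_inv_right[OF A inv] flip: assoc_mult_mat_vec)
    then have "?w \<noteq> 0\<^sub>v n" using v mult_mat_zero_vec[OF A] by metis
    then have "?w \<bullet> (A *v ?w) > 0" using pd w unfolding positive_definite_iff[OF A] by blast
    then show ?thesis using v_eq comm_scalar_prod[OF w v(1)] by simp
  qed
  then show ?thesis using transpose_mat_inv[OF A sym inv] unfolding positive_definite_iff[OF I] by blast
qed

lemma positive_definite_lower:
  assumes A: "A \<in> carrier_mat n n" and pd: "positive_definite A"
  shows "\<exists>e>0. \<forall>v\<in>carrier_vec n. e * (v \<bullet> v) \<le> v \<bullet> (A *v v)"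
proof -
  have sym: "A\<^sup>T = A" using pd unfolding positive_definite_iff[OF A] by blast
  note inv = positive_definite_invertible[OF A pd]
  obtain K where K: "K > 0" "opbound A K" using opbound_exists by blast
  obtain L where L: "L > 0" "opbound (mat_inv A) L" using opbound_exists by blast
  have *: "v \<bullet> v \<le> L\<^sup>2 * K * (v \<bullet> (A *v v))" if v: "v \<in> carrier_vec n" for v
    apply (rule psd_invertible_lower[OF A sym _ K(1) _ L(1) _ v]) using positive_definite_nonneg[OF A pd] quad_le_opbound[OF A K(2)]
      inverse_lower[OF A mat_inv_carrier[OF A inv] mat_inv_left[OF A inv] L(2)] by force+
  show ?thesis by (rule exI[of _ "1 / (L\<^sup>2 * K)"]) (use * K L in \<open>auto simp: field_simps\<close>)
qed

section \<open>Traces\<close>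

lemma mat_trace_mult_comm:
  assumes "A \<in> carrier_mat m n" "B \<in> carrier_mat n m"
  shows "mat_trace (A * B) = mat_trace (B * A)" using assms unfolding mat_trace_def
  by (simp add: scalar_prod_def) (subst sum.swap, simp add: mult.commute lessThan_atLeast0)

lemma mat_trace_add:
  assumes "A \<in> carrier_mat n n" "B \<in> carrier_mat n n"
  shows "mat_trace (A + B) = mat_trace A + mat_trace B" using assms by (simp add: mat_trace_def sum.distrib)

lemma mat_trace_minus:
  assumes "A \<in> carrier_mat n n" "B \<in> carrier_mat n n"
  shows "mat_trace (A - B) = mat_trace A - mat_trace B" using assms by (simp add: mat_trace_def sum_subtractf)

lemma mat_trace_smult: "A \<in> carrier_mat n n \<Longrightarrow> mat_trace (k \<cdot>\<^sub>m A) = k * mat_trace A"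
  by (simp add: mat_trace_def sum_distrib_left)

lemma mat_trace_one: "mat_trace (1\<^sub>m n) = real n" by (simp add: mat_trace_def)

lemma mat_trace_transpose_mult_quad:
  assumes E: "E \<in> carrier_mat n m" and A: "A \<in> carrier_mat n n"
  shows "mat_trace (E\<^sup>T * (A * E)) = (\<Sum>j<m. col E j \<bullet> (A *v col E j))"
  using assms by (auto simp: mat_trace_def mult_mat_vec_def intro!: sum.cong)

lemma mat_trace_transpose_mult_self:
  assumes E: "E \<in> carrier_mat n m"
  shows "mat_trace (E\<^sup>T * E) = (\<Sum>j<m. col E j \<bullet> col E j)" using assms by (auto simp: mat_trace_def intro!: sum.cong)

lemma mat_eq_0_of_cols:
  assumes E: "(E :: real mat) \<in> carrier_mat n m" and "\<And>j. j < m \<Longrightarrow> col E j = 0\<^sub>v n"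
  shows "E = 0\<^sub>m n m"
proof (rule eq_matI)
  fix i j assume "i < dim_row (0\<^sub>m n m)" "j < dim_col (0\<^sub>m n m)"
  then have ij: "i < n" "j < m" by auto
  have "E $$ (i, j) = col E j $ i" using E ij by simp
  then show "E $$ (i, j) = 0\<^sub>m n m $$ (i, j)" using assms(2)[OF ij(2)] ij by simp
qed (use E in auto)

lemma mat_trace_self_eq_0:
  assumes E: "E \<in> carrier_mat n m" and 0: "mat_trace (E\<^sup>T * E) = 0"
  shows "E = 0\<^sub>m n m"
proof (rule mat_eq_0_of_cols[OF E])
  fix j assume "j < m"
  then have "col E j \<bullet> col E j = 0" using 0 unfolding mat_trace_transpose_mult_self[OF E]
    by (subst (asm) sum_nonneg_eq_0_iff) (auto simp: scalar_prod_self_nonneg)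
  then show "col E j = 0\<^sub>v n" using scalar_prod_self_eq_0[of "col E j" n] E by auto
qed

text \<open>With E = B - C one has \<open>B E + E C = B B - C C = 0\<close>. Multiplying by E and
  taking traces writes 0 as a sum of B-forms and C-forms of the columns of E, all nonnegative;
  definiteness of B then kills every column.\<close>

lemma square_root_unique:
  assumes B: "B \<in> carrier_mat n n" "positive_definite B"
    and C: "C \<in> carrier_mat n n" "positive_definite C" and eq: "B * B = C * C"
  shows "B = C"
proof -
  define E where "E = B - C"
  have E: "E \<in> carrier_mat n n" unfolding E_def using C by (intro minus_carrier_mat)
  have Bs: "B\<^sup>T = B" and Cs: "C\<^sup>T = C" using B C positive_definite_iff by blast+
  have Es: "E\<^sup>T = E" unfolding E_def using transpose_minus[OF B(1) C(1)] Bs Cs by simp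
  have BE: "B * E = B * B - B * C" unfolding E_def by (rule mult_minus_distrib_mat) (use B C in auto)
  have EC: "E * C = B * C - C * C" unfolding E_def by (rule minus_mult_distrib_mat) (use B C in auto)
  have "B * E + E * C = 0\<^sub>m n n" unfolding BE EC eq using B C by (intro eq_matI) auto
  then have "mat_trace (E * (B * E + E * C)) = 0" using E by (simp add: mat_trace_def)
  moreover have "E * (B * E + E * C) = E * (B * E) + E * (E * C)" by (rule mult_add_distrib_mat) (use B C E in auto)
  ultimately have "mat_trace (E * (B * E)) + mat_trace (E * (E * C)) = 0" using B C E by (simp add: mat_trace_add[of _ n])
  moreover have "mat_trace (E * (E * C)) = mat_trace (E * (C * E))" using mat_trace_mult_comm[of "E * C" n n E] E C(1) by simp
  ultimately have 0: "(\<Sum>j<n. col E j \<bullet> (B *v col E j)) + (\<Sum>j<n. col E j \<bullet> (C *v col E j)) = 0"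
    using mat_trace_transpose_mult_quad[OF E B(1)] mat_trace_transpose_mult_quad[OF E C(1)] Es by simp
  have nn: "0 \<le> col E j \<bullet> (B *v col E j)" "0 \<le> col E j \<bullet> (C *v col E j)" if "j < n" for j
    using positive_definite_nonneg B C E by auto
  have "(\<Sum>j<n. col E j \<bullet> (B *v col E j)) \<ge> 0" "(\<Sum>j<n. col E j \<bullet> (C *v col E j)) \<ge> 0"
    by (auto intro!: sum_nonneg nn)
  then have "(\<Sum>j<n. col E j \<bullet> (B *v col E j)) = 0" using 0 by linarith
  then have z: "col E j \<bullet> (B *v col E j) = 0" if "j < n" for j using that nn by (subst (asm) sum_nonneg_eq_0_iff) auto
  have "E = 0\<^sub>m n n"
  proof (rule mat_eq_0_of_cols[OF E])
    fix j assume j: "j < n"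
    have "col E j \<in> carrier_vec n" using E j by auto
    then show "col E j = 0\<^sub>v n" using z[OF j] B(2) unfolding positive_definite_iff[OF B(1)] by force
  qed
  then have "\<And>i j. i < n \<Longrightarrow> j < n \<Longrightarrow> B $$ (i, j) - C $$ (i, j) = 0"
    unfolding E_def using B C by (metis carrier_matD index_minus_mat(1) index_zero_mat(1))
  then show ?thesis using B C by (intro eq_matI) auto
qed

text \<open>Picard iteration for \<open>1 - sqrt (1 - R)\<close>. It reduces the existence of a
  square root to completeness of the reals, entry by entry, instead of a spectral theorem.\<close>

fun sqrt_iterate :: "nat \<Rightarrow> real mat \<Rightarrow> nat \<Rightarrow> real mat" where
  "sqrt_iterate n R 0 = 0\<^sub>m n n"
| "sqrt_iterate n R (Suc k) = (1/2) \<cdot>\<^sub>m (R + sqrt_iterate n R k * sqrt_iterate n R k)"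

text \<open>The map Y to (R + Y Y)/2 is a contraction on the ball of radius r < 1; its fixed point Y
  satisfies (I - Y)(I - Y) = I - R.\<close>

lemma sqrt_iterate_fixpoint:
  assumes R: "R \<in> carrier_mat n n" "R\<^sup>T = R" "opbound R r" and r: "r < 1"
  shows "\<exists>Y\<in>carrier_mat n n. Y\<^sup>T = Y \<and> Y = (1/2) \<cdot>\<^sub>m (R + Y * Y) \<and>
    (\<forall>v\<in>carrier_vec n. v \<bullet> (Y *v v) \<le> r * (v \<bullet> v))"
proof -
  let ?Y = "sqrt_iterate n R"
  have r0: "0 \<le> r" using R(3) by (simp add: opbound_def)
  have Yc: "?Y k \<in> carrier_mat n n" for k by (induction k) (use R in auto)
  have Yd [simp]: "dim_row (?Y k) = n" "dim_col (?Y k) = n" for k using Yc[of k] by auto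
  have Ysym: "transpose_mat (?Y k) = ?Y k" for k
  proof (induction k)
    case (Suc k)
    have "transpose_mat (?Y (Suc k)) = (1/2) \<cdot>\<^sub>m transpose_mat (R + ?Y k * ?Y k)" by (intro eq_matI) (use R Yc[of k] in auto)
    also have "transpose_mat (R + ?Y k * ?Y k) = R + ?Y k * ?Y k"
      using transpose_add[of R n n "?Y k * ?Y k"] transpose_mult[OF Yc[of k] Yc[of k]] R Suc Yc[of k] by simp
    finally show ?case by simp
  qed simp
  have Yb: "opbound (?Y k) r" for k
  proof (induction k)
    case 0
    then show ?case using r0 by (auto simp: opbound_def zero_mat_mult_vec)
  next
    case (Suc k)
    have "opbound (R + ?Y k * ?Y k) (r + r * r)" by (rule opbound_add[of _ n n]) (use R Yc[of k] Suc opbound_mult[OF Yc Yc] in auto)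
    from opbound_smult[OF this, of "1/2"] have "opbound (?Y (Suc k)) ((r + r * r) / 2)" by simp
    \<comment> \<open>The ball of radius r is invariant because r < 1.\<close>
    moreover have "(r + r * r) / 2 \<le> r" using r r0 mult_left_mono[of r 1 r] by simp
    ultimately show ?case by (rule opbound_mono)
  qed
  define De where "De k = ?Y (Suc k) - ?Y k" for k
  have Dc: "De k \<in> carrier_mat n n" for k unfolding De_def using Yc by (intro minus_carrier_mat)
  have Db: "opbound (De k) (r ^ k)" for k
  proof (induction k)
    case 0
    have "De 0 = ?Y 1" unfolding De_def by (intro eq_matI) (use Yc[of 1] in auto)
    moreover have "opbound (?Y 1) 1" using Yb[of 1] r by (rule opbound_mono[OF _ less_imp_le])
    ultimately show ?case by simp
  next
    case (Suc k)
    let ?A = "?Y (Suc k)" and ?B = "?Y k"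
    \<comment> \<open>Matrix products do not commute, so the difference of the squares is written as
      \<open>A (A - B) + (A - B) B\<close>.\<close>
    have "De (Suc k) = (1/2) \<cdot>\<^sub>m (?A * De k + De k * ?B)"
    proof -
      have 1: "?A * De k = ?A * ?A - ?A * ?B" unfolding De_def by (rule mult_minus_distrib_mat[OF Yc Yc Yc])
      have 2: "De k * ?B = ?A * ?B - ?B * ?B" unfolding De_def by (rule minus_mult_distrib_mat[OF Yc Yc Yc])
      have "De (Suc k) = (1/2) \<cdot>\<^sub>m (R + ?A * ?A) - (1/2) \<cdot>\<^sub>m (R + ?B * ?B)" unfolding De_def by simp
      also have "\<dots> = (1/2) \<cdot>\<^sub>m (?A * ?A - ?A * ?B + (?A * ?B - ?B * ?B))"
        by (intro eq_matI) (use R in \<open>auto simp del: sqrt_iterate.simps simp: field_simps\<close>)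
      finally show ?thesis using 1 2 by simp
    qed
    moreover have "opbound (?A * De k + De k * ?B) (r * r ^ k + r ^ k * r)"
      by (rule opbound_add[OF mult_carrier_mat[OF Yc Dc] mult_carrier_mat[OF Dc Yc]
            opbound_mult[OF Yc Dc Yb Suc] opbound_mult[OF Dc Yc Suc Yb]])
    ultimately have "opbound (De (Suc k)) (\<bar>1/2\<bar> * (r * r ^ k + r ^ k * r))" using opbound_smult by metis
    then show ?case by (simp only: abs_of_pos[of "1/2::real"]) (simp add: mult.commute)
  qed
  have conv: "\<exists>l. (\<lambda>k. ?Y k $$ (i, j)) \<longlonglongrightarrow> l" if ij: "i < n" "j < n" for i j
  proof -
    have D: "norm (De k $$ (i, j)) \<le> r ^ k" for k using opbound_entry[OF Dc Db ij] by simp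
    have "summable (\<lambda>k. r ^ k)" using r r0 by (intro summable_geometric) simp
    from summable_comparison_test'[OF this D] have "summable (\<lambda>k. De k $$ (i, j))" .
    then have "(\<lambda>m. \<Sum>k<m. De k $$ (i, j)) \<longlonglongrightarrow> (\<Sum>k. De k $$ (i, j))" by (rule summable_LIMSEQ)
    moreover have "(\<Sum>k<m. De k $$ (i, j)) = ?Y m $$ (i, j)" for m
    proof -
      have "(\<Sum>k<m. De k $$ (i, j)) = (\<Sum>k<m. ?Y (Suc k) $$ (i, j) - ?Y k $$ (i, j))"
        unfolding De_def using ij by (simp del: sqrt_iterate.simps)
      also have "\<dots> = ?Y m $$ (i, j) - ?Y 0 $$ (i, j)" by (rule sum_lessThan_telescope)
      finally show ?thesis using ij by simp
    qed
    ultimately show ?thesis by auto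
  qed
  define Y where "Y = mat n n (\<lambda>(i, j). lim (\<lambda>k. ?Y k $$ (i, j)))"
  have Y: "Y \<in> carrier_mat n n" by (simp add: Y_def)
  have lim: "(\<lambda>k. ?Y k $$ (i, j)) \<longlonglongrightarrow> Y $$ (i, j)" if ij: "i < n" "j < n" for i j
    using conv[OF ij] ij by (auto simp: Y_def convergent_def convergent_LIMSEQ_iff[symmetric])
  have sym: "Y\<^sup>T = Y"
  proof (rule eq_matI)
    fix i j assume "i < dim_row Y" "j < dim_col Y"
    then have ij: "i < n" "j < n" using Y by auto
    have "?Y k $$ (j, i) = ?Y k $$ (i, j)" for k using arg_cong[OF Ysym[of k], of "\<lambda>M. M $$ (i, j)"] Yc[of k] ij by simp
    then have "Y $$ (j, i) = Y $$ (i, j)" using lim[OF ij] lim[OF ij(2,1)] LIMSEQ_unique by simp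
    then show "Y\<^sup>T $$ (i, j) = Y $$ (i, j)" using Y ij by simp
  qed (use Y in auto)
  have fixpt: "Y = (1/2) \<cdot>\<^sub>m (R + Y * Y)"
  proof (rule eq_matI)
    fix i j assume "i < dim_row ((1/2) \<cdot>\<^sub>m (R + Y * Y))" "j < dim_col ((1/2) \<cdot>\<^sub>m (R + Y * Y))"
    then have ij: "i < n" "j < n" using Y R by auto
    have "(\<lambda>k. (R $$ (i, j) + (\<Sum>l<n. ?Y k $$ (i, l) * ?Y k $$ (l, j))) / 2)
        \<longlonglongrightarrow> (R $$ (i, j) + (\<Sum>l<n. Y $$ (i, l) * Y $$ (l, j))) / 2" by (intro tendsto_intros lim) (use ij in auto)
    moreover have "(R $$ (i, j) + (\<Sum>l<n. ?Y k $$ (i, l) * ?Y k $$ (l, j))) / 2 = ?Y (Suc k) $$ (i, j)" for k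
      using ij R Yc[of k] by (simp add: scalar_prod_lessThan)
    ultimately have "(\<lambda>k. ?Y (Suc k) $$ (i, j)) \<longlonglongrightarrow> (R $$ (i, j) + (\<Sum>l<n. Y $$ (i, l) * Y $$ (l, j))) / 2"
      by (simp del: sqrt_iterate.simps)
    from LIMSEQ_unique[OF LIMSEQ_Suc[OF lim[OF ij]] this]
    show "Y $$ (i, j) = ((1/2) \<cdot>\<^sub>m (R + Y * Y)) $$ (i, j)" using ij R Y by (simp add: scalar_prod_lessThan)
  qed (use Y R in auto)
  have "v \<bullet> (Y *v v) \<le> r * (v \<bullet> v)" if v: "v \<in> carrier_vec n" for v
  proof (rule LIMSEQ_le_const2)
    have e: "v \<bullet> (A *v v) = (\<Sum>i<n. v $ i * (\<Sum>j<n. A $$ (i, j) * v $ j))" if "A \<in> carrier_mat n n" for A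
      using that v by (simp add: scalar_prod_lessThan)
    have "(\<lambda>k. \<Sum>i<n. v $ i * (\<Sum>j<n. ?Y k $$ (i, j) * v $ j)) \<longlonglongrightarrow> (\<Sum>i<n. v $ i * (\<Sum>j<n. Y $$ (i, j) * v $ j))"
      by (intro tendsto_intros lim) auto
    then show "(\<lambda>k. v \<bullet> (?Y k *v v)) \<longlonglongrightarrow> v \<bullet> (Y *v v)" using e[OF Y] e[OF Yc] by simp
    show "\<exists>N. \<forall>k\<ge>N. v \<bullet> (?Y k *v v) \<le> r * (v \<bullet> v)"
      using quad_le_opbound[OF Yc Yb v] by (auto simp: abs_le_iff)
  qed
  then show ?thesis using Y sym fixpt by blast
qed

text \<open>After division by an upper bound c the matrix lies between e/c and 1, so
  \<open>R = 1 - A/c\<close> has norm at most r = 1 - e/c < 1. The fixed point Y gives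
  \<open>(1 - Y)\<^sup>2 = A/c\<close>, and the form bound r for Y makes 1 - Y positive
  definite.\<close>

lemma square_root_exists:
  assumes A: "A \<in> carrier_mat n n" and pd: "positive_definite A"
  shows "\<exists>B\<in>carrier_mat n n. positive_definite B \<and> B * B = A"
proof -
  have sym: "A\<^sup>T = A" using pd unfolding positive_definite_iff[OF A] by blast
  obtain e where e: "e > 0" "\<And>v. v\<in>carrier_vec n \<Longrightarrow> e * (v \<bullet> v) \<le> v \<bullet> (A *v v)"
    using positive_definite_lower[OF A pd] by blast
  obtain c' where c': "c' > 0" "opbound A c'" using opbound_exists by blast
  \<comment> \<open>Adding e secures \<open>e < c\<close>, hence \<open>0 \<le> r\<close>, without
    comparing e and c'.\<close>
  define c where "c = c' + e"
  have c: "c > 0" "e < c" "\<And>v. v\<in>carrier_vec n \<Longrightarrow> v \<bullet> (A *v v) \<le> c * (v \<bullet> v)"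
  proof -
    fix v :: "real vec" assume v: "v \<in> carrier_vec n"
    have "v \<bullet> (A *v v) \<le> c' * (v \<bullet> v)" using quad_le_opbound[OF A c'(2) v] by (simp add: abs_le_iff)
    also have "\<dots> \<le> c * (v \<bullet> v)" using e unfolding c_def by (intro mult_right_mono scalar_prod_self_nonneg) simp
    finally show "v \<bullet> (A *v v) \<le> c * (v \<bullet> v)" .
  qed (use e c' in \<open>auto simp: c_def\<close>)
  define R where "R = 1 \<cdot>\<^sub>m 1\<^sub>m n - (1/c) \<cdot>\<^sub>m A"
  define r where "r = 1 - e / c"
  have r: "0 \<le> r" "r < 1" using e c unfolding r_def by (auto simp: field_simps)
  have cA: "(1/c) \<cdot>\<^sub>m A \<in> carrier_mat n n" using A by simp
  have R: "R \<in> carrier_mat n n" unfolding R_def by (intro minus_carrier_mat cA)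
  have Rsym: "R\<^sup>T = R" unfolding R_def using A by (intro eq_matI) (auto simp: sym_mat_index[OF sym A])
  have cAv: "(1/c) \<cdot>\<^sub>m A *v v = (1/c) \<cdot>\<^sub>v (A *v v)" if "v \<in> carrier_vec n" for v
    using A that by (intro eq_vecI) (auto simp: row_smult)
  have Rv: "v \<bullet> (R *v v) = v \<bullet> v - (v \<bullet> (A *v v)) / c" if v: "v \<in> carrier_vec n" for v
    unfolding R_def using minus_smult_one_mult_vec[OF cA v, of 1] A v by (simp add: scalar_prod_minus_distrib[of _ n] cAv)
  have Rnn: "0 \<le> v \<bullet> (R *v v)" if v: "v \<in> carrier_vec n" for v using c(3)[OF v] c(1) by (simp add: Rv[OF v] field_simps)
  have Rle: "v \<bullet> (R *v v) \<le> r * (v \<bullet> v)" if v: "v \<in> carrier_vec n" for v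
    using e(2)[OF v] c(1) by (simp add: Rv[OF v] r_def field_simps)
  have "opbound R r" unfolding opbound_def
  proof (intro conjI ballI r)
    fix v :: "real vec" assume "v \<in> carrier_vec (dim_col R)"
    then have v: "v \<in> carrier_vec n" using R by simp
    have "(vec_norm2 (R *v v))\<^sup>2 \<le> r * (v \<bullet> (R *v v))"
      using psd_norm_sq_le[OF R Rsym Rnn Rle v] by (simp add: vec_norm2_power2)
    also have "\<dots> \<le> r * (r * (v \<bullet> v))" by (intro mult_left_mono Rle v r)
    also have "\<dots> = (r * vec_norm2 v)\<^sup>2" by (simp add: power_mult_distrib vec_norm2_power2) (simp add: power2_eq_square)
    finally show "vec_norm2 (R *v v) \<le> r * vec_norm2 v" by (rule power2_le_imp_le) (use r in simp)
  qed
  then obtain Y where Y: "Y \<in> carrier_mat n n" "Y\<^sup>T = Y" "Y = (1/2) \<cdot>\<^sub>m (R + Y * Y)"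
    "\<And>v. v\<in>carrier_vec n \<Longrightarrow> v \<bullet> (Y *v v) \<le> r * (v \<bullet> v)"
    using sqrt_iterate_fixpoint[OF R Rsym _ r(2)] by blast
  define B where "B = 1 \<cdot>\<^sub>m 1\<^sub>m n - Y"
  have B: "B \<in> carrier_mat n n" unfolding B_def by (intro minus_carrier_mat Y)
  have Bsym: "B\<^sup>T = B" unfolding B_def using Y(1) by (intro eq_matI) (auto simp: sym_mat_index[OF Y(2,1)])
  have BB: "B * B = (1/c) \<cdot>\<^sub>m A"
  proof -
    have "B * B = 1 \<cdot>\<^sub>m 1\<^sub>m n * B - Y * B" unfolding B_def
      by (rule minus_mult_distrib_mat[of _ n n _ _ n]) (use Y in auto)
    also have "1 \<cdot>\<^sub>m 1\<^sub>m n * B = B" using B by simp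
    also have "Y * B = Y * (1 \<cdot>\<^sub>m 1\<^sub>m n) - Y * Y" unfolding B_def
      by (rule mult_minus_distrib_mat[of _ n n _ n]) (use Y in auto)
    also have "Y * (1 \<cdot>\<^sub>m 1\<^sub>m n) = Y" using Y by simp
    finally have *: "B * B = B - (Y - Y * Y)" .
    show ?thesis unfolding *
    proof (rule eq_matI)
      fix i j assume "i < dim_row ((1/c) \<cdot>\<^sub>m A)" "j < dim_col ((1/c) \<cdot>\<^sub>m A)"
      then have ij: "i < n" "j < n" using A by auto
      have "Y $$ (i, j) = ((1/2) \<cdot>\<^sub>m (R + Y * Y)) $$ (i, j)" using Y(3) by simp
      then have "2 * Y $$ (i, j) = R $$ (i, j) + (Y * Y) $$ (i, j)"
        using ij R Y(1) by (simp del: index_mult_mat(1) add: index_mult_mat(2,3))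
      moreover have "R $$ (i, j) = (if i = j then 1 else 0) - A $$ (i, j) / c" unfolding R_def using ij A by simp
      moreover have "B $$ (i, j) = (if i = j then 1 else 0) - Y $$ (i, j)" unfolding B_def using ij Y(1) by simp
      ultimately show "(B - (Y - Y * Y)) $$ (i, j) = ((1/c) \<cdot>\<^sub>m A) $$ (i, j)"
        using ij A B Y(1) by (simp del: index_mult_mat(1) add: index_mult_mat(2,3))
    qed (use A B Y(1) in auto)
  qed
  define C where "C = sqrt c \<cdot>\<^sub>m B"
  have C: "C \<in> carrier_mat n n" using B by (simp add: C_def)
  have "C * C = c \<cdot>\<^sub>m (B * B)" unfolding C_def using B c(1)
    by (simp add: mult_smult_distrib[of _ n n] mult_smult_assoc_mat[of _ n n]) (auto intro!: eq_matI simp: mult.assoc[symmetric])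
  also have "\<dots> = A" unfolding BB using A c(1) by (auto intro!: eq_matI)
  finally have CC: "C * C = A" .
  have "v \<bullet> (C *v v) > 0" if v: "v \<in> carrier_vec n" "v \<noteq> 0\<^sub>v n" for v
  proof -
    have "v \<bullet> v > 0" using scalar_prod_self_nonneg[of v] scalar_prod_self_eq_0[OF v(1)] v(2) by linarith
    moreover have "v \<bullet> (Y *v v) \<le> r * (v \<bullet> v)" by (rule Y(4)[OF v(1)])
    moreover have "r * (v \<bullet> v) < 1 * (v \<bullet> v)" using calculation(1) r by (intro mult_strict_right_mono) auto
    moreover have "v \<bullet> (B *v v) = v \<bullet> v - v \<bullet> (Y *v v)"
      unfolding B_def using minus_smult_one_mult_vec[OF Y(1) v(1), of 1] Y(1) v by (simp add: scalar_prod_minus_distrib[of _ n])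
    ultimately have "v \<bullet> (B *v v) > 0" by linarith
    moreover have "C *v v = sqrt c \<cdot>\<^sub>v (B *v v)" unfolding C_def using B v by (intro eq_vecI) (auto simp: row_smult)
    ultimately show ?thesis using c(1) v B by simp
  qed
  moreover have "C\<^sup>T = C" unfolding C_def using B by (intro eq_matI) (auto simp: sym_mat_index[OF Bsym B])
  ultimately have "positive_definite C" unfolding positive_definite_iff[OF C] by blast
  then show ?thesis using C CC by blast
qed

text \<open>Existence and uniqueness of the positive definite root turn the description operator in
  the definition into a usable matrix.\<close>

lemma mat_inv_sqrt:
  assumes A: "A \<in> carrier_mat n n" and pd: "positive_definite A"
  shows mat_inv_sqrt_carrier: "mat_inv_sqrt A \<in> carrier_mat n n"
    and mat_inv_sqrt_pd: "positive_definite (mat_inv_sqrt A)"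
    and mat_inv_sqrt_mult: "mat_inv_sqrt A * mat_inv_sqrt A = mat_inv A"
proof -
  note inv = positive_definite_invertible[OF A pd]
  obtain B where B: "B \<in> carrier_mat n n" "positive_definite B" "B * B = mat_inv A"
    using square_root_exists[OF mat_inv_carrier[OF A inv] positive_definite_mat_inv[OF A pd]] by blast
  have "mat_inv_sqrt A = B" unfolding mat_inv_sqrt_def
  proof (rule the_equality)
    show "dim_row B = dim_row A \<and> positive_definite B \<and> B * B = mat_inv A" using A B by auto
    fix C assume C: "dim_row C = dim_row A \<and> positive_definite C \<and> C * C = mat_inv A"
    then have "C \<in> carrier_mat n n" using A by (auto simp: positive_definite_def)
    then show "C = B" using square_root_unique[of C n B] B C by simp
  qed
  then show "mat_inv_sqrt A \<in> carrier_mat n n" "positive_definite (mat_inv_sqrt A)"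
    "mat_inv_sqrt A * mat_inv_sqrt A = mat_inv A" using B by auto
qed

section \<open>Generalized least squares\<close>

text \<open>Associativity with dimension equations as premises in place of carriers: simplification
  computes the dimensions, so long products can be rebracketed by rewriting.\<close>

lemma mat_assoc:
  fixes A :: "real mat"
  assumes "dim_col A = dim_row B" "dim_col B = dim_row C"
  shows "(A * B) * C = A * (B * C)" by (rule assoc_mult_mat[of _ "dim_row A" "dim_row B" _ "dim_row C" _ "dim_col C"]) (use assms in auto)

lemma mat_vec_assoc:
  fixes A :: "real mat"
  assumes "dim_col A = dim_row B" "dim_col B = dim_vec v"
  shows "(A * B) *v v = A *v (B *v v)" by (rule assoc_mult_mat_vec[of _ "dim_row A" "dim_row B" _ "dim_vec v"]) (use assms in auto)

definition injective_mat :: "real mat \<Rightarrow> bool" where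
  "injective_mat A \<longleftrightarrow>
    (\<forall>v\<in>carrier_vec (dim_col A). A *v v = 0\<^sub>v (dim_row A) \<longrightarrow> v = 0\<^sub>v (dim_col A))"

lemma injective_matD:
  assumes "injective_mat A" "A \<in> carrier_mat n m" "v \<in> carrier_vec m" "A *v v = 0\<^sub>v n"
  shows "v = 0\<^sub>v m" using assms by (auto simp: injective_mat_def)

text \<open>The rank is the size of a maximal independent subset of the set of columns. Repeated
  columns make that set too small, so full rank forces distinct columns; a nonzero kernel vector is
  then a linear dependence among them.\<close>

lemma full_rank_injective:
  assumes A: "(A :: real mat) \<in> carrier_mat n m" and rank: "vec_space.rank n A = m"
  shows "injective_mat A" unfolding injective_mat_def
proof (intro ballI impI)
  interpret vec_space "TYPE(real)" n .
  fix v assume "v \<in> carrier_vec (dim_col A)" "A *v v = 0\<^sub>v (dim_row A)"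
  then have v: "v \<in> carrier_vec m" "A *v v = 0\<^sub>v n" using A by auto
  have "v = 0\<^sub>v m"
  proof (rule ccontr)
  assume v0: "v \<noteq> 0\<^sub>v m"
  have "distinct (cols A)"
  proof (rule ccontr)
    assume nd: "\<not> distinct (cols A)"
    obtain S where S: "maximal S (\<lambda>T. T \<subseteq> set (cols A) \<and> lin_indpt T)"
      using maximal_exists[of "(\<lambda>T. T \<subseteq> set (cols A) \<and> lin_indpt T)" "card (set (cols A))" "{}"]
      by (meson List.finite_set card_mono empty_iff empty_subsetI finite_lin_indpt2 rev_finite_subset)
    then have "card S \<le> card (set (cols A))" by (simp add: card_mono maximal_def)
    also have "\<dots> < length (cols A)" using nd card_distinct card_length le_neq_implies_less by blast
    finally have "card S < m" using A by simp
    then show False using rank rank_card_indpt[OF A S] by simp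
  qed
  then show False using lin_depI[OF A v(1) v0 v(2)] full_rank_lin_indpt[OF A rank] by blast
  qed
  then show "v = 0\<^sub>v (dim_col A)" using A by simp
qed

lemma quad_transpose_mult:
  assumes A: "(A :: real mat) \<in> carrier_mat n m" and B: "B \<in> carrier_mat n n" and v: "v \<in> carrier_vec m"
  shows "v \<bullet> ((A\<^sup>T * B * A) *v v) = (A *v v) \<bullet> (B *v (A *v v))"
proof -
  have "v \<bullet> ((A\<^sup>T * B * A) *v v) = v \<bullet> (A\<^sup>T *v (B *v (A *v v)))" using A B v by (simp add: mat_vec_assoc)
  also have "\<dots> = (A\<^sup>T *v (B *v (A *v v))) \<bullet> v" by (rule comm_scalar_prod[of _ m]) (use A B v in auto)
  also have "\<dots> = (B *v (A *v v)) \<bullet> (A *v v)" by (rule transpose_vec_mult_scalar[OF A v]) (use A B v in auto)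
  also have "\<dots> = (A *v v) \<bullet> (B *v (A *v v))" by (rule comm_scalar_prod[of _ n]) (use A B v in auto)
  finally show ?thesis .
qed

lemma positive_definite_congruence:
  assumes A: "A \<in> carrier_mat n m" and B: "B \<in> carrier_mat n n" "positive_definite B"
    and inj: "injective_mat A"
  shows "positive_definite (A\<^sup>T * B * A)"
proof -
  have C: "A\<^sup>T * B * A \<in> carrier_mat m m" using A B by auto
  have Bs: "B\<^sup>T = B" using B positive_definite_iff by blast
  have "transpose_mat (A\<^sup>T * B * A) = A\<^sup>T * (B * A)"
    using A B Bs transpose_mult[of "A\<^sup>T * B" m n A m] transpose_mult[of "A\<^sup>T" m n B n] by simp
  then have "transpose_mat (A\<^sup>T * B * A) = A\<^sup>T * B * A" using A B by simp
  moreover have "v \<bullet> ((A\<^sup>T * B * A) *v v) > 0" if v: "v \<in> carrier_vec m" "v \<noteq> 0\<^sub>v m" for v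
    using quad_transpose_mult[OF A B(1) v(1)] injective_matD[OF inj A v(1)] v A B(2) unfolding positive_definite_iff[OF B(1)] by fastforce
  ultimately show ?thesis unfolding positive_definite_iff[OF C] by blast
qed

text \<open>The covariance matrix of the GLS fitted values. The projection onto the column space of
  X is this matrix times the inverse of V; leaving that factor out keeps the matrix
  symmetric.\<close>

definition gls_proj :: "real mat \<Rightarrow> real mat \<Rightarrow> real mat" where
  "gls_proj X V = X * mat_inv (X\<^sup>T * mat_inv V * X) * X\<^sup>T"

text \<open>P as a function of X and V, so that V can be varied without reference to the
  parametrization.\<close>

definition gls_P :: "real mat \<Rightarrow> real mat \<Rightarrow> real mat" where
  "gls_P X V = mat_inv V - mat_inv V * X * mat_inv (X\<^sup>T * mat_inv V * X) * X\<^sup>T * mat_inv V"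

locale gls =
  fixes N p :: nat and X V :: "real mat"
  assumes X: "X \<in> carrier_mat N p"
    and inj: "injective_mat X"
    and V: "V \<in> carrier_mat N N" and pd: "positive_definite V"
begin

definition "Vi = mat_inv V"
definition "H = mat_inv (X\<^sup>T * Vi * X)"
definition "J = gls_proj X V"
definition "P = gls_P X V"

lemma V_sym: "V\<^sup>T = V" using V pd positive_definite_iff by blast
lemma Vi: "Vi \<in> carrier_mat N N" unfolding Vi_def by (rule mat_inv_carrier[OF V positive_definite_invertible[OF V pd]])
lemma V_Vi: "V * Vi = 1\<^sub>m N" unfolding Vi_def by (rule mat_inv_right[OF V positive_definite_invertible[OF V pd]])
lemma Vi_pd: "positive_definite Vi" unfolding Vi_def by (rule positive_definite_mat_inv[OF V pd])
lemma Vi_sym: "Vi\<^sup>T = Vi" using Vi Vi_pd positive_definite_iff by blast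

lemma information_carrier: "X\<^sup>T * Vi * X \<in> carrier_mat p p" using X Vi by auto
lemma information_pd: "positive_definite (X\<^sup>T * Vi * X)" by (rule positive_definite_congruence[OF X Vi Vi_pd inj])
lemmas information_inv = positive_definite_invertible[OF information_carrier information_pd]
lemma H: "H \<in> carrier_mat p p" unfolding H_def by (rule mat_inv_carrier[OF information_carrier information_inv])
lemma H_left: "H * (X\<^sup>T * Vi * X) = 1\<^sub>m p" unfolding H_def by (rule mat_inv_left[OF information_carrier information_inv])
lemma H_right: "(X\<^sup>T * Vi * X) * H = 1\<^sub>m p" unfolding H_def by (rule mat_inv_right[OF information_carrier information_inv])
lemma H_sym: "H\<^sup>T = H" unfolding H_def using information_carrier information_pd information_inv
  by (intro transpose_mat_inv[of _ p]) (auto simp: positive_definite_iff)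

lemma J_eq: "J = X * H * X\<^sup>T" by (simp add: J_def gls_proj_def H_def Vi_def)
lemma J: "J \<in> carrier_mat N N" unfolding J_eq using X H by auto
lemma J_sym: "J\<^sup>T = J" unfolding J_eq using X H H_sym transpose_mult[of "X * H" N p "X\<^sup>T" N] transpose_mult[OF X H] by simp

lemma J_Vi_X: "J * (Vi * X) = X"
proof -
  have "J * (Vi * X) = X * (H * (X\<^sup>T * Vi * X))" unfolding J_eq using X H Vi by (simp add: mat_assoc)
  then show ?thesis using H_left X by simp
qed

lemma J_Vi_J: "J * (Vi * J) = J"
proof -
  have "J * (Vi * J) = (J * (Vi * X)) * (H * X\<^sup>T)" unfolding J_eq[of] using X H Vi J by (simp add: mat_assoc)
  also have "\<dots> = J" unfolding J_Vi_X using J_eq X H by simp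
  finally show ?thesis .
qed

lemma P_eq: "P = Vi - Vi * (J * Vi)"
proof -
  have "Vi * X * H * X\<^sup>T * Vi = Vi * (J * Vi)" unfolding J_eq using X H Vi by (simp add: mat_assoc)
  then show ?thesis by (simp add: P_def gls_P_def Vi_def H_def)
qed

lemma P: "P \<in> carrier_mat N N" unfolding P_eq using Vi J by (intro minus_carrier_mat) auto

lemma P_sym: "P\<^sup>T = P"
proof -
  have "transpose_mat (Vi * (J * Vi)) = (Vi * J) * Vi"
    using transpose_mult[of Vi N N "J * Vi" N] transpose_mult[of J N N Vi N] Vi J Vi_sym J_sym by simp
  then show ?thesis unfolding P_eq using transpose_minus[of Vi N N "Vi * (J * Vi)"] Vi J Vi_sym by simp
qed

text \<open>V P is the residual maker: \<open>V P u\<close> is u minus its GLS fit. The comparisons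
  of fits under different covariance matrices all go through this identity.\<close>

lemma V_P: "V * P = 1\<^sub>m N - J * Vi"
proof -
  have "V * P = V * Vi - V * (Vi * (J * Vi))" unfolding P_eq by (rule mult_minus_distrib_mat) (use V Vi J in auto)
  also have "V * (Vi * (J * Vi)) = (V * Vi) * (J * Vi)" using V Vi J by (simp add: mat_assoc)
  finally show ?thesis using V_Vi J Vi by simp
qed

lemma P_V: "P * V = 1\<^sub>m N - Vi * J"
proof -
  have "P * V = transpose_mat (V * P)" using transpose_mult[OF V P] V_sym P_sym by simp
  also have "\<dots> = 1\<^sub>m N - Vi * J" unfolding V_P
    using transpose_minus[of "1\<^sub>m N" N N "J * Vi"] transpose_mult[OF J Vi] J Vi J_sym Vi_sym by simp
  finally show ?thesis .
qed

lemma P_X: "P * X = 0\<^sub>m N p"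
proof -
  have "P * X = Vi * X - Vi * (J * Vi) * X" unfolding P_eq by (rule minus_mult_distrib_mat) (use X Vi J in auto)
  also have "Vi * (J * Vi) * X = Vi * (J * (Vi * X))" using X Vi J by (simp add: mat_assoc)
  finally show ?thesis unfolding J_Vi_X using X Vi by auto
qed

lemma P_V_P: "P * (V * P) = P"
proof -
  have "P * (V * P) = P * 1\<^sub>m N - P * (J * Vi)" unfolding V_P by (rule mult_minus_distrib_mat) (use P J Vi in auto)
  also have "P * (J * Vi) = (P * X) * (H * X\<^sup>T * Vi)" unfolding J_eq using P X H Vi by (simp add: mat_assoc)
  also have "\<dots> = 0\<^sub>m N N" unfolding P_X using H X Vi by simp
  finally show ?thesis using P by auto
qed

lemma P_psd:
  assumes v: "v \<in> carrier_vec N"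
  shows "v \<bullet> (P *v v) = (P *v v) \<bullet> (V *v (P *v v))"
proof -
  have "P\<^sup>T * V * P = P" using P_sym P_V_P P V by simp
  then show ?thesis using quad_transpose_mult[OF P V v] by simp
qed


text \<open>The chain is \<open>l |P v|\<^sup>2 \<le> (P v)' V (P v) = v' P v \<le> |v| |P
  v|\<close>.\<close>

lemma P_opbound:
  assumes l: "l > 0" "\<And>w. w \<in> carrier_vec N \<Longrightarrow> l * (w \<bullet> w) \<le> w \<bullet> (V *v w)"
  shows "opbound P (1 / l)" unfolding opbound_def
proof (intro conjI ballI)
  fix v :: "real vec" assume "v \<in> carrier_vec (dim_col P)"
  then have v: "v \<in> carrier_vec N" using P by simp
  let ?w = "P *v v"
  have w: "?w \<in> carrier_vec N" using P v by simp
  have "l * (vec_norm2 ?w * vec_norm2 ?w) \<le> v \<bullet> ?w" using l(2)[OF w] P_psd[OF v] by (simp add: vec_norm2_sq)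
  also have "\<dots> \<le> vec_norm2 v * vec_norm2 ?w" using scalar_prod_le_norm[OF v w] by simp
  finally have "(l * vec_norm2 ?w) * vec_norm2 ?w \<le> vec_norm2 v * vec_norm2 ?w" by (simp add: mult.assoc)
  then have "l * vec_norm2 ?w \<le> vec_norm2 v" by (cases "vec_norm2 ?w = 0") (auto simp: mult_le_cancel_right order.strict_iff_order)
  then show "vec_norm2 ?w \<le> 1 / l * vec_norm2 v" using l(1) by (simp add: field_simps)
qed (use l in simp)

text \<open>The GLS fit at the design point x has variance x H x.\<close>

lemma H_quad_le:
  assumes x: "x \<in> carrier_vec p"
    and l: "l > 0" "\<And>w. w \<in> carrier_vec p \<Longrightarrow> l * (w \<bullet> w) \<le> w \<bullet> ((X\<^sup>T * Vi * X) *v w)"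
  shows "x \<bullet> (H *v x) \<le> (x \<bullet> x) / l"
proof -
  let ?y = "H *v x"
  let ?K = "X\<^sup>T * Vi * X"
  have y: "?y \<in> carrier_vec p" using H x by simp
  have Ky: "?K *v ?y = x" using assoc_mult_mat_vec[OF information_carrier H x] H_right x by simp
  have q: "l * (?y \<bullet> ?y) \<le> x \<bullet> ?y" using l(2)[OF y] unfolding Ky using comm_scalar_prod[OF x y] by simp
  have "(l * vec_norm2 ?y) * vec_norm2 ?y \<le> vec_norm2 x * vec_norm2 ?y"
    using q scalar_prod_le_norm[OF x y] by (simp add: mult.assoc vec_norm2_sq)
  then have "l * vec_norm2 ?y \<le> vec_norm2 x" by (cases "vec_norm2 ?y = 0") (auto simp: mult_le_cancel_right order.strict_iff_order)
  then have "vec_norm2 ?y \<le> vec_norm2 x / l" using l(1) by (simp add: field_simps)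
  then have "vec_norm2 x * vec_norm2 ?y \<le> vec_norm2 x * (vec_norm2 x / l)" by (intro mult_left_mono) auto
  then show ?thesis using scalar_prod_le_norm[OF x y] by (simp add: vec_norm2_sq)
qed

end

section \<open>Two covariance matrices with the same design\<close>

locale gls2 = A: gls N p X V + B: gls N p X V' for N p X V V'
begin

text \<open>V' P' is the identity up to a term whose range lies in the column space of X, and P
  annihilates that space.\<close>

lemma P_V'_P': "A.P * (V' * B.P) = A.P"
proof -
  have "A.P * (V' * B.P) = A.P * 1\<^sub>m N - A.P * (B.J * B.Vi)" unfolding B.V_P
    by (rule mult_minus_distrib_mat) (use A.P B.J B.Vi in auto)
  also have "A.P * (B.J * B.Vi) = (A.P * X) * (B.H * X\<^sup>T * B.Vi)" unfolding B.J_eq using A.P A.X B.H B.Vi by (simp add: mat_assoc)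
  also have "\<dots> = 0\<^sub>m N N" unfolding A.P_X using B.H A.X B.Vi by simp
  finally show ?thesis using A.P by auto
qed

lemma P_V_P': "A.P * (V * B.P) = B.P"
proof -
  interpret C: gls2 N p X V' V by unfold_locales
  have "A.P * (V * B.P) = transpose_mat (B.P * (V * A.P))"
    using A.P B.P A.V transpose_mult[of B.P N N "V * A.P" N] transpose_mult[OF A.V A.P] A.P_sym B.P_sym A.V_sym by simp
  also have "\<dots> = B.P" unfolding C.P_V'_P' by (rule B.P_sym)
  finally show ?thesis .
qed

text \<open>The resolvent identity, exact however far V' is from V: P behaves like an inverse of V,
  with \<open>P V' P' = P\<close> and \<open>P V P' = P'\<close> as the cancellation rules.\<close>

lemma P'_eq: "B.P = A.P - A.P * ((V' - V) * B.P)"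
proof -
  have "(V' - V) * B.P = V' * B.P - V * B.P" by (rule minus_mult_distrib_mat) (use A.V B.V B.P in auto)
  then have "A.P * ((V' - V) * B.P) = A.P * (V' * B.P) - A.P * (V * B.P)"
    by (simp, intro mult_minus_distrib_mat) (use A.P A.V B.V B.P in auto)
  then have "A.P * ((V' - V) * B.P) = A.P - B.P" by (simp add: P_V'_P' P_V_P')
  then show ?thesis using A.P B.P by (intro eq_matI) auto
qed

text \<open>Passing from V to V' amounts to changing the data from u to w while keeping P and J of
  V. The third equation involves only the fixed P, and iterating it gives bounds that are uniform in
  V'.\<close>

lemma fit_eq:
  assumes u: "u \<in> carrier_vec N"
  defines "w \<equiv> u - (V' - V) *v (B.P *v u)"
  shows "B.P *v u = A.P *v w" and "B.J *v (B.Vi *v u) = A.J *v (A.Vi *v w)"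
    and "w = u - (V' - V) *v (A.P *v w)"
proof -
  have D: "V' - V \<in> carrier_mat N N" by (rule minus_carrier_mat[OF A.V])
  have w: "w \<in> carrier_vec N" unfolding w_def using D B.P u by simp
  have "B.P *v u = (A.P - A.P * ((V' - V) * B.P)) *v u" using P'_eq by simp
  also have "\<dots> = A.P *v u - A.P *v ((V' - V) *v (B.P *v u))"
    using minus_mult_distrib_mat_vec[of A.P N N "A.P * ((V' - V) * B.P)" u] A.P B.P D u A.V B.V by (simp add: mat_vec_assoc)
  also have "\<dots> = A.P *v w" unfolding w_def by (rule mult_minus_distrib_mat_vec[symmetric]) (use A.P D B.P u in auto)
  finally show 1: "B.P *v u = A.P *v w" .
  show "w = u - (V' - V) *v (A.P *v w)" unfolding 1[symmetric] by (simp add: w_def)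
  have JB: "B.J *v (B.Vi *v z) = z - V' *v (B.P *v z)" if z: "z \<in> carrier_vec N" for z
  proof -
    have "B.J * B.Vi = 1\<^sub>m N - V' * B.P" unfolding B.V_P using B.J B.Vi by (intro eq_matI) auto
    then have "B.J *v (B.Vi *v z) = (1\<^sub>m N - V' * B.P) *v z" using B.J B.Vi z by (simp flip: assoc_mult_mat_vec)
    also have "\<dots> = z - V' *v (B.P *v z)" using minus_mult_distrib_mat_vec[of "1\<^sub>m N" N N "V' * B.P" z] B.V B.P z by simp
    finally show ?thesis .
  qed
  have JA: "A.J *v (A.Vi *v z) = z - V *v (A.P *v z)" if z: "z \<in> carrier_vec N" for z
  proof -
    have "A.J * A.Vi = 1\<^sub>m N - V * A.P" unfolding A.V_P using A.J A.Vi by (intro eq_matI) auto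
    then have "A.J *v (A.Vi *v z) = (1\<^sub>m N - V * A.P) *v z" using A.J A.Vi z by (simp flip: assoc_mult_mat_vec)
    also have "\<dots> = z - V *v (A.P *v z)" using minus_mult_distrib_mat_vec[of "1\<^sub>m N" N N "V * A.P" z] A.V A.P z by simp
    finally show ?thesis .
  qed
  have b: "B.P *v u \<in> carrier_vec N" using B.P u by simp
  \<comment> \<open>Fits are data minus residuals: \<open>u - V' P' u = w - V P' u\<close>, and
    \<open>P' u = P w\<close>.\<close>
  have "(V' - V) *v (B.P *v u) = V' *v (B.P *v u) - V *v (B.P *v u)" by (rule minus_mult_distrib_mat_vec[OF B.V A.V b])
  then have "u - V' *v (B.P *v u) = w - V *v (B.P *v u)" unfolding w_def using u A.V B.V b by (intro eq_vecI) auto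
  then show "B.J *v (B.Vi *v u) = A.J *v (A.Vi *v w)" using JB[OF u] JA[OF w] 1 by simp
qed

end

section \<open>Error contrasts\<close>

text \<open>A matrix T with TX = 0 and complementary rank spans the orthogonal complement of X: the difference
  between I and the sum of the two orthogonal projections is a symmetric idempotent of trace 0.\<close>

lemma complementary_projections:
  assumes T: "(T :: real mat) \<in> carrier_mat N (N - p)" and X: "X \<in> carrier_mat N p" and p: "p \<le> N"
    and T_inj: "injective_mat T"
    and X_inj: "injective_mat X"
    and TX: "T\<^sup>T * X = 0\<^sub>m (N - p) p"
  shows "\<exists>A B. A \<in> carrier_mat (N - p) N \<and> B \<in> carrier_mat p N \<and> A = mat_inv (T\<^sup>T * T) * T\<^sup>T
    \<and> 1\<^sub>m N = T * A + X * B"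
proof -
  define m where "m = N - p"
  note T = T[folded m_def] and TX = TX[folded m_def]
  have one: "1\<^sub>m N \<in> carrier_mat N N" "positive_definite (1\<^sub>m N)" using positive_definite_iff[of "1\<^sub>m N" N]
    by (auto simp: scalar_prod_self_eq_0 scalar_prod_self_nonneg order.strict_iff_order)
  have gram: "positive_definite (Y\<^sup>T * Y)" "Y\<^sup>T * Y \<in> carrier_mat q q"
      "invertible_mat (Y\<^sup>T * Y)" if Y: "(Y :: real mat) \<in> carrier_mat N q" "injective_mat Y" for Y q
  proof -
    show a: "positive_definite (Y\<^sup>T * Y)" using positive_definite_congruence[OF Y(1) one Y(2)] Y(1) by simp
    show b: "Y\<^sup>T * Y \<in> carrier_mat q q" using Y(1) by simp
    show "invertible_mat (Y\<^sup>T * Y)" by (rule positive_definite_invertible[OF b a])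
  qed
  define pr where "pr Y = Y * (mat_inv (Y\<^sup>T * Y) * Y\<^sup>T)" for Y :: "real mat"
  have pr: "pr Y \<in> carrier_mat N N" "transpose_mat (pr Y) = pr Y" "pr Y * pr Y = pr Y"
      "mat_trace (pr Y) = real q" "mat_inv (Y\<^sup>T * Y) * Y\<^sup>T \<in> carrier_mat q N"
    if Y: "(Y :: real mat) \<in> carrier_mat N q" "injective_mat Y" for Y q
  proof -
    note g = gram[OF Y] and I = mat_inv_carrier[OF gram(2,3)[OF Y]]
    let ?I = "mat_inv (Y\<^sup>T * Y)"
    show "?I * Y\<^sup>T \<in> carrier_mat q N" using I Y(1) by simp
    show "pr Y \<in> carrier_mat N N" using I Y(1) by (simp add: pr_def)
    have Is: "?I\<^sup>T = ?I" using transpose_mat_inv[OF g(2) _ g(3)] g(1) positive_definite_iff[OF g(2)] by blast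
    show "transpose_mat (pr Y) = pr Y" unfolding pr_def
      using I Y(1) Is transpose_mult[of Y N q "?I * Y\<^sup>T" N] transpose_mult[of ?I q q "Y\<^sup>T" N] by simp
    have "pr Y * pr Y = Y * ((?I * (Y\<^sup>T * Y)) * (?I * Y\<^sup>T))" unfolding pr_def using I Y(1) by (simp add: mat_assoc)
    then show "pr Y * pr Y = pr Y" unfolding mat_inv_left[OF g(2,3)] pr_def using I Y(1) by simp
    have "mat_trace (pr Y) = mat_trace ((?I * Y\<^sup>T) * Y)" unfolding pr_def by (rule mat_trace_mult_comm) (use I Y(1) in auto)
    also have "(?I * Y\<^sup>T) * Y = 1\<^sub>m q" using mat_inv_left[OF g(2,3)] I Y(1) by simp
    finally show "mat_trace (pr Y) = real q" by (simp add: mat_trace_one)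
  qed
  note pT = pr[OF T T_inj] and pX = pr[OF X X_inj]
  have XT: "X\<^sup>T * T = 0\<^sub>m p m" using arg_cong[OF TX, of transpose_mat] transpose_mult[of "T\<^sup>T" m N X p] T X by simp
  have TXp: "pr T * pr X = 0\<^sub>m N N"
  proof -
    have "pr T * pr X = T * (mat_inv (T\<^sup>T * T) * ((T\<^sup>T * X) * (mat_inv (X\<^sup>T * X) * X\<^sup>T)))"
      unfolding pr_def using T X mat_inv_carrier[OF gram(2,3)[OF T T_inj]] mat_inv_carrier[OF gram(2,3)[OF X X_inj]]
      by (simp add: mat_assoc)
    then show ?thesis unfolding TX left_mult_zero_mat[OF pX(5)] using T mat_inv_carrier[OF gram(2,3)[OF T T_inj]] by simp
  qed
  have XTp: "pr X * pr T = 0\<^sub>m N N" using arg_cong[OF TXp, of transpose_mat] transpose_mult[OF pT(1) pX(1)] pT(2) pX(2) by simp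
  define E where "E = 1\<^sub>m N - (pr T + pr X)"
  have S: "pr T + pr X \<in> carrier_mat N N" using pT(1) pX(1) by simp
  have E: "E \<in> carrier_mat N N" unfolding E_def by (rule minus_carrier_mat[OF S])
  have Es: "E\<^sup>T = E" unfolding E_def using transpose_minus[OF one(1) S] transpose_add[OF pT(1) pX(1)] pT(2) pX(2) by simp
  have SS: "(pr T + pr X) * (pr T + pr X) = pr T + pr X"
  proof -
    have "(pr T + pr X) * (pr T + pr X) = pr T * (pr T + pr X) + pr X * (pr T + pr X)" by (rule add_mult_distrib_mat[OF pT(1) pX(1) S])
    also have "pr T * (pr T + pr X) = pr T * pr T + pr T * pr X" by (rule mult_add_distrib_mat[OF pT(1) pT(1) pX(1)])
    also have "pr X * (pr T + pr X) = pr X * pr T + pr X * pr X" by (rule mult_add_distrib_mat[OF pX(1) pT(1) pX(1)])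
    finally show ?thesis using pT pX TXp XTp by simp
  qed
  have "E * E = E * 1\<^sub>m N - E * (pr T + pr X)" unfolding E_def
    by (rule mult_minus_distrib_mat) (use E S in \<open>auto simp: E_def\<close>)
  also have "E * (pr T + pr X) = 1\<^sub>m N * (pr T + pr X) - (pr T + pr X) * (pr T + pr X)" unfolding E_def
    by (rule minus_mult_distrib_mat[OF one(1) S S])
  also have "\<dots> = 0\<^sub>m N N" unfolding SS left_mult_one_mat[OF S] using S by (intro eq_matI) auto
  finally have EE: "E * E = E" using E by auto
  have "mat_trace (E\<^sup>T * E) = mat_trace (1\<^sub>m N) - (mat_trace (pr T) + mat_trace (pr X))" unfolding Es EE unfolding E_def
    using mat_trace_minus[OF one(1) S] mat_trace_add[OF pT(1) pX(1)] by simp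
  also have "\<dots> = 0" using p by (simp add: mat_trace_one pT(4) pX(4) m_def)
  finally have "E = 0\<^sub>m N N" by (rule mat_trace_self_eq_0[OF E])
  then have ent: "E $$ (i, j) = 0" if "i < N" "j < N" for i j using that by simp
  have "1\<^sub>m N = pr T + pr X"
  proof (rule eq_matI)
    fix i j assume "i < dim_row (pr T + pr X)" "j < dim_col (pr T + pr X)"
    then have "i < N" "j < N" using S by auto
    then show "1\<^sub>m N $$ (i, j) = (pr T + pr X) $$ (i, j)" using ent[of i j] pT(1) pX(1) unfolding E_def by auto
  qed (use S in auto)
  then show ?thesis unfolding pr_def using pT(5) pX(5) unfolding m_def by blast
qed

context gls begin

text \<open>This links the likelihood, whose determinant sees V only through T, to P. Let Q be the
  right-hand side and T' the transpose of T. Then \<open>P V Q = Q\<close> and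
  \<open>T' V Q = T'\<close>. The identity splits as \<open>T A + X B\<close>, and P kills the
  second part, so \<open>P = P T A = P T A V Q = P V Q = Q\<close>.\<close>

lemma P_contrast:
  assumes T: "T \<in> carrier_mat N (N - p)" and p: "p \<le> N"
    and T_inj: "injective_mat T"
    and TX: "T\<^sup>T * X = 0\<^sub>m (N - p) p"
  shows "P = T * (mat_inv (T\<^sup>T * V * T) * T\<^sup>T)"
proof -
  define m where "m = N - p"
  note T = T[folded m_def] and TX = TX[folded m_def]
  let ?K = "T\<^sup>T * V * T"
  let ?I = "mat_inv ?K"
  have Kpd: "positive_definite ?K" by (rule positive_definite_congruence[OF T V pd T_inj])
  have K: "?K \<in> carrier_mat m m" using T V by simp
  note Kinv = positive_definite_invertible[OF K Kpd]
  note I = mat_inv_carrier[OF K Kinv]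
  obtain A B where A: "A \<in> carrier_mat m N" "A = mat_inv (T\<^sup>T * T) * T\<^sup>T"
    and B: "B \<in> carrier_mat p N" and AB: "1\<^sub>m N = T * A + X * B"
    using complementary_projections[OF assms(1) X p assms(3) inj assms(4)] unfolding m_def by blast
  define Q where "Q = T * (?I * T\<^sup>T)"
  have Q: "Q \<in> carrier_mat N N" using T I by (simp add: Q_def)
  have XQ: "X\<^sup>T * Q = 0\<^sub>m p N"
  proof -
    have "X\<^sup>T * T = 0\<^sub>m p m" using arg_cong[OF TX, of transpose_mat] transpose_mult[of "T\<^sup>T" m N X p] T X by simp
    moreover have "X\<^sup>T * Q = (X\<^sup>T * T) * (?I * T\<^sup>T)" unfolding Q_def using X T I by (simp add: mat_assoc)
    ultimately show ?thesis using I T by simp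
  qed
  have PVQ: "P * (V * Q) = Q"
  proof -
    have "P * (V * Q) = (P * V) * Q" using P V Q by simp
    also have "\<dots> = 1\<^sub>m N * Q - (Vi * J) * Q" unfolding P_V by (rule minus_mult_distrib_mat) (use Vi J Q in auto)
    also have "(Vi * J) * Q = Vi * (X * (H * (X\<^sup>T * Q)))" unfolding J_eq using Vi X H Q by (simp add: mat_assoc)
    also have "\<dots> = 0\<^sub>m N N" unfolding XQ using Vi X H by simp
    finally show ?thesis using Q by auto
  qed
  have TR: "T\<^sup>T * (V * Q) = T\<^sup>T"
  proof -
    have "T\<^sup>T * (V * Q) = (?K * ?I) * T\<^sup>T" unfolding Q_def using T V I by (simp add: mat_assoc)
    then show ?thesis using mat_inv_right[OF K Kinv] T by simp
  qed
  have "T * A * (V * Q) = T * A"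
  proof -
    have G: "mat_inv (T\<^sup>T * T) \<in> carrier_mat m m"
    proof -
      have "dim_row A = m" using A(1) by simp
      moreover have "T\<^sup>T * T \<in> carrier_mat m m" using T by simp
      moreover have "positive_definite (T\<^sup>T * 1\<^sub>m N * T)" by (rule positive_definite_congruence[OF T _ _ T_inj])
          (auto simp: positive_definite_iff[of _ N] scalar_prod_self_eq_0 scalar_prod_self_nonneg order.strict_iff_order)
      ultimately show ?thesis using T by (intro mat_inv_carrier positive_definite_invertible[of _ m]) auto
    qed
    have "T * A * (V * Q) = T * (mat_inv (T\<^sup>T * T) * (T\<^sup>T * (V * Q)))" unfolding A(2) using T V Q G by (simp add: mat_assoc)
    then show ?thesis unfolding TR by (simp add: A(2))
  qed
  then have "P * (T * A * (V * Q)) = P * (T * A)" by simp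
  moreover have "P * (T * A) = P"
  proof -
    have "P * (T * A + X * B) = P * (T * A) + P * (X * B)" by (rule mult_add_distrib_mat) (use P T A(1) X B in auto)
    moreover have "P * (X * B) = (P * X) * B" using P X B by simp
    ultimately show ?thesis unfolding AB[symmetric] P_X using B P T A(1) by simp
  qed
  moreover have "P * (T * A * (V * Q)) = (P * (T * A)) * (V * Q)" using P T A(1) V Q by (simp add: mat_assoc)
  ultimately have "P = P * (V * Q)" by simp
  then show ?thesis using PVQ by (simp add: Q_def)
qed

end

section \<open>Derivatives of matrix functions\<close>

text \<open>Jacobi's formula at the identity, from the Leibniz expansion: a permutation other than
  the identity moves at least two indices, so its product has at least two factors vanishing at 0
  and no first-order term.\<close>

lemma DERIV_det_one_plus:
  assumes C: "(C :: real mat) \<in> carrier_mat n n"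
  shows "((\<lambda>t. det (1\<^sub>m n + t \<cdot>\<^sub>m C)) has_field_derivative mat_trace C) (at 0)"
proof -
  let ?f = "\<lambda>p i t. (1\<^sub>m n + t \<cdot>\<^sub>m C) $$ (i, p i)"
  have perm: "p i < n" if "p permutes {0..<n}" "i < n" for p i using permutes_in_image[OF that(1), of i] that(2) by simp
  have f: "?f p i t = (if i = p i then 1 else 0) + t * C $$ (i, p i)" if "p permutes {0..<n}" "i < n" for p i t
    using perm[OF that] that C by simp
  have D: "((\<lambda>t. \<Prod>i=0..<n. ?f p i t) has_field_derivative (if p = id then mat_trace C else 0)) (at 0)"
    if p: "p permutes {0..<n}" for p
  proof -
    have "((\<lambda>t. \<Prod>i=0..<n. (if i = p i then 1 else 0) + t * C $$ (i, p i)) has_field_derivative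
       (\<Sum>i=0..<n. C $$ (i, p i) * (\<Prod>j\<in>{0..<n} - {i}. (if j = p j then 1 else 0) + 0 * C $$ (j, p j)))) (at 0)"
      by (rule has_field_derivative_prod) (auto intro!: derivative_eq_intros)
    moreover have "(\<Sum>i=0..<n. C $$ (i, p i) * (\<Prod>j\<in>{0..<n} - {i}. (if j = p j then 1 else 0) + 0 * C $$ (j, p j)))
      = (if p = id then mat_trace C else 0)"
    proof (cases "p = id")
      case True
      then show ?thesis using C by (simp add: mat_trace_def lessThan_atLeast0)
    next
      case False
      then obtain a where a: "p a \<noteq> a" by (auto simp: fun_eq_iff)
      have an: "a \<in> {0..<n}" using a p unfolding permutes_def by blast
      have pan: "p a \<in> {0..<n}" using permutes_in_image[OF p] an by blast
      have ppa: "p (p a) \<noteq> p a" using a permutes_inj[OF p] by (auto simp: inj_def)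
      have z: "(\<Prod>j\<in>{0..<n} - {i}. (if j = p j then 1 else 0) + 0 * C $$ (j, p j)) = 0" for i
      proof -
        obtain b where "b \<in> {0..<n} - {i}" "p b \<noteq> b" using a an pan ppa by (cases "i = a") auto
        then show ?thesis by (intro prod_zero bexI[of _ b]) auto
      qed
      show ?thesis using False unfolding z by simp
    qed
    ultimately have "((\<lambda>t. \<Prod>i=0..<n. (if i = p i then 1 else 0) + t * C $$ (i, p i)) has_field_derivative
       (if p = id then mat_trace C else 0)) (at 0)" by simp
    moreover have "(\<lambda>t. \<Prod>i=0..<n. ?f p i t) = (\<lambda>t. \<Prod>i=0..<n. (if i = p i then 1 else 0) + t * C $$ (i, p i))"
      by (intro ext prod.cong refl f p) auto
    ultimately show ?thesis by simp
  qed
  let ?S = "{p. p permutes {0..<n}}"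
  have "((\<lambda>t. \<Sum>p\<in>?S. signof p * (\<Prod>i=0..<n. ?f p i t)) has_field_derivative
      (\<Sum>p\<in>?S. signof p * (if p = id then mat_trace C else 0))) (at 0)" by (intro DERIV_sum DERIV_cmult D) simp
  moreover have "(\<Sum>p\<in>?S. signof p * (if p = id then mat_trace C else 0)) = mat_trace C"
    by (subst sum.remove[of _ id]) (auto simp: permutes_id finite_permutations intro!: sum.neutral)
  moreover have "det (1\<^sub>m n + t \<cdot>\<^sub>m C) = (\<Sum>p\<in>?S. signof p * (\<Prod>i=0..<n. ?f p i t))" for t
    by (rule det_def') (use C in simp)
  ultimately show ?thesis by simp
qed

lemma mult_smult_mat:
  fixes A :: "real mat"
  assumes "dim_col A = dim_row B"
  shows "A * (k \<cdot>\<^sub>m B) = k \<cdot>\<^sub>m (A * B)"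
  by (rule mult_smult_distrib[of _ "dim_row A" "dim_row B" _ "dim_col B"]) (use assms in auto)

lemma smult_mult_mat:
  fixes A :: "real mat"
  assumes "dim_col A = dim_row B"
  shows "(k \<cdot>\<^sub>m A) * B = k \<cdot>\<^sub>m (A * B)"
  by (rule mult_smult_assoc_mat[of _ "dim_row A" "dim_row B" _ "dim_col B"]) (use assms in auto)

text \<open>Reduced to Jacobi's formula at the identity by factoring K out of the
  determinant.\<close>

lemma DERIV_ln_det:
  assumes K: "(K :: real mat) \<in> carrier_mat n n" and inv: "invertible_mat K" and pos: "det K > 0"
    and B: "B \<in> carrier_mat n n"
  shows "((\<lambda>x. ln (det (K + (x - x0) \<cdot>\<^sub>m B))) has_field_derivative mat_trace (mat_inv K * B)) (at x0)"
proof -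
  note I = mat_inv_carrier[OF K inv]
  let ?C = "mat_inv K * B"
  have C: "?C \<in> carrier_mat n n" using I B by simp
  have det_eq: "det (K + t \<cdot>\<^sub>m B) = det K * det (1\<^sub>m n + t \<cdot>\<^sub>m ?C)" for t
  proof -
    have "K * (1\<^sub>m n + t \<cdot>\<^sub>m ?C) = K * 1\<^sub>m n + K * (t \<cdot>\<^sub>m ?C)"
      by (rule mult_add_distrib_mat) (use K C in auto)
    also have "K * (t \<cdot>\<^sub>m ?C) = t \<cdot>\<^sub>m ((K * mat_inv K) * B)"
      using K I B by (simp add: mult_smult_mat smult_mult_mat mat_assoc)
    also have "\<dots> = t \<cdot>\<^sub>m B" using mat_inv_right[OF K inv] B by simp
    finally have "K + t \<cdot>\<^sub>m B = K * (1\<^sub>m n + t \<cdot>\<^sub>m ?C)" using K by simp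
    moreover have "1\<^sub>m n + t \<cdot>\<^sub>m ?C \<in> carrier_mat n n" using C by simp
    ultimately show ?thesis using det_mult[OF K] by metis
  qed
  have "((\<lambda>x. det (1\<^sub>m n + (x - x0) \<cdot>\<^sub>m ?C)) has_field_derivative mat_trace ?C * 1) (at x0)"
    by (rule DERIV_chain2[of "\<lambda>t. det (1\<^sub>m n + t \<cdot>\<^sub>m ?C)"])
      (use DERIV_det_one_plus[OF C] in \<open>auto intro!: derivative_eq_intros\<close>)
  from DERIV_cmult[OF this, of "det K"]
  have D: "((\<lambda>x. det (K + (x - x0) \<cdot>\<^sub>m B)) has_field_derivative det K * mat_trace ?C) (at x0)" unfolding det_eq by simp
  have "K + 0 \<cdot>\<^sub>m B = K" using K B by auto
  then have "((\<lambda>x. ln (det (K + (x - x0) \<cdot>\<^sub>m B))) has_field_derivative inverse (det K) * (det K * mat_trace ?C)) (at x0)"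
    using pos by (intro DERIV_chain2[OF DERIV_ln D, THEN DERIV_cong]) auto
  then show ?thesis using pos by (simp add: field_simps)
qed

text \<open>The determinant is the square of that of the positive definite root, and it is nonzero
  because the kernel is trivial.\<close>

lemma positive_definite_det_pos:
  assumes K: "K \<in> carrier_mat n n" and pd: "positive_definite K"
  shows "det K > 0"
proof -
  obtain B where B: "B \<in> carrier_mat n n" "B * B = K" using square_root_exists[OF K pd] by blast
  then have "det K = det B * det B" using det_mult by blast
  moreover have "det K \<noteq> 0"
  proof
    assume "det K = 0"
    then obtain v where "v \<in> carrier_vec n" "v \<noteq> 0\<^sub>v n" "K *v v = 0\<^sub>v n" using det_0_iff_vec_prod_zero[OF K] by blast
    moreover from this have "v \<bullet> (K *v v) = 0" by simp
    ultimately show False using pd unfolding positive_definite_iff[OF K] by force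
  qed
  ultimately show ?thesis by (metis linorder_neqE_linordered_idom not_square_less_zero)
qed

text \<open>Entrywise differentiability. The carrier condition is imposed only near x, since the
  dimensions of \<open>mat_inv\<close> of a singular matrix are unspecified.\<close>

definition mat_DERIV :: "nat \<Rightarrow> nat \<Rightarrow> (real \<Rightarrow> real mat) \<Rightarrow> real mat \<Rightarrow> real \<Rightarrow> bool" where
  "mat_DERIV m n F F' x \<longleftrightarrow> (\<forall>\<^sub>F y in nhds x. F y \<in> carrier_mat m n) \<and> F' \<in> carrier_mat m n \<and>
    (\<forall>i<m. \<forall>j<n. ((\<lambda>y. F y $$ (i, j)) has_field_derivative F' $$ (i, j)) (at x))"

lemma mat_DERIV_mult:
  assumes F: "mat_DERIV m k F F' x" and G: "mat_DERIV k n G G' x"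
  shows "mat_DERIV m n (\<lambda>y. F y * G y) (F' * G x + F x * G') x"
proof -
  have Fx: "F x \<in> carrier_mat m k" and Gx: "G x \<in> carrier_mat k n"
    using F G by (auto simp: mat_DERIV_def dest: eventually_nhds_x_imp_x)
  have F': "F' \<in> carrier_mat m k" and G': "G' \<in> carrier_mat k n" using F G by (auto simp: mat_DERIV_def)
  have ev: "\<forall>\<^sub>F y in nhds x. F y \<in> carrier_mat m k \<and> G y \<in> carrier_mat k n"
    using F G by (auto simp: mat_DERIV_def eventually_conj_iff)
  show ?thesis unfolding mat_DERIV_def
  proof (intro conjI allI impI)
    show "\<forall>\<^sub>F y in nhds x. F y * G y \<in> carrier_mat m n" using ev by eventually_elim auto
    show "F' * G x + F x * G' \<in> carrier_mat m n" using Fx Gx F' G' by simp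
    fix i j assume ij: "i < m" "j < n"
    have "((\<lambda>y. \<Sum>l<k. F y $$ (i, l) * G y $$ (l, j)) has_field_derivative
        (\<Sum>l<k. F' $$ (i, l) * G x $$ (l, j) + G' $$ (l, j) * F x $$ (i, l))) (at x)"
      by (intro DERIV_sum DERIV_mult) (use F G ij in \<open>auto simp: mat_DERIV_def\<close>)
    moreover have "(\<Sum>l<k. F' $$ (i, l) * G x $$ (l, j) + G' $$ (l, j) * F x $$ (i, l)) = (F' * G x + F x * G') $$ (i, j)"
      using Fx Gx F' G' ij by (simp add: scalar_prod_lessThan sum.distrib mult.commute)
    moreover have "\<forall>\<^sub>F y in nhds x. (F y * G y) $$ (i, j) = (\<Sum>l<k. F y $$ (i, l) * G y $$ (l, j))"
      using ev by eventually_elim (use ij in \<open>auto simp: scalar_prod_lessThan\<close>)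
    ultimately show "((\<lambda>y. (F y * G y) $$ (i, j)) has_field_derivative (F' * G x + F x * G') $$ (i, j)) (at x)"
      by (subst DERIV_cong_ev[OF refl _ refl]) auto
  qed
qed

lemma mat_DERIV_affine:
  assumes "A \<in> carrier_mat m n" "B \<in> carrier_mat m n"
  shows "mat_DERIV m n (\<lambda>y. A + (y - x) \<cdot>\<^sub>m B) B x"
  unfolding mat_DERIV_def using assms by (auto intro!: derivative_eq_intros)

lemma mat_DERIV_trace:
  assumes "mat_DERIV n n F F' x"
  shows "((\<lambda>y. mat_trace (F y)) has_field_derivative mat_trace F') (at x)"
proof -
  have "((\<lambda>y. \<Sum>i<n. F y $$ (i, i)) has_field_derivative (\<Sum>i<n. F' $$ (i, i))) (at x)"
    by (intro DERIV_sum) (use assms in \<open>auto simp: mat_DERIV_def\<close>)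
  moreover have "\<forall>\<^sub>F y in nhds x. F y \<in> carrier_mat n n" and "F' \<in> carrier_mat n n"
    using assms by (auto simp: mat_DERIV_def)
  then have "\<forall>\<^sub>F y in nhds x. mat_trace (F y) = (\<Sum>i<n. F y $$ (i, i))" "mat_trace F' = (\<Sum>i<n. F' $$ (i, i))"
    by (auto simp: mat_trace_def elim: eventually_mono)
  ultimately show ?thesis by (subst DERIV_cong_ev[OF refl _ refl]) auto
qed

lemma quad_form_sum:
  assumes "A \<in> carrier_mat n n" "v \<in> carrier_vec n" "w \<in> carrier_vec n"
  shows "v \<bullet> (A *v w) = (\<Sum>i<n. \<Sum>j<n. v $ i * A $$ (i, j) * w $ j)"
  using assms by (simp add: scalar_prod_lessThan sum_distrib_left mult.assoc)

lemma mat_DERIV_quad: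
  assumes F: "mat_DERIV n n F F' x" and v: "v \<in> carrier_vec n"
  shows "((\<lambda>y. v \<bullet> (F y *v v)) has_field_derivative v \<bullet> (F' *v v)) (at x)"
proof -
  have "((\<lambda>y. \<Sum>i<n. \<Sum>j<n. v $ i * F y $$ (i, j) * v $ j) has_field_derivative
      (\<Sum>i<n. \<Sum>j<n. v $ i * F' $$ (i, j) * v $ j)) (at x)"
    by (intro DERIV_sum DERIV_cmult_right DERIV_cmult) (use F in \<open>auto simp: mat_DERIV_def\<close>)
  moreover have "\<forall>\<^sub>F y in nhds x. F y \<in> carrier_mat n n" and F': "F' \<in> carrier_mat n n"
    using F by (auto simp: mat_DERIV_def)
  from this(1) have "\<forall>\<^sub>F y in nhds x. v \<bullet> (F y *v v) = (\<Sum>i<n. \<Sum>j<n. v $ i * F y $$ (i, j) * v $ j)"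
    by eventually_elim (rule quad_form_sum[OF _ v v])
  ultimately show ?thesis unfolding quad_form_sum[OF F' v v] by (subst DERIV_cong_ev[OF refl _ refl]) auto
qed

text \<open>The resolvent identity turns the difference quotient into \<open>- P0 V1 P(x)\<close>.
  The common lower bound l for the forms bounds every P(x), so P(x) tends to P0; the derivative of
  an inverse matrix is never computed.\<close>

lemma gls_P_DERIV:
  assumes X: "X \<in> carrier_mat N p" "injective_mat X"
    and V0: "V0 \<in> carrier_mat N N" "positive_definite V0" and V1: "V1 \<in> carrier_mat N N"
    and ev: "\<forall>\<^sub>F x in nhds x0. positive_definite (V0 + (x - x0) \<cdot>\<^sub>m V1) \<and>
      (\<forall>w\<in>carrier_vec N. l * (w \<bullet> w) \<le> w \<bullet> ((V0 + (x - x0) \<cdot>\<^sub>m V1) *v w))" and l: "l > 0"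
  shows "mat_DERIV N N (\<lambda>x. gls_P X (V0 + (x - x0) \<cdot>\<^sub>m V1)) (- (gls_P X V0 * V1 * gls_P X V0)) x0"
proof -
  define V where "V x = V0 + (x - x0) \<cdot>\<^sub>m V1" for x
  define P where "P x = gls_P X (V x)" for x
  define P0 where "P0 = gls_P X V0"
  interpret A: gls N p X V0 by unfold_locales (use X V0 in auto)
  have P0: "P0 \<in> carrier_mat N N" using A.P by (simp add: A.P_def P0_def)
  have V: "V x \<in> carrier_mat N N" for x using V0 V1 by (simp add: V_def)
  have res: "P x \<in> carrier_mat N N \<and> opbound (P x) (1 / l) \<and> P x = P0 - (x - x0) \<cdot>\<^sub>m (P0 * V1 * P x)"
    if x: "positive_definite (V x)" "\<forall>w\<in>carrier_vec N. l * (w \<bullet> w) \<le> w \<bullet> (V x *v w)" for x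
  proof -
    interpret B: gls2 N p X V0 "V x" by unfold_locales (use X V0 V x in auto)
    have Px: "P x \<in> carrier_mat N N" using B.B.P by (simp add: B.B.P_def P_def)
    have D: "V x - V0 = (x - x0) \<cdot>\<^sub>m V1" unfolding V_def using V0 V1 by (intro eq_matI) auto
    have "P0 * (((x - x0) \<cdot>\<^sub>m V1) * P x) = (x - x0) \<cdot>\<^sub>m (P0 * V1 * P x)"
      using P0 V1 Px by (simp add: mult_smult_mat smult_mult_mat mat_assoc)
    then have "P x = P0 - (x - x0) \<cdot>\<^sub>m (P0 * V1 * P x)" using B.P'_eq unfolding D by (simp add: B.B.P_def A.P_def P_def P0_def)
    then show ?thesis using Px B.B.P_opbound[OF l] x(2) by (simp add: B.B.P_def P_def)
  qed
  have ev': "\<forall>\<^sub>F x in nhds x0. P x \<in> carrier_mat N N \<and> opbound (P x) (1 / l) \<and> P x = P0 - (x - x0) \<cdot>\<^sub>m (P0 * V1 * P x)"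
    using ev unfolding V_def[symmetric] by eventually_elim (use res in blast)
  have Px0: "P x0 = P0" unfolding P_def P0_def V_def using V0 V1 by (auto intro!: arg_cong[of _ _ "gls_P X"])
  obtain K where K: "K > 0" "opbound (P0 * V1) K" using opbound_exists by blast
  have ent: "P x $$ (i, j) = P0 $$ (i, j) - (x - x0) * (\<Sum>k<N. (P0 * V1) $$ (i, k) * P x $$ (k, j))"
    if x: "P x \<in> carrier_mat N N" "P x = P0 - (x - x0) \<cdot>\<^sub>m (P0 * V1 * P x)" and ij: "i < N" "j < N" for x i j
  proof -
    have "P x $$ (i, j) = (P0 - (x - x0) \<cdot>\<^sub>m (P0 * V1 * P x)) $$ (i, j)" using x(2) by simp
    also have "\<dots> = P0 $$ (i, j) - (x - x0) * (P0 * V1 * P x) $$ (i, j)" using x(1) P0 V1 ij by simp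
    also have "(P0 * V1 * P x) $$ (i, j) = (\<Sum>k<N. (P0 * V1) $$ (i, k) * P x $$ (k, j))"
      using x(1) P0 V1 ij by (auto simp: scalar_prod_lessThan simp del: assoc_mult_mat intro!: sum.cong)
    finally show ?thesis .
  qed
  have cont: "((\<lambda>x. P x $$ (i, j)) \<longlongrightarrow> P0 $$ (i, j)) (nhds x0)" if ij: "i < N" "j < N" for i j
  proof -
    have "\<forall>\<^sub>F x in nhds x0. norm (P x $$ (i, j) - P0 $$ (i, j)) \<le> \<bar>x - x0\<bar> * (K * (1 / l))" using ev'
    proof eventually_elim
      case (elim x)
      then have Pc: "P x \<in> carrier_mat N N" by blast
      have "P x $$ (i, j) = (P0 - (x - x0) \<cdot>\<^sub>m (P0 * V1 * P x)) $$ (i, j)" using elim by simp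
      also have "\<dots> = P0 $$ (i, j) - (x - x0) * (P0 * V1 * P x) $$ (i, j)" using Pc P0 V1 ij by simp
      finally have e: "P x $$ (i, j) - P0 $$ (i, j) = - ((x - x0) * (P0 * V1 * P x) $$ (i, j))" by simp
      have "\<bar>(P0 * V1 * P x) $$ (i, j)\<bar> \<le> K * (1 / l)"
        by (rule opbound_entry[OF _ opbound_mult[OF _ _ K(2)]]) (use elim P0 V1 ij in auto)
      then have "\<bar>x - x0\<bar> * \<bar>(P0 * V1 * P x) $$ (i, j)\<bar> \<le> \<bar>x - x0\<bar> * (K * (1 / l))"
        by (intro mult_left_mono) auto
      then show ?case unfolding e by (simp add: abs_mult)
    qed
    moreover have "((\<lambda>x. \<bar>x - x0\<bar> * (K * (1 / l))) \<longlongrightarrow> 0) (nhds x0)"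
    proof -
      have "((\<lambda>x. \<bar>x - x0\<bar> * (K * (1 / l))) \<longlongrightarrow> \<bar>x0 - x0\<bar> * (K * (1 / l))) (nhds x0)"
        by (intro tendsto_intros filterlim_ident)
      then show ?thesis by simp
    qed
    ultimately have "((\<lambda>x. P x $$ (i, j) - P0 $$ (i, j)) \<longlongrightarrow> 0) (nhds x0)" by (rule Lim_null_comparison)
    then show ?thesis by (simp add: Lim_null[symmetric])
  qed
  have "mat_DERIV N N P (- (P0 * V1 * P0)) x0" unfolding mat_DERIV_def
  proof (intro conjI allI impI)
    show "\<forall>\<^sub>F x in nhds x0. P x \<in> carrier_mat N N" using ev' by eventually_elim simp
    show "- (P0 * V1 * P0) \<in> carrier_mat N N" using P0 V1 by simp
    fix i j assume ij: "i < N" "j < N"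
    have "((\<lambda>x. - (\<Sum>k<N. (P0 * V1) $$ (i, k) * P x $$ (k, j))) \<longlongrightarrow> - (\<Sum>k<N. (P0 * V1) $$ (i, k) * P0 $$ (k, j))) (at x0)"
      by (intro tendsto_intros tendsto_mono[OF _ cont[OF _ ij(2)]]) (auto simp: at_within_le_nhds)
    moreover have "\<forall>\<^sub>F x in at x0. (P x $$ (i, j) - P x0 $$ (i, j)) / (x - x0) = - (\<Sum>k<N. (P0 * V1) $$ (i, k) * P x $$ (k, j))"
      unfolding eventually_at_filter using ev'
    proof eventually_elim
      case (elim x)
      then show ?case using ent[OF _ _ ij, of x] Px0 by (auto simp: divide_eq_eq)
    qed
    moreover have "- (\<Sum>k<N. (P0 * V1) $$ (i, k) * P0 $$ (k, j)) = (- (P0 * V1 * P0)) $$ (i, j)"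
      using P0 V1 ij by (auto simp: scalar_prod_lessThan simp del: assoc_mult_mat intro!: sum.cong)
    ultimately show "((\<lambda>x. P x $$ (i, j)) has_field_derivative (- (P0 * V1 * P0)) $$ (i, j)) (at x0)"
      unfolding has_field_derivative_iff by (simp add: tendsto_cong)
  qed
  then show ?thesis by (simp add: P_def[abs_def] V_def P0_def)
qed

section \<open>Fourth-order inequalities\<close>

lemma power4_eq: "(x :: real) ^ 4 = (x\<^sup>2)\<^sup>2" by simp

lemma prod4_le: "\<bar>a * b * c * d\<bar> \<le> (a ^ 4 + b ^ 4 + c ^ 4 + d ^ 4) / (4 :: real)"
proof -
  have *: "\<bar>x * y\<bar> \<le> (x\<^sup>2 + y\<^sup>2) / 2" for x y :: real
    using sum_squares_bound[of "\<bar>x\<bar>" "\<bar>y\<bar>"] by (simp add: abs_mult)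
  have "\<bar>a * b * c * d\<bar> = \<bar>(a * b) * (c * d)\<bar>" by (simp add: mult.assoc)
  also have "\<dots> \<le> ((a * b)\<^sup>2 + (c * d)\<^sup>2) / 2" by (rule *)
  also have "(a * b)\<^sup>2 \<le> (a ^ 4 + b ^ 4) / 2" using *[of "a\<^sup>2" "b\<^sup>2"] by (simp add: power_mult_distrib)
  also have "(c * d)\<^sup>2 \<le> (c ^ 4 + d ^ 4) / 2" using *[of "c\<^sup>2" "d\<^sup>2"] by (simp add: power_mult_distrib)
  finally show ?thesis by (simp add: add_divide_distrib)
qed

lemma sum2_power4_le: "(x + y) ^ 4 \<le> 8 * (x ^ 4 + y ^ 4 :: real)"
proof -
  have sq: "(a + b)\<^sup>2 \<le> 2 * (a\<^sup>2 + b\<^sup>2)" for a b :: real using sum_squares_bound[of a b] by (simp add: power2_sum)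
  have "(x + y) ^ 4 = ((x + y)\<^sup>2)\<^sup>2" by (rule power4_eq)
  also have "\<dots> \<le> (2 * (x\<^sup>2 + y\<^sup>2))\<^sup>2" by (rule power_mono[OF sq]) simp
  also have "\<dots> = 4 * (x\<^sup>2 + y\<^sup>2)\<^sup>2" by (simp only: power_mult_distrib) simp
  also have "\<dots> \<le> 4 * (2 * ((x\<^sup>2)\<^sup>2 + (y\<^sup>2)\<^sup>2))" by (intro mult_left_mono sq) simp
  finally show ?thesis by simp
qed

text \<open>A weighted arithmetic-geometric mean inequality: the first factor is divided by
  \<open>e ^ 3\<close> and each of the others multiplied by e. With e fixed and small, a small
  enough fourth moment of r makes the whole small.\<close>

lemma prod4_small_factor:
  fixes e :: real assumes e: "e > 0"
  shows "\<bar>r * b * c * d\<bar> \<le> (r ^ 4 / e ^ 12 + e ^ 4 * (b ^ 4 + c ^ 4 + d ^ 4)) / 4"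
proof -
  have "\<bar>r * b * c * d\<bar> = \<bar>(r / e ^ 3) * (e * b) * (e * c) * (e * d)\<bar>" using e by (simp add: power3_eq_cube)
  also have "\<dots> \<le> ((r / e ^ 3) ^ 4 + (e * b) ^ 4 + (e * c) ^ 4 + (e * d) ^ 4) / 4" by (rule prod4_le)
  also have "\<dots> = (r ^ 4 / e ^ 12 + e ^ 4 * (b ^ 4 + c ^ 4 + d ^ 4)) / 4"
    by (simp add: power_divide power_mult_distrib algebra_simps flip: power_mult)
  finally show ?thesis .
qed

text \<open>Factors are exchanged one at a time. The differences enter only through the bounds r1 to
  r4, which can later be random variables not involving the estimated parameter.\<close>

lemma prod4_perturbation:
  fixes e :: real assumes e: "e > 0"
    and r: "\<bar>x1 - y1\<bar> \<le> r1" "\<bar>x2 - y2\<bar> \<le> r2" "\<bar>x3 - y3\<bar> \<le> r3" "\<bar>x4 - y4\<bar> \<le> r4"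
  shows "\<bar>x1 * x2 * x3 * x4 - y1 * y2 * y3 * y4\<bar> \<le>
    (r1 ^ 4 / e ^ 12 + e ^ 4 * (x1 ^ 4 + y1 ^ 4)) + (r2 ^ 4 / e ^ 12 + e ^ 4 * (x2 ^ 4 + y2 ^ 4)) +
    (r3 ^ 4 / e ^ 12 + e ^ 4 * (x3 ^ 4 + y3 ^ 4)) + (r4 ^ 4 / e ^ 12 + e ^ 4 * (x4 ^ 4 + y4 ^ 4))"
proof -
  have step: "\<bar>d * a * b * c\<bar> \<le> (r ^ 4 / e ^ 12 + e ^ 4 * (a ^ 4 + b ^ 4 + c ^ 4)) / 4"
    if "\<bar>d\<bar> \<le> r" for d a b c r
  proof -
    have "d ^ 4 \<le> r ^ 4" using power_mono[OF that, of 4] by (simp add: power_even_abs)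
    then have "d ^ 4 / e ^ 12 \<le> r ^ 4 / e ^ 12" by (intro divide_right_mono) (use e in auto)
    then have "(d ^ 4 / e ^ 12 + e ^ 4 * (a ^ 4 + b ^ 4 + c ^ 4)) / 4 \<le> (r ^ 4 / e ^ 12 + e ^ 4 * (a ^ 4 + b ^ 4 + c ^ 4)) / 4"
      using \<open>d ^ 4 \<le> r ^ 4\<close> by (intro divide_right_mono add_right_mono) simp_all
    then show ?thesis using prod4_small_factor[OF e, of d a b c] by (rule order_trans[rotated])
  qed
  have "x1 * x2 * x3 * x4 - y1 * y2 * y3 * y4 =
    (x1 - y1) * x2 * x3 * x4 + (x2 - y2) * y1 * x3 * x4 + (x3 - y3) * y1 * y2 * x4 + (x4 - y4) * y1 * y2 * y3" by (simp add: algebra_simps)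
  then have "\<bar>x1 * x2 * x3 * x4 - y1 * y2 * y3 * y4\<bar> \<le>
    \<bar>(x1 - y1) * x2 * x3 * x4\<bar> + \<bar>(x2 - y2) * y1 * x3 * x4\<bar> + \<bar>(x3 - y3) * y1 * y2 * x4\<bar> + \<bar>(x4 - y4) * y1 * y2 * y3\<bar>"
    by linarith
  also have "\<dots> \<le> (r1 ^ 4 / e ^ 12 + e ^ 4 * (x2 ^ 4 + x3 ^ 4 + x4 ^ 4)) / 4 + (r2 ^ 4 / e ^ 12 + e ^ 4 * (y1 ^ 4 + x3 ^ 4 + x4 ^ 4)) / 4
     + (r3 ^ 4 / e ^ 12 + e ^ 4 * (y1 ^ 4 + y2 ^ 4 + x4 ^ 4)) / 4 + (r4 ^ 4 / e ^ 12 + e ^ 4 * (y1 ^ 4 + y2 ^ 4 + y3 ^ 4)) / 4"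
    by (intro add_mono step r)
  also have "\<dots> \<le> (r1 ^ 4 / e ^ 12 + e ^ 4 * (x1 ^ 4 + y1 ^ 4)) + (r2 ^ 4 / e ^ 12 + e ^ 4 * (x2 ^ 4 + y2 ^ 4)) +
    (r3 ^ 4 / e ^ 12 + e ^ 4 * (x3 ^ 4 + y3 ^ 4)) + (r4 ^ 4 / e ^ 12 + e ^ 4 * (x4 ^ 4 + y4 ^ 4))"
  proof -
    have nn: "0 \<le> e ^ 4 * z ^ 4" "0 \<le> z ^ 4 / e ^ 12" for z using e by auto
    have lin: "(a1 + (p2 + p3 + p4)) / 4 + (a2 + (q1 + p3 + p4)) / 4 + (a3 + (q1 + q2 + p4)) / 4 + (a4 + (q1 + q2 + q3)) / 4
        \<le> (a1 + (p1 + q1)) + (a2 + (p2 + q2)) + (a3 + (p3 + q3)) + (a4 + (p4 + q4))"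
      if "0 \<le> a1" "0 \<le> a2" "0 \<le> a3" "0 \<le> a4" "0 \<le> p1" "0 \<le> p2" "0 \<le> p3" "0 \<le> p4"
        "0 \<le> q1" "0 \<le> q2" "0 \<le> q3" "0 \<le> q4" for a1 a2 a3 a4 p1 p2 p3 p4 q1 q2 q3 q4 :: real
      using that by (simp add: field_simps)
    show ?thesis unfolding distrib_left by (rule lin) (rule nn)+
  qed
  finally show ?thesis .
qed

text \<open>Cauchy-Schwarz twice, with the weights z. Through it the bounds on l1 norms of rows
  become bounds on fourth moments.\<close>

lemma weighted_sum_power4_le:
  fixes z x :: "'i \<Rightarrow> real"
  assumes z: "\<And>i. i \<in> A \<Longrightarrow> 0 \<le> z i"
  shows "(\<Sum>i\<in>A. z i * x i) ^ 4 \<le> (\<Sum>i\<in>A. z i) ^ 3 * (\<Sum>i\<in>A. z i * x i ^ 4)"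
proof -
  have cs: "(\<Sum>i\<in>A. z i * f i)\<^sup>2 \<le> (\<Sum>i\<in>A. z i) * (\<Sum>i\<in>A. z i * (f i)\<^sup>2)" for f
  proof -
    have "(\<Sum>i\<in>A. z i * f i)\<^sup>2 = (\<Sum>i\<in>A. sqrt (z i) * (sqrt (z i) * f i))\<^sup>2"
      by (intro arg_cong[of _ _ "\<lambda>x. x\<^sup>2"] sum.cong) (auto simp: z simp flip: mult.assoc)
    also have "\<dots> \<le> (\<Sum>i\<in>A. (sqrt (z i))\<^sup>2) * (\<Sum>i\<in>A. (sqrt (z i) * f i)\<^sup>2)" by (rule Cauchy_Schwarz_ineq_sum)
    also have "\<dots> = (\<Sum>i\<in>A. z i) * (\<Sum>i\<in>A. z i * (f i)\<^sup>2)"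
      by (intro arg_cong2[of _ _ _ _ "(*)"] sum.cong) (auto simp: z power_mult_distrib)
    finally show ?thesis .
  qed
  have nn: "0 \<le> (\<Sum>i\<in>A. z i)" "0 \<le> (\<Sum>i\<in>A. z i * (x i)\<^sup>2)" by (auto intro!: sum_nonneg z mult_nonneg_nonneg)
  have "(\<Sum>i\<in>A. z i * x i) ^ 4 = ((\<Sum>i\<in>A. z i * x i)\<^sup>2)\<^sup>2" by (rule power4_eq)
  also have "\<dots> \<le> ((\<Sum>i\<in>A. z i) * (\<Sum>i\<in>A. z i * (x i)\<^sup>2))\<^sup>2" by (rule power_mono[OF cs]) simp
  also have "\<dots> = (\<Sum>i\<in>A. z i)\<^sup>2 * (\<Sum>i\<in>A. z i * (x i)\<^sup>2)\<^sup>2" by (rule power_mult_distrib)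
  also have "\<dots> \<le> (\<Sum>i\<in>A. z i)\<^sup>2 * ((\<Sum>i\<in>A. z i) * (\<Sum>i\<in>A. z i * ((x i)\<^sup>2)\<^sup>2))"
    by (intro mult_left_mono cs) simp
  also have "\<dots> = (\<Sum>i\<in>A. z i) ^ 3 * (\<Sum>i\<in>A. z i * x i ^ 4)"
  proof -
    have "s ^ 3 = s\<^sup>2 * s" for s :: real by (simp add: power3_eq_cube power2_eq_square)
    then show ?thesis by (simp add: mult.assoc)
  qed
  finally show ?thesis .
qed

lemma weighted_sum_power4_le_abs:
  fixes z x :: "'i \<Rightarrow> real"
  shows "(\<Sum>i\<in>A. z i * x i) ^ 4 \<le> (\<Sum>i\<in>A. \<bar>z i\<bar>) ^ 3 * (\<Sum>i\<in>A. \<bar>z i\<bar> * x i ^ 4)"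
proof -
  have "(\<Sum>i\<in>A. z i * x i) ^ 4 = \<bar>\<Sum>i\<in>A. z i * x i\<bar> ^ 4" by (simp add: power_even_abs)
  also have "\<dots> \<le> (\<Sum>i\<in>A. \<bar>z i\<bar> * \<bar>x i\<bar>) ^ 4"
    by (intro power_mono) (auto simp: abs_mult[symmetric] intro!: sum_abs)
  also have "\<dots> \<le> (\<Sum>i\<in>A. \<bar>z i\<bar>) ^ 3 * (\<Sum>i\<in>A. \<bar>z i\<bar> * \<bar>x i\<bar> ^ 4)"
    by (rule weighted_sum_power4_le) simp
  finally show ?thesis by (simp add: power_even_abs)
qed

section \<open>Moments of linear forms in independent variables\<close>

definition kron :: "'i \<Rightarrow> 'i \<Rightarrow> real" where "kron a b = (if a = b then 1 else 0)"

lemma sum_kron: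
  assumes "finite A" "a \<in> A"
  shows "(\<Sum>b\<in>A. f b * kron a b) = f a"
proof -
  have "(\<Sum>b\<in>A. f b * kron a b) = (\<Sum>b\<in>A. if b = a then f b else 0)" by (intro sum.cong) (auto simp: kron_def)
  then show ?thesis using assms by simp
qed

locale indep_effects = prob_space M for M :: "'a measure" +
  fixes A :: "'i set" and \<xi> :: "'i \<Rightarrow> 'a \<Rightarrow> real" and v \<kappa> :: "'i \<Rightarrow> real"
  assumes finite_A: "finite A"
    and indep: "indep_vars (\<lambda>_. borel) \<xi> A"
    and int4: "\<And>a. a \<in> A \<Longrightarrow> integrable M (\<lambda>z. \<xi> a z ^ 4)"
    and mean: "\<And>a. a \<in> A \<Longrightarrow> (\<integral>z. \<xi> a z \<partial>M) = 0"
    and var: "\<And>a. a \<in> A \<Longrightarrow> (\<integral>z. (\<xi> a z)\<^sup>2 \<partial>M) = v a"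
    and fourth: "\<And>a. a \<in> A \<Longrightarrow> (\<integral>z. \<xi> a z ^ 4 \<partial>M) = \<kappa> a + 3 * (v a)\<^sup>2"
begin

lemma \<xi>_measurable [measurable]: "a \<in> A \<Longrightarrow> \<xi> a \<in> borel_measurable M"
  using indep by (auto simp: indep_vars_def)

lemma integrable_\<xi>_power:
  assumes a: "a \<in> A" and k: "k \<le> 4"
  shows "integrable M (\<lambda>z. \<xi> a z ^ k)"
proof (rule Bochner_Integration.integrable_bound)
  show "integrable M (\<lambda>z. 1 + \<xi> a z ^ 4)" using int4[OF a] by simp
  show "(\<lambda>z. \<xi> a z ^ k) \<in> borel_measurable M" using a by simp
  have "\<bar>x\<bar> ^ k \<le> 1 + x ^ 4" for x :: real
  proof (cases "\<bar>x\<bar> \<le> 1")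
    case True
    then have "\<bar>x\<bar> ^ k \<le> 1" by (simp add: power_le_one)
    then show ?thesis by (smt (verit) zero_le_even_power[of 4 x] even_numeral)
  next
    case False
    then have "\<bar>x\<bar> ^ k \<le> \<bar>x\<bar> ^ 4" using k by (intro power_increasing) auto
    then show ?thesis by (simp add: power_even_abs)
  qed
  then show "AE z in M. norm (\<xi> a z ^ k) \<le> norm (1 + \<xi> a z ^ 4)" by (auto simp: power_abs intro: order_trans[OF _ abs_ge_self])
qed

definition mom :: "'i \<Rightarrow> nat \<Rightarrow> real" where "mom a k = (\<integral>z. \<xi> a z ^ k \<partial>M)"

lemma mom:
  assumes "a \<in> A"
  shows "mom a 0 = 1" "mom a (Suc 0) = 0" "mom a 2 = v a" "mom a 4 = \<kappa> a + 3 * (v a)\<^sup>2"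
  using mean[OF assms] var[OF assms] fourth[OF assms] by (auto simp: mom_def prob_space)

text \<open>Collecting equal indices writes the product as powers of distinct independent variables.
  A variable that occurs once contributes its mean 0, so only two pairs or four equal indices
  survive; in the latter case the three pairings give \<open>3 * (v a)\<^sup>2\<close> and the
  cumulant the rest.\<close>

lemma prod4_moment:
  assumes abcd: "a \<in> A" "b \<in> A" "c \<in> A" "d \<in> A"
  shows "integrable M (\<lambda>z. \<xi> a z * \<xi> b z * \<xi> c z * \<xi> d z)" (is ?int)
    and "(\<integral>z. \<xi> a z * \<xi> b z * \<xi> c z * \<xi> d z \<partial>M) = \<kappa> a * kron a b * kron a c * kron a d +
      v a * v c * kron a b * kron c d + v a * v b * kron a c * kron b d + v a * v b * kron a d * kron b c" (is ?eq)
proof -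
  define m where "m i = (if i = a then 1 else 0) + (if i = b then 1 else 0) + (if i = c then 1 else 0) + (if i = d then 1 else (0::nat))" for i
  let ?S = "{a, b, c, d}"
  have ind: "indep_vars (\<lambda>_. borel) (\<lambda>i z. \<xi> i z ^ m i) ?S"
    using indep_vars_compose2[OF indep_vars_subset[OF indep, of ?S], of "\<lambda>i x. x ^ m i" "\<lambda>_. borel"] abcd by auto
  have int: "integrable M (\<lambda>z. \<xi> i z ^ m i)" if "i \<in> ?S" for i
    using that abcd by (intro integrable_\<xi>_power) (auto simp: m_def)
  have pw: "\<xi> a z * \<xi> b z * \<xi> c z * \<xi> d z = (\<Prod>i\<in>?S. \<xi> i z ^ m i)" for z
  proof -
    have "(\<Prod>i\<in>?S. \<xi> i z ^ m i) = (\<Prod>i\<in>?S. (if i = a then \<xi> i z else 1) * (if i = b then \<xi> i z else 1) *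
        (if i = c then \<xi> i z else 1) * (if i = d then \<xi> i z else 1))" by (intro prod.cong) (auto simp: m_def power_add)
    also have "\<dots> = \<xi> a z * \<xi> b z * \<xi> c z * \<xi> d z" by (simp add: prod.distrib prod.delta del: prod.insert)
    finally show ?thesis by simp
  qed
  show ?int unfolding pw by (rule indep_vars_integrable[OF _ ind int]) auto
  have "(\<integral>z. (\<Prod>i\<in>?S. \<xi> i z ^ m i) \<partial>M) = (\<Prod>i\<in>?S. mom i (m i))"
    unfolding mom_def by (rule indep_vars_lebesgue_integral[OF _ ind int]) auto
  also have "\<dots> = \<kappa> a * kron a b * kron a c * kron a d +
      v a * v c * kron a b * kron c d + v a * v b * kron a c * kron b d + v a * v b * kron a d * kron b c" using abcd mom
    by (cases "a = b"; cases "a = c"; cases "a = d"; cases "b = c"; cases "b = d"; cases "c = d")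
      (simp_all add: m_def kron_def power2_eq_square numeral_2_eq_2[symmetric] insert_commute)
  finally show ?eq unfolding pw .
qed

lemma prod2_moment:
  assumes ab: "a \<in> A" "b \<in> A"
  shows "integrable M (\<lambda>z. \<xi> a z * \<xi> b z)"
    and "(\<integral>z. \<xi> a z * \<xi> b z \<partial>M) = v a * kron a b"
proof -
  have "integrable M (\<lambda>z. \<xi> a z * \<xi> b z) \<and> (\<integral>z. \<xi> a z * \<xi> b z \<partial>M) = v a * kron a b"
  proof (cases "a = b")
    case True
    then show ?thesis using integrable_\<xi>_power[OF ab(1), of 2] var[OF ab(1)] by (simp add: kron_def power2_eq_square)
  next
    case False
    have "indep_vars (\<lambda>_. borel) \<xi> {a, b}" using indep_vars_subset[OF indep] ab by auto
    moreover have "integrable M (\<xi> i)" if "i \<in> {a, b}" for i using that integrable_\<xi>_power[of i 1] ab by auto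
    ultimately have "(\<integral>z. (\<Prod>i\<in>{a, b}. \<xi> i z) \<partial>M) = (\<Prod>i\<in>{a, b}. \<integral>z. \<xi> i z \<partial>M)"
      "integrable M (\<lambda>z. (\<Prod>i\<in>{a, b}. \<xi> i z))" by (auto intro!: indep_vars_lebesgue_integral indep_vars_integrable)
    then show ?thesis using False mean ab by (simp add: kron_def)
  qed
  then show "integrable M (\<lambda>z. \<xi> a z * \<xi> b z)" "(\<integral>z. \<xi> a z * \<xi> b z \<partial>M) = v a * kron a b" by auto
qed

definition lin :: "('i \<Rightarrow> real) \<Rightarrow> 'a \<Rightarrow> real" where "lin b z = (\<Sum>a\<in>A. b a * \<xi> a z)"
definition cov :: "('i \<Rightarrow> real) \<Rightarrow> ('i \<Rightarrow> real) \<Rightarrow> real" where "cov b c = (\<Sum>a\<in>A. v a * b a * c a)"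

lemma lin_measurable [measurable]: "lin b \<in> borel_measurable M" unfolding lin_def by measurable

lemma lin2_moment:
  shows "integrable M (\<lambda>z. lin b z * lin c z)"
    and "(\<integral>z. lin b z * lin c z \<partial>M) = cov b c"
proof -
  have e: "lin b z * lin c z = (\<Sum>x\<in>A. \<Sum>y\<in>A. (b x * c y) * (\<xi> x z * \<xi> y z))" for z
    by (simp add: lin_def sum_product mult_ac)
  show "integrable M (\<lambda>z. lin b z * lin c z)"
    unfolding e by (intro Bochner_Integration.integrable_sum integrable_mult_right prod2_moment)
  have "(\<integral>z. lin b z * lin c z \<partial>M) = (\<Sum>x\<in>A. \<Sum>y\<in>A. (b x * c y) * (v x * kron x y))"
    unfolding e by (simp add: prod2_moment)
  also have "\<dots> = (\<Sum>x\<in>A. \<Sum>y\<in>A. (v x * b x * c y) * kron x y)" by (simp add: mult_ac)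
  also have "\<dots> = cov b c" unfolding cov_def by (simp add: sum_kron finite_A)
  finally show "(\<integral>z. lin b z * lin c z \<partial>M) = cov b c" .
qed


text \<open>Multilinear expansion: the three Gaussian pairings plus a fourth cumulant term, in which
  all four indices coincide.\<close>

lemma lin4_moment:
  shows "integrable M (\<lambda>z. lin b z * lin c z * lin d z * lin e z)"
    and "(\<integral>z. lin b z * lin c z * lin d z * lin e z \<partial>M) =
      (\<Sum>a\<in>A. \<kappa> a * b a * c a * d a * e a) + cov b c * cov d e + cov b d * cov c e + cov b e * cov c d"
proof -
  have e: "lin b z * lin c z * lin d z * lin e z =
    (\<Sum>x\<in>A. \<Sum>y\<in>A. \<Sum>q\<in>A. \<Sum>w\<in>A. (b x * c y * d q * e w) * (\<xi> x z * \<xi> y z * \<xi> q z * \<xi> w z))" for z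
  proof -
    have "lin b z * lin c z * lin d z * lin e z = (lin b z * (lin c z * (lin d z * lin e z)))" by (simp add: mult.assoc)
    also have "\<dots> = (\<Sum>x\<in>A. \<Sum>y\<in>A. \<Sum>q\<in>A. \<Sum>w\<in>A. (b x * \<xi> x z) * ((c y * \<xi> y z) * ((d q * \<xi> q z) * (e w * \<xi> w z))))"
      unfolding lin_def sum_distrib_right unfolding sum_distrib_left by (rule refl)
    finally show ?thesis by (simp add: mult_ac)
  qed
  show "integrable M (\<lambda>z. lin b z * lin c z * lin d z * lin e z)"
    unfolding e by (intro Bochner_Integration.integrable_sum integrable_mult_right prod4_moment)
  have "(\<integral>z. lin b z * lin c z * lin d z * lin e z \<partial>M) =
    (\<Sum>x\<in>A. \<Sum>y\<in>A. \<Sum>q\<in>A. \<Sum>w\<in>A. (b x * c y * d q * e w) * (\<kappa> x * kron x y * kron x q * kron x w +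
      v x * v q * kron x y * kron q w + v x * v y * kron x q * kron y w + v x * v y * kron x w * kron y q))"
    unfolding e by (simp add: prod4_moment)
  also have "\<dots> = (\<Sum>x\<in>A. \<Sum>y\<in>A. \<Sum>q\<in>A. \<Sum>w\<in>A. ((\<kappa> x * b x * c y * d q * e w) * kron x y * kron x q) * kron x w) +
     (\<Sum>x\<in>A. \<Sum>y\<in>A. \<Sum>q\<in>A. \<Sum>w\<in>A. (v x * b x * c y * kron x y) * (v q * d q * e w * kron q w)) +
     (\<Sum>x\<in>A. \<Sum>y\<in>A. \<Sum>q\<in>A. \<Sum>w\<in>A. (v x * b x * d q * v y * c y * e w * kron x q) * kron y w) +
     (\<Sum>x\<in>A. \<Sum>y\<in>A. \<Sum>q\<in>A. \<Sum>w\<in>A. (v x * b x * e w * v y * c y * d q * kron y q) * kron x w)"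
    unfolding sum.distrib[symmetric] by (intro sum.cong refl) (simp add: algebra_simps)
  also have "(\<Sum>x\<in>A. \<Sum>y\<in>A. \<Sum>q\<in>A. \<Sum>w\<in>A. ((\<kappa> x * b x * c y * d q * e w) * kron x y * kron x q) * kron x w) =
      (\<Sum>x\<in>A. \<Sum>y\<in>A. \<Sum>q\<in>A. ((\<kappa> x * b x * c y * d q * e x) * kron x y) * kron x q)"
    by (intro sum.cong refl sum_kron finite_A) (simp add: sum_kron finite_A)
  also have "\<dots> = (\<Sum>x\<in>A. \<Sum>y\<in>A. (\<kappa> x * b x * c y * d x * e x) * kron x y)"
    by (intro sum.cong refl) (subst sum_kron[OF finite_A], simp_all add: mult_ac)
  also have "\<dots> = (\<Sum>x\<in>A. \<kappa> x * b x * c x * d x * e x)" by (simp add: sum_kron finite_A)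
  also have "(\<Sum>x\<in>A. \<Sum>y\<in>A. \<Sum>q\<in>A. \<Sum>w\<in>A. (v x * b x * c y * kron x y) * (v q * d q * e w * kron q w)) =
     (\<Sum>x\<in>A. \<Sum>y\<in>A. (v x * b x * c y) * kron x y) * (\<Sum>q\<in>A. \<Sum>w\<in>A. (v q * d q * e w) * kron q w)"
    unfolding sum_distrib_right unfolding sum_distrib_left by (rule refl)
  also have "\<dots> = cov b c * cov d e" by (simp add: sum_kron finite_A cov_def)
  also have "(\<Sum>x\<in>A. \<Sum>y\<in>A. \<Sum>q\<in>A. \<Sum>w\<in>A. (v x * b x * d q * v y * c y * e w * kron x q) * kron y w) =
     (\<Sum>x\<in>A. \<Sum>y\<in>A. \<Sum>q\<in>A. (v x * b x * d q * (v y * c y * e y)) * kron x q)"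
    by (intro sum.cong refl) (subst sum_kron[OF finite_A], simp_all add: mult_ac)
  also have "\<dots> = (\<Sum>x\<in>A. \<Sum>y\<in>A. (v x * b x * d x) * (v y * c y * e y))"
    by (intro sum.cong refl) (subst sum_kron[OF finite_A], simp_all add: mult_ac)
  also have "\<dots> = cov b d * cov c e" by (simp add: cov_def sum_product)
  also have "(\<Sum>x\<in>A. \<Sum>y\<in>A. \<Sum>q\<in>A. \<Sum>w\<in>A. (v x * b x * e w * v y * c y * d q * kron y q) * kron x w) =
     (\<Sum>x\<in>A. \<Sum>y\<in>A. \<Sum>q\<in>A. ((v x * b x * e x) * (v y * c y * d q)) * kron y q)"
    by (intro sum.cong refl) (subst sum_kron[OF finite_A], simp_all add: mult_ac)
  also have "\<dots> = (\<Sum>x\<in>A. \<Sum>y\<in>A. (v x * b x * e x) * (v y * c y * d y))"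
    by (intro sum.cong refl) (subst sum_kron[OF finite_A], simp_all add: mult_ac)
  also have "\<dots> = cov b e * cov c d" by (simp add: cov_def sum_product)
  finally show "(\<integral>z. lin b z * lin c z * lin d z * lin e z \<partial>M) =
      (\<Sum>a\<in>A. \<kappa> a * b a * c a * d a * e a) + cov b c * cov d e + cov b d * cov c e + cov b e * cov c d" .
qed

text \<open>The cumulant term is at most K times the sum of the squared variance contributions,
  hence at most K times the square of their sum. The constant is free of the number of
  variables.\<close>

lemma lin_power4:
  assumes K: "\<And>a. a \<in> A \<Longrightarrow> \<kappa> a \<le> K * (v a)\<^sup>2" and K0: "0 \<le> K"
  shows "integrable M (\<lambda>z. lin b z ^ 4)" and "(\<integral>z. lin b z ^ 4 \<partial>M) \<le> (K + 3) * (cov b b)\<^sup>2"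
proof -
  have e: "lin b z ^ 4 = lin b z * lin b z * lin b z * lin b z" for z by (simp add: numeral_eq_Suc mult_ac)
  show "integrable M (\<lambda>z. lin b z ^ 4)" unfolding e by (rule lin4_moment)
  have vnn: "v a \<ge> 0" if "a \<in> A" for a using var[OF that] by (metis integral_nonneg_AE AE_I2 zero_le_power2)
  have "(\<Sum>a\<in>A. \<kappa> a * b a * b a * b a * b a) \<le> (\<Sum>a\<in>A. K * (v a * b a * b a)\<^sup>2)"
  proof (rule sum_mono)
    fix a assume a: "a \<in> A"
    have "\<kappa> a * (b a ^ 4) \<le> K * (v a)\<^sup>2 * (b a ^ 4)" by (intro mult_right_mono K a) simp
    then show "\<kappa> a * b a * b a * b a * b a \<le> K * (v a * b a * b a)\<^sup>2" by (simp add: numeral_eq_Suc mult_ac)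
  qed
  also have "\<dots> = K * (\<Sum>a\<in>A. (v a * b a * b a)\<^sup>2)" by (simp add: sum_distrib_left)
  also have "(\<Sum>a\<in>A. (v a * b a * b a)\<^sup>2) \<le> (cov b b)\<^sup>2"
  proof -
    have nn: "0 \<le> v a * b a * b a" if "a \<in> A" for a using vnn[OF that] by (simp add: mult.assoc)
    have "(\<Sum>a\<in>A. (v a * b a * b a) * (v a * b a * b a)) \<le> (\<Sum>a\<in>A. (v a * b a * b a) * cov b b)"
      unfolding cov_def by (intro sum_mono mult_left_mono member_le_sum) (auto intro: nn finite_A)
    also have "\<dots> = cov b b * cov b b" by (simp add: cov_def sum_distrib_right)
    finally show ?thesis by (simp add: power2_eq_square)
  qed
  finally have "(\<Sum>a\<in>A. \<kappa> a * b a * b a * b a * b a) \<le> K * (cov b b)\<^sup>2" using K0 by (simp add: mult_left_mono)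
  then show "(\<integral>z. lin b z ^ 4 \<partial>M) \<le> (K + 3) * (cov b b)\<^sup>2"
    unfolding e lin4_moment by (simp add: power2_eq_square algebra_simps)
qed

end

section \<open>A weak law for weighted products of four linear forms\<close>

text \<open>Unlike \<open>lin_power4\<close> this works from the l1 norm of the coefficients, so it
  also covers the truncated variables, which need not be centred.\<close>

lemma (in prob_space) weighted_sum_fourth_moment:
  fixes \<eta> :: "'i \<Rightarrow> 'a \<Rightarrow> real"
  assumes A: "finite A" and meas: "\<And>a. a \<in> A \<Longrightarrow> \<eta> a \<in> borel_measurable M"
    and int: "\<And>a. a \<in> A \<Longrightarrow> integrable M (\<lambda>z. \<eta> a z ^ 4)"
    and c: "\<And>a. a \<in> A \<Longrightarrow> (\<integral>z. \<eta> a z ^ 4 \<partial>M) \<le> c" "0 \<le> c"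
    and w: "(\<Sum>a\<in>A. \<bar>w a\<bar>) \<le> C"
  shows "integrable M (\<lambda>z. (\<Sum>a\<in>A. w a * \<eta> a z) ^ 4)"
    and "(\<integral>z. (\<Sum>a\<in>A. w a * \<eta> a z) ^ 4 \<partial>M) \<le> C ^ 4 * c"
proof -
  let ?W = "\<Sum>a\<in>A. \<bar>w a\<bar>"
  have W: "0 \<le> ?W" by (simp add: sum_nonneg)
  have pw: "(\<Sum>a\<in>A. w a * \<eta> a z) ^ 4 \<le> ?W ^ 3 * (\<Sum>a\<in>A. \<bar>w a\<bar> * \<eta> a z ^ 4)" for z
    by (rule weighted_sum_power4_le_abs)
  have int': "integrable M (\<lambda>z. ?W ^ 3 * (\<Sum>a\<in>A. \<bar>w a\<bar> * \<eta> a z ^ 4))"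
    by (intro integrable_mult_right Bochner_Integration.integrable_sum int)
  show 1: "integrable M (\<lambda>z. (\<Sum>a\<in>A. w a * \<eta> a z) ^ 4)"
  proof (rule Bochner_Integration.integrable_bound[OF int'])
    show "(\<lambda>z. (\<Sum>a\<in>A. w a * \<eta> a z) ^ 4) \<in> borel_measurable M" using meas by measurable
    show "AE z in M. norm ((\<Sum>a\<in>A. w a * \<eta> a z) ^ 4) \<le> norm (?W ^ 3 * (\<Sum>a\<in>A. \<bar>w a\<bar> * \<eta> a z ^ 4))"
      using pw by (auto intro!: order_trans[OF _ abs_ge_self] simp del: abs_mult)
  qed
  have "(\<integral>z. (\<Sum>a\<in>A. w a * \<eta> a z) ^ 4 \<partial>M) \<le> (\<integral>z. ?W ^ 3 * (\<Sum>a\<in>A. \<bar>w a\<bar> * \<eta> a z ^ 4) \<partial>M)"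
    by (intro integral_mono 1 int' pw)
  also have "\<dots> = ?W ^ 3 * (\<Sum>a\<in>A. \<bar>w a\<bar> * (\<integral>z. \<eta> a z ^ 4 \<partial>M))" using int by simp
  also have "\<dots> \<le> ?W ^ 3 * (\<Sum>a\<in>A. \<bar>w a\<bar> * c)" by (intro mult_left_mono sum_mono c) (use W in auto)
  also have "\<dots> = ?W ^ 4 * c" by (simp add: sum_distrib_right[symmetric] numeral_eq_Suc)
  also have "\<dots> \<le> C ^ 4 * c" by (intro mult_right_mono power_mono w W c)
  finally show "(\<integral>z. (\<Sum>a\<in>A. w a * \<eta> a z) ^ 4 \<partial>M) \<le> C ^ 4 * c" .
qed

text \<open>The bound becomes small by taking e small first and then t small compared with
  \<open>e ^ 12\<close>.\<close>

lemma (in prob_space) prod4_diff_expectation: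
  fixes x1 x2 x3 x4 y1 y2 y3 y4 :: "'a \<Rightarrow> real"
  assumes meas [measurable]: "x1 \<in> borel_measurable M" "x2 \<in> borel_measurable M" "x3 \<in> borel_measurable M" "x4 \<in> borel_measurable M"
      "y1 \<in> borel_measurable M" "y2 \<in> borel_measurable M" "y3 \<in> borel_measurable M" "y4 \<in> borel_measurable M"
    and mom: "\<And>x y. (x, y) \<in> {(x1, y1), (x2, y2), (x3, y3), (x4, y4)} \<Longrightarrow>
      integrable M (\<lambda>z. x z ^ 4) \<and> integrable M (\<lambda>z. y z ^ 4) \<and> integrable M (\<lambda>z. (x z - y z) ^ 4) \<and>
      (\<integral>z. x z ^ 4 \<partial>M) \<le> F \<and> (\<integral>z. y z ^ 4 \<partial>M) \<le> F \<and> (\<integral>z. (x z - y z) ^ 4 \<partial>M) \<le> t"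
    and e: "e > 0"
  shows "integrable M (\<lambda>z. x1 z * x2 z * x3 z * x4 z - y1 z * y2 z * y3 z * y4 z)"
    and "(\<integral>z. \<bar>x1 z * x2 z * x3 z * x4 z - y1 z * y2 z * y3 z * y4 z\<bar> \<partial>M) \<le> 4 * (t / e ^ 12 + 2 * e ^ 4 * F)"
proof -
  define T where "T x y z = (x z - y z) ^ 4 / e ^ 12 + e ^ 4 * (x z ^ 4 + y z ^ 4)" for x y :: "'a \<Rightarrow> real" and z
  define G where "G z = T x1 y1 z + T x2 y2 z + T x3 y3 z + T x4 y4 z" for z
  have T: "integrable M (T x y)" "(\<integral>z. T x y z \<partial>M) \<le> t / e ^ 12 + 2 * e ^ 4 * F"
    if "(x, y) \<in> {(x1, y1), (x2, y2), (x3, y3), (x4, y4)}" for x y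
  proof -
    note m = mom[OF that]
    have i: "integrable M (\<lambda>z. (x z - y z) ^ 4 / e ^ 12)" "integrable M (\<lambda>z. e ^ 4 * (x z ^ 4 + y z ^ 4))" using m by auto
    then show "integrable M (T x y)" unfolding T_def by (rule Bochner_Integration.integrable_add)
    have "(\<integral>z. T x y z \<partial>M) = (\<integral>z. (x z - y z) ^ 4 \<partial>M) / e ^ 12 + e ^ 4 * ((\<integral>z. x z ^ 4 \<partial>M) + (\<integral>z. y z ^ 4 \<partial>M))"
      unfolding T_def using Bochner_Integration.integral_add[OF i] m by simp
    also have "\<dots> \<le> t / e ^ 12 + e ^ 4 * (F + F)" by (intro add_mono divide_right_mono mult_left_mono) (use m e in auto)
    finally show "(\<integral>z. T x y z \<partial>M) \<le> t / e ^ 12 + 2 * e ^ 4 * F" by simp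
  qed
  have G: "integrable M G" unfolding G_def[abs_def] by (intro Bochner_Integration.integrable_add T) auto
  have pw: "\<bar>x1 z * x2 z * x3 z * x4 z - y1 z * y2 z * y3 z * y4 z\<bar> \<le> G z" for z
    using prod4_perturbation[OF e order_refl order_refl order_refl order_refl, where ?x1.0 = "x1 z" and ?y1.0 = "y1 z"
      and ?x2.0 = "x2 z" and ?y2.0 = "y2 z" and ?x3.0 = "x3 z" and ?y3.0 = "y3 z" and ?x4.0 = "x4 z" and ?y4.0 = "y4 z"]
    by (simp add: G_def T_def power_even_abs)
  show 1: "integrable M (\<lambda>z. x1 z * x2 z * x3 z * x4 z - y1 z * y2 z * y3 z * y4 z)"
    by (rule Bochner_Integration.integrable_bound[OF G])
      (use pw in \<open>auto intro!: order_trans[OF _ abs_ge_self]\<close>)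
  have "(\<integral>z. \<bar>x1 z * x2 z * x3 z * x4 z - y1 z * y2 z * y3 z * y4 z\<bar> \<partial>M) \<le> (\<integral>z. G z \<partial>M)"
    by (intro integral_mono integrable_abs 1 G pw)
  also have "\<dots> = (\<integral>z. T x1 y1 z \<partial>M) + (\<integral>z. T x2 y2 z \<partial>M) + (\<integral>z. T x3 y3 z \<partial>M) + (\<integral>z. T x4 y4 z \<partial>M)"
    unfolding G_def by (simp add: T)
  also have "\<dots> \<le> 4 * (t / e ^ 12 + 2 * e ^ 4 * F)" using T(2)[of x1 y1] T(2)[of x2 y2] T(2)[of x3 y3] T(2)[of x4 y4] by simp
  finally show "(\<integral>z. \<bar>x1 z * x2 z * x3 z * x4 z - y1 z * y2 z * y3 z * y4 z\<bar> \<partial>M) \<le> 4 * (t / e ^ 12 + 2 * e ^ 4 * F)" .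
qed

text \<open>The truncated variables are not recentred; it is enough to centre the products formed
  from them.\<close>

definition trunc :: "real \<Rightarrow> real \<Rightarrow> real" where
  "trunc B x = (if \<bar>x\<bar> \<le> B then x else 0)"

lemma trunc_measurable [measurable]: "trunc B \<in> borel_measurable borel" unfolding trunc_def by measurable

lemma trunc_bounds: "\<bar>trunc B x\<bar> \<le> \<bar>x\<bar>" "0 \<le> B \<Longrightarrow> \<bar>trunc B x\<bar> \<le> B" "\<bar>x - trunc B x\<bar> \<le> \<bar>x\<bar>"
  by (auto simp: trunc_def)

fun prod4 :: "(nat \<Rightarrow> 'b \<Rightarrow> real) \<Rightarrow> quad \<Rightarrow> 'b \<Rightarrow> real" where
  "prod4 u (i, j, k, l) z = u i z * u j z * u k z * u l z"

fun quad_set :: "quad \<Rightarrow> nat set" where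
  "quad_set (i, j, k, l) = {i, j, k, l}"

context indep_effects begin

text \<open>Only fourth moments are available, so the variance can be computed only after truncation.\<close>

lemma weak_law:
  fixes w :: "nat \<Rightarrow> 'i \<Rightarrow> real" and c :: "quad \<Rightarrow> real"
  assumes Q: "finite Q" and W: "\<And>q i. q \<in> Q \<Longrightarrow> i \<in> quad_set q \<Longrightarrow> (\<Sum>a\<in>A. \<bar>w i a\<bar>) \<le> C" and C: "0 \<le> C"
    and F: "\<And>a. a \<in> A \<Longrightarrow> (\<integral>z. \<xi> a z ^ 4 \<partial>M) \<le> F" "0 \<le> F"
    and t: "\<And>a. a \<in> A \<Longrightarrow> (\<integral>z. (\<xi> a z - trunc B (\<xi> a z)) ^ 4 \<partial>M) \<le> t" "0 \<le> t"
    and B: "0 \<le> B" and e: "0 < e" and h: "0 < h"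
    and R: "\<And>q q'. q \<in> Q \<Longrightarrow> q' \<in> Q \<Longrightarrow> (q, q') \<notin> R \<Longrightarrow>
      (\<forall>a\<in>A. (\<forall>i\<in>quad_set q. w i a = 0) \<or> (\<forall>i\<in>quad_set q'. w i a = 0))"
  defines "U \<equiv> prod4 (\<lambda>i. lin (w i))"
  shows "integrable M (\<lambda>z. \<Sum>q\<in>Q. c q * (U q z - (\<integral>z. U q z \<partial>M)))"
    and "(\<integral>z. \<bar>\<Sum>q\<in>Q. c q * (U q z - (\<integral>z. U q z \<partial>M))\<bar> \<partial>M) \<le>
      2 * (\<Sum>q\<in>Q. \<bar>c q\<bar>) * (4 * (C ^ 4 * t / e ^ 12 + 2 * e ^ 4 * (C ^ 4 * F))) +
      (h + 4 * (C * B) ^ 8 * (\<Sum>(q, q')\<in>(Q \<times> Q) \<inter> R. \<bar>c q\<bar> * \<bar>c q'\<bar>) / h)"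
proof -
  define uB where "uB i z = (\<Sum>a\<in>A. w i a * trunc B (\<xi> a z))" for i z
  define UB where "UB = prod4 uB"
  have uB_meas [measurable]: "uB i \<in> borel_measurable M" for i unfolding uB_def[abs_def] by measurable
  have i4: "integrable M (\<lambda>z. trunc B (\<xi> a z) ^ 4)" "integrable M (\<lambda>z. (\<xi> a z - trunc B (\<xi> a z)) ^ 4)"
      "(\<integral>z. trunc B (\<xi> a z) ^ 4 \<partial>M) \<le> F" if a: "a \<in> A" for a
  proof -
    have le: "trunc B x ^ 4 \<le> x ^ 4" "(x - trunc B x) ^ 4 \<le> x ^ 4" for x
      using power_mono[OF trunc_bounds(1)[of B x], of 4] power_mono[OF trunc_bounds(3)[of x B], of 4] by (auto simp: power_even_abs)
    show 1: "integrable M (\<lambda>z. trunc B (\<xi> a z) ^ 4)" "integrable M (\<lambda>z. (\<xi> a z - trunc B (\<xi> a z)) ^ 4)"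
      using a le by (auto intro!: Bochner_Integration.integrable_bound[OF int4[OF a]])
    show "(\<integral>z. trunc B (\<xi> a z) ^ 4 \<partial>M) \<le> F"
      by (rule order_trans[OF integral_mono[OF 1(1) int4[OF a] le(1)] F(1)[OF a]])
  qed
  have mom: "integrable M (\<lambda>z. lin (w i) z ^ 4)" "integrable M (\<lambda>z. uB i z ^ 4)"
      "integrable M (\<lambda>z. (lin (w i) z - uB i z) ^ 4)"
      "(\<integral>z. lin (w i) z ^ 4 \<partial>M) \<le> C ^ 4 * F" "(\<integral>z. uB i z ^ 4 \<partial>M) \<le> C ^ 4 * F"
      "(\<integral>z. (lin (w i) z - uB i z) ^ 4 \<partial>M) \<le> C ^ 4 * t" if "q \<in> Q" "i \<in> quad_set q" for q i
  proof -
    note w = W[OF that]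
    have d: "lin (w i) z - uB i z = (\<Sum>a\<in>A. w i a * (\<xi> a z - trunc B (\<xi> a z)))" for z
      by (simp add: lin_def uB_def sum_subtractf right_diff_distrib)
    show "integrable M (\<lambda>z. lin (w i) z ^ 4)" "(\<integral>z. lin (w i) z ^ 4 \<partial>M) \<le> C ^ 4 * F"
      unfolding lin_def using weighted_sum_fourth_moment[OF finite_A \<xi>_measurable int4 F w] by auto
    show "integrable M (\<lambda>z. uB i z ^ 4)" "(\<integral>z. uB i z ^ 4 \<partial>M) \<le> C ^ 4 * F"
      unfolding uB_def using weighted_sum_fourth_moment[OF finite_A _ i4(1) i4(3) F(2) w] by auto
    show "integrable M (\<lambda>z. (lin (w i) z - uB i z) ^ 4)" "(\<integral>z. (lin (w i) z - uB i z) ^ 4 \<partial>M) \<le> C ^ 4 * t"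
      unfolding d using weighted_sum_fourth_moment[OF finite_A _ i4(2) t w] by auto
  qed
  \<comment> \<open>The mean cost of truncating inside one product. It is paid twice, for the
    product and for its expectation.\<close>
  define D where "D = 4 * (C ^ 4 * t / e ^ 12 + 2 * e ^ 4 * (C ^ 4 * F))"
  have diff: "integrable M (\<lambda>z. U q z - UB q z)" "(\<integral>z. \<bar>U q z - UB q z\<bar> \<partial>M) \<le> D" if q: "q \<in> Q" for q
  proof -
    obtain i j k l where q4: "q = (i, j, k, l)" by (cases q) auto
    have m: "integrable M (\<lambda>z. x z ^ 4) \<and> integrable M (\<lambda>z. y z ^ 4) \<and> integrable M (\<lambda>z. (x z - y z) ^ 4) \<and>
      (\<integral>z. x z ^ 4 \<partial>M) \<le> C ^ 4 * F \<and> (\<integral>z. y z ^ 4 \<partial>M) \<le> C ^ 4 * F \<and> (\<integral>z. (x z - y z) ^ 4 \<partial>M) \<le> C ^ 4 * t"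
      if "(x, y) \<in> {(lin (w i), uB i), (lin (w j), uB j), (lin (w k), uB k), (lin (w l), uB l)}" for x y
    proof -
      have "\<exists>n\<in>quad_set q. x = lin (w n) \<and> y = uB n" using that unfolding q4 quad_set.simps by blast
      then obtain n where n: "n \<in> quad_set q" and xy: "x = lin (w n)" "y = uB n" by blast
      show ?thesis unfolding xy by (intro conjI mom[OF q n])
    qed
    show "integrable M (\<lambda>z. U q z - UB q z)" unfolding U_def UB_def q4 prod4.simps
      by (rule prod4_diff_expectation(1)[OF lin_measurable lin_measurable lin_measurable lin_measurable
            uB_meas uB_meas uB_meas uB_meas _ e]) (rule m)
    show "(\<integral>z. \<bar>U q z - UB q z\<bar> \<partial>M) \<le> D" unfolding U_def UB_def q4 prod4.simps D_def
      by (rule prod4_diff_expectation(2)[OF lin_measurable lin_measurable lin_measurable lin_measurable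
            uB_meas uB_meas uB_meas uB_meas _ e]) (rule m)
  qed
  have uB_bound: "\<bar>uB i z\<bar> \<le> C * B" if "q \<in> Q" "i \<in> quad_set q" for q i z
  proof -
    have "\<bar>uB i z\<bar> \<le> (\<Sum>a\<in>A. \<bar>w i a\<bar> * \<bar>trunc B (\<xi> a z)\<bar>)" unfolding uB_def by (auto simp: abs_mult[symmetric] intro!: sum_abs)
    also have "\<dots> \<le> (\<Sum>a\<in>A. \<bar>w i a\<bar> * B)" by (intro sum_mono mult_left_mono trunc_bounds B) auto
    also have "\<dots> = (\<Sum>a\<in>A. \<bar>w i a\<bar>) * B" by (simp add: sum_distrib_right)
    also have "\<dots> \<le> C * B" by (intro mult_right_mono W[OF that] B)
    finally show ?thesis .
  qed
  have UB_bound: "\<bar>UB q z\<bar> \<le> (C * B) ^ 4" if q: "q \<in> Q" for q z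
  proof -
    obtain i j k l where q4: "q = (i, j, k, l)" by (cases q) auto
    have "\<bar>uB i z\<bar> * \<bar>uB j z\<bar> * \<bar>uB k z\<bar> * \<bar>uB l z\<bar> \<le> (C * B) * (C * B) * (C * B) * (C * B)"
      using uB_bound[OF q] C B unfolding q4 by (intro mult_mono) auto
    then show ?thesis by (simp add: UB_def q4 abs_mult numeral_eq_Suc mult.assoc)
  qed
  have UB_meas [measurable]: "UB q \<in> borel_measurable M" for q by (cases q) (auto simp: UB_def cong: measurable_cong)
  have UB_int: "integrable M (UB q)" if "q \<in> Q" for q using UB_bound[OF that] by (intro integrable_const_bound[of _ "(C * B) ^ 4"]) auto
  define Z where "Z q z = UB q z - (\<integral>z. UB q z \<partial>M)" for q z
  have EUB: "\<bar>\<integral>z. UB q z \<partial>M\<bar> \<le> (C * B) ^ 4" if q: "q \<in> Q" for q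
  proof -
    have "\<bar>\<integral>z. UB q z \<partial>M\<bar> \<le> (\<integral>z. \<bar>UB q z\<bar> \<partial>M)" by (rule integral_abs_bound)
    also have "\<dots> \<le> (\<integral>z. (C * B) ^ 4 \<partial>M)" by (intro integral_mono integrable_abs UB_int q UB_bound) simp
    finally show ?thesis by (simp add: prob_space)
  qed
  have Z_bound: "\<bar>Z q z\<bar> \<le> 2 * (C * B) ^ 4" if "q \<in> Q" for q z
    using UB_bound[OF that, of z] EUB[OF that] unfolding Z_def by linarith
  have Z_meas [measurable]: "Z q \<in> borel_measurable M" for q unfolding Z_def[abs_def] by measurable
  have Z_int: "integrable M (Z q)" if "q \<in> Q" for q unfolding Z_def[abs_def] using UB_int[OF that] by simp
  have ZZ_bound: "\<bar>Z q z * Z q' z\<bar> \<le> 4 * (C * B) ^ 8" if "q \<in> Q" "q' \<in> Q" for q q' z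
  proof -
    have "\<bar>Z q z\<bar> * \<bar>Z q' z\<bar> \<le> (2 * (C * B) ^ 4) * (2 * (C * B) ^ 4)" by (intro mult_mono Z_bound that) (use C B in auto)
    then show ?thesis by (simp add: abs_mult flip: power_add)
  qed
  have ZZ_int: "integrable M (\<lambda>z. Z q z * Z q' z)" if "q \<in> Q" "q' \<in> Q" for q q'
    using ZZ_bound[OF that] by (intro integrable_const_bound[of _ "4 * (C * B) ^ 8"]) auto
  have ZZ_le: "(\<integral>z. Z q z * Z q' z \<partial>M) \<le> 4 * (C * B) ^ 8" "(\<integral>z. Z q z * Z q' z \<partial>M) \<ge> - (4 * (C * B) ^ 8)" if "q \<in> Q" "q' \<in> Q" for q q'
  proof -
    have "\<bar>\<integral>z. Z q z * Z q' z \<partial>M\<bar> \<le> (\<integral>z. \<bar>Z q z * Z q' z\<bar> \<partial>M)" by (rule integral_abs_bound)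
    also have "\<dots> \<le> (\<integral>z. 4 * (C * B) ^ 8 \<partial>M)" by (intro integral_mono integrable_abs ZZ_int that ZZ_bound) simp
    finally have "\<bar>\<integral>z. Z q z * Z q' z \<partial>M\<bar> \<le> 4 * (C * B) ^ 8" by (simp add: prob_space)
    then show "(\<integral>z. Z q z * Z q' z \<partial>M) \<le> 4 * (C * B) ^ 8" "(\<integral>z. Z q z * Z q' z \<partial>M) \<ge> - (4 * (C * B) ^ 8)" by linarith+
  qed
  \<comment> \<open>Outside R the two products use disjoint sets of effects, so they are functions
    of independent blocks.\<close>
  have ZZ_0: "(\<integral>z. Z q z * Z q' z \<partial>M) = 0" if q: "q \<in> Q" "q' \<in> Q" and nR: "(q, q') \<notin> R" for q q'
  proof -
    define supp where "supp q = {a\<in>A. \<exists>i\<in>quad_set q. w i a \<noteq> 0}" for q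
    define f where "f q x = prod4 (\<lambda>i x. \<Sum>a\<in>supp q. w i a * trunc B (x a)) q x" for q and x :: "'i \<Rightarrow> real"
    have disj: "supp q \<inter> supp q' = {}" using R[OF q nR] by (auto simp: supp_def)
    have fin: "finite (supp q)" for q using finite_A by (simp add: supp_def)
    have "indep_var (PiM (supp q) (\<lambda>_. borel)) (\<lambda>z. restrict (\<lambda>a. \<xi> a z) (supp q))
        (PiM (supp q') (\<lambda>_. borel)) (\<lambda>z. restrict (\<lambda>a. \<xi> a z) (supp q'))"
      by (rule indep_var_restrict[OF indep disj]) (auto simp: supp_def)
    moreover have fm: "f q \<in> borel_measurable (PiM (supp q) (\<lambda>_. borel))" for q
    proof -
      obtain i j k l where q4: "q = (i, j, k, l)" by (cases q) auto
      show ?thesis unfolding f_def[abs_def] q4 prod4.simps by measurable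
    qed
    ultimately have "indep_var borel (f q \<circ> (\<lambda>z. restrict (\<lambda>a. \<xi> a z) (supp q))) borel (f q' \<circ> (\<lambda>z. restrict (\<lambda>a. \<xi> a z) (supp q')))"
      by (intro indep_var_compose[OF _ fm fm])
    moreover have "f q \<circ> (\<lambda>z. restrict (\<lambda>a. \<xi> a z) (supp q)) = UB q" for q
    proof
      fix z
      obtain i j k l where q4: "q = (i, j, k, l)" by (cases q) auto
      have s: "(\<Sum>a\<in>supp q. w n a * trunc B (restrict (\<lambda>a. \<xi> a z) (supp q) a)) = uB n z" if "n \<in> quad_set q" for n
      proof -
        have "uB n z = (\<Sum>a\<in>supp q. w n a * trunc B (\<xi> a z))" unfolding uB_def
          by (rule sum.mono_neutral_right[OF finite_A]) (use that in \<open>auto simp: supp_def\<close>)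
        then show ?thesis by (simp cong: sum.cong)
      qed
      show "(f q \<circ> (\<lambda>z. restrict (\<lambda>a. \<xi> a z) (supp q))) z = UB q z"
        using s unfolding f_def UB_def comp_def q4 by simp
    qed
    ultimately have "indep_var borel (UB q) borel (UB q')" by simp
    then have "(\<integral>z. UB q z * UB q' z \<partial>M) = (\<integral>z. UB q z \<partial>M) * (\<integral>z. UB q' z \<partial>M)"
        "integrable M (\<lambda>z. UB q z * UB q' z)" by (rule indep_var_lebesgue_integral[OF _ UB_int[OF q(1)] UB_int[OF q(2)]],
        rule indep_var_integrable[OF _ UB_int[OF q(1)] UB_int[OF q(2)]])
    moreover have "Z q z * Z q' z = UB q z * UB q' z - (\<integral>z. UB q z \<partial>M) * UB q' z - UB q z * (\<integral>z. UB q' z \<partial>M)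
        + (\<integral>z. UB q z \<partial>M) * (\<integral>z. UB q' z \<partial>M)" for z by (simp add: Z_def algebra_simps)
    ultimately show ?thesis using UB_int[OF q(1)] UB_int[OF q(2)] by (simp add: prob_space)
  qed
  define Y where "Y z = (\<Sum>q\<in>Q. c q * Z q z)" for z
  have Y_meas [measurable]: "Y \<in> borel_measurable M" unfolding Y_def[abs_def] by measurable
  have Y_int: "integrable M Y" unfolding Y_def[abs_def] by (auto intro!: Bochner_Integration.integrable_sum Z_int)
  have YY: "(Y z)\<^sup>2 = (\<Sum>q\<in>Q. \<Sum>q'\<in>Q. (c q * c q') * (Z q z * Z q' z))" for z
    by (simp add: Y_def power2_eq_square sum_product mult_ac)
  have YY_int: "integrable M (\<lambda>z. (Y z)\<^sup>2)" unfolding YY by (auto intro!: Bochner_Integration.integrable_sum ZZ_int)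
  have "(\<integral>z. (Y z)\<^sup>2 \<partial>M) = (\<Sum>q\<in>Q. \<Sum>q'\<in>Q. (c q * c q') * (\<integral>z. Z q z * Z q' z \<partial>M))"
    unfolding YY using ZZ_int by (simp add: Bochner_Integration.integral_sum)
  also have "\<dots> = (\<Sum>(q, q')\<in>Q \<times> Q. (c q * c q') * (\<integral>z. Z q z * Z q' z \<partial>M))" by (simp add: sum.cartesian_product)
  also have "\<dots> = (\<Sum>(q, q')\<in>(Q \<times> Q) \<inter> R. (c q * c q') * (\<integral>z. Z q z * Z q' z \<partial>M))"
  proof (rule sum.mono_neutral_right; (intro ballI)?)
    fix x assume x: "x \<in> Q \<times> Q - (Q \<times> Q) \<inter> R"
    obtain q q' where qq: "x = (q, q')" by (cases x)
    have "(\<integral>z. Z q z * Z q' z \<partial>M) = 0" by (rule ZZ_0) (use x qq in blast)+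
    then show "(case x of (q, q') \<Rightarrow> (c q * c q') * (\<integral>z. Z q z * Z q' z \<partial>M)) = 0" by (simp add: qq)
  qed (use Q in auto)
  also have "\<dots> \<le> (\<Sum>(q, q')\<in>(Q \<times> Q) \<inter> R. (\<bar>c q\<bar> * \<bar>c q'\<bar>) * (4 * (C * B) ^ 8))"
  proof (rule sum_mono)
    fix x assume x: "x \<in> (Q \<times> Q) \<inter> R"
    obtain q q' where qq: "x = (q, q')" by (cases x)
    have q: "q \<in> Q" "q' \<in> Q" using x qq by auto
    let ?E = "\<integral>z. Z q z * Z q' z \<partial>M"
    have "\<bar>?E\<bar> \<le> 4 * (C * B) ^ 8" using ZZ_le[OF q] by (simp add: abs_le_iff)
    then have "\<bar>c q\<bar> * \<bar>c q'\<bar> * \<bar>?E\<bar> \<le> \<bar>c q\<bar> * \<bar>c q'\<bar> * (4 * (C * B) ^ 8)"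
      by (intro mult_left_mono) auto
    moreover have "c q * c q' * ?E \<le> \<bar>c q\<bar> * \<bar>c q'\<bar> * \<bar>?E\<bar>" unfolding abs_mult[symmetric] by (rule abs_ge_self)
    ultimately show "(case x of (q, q') \<Rightarrow> (c q * c q') * (\<integral>z. Z q z * Z q' z \<partial>M))
       \<le> (case x of (q, q') \<Rightarrow> (\<bar>c q\<bar> * \<bar>c q'\<bar>) * (4 * (C * B) ^ 8))" unfolding qq by simp
  qed
  also have "\<dots> = 4 * (C * B) ^ 8 * (\<Sum>(q, q')\<in>(Q \<times> Q) \<inter> R. \<bar>c q\<bar> * \<bar>c q'\<bar>)"
    by (simp add: sum_distrib_left mult.commute case_prod_unfold)
  finally have var_le: "(\<integral>z. (Y z)\<^sup>2 \<partial>M) \<le> 4 * (C * B) ^ 8 * (\<Sum>(q, q')\<in>(Q \<times> Q) \<inter> R. \<bar>c q\<bar> * \<bar>c q'\<bar>)" .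
  have Y_abs: "(\<integral>z. \<bar>Y z\<bar> \<partial>M) \<le> h + 4 * (C * B) ^ 8 * (\<Sum>(q, q')\<in>(Q \<times> Q) \<inter> R. \<bar>c q\<bar> * \<bar>c q'\<bar>) / h"
  proof -
    \<comment> \<open>Used in place of the square root of the second moment: the bound stays linear
      in the second moment, and the free h will be proportional to the scaling.\<close>
    have "\<bar>y\<bar> \<le> h + y\<^sup>2 / h" for y :: real
    proof -
      have "2 * \<bar>y\<bar> * h \<le> y\<^sup>2 + h\<^sup>2" using sum_squares_bound[of "\<bar>y\<bar>" h] by simp
      moreover have "0 \<le> \<bar>y\<bar> * h" using h by simp
      ultimately have "\<bar>y\<bar> * h \<le> h\<^sup>2 + y\<^sup>2" by linarith
      then show ?thesis using h by (simp add: field_simps power2_eq_square)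
    qed
    then have "(\<integral>z. \<bar>Y z\<bar> \<partial>M) \<le> (\<integral>z. h + (Y z)\<^sup>2 / h \<partial>M)"
      by (intro integral_mono integrable_abs Y_int) (use YY_int in auto)
    also have "\<dots> = h + (\<integral>z. (Y z)\<^sup>2 \<partial>M) / h" using YY_int by (simp add: prob_space)
    also have "\<dots> \<le> h + 4 * (C * B) ^ 8 * (\<Sum>(q, q')\<in>(Q \<times> Q) \<inter> R. \<bar>c q\<bar> * \<bar>c q'\<bar>) / h"
      by (intro add_left_mono divide_right_mono var_le) (use h in simp)
    finally show ?thesis .
  qed
  have U_int: "integrable M (U q)" for q
  proof -
    obtain i j k l where q4: "q = (i, j, k, l)" by (cases q) auto
    have "U q = (\<lambda>z. lin (w i) z * lin (w j) z * lin (w k) z * lin (w l) z)" by (rule ext) (simp add: U_def q4)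
    then show ?thesis by (simp add: lin4_moment)
  qed
  show int: "integrable M (\<lambda>z. \<Sum>q\<in>Q. c q * (U q z - (\<integral>z. U q z \<partial>M)))"
    using U_int by (intro Bochner_Integration.integrable_sum) auto
  have pw: "\<bar>\<Sum>q\<in>Q. c q * (U q z - (\<integral>z. U q z \<partial>M))\<bar> \<le> (\<Sum>q\<in>Q. \<bar>c q\<bar> * (\<bar>U q z - UB q z\<bar> + D)) + \<bar>Y z\<bar>" for z
  proof -
    have E: "\<bar>(\<integral>z. UB q z \<partial>M) - (\<integral>z. U q z \<partial>M)\<bar> \<le> D" if q: "q \<in> Q" for q
    proof -
      have "(\<integral>z. U q z \<partial>M) - (\<integral>z. UB q z \<partial>M) = (\<integral>z. U q z - UB q z \<partial>M)" using U_int UB_int[OF q] by simp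
      also have "\<bar>\<dots>\<bar> \<le> (\<integral>z. \<bar>U q z - UB q z\<bar> \<partial>M)" by (rule integral_abs_bound)
      also have "\<dots> \<le> D" by (rule diff[OF q])
      finally show ?thesis by (simp add: abs_minus_commute)
    qed
    have "(\<Sum>q\<in>Q. c q * (U q z - (\<integral>z. U q z \<partial>M))) =
      (\<Sum>q\<in>Q. c q * ((U q z - UB q z) + ((\<integral>z. UB q z \<partial>M) - (\<integral>z. U q z \<partial>M)))) + Y z"
      unfolding Y_def Z_def sum.distrib[symmetric] by (intro sum.cong refl) (simp add: algebra_simps)
    also have "\<bar>\<dots>\<bar> \<le> (\<Sum>q\<in>Q. \<bar>c q * ((U q z - UB q z) + ((\<integral>z. UB q z \<partial>M) - (\<integral>z. U q z \<partial>M)))\<bar>) + \<bar>Y z\<bar>"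
      by (rule order_trans[OF abs_triangle_ineq add_right_mono[OF sum_abs]])
    also have "\<dots> \<le> (\<Sum>q\<in>Q. \<bar>c q\<bar> * (\<bar>U q z - UB q z\<bar> + D)) + \<bar>Y z\<bar>" unfolding abs_mult
      by (intro add_right_mono sum_mono mult_left_mono order_trans[OF abs_triangle_ineq add_left_mono[OF E]]) auto
    finally show ?thesis .
  qed
  have int1: "integrable M (\<lambda>z. \<Sum>q\<in>Q. \<bar>c q\<bar> * (\<bar>U q z - UB q z\<bar> + D))"
    by (intro Bochner_Integration.integrable_sum integrable_mult_right Bochner_Integration.integrable_add integrable_abs diff) auto
  have "(\<integral>z. \<bar>\<Sum>q\<in>Q. c q * (U q z - (\<integral>z. U q z \<partial>M))\<bar> \<partial>M) \<le>
     (\<integral>z. (\<Sum>q\<in>Q. \<bar>c q\<bar> * (\<bar>U q z - UB q z\<bar> + D)) + \<bar>Y z\<bar> \<partial>M)"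
    by (intro integral_mono integrable_abs int Bochner_Integration.integrable_add int1 Y_int pw)
  also have "\<dots> = (\<integral>z. (\<Sum>q\<in>Q. \<bar>c q\<bar> * (\<bar>U q z - UB q z\<bar> + D)) \<partial>M) + (\<integral>z. \<bar>Y z\<bar> \<partial>M)"
    by (intro Bochner_Integration.integral_add int1 integrable_abs Y_int)
  also have "(\<integral>z. (\<Sum>q\<in>Q. \<bar>c q\<bar> * (\<bar>U q z - UB q z\<bar> + D)) \<partial>M) = (\<Sum>q\<in>Q. \<bar>c q\<bar> * ((\<integral>z. \<bar>U q z - UB q z\<bar> \<partial>M) + D))"
    using diff(1) by (subst Bochner_Integration.integral_sum) (auto intro!: sum.cong simp: prob_space)
  also have "\<dots> \<le> (\<Sum>q\<in>Q. \<bar>c q\<bar> * (D + D))" by (intro sum_mono mult_left_mono add_right_mono diff) auto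
  also have "\<dots> = 2 * (\<Sum>q\<in>Q. \<bar>c q\<bar>) * D" by (simp add: sum_distrib_right[symmetric])
  finally show "(\<integral>z. \<bar>\<Sum>q\<in>Q. c q * (U q z - (\<integral>z. U q z \<partial>M))\<bar> \<partial>M) \<le>
      2 * (\<Sum>q\<in>Q. \<bar>c q\<bar>) * (4 * (C ^ 4 * t / e ^ 12 + 2 * e ^ 4 * (C ^ 4 * F))) +
      (h + 4 * (C * B) ^ 8 * (\<Sum>(q, q')\<in>(Q \<times> Q) \<inter> R. \<bar>c q\<bar> * \<bar>c q'\<bar>) / h)"
    using Y_abs unfolding D_def by linarith
qed

end

section \<open>Fitted values, uniformly in the covariance parameters\<close>

text \<open>The decisive assumption is \<open>S_le\<close>: each variance component matrix is
  dominated by V in the order of quadratic forms, with a constant free of N, whatever its operator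
  norm.\<close>

locale mixed = indep_effects M A \<xi> v \<kappa> + gls N p X V
  for M :: "'a measure" and A :: "'i set" and \<xi> v \<kappa> and N p :: nat and X V :: "real mat" +
  fixes w :: "nat \<Rightarrow> 'i \<Rightarrow> real" and s :: nat and S :: "nat \<Rightarrow> real mat" and \<sigma> :: "nat \<Rightarrow> real" and K :: real
  assumes V_cov: "\<And>i j. i < N \<Longrightarrow> j < N \<Longrightarrow> V $$ (i, j) = cov (w i) (w j)"
    and S: "\<And>t. t \<le> s \<Longrightarrow> S t \<in> carrier_mat N N" "\<And>t. t \<le> s \<Longrightarrow> transpose_mat (S t) = S t"
    and S_psd: "\<And>t a. t \<le> s \<Longrightarrow> a \<in> carrier_vec N \<Longrightarrow> 0 \<le> a \<bullet> (S t *v a)"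
    and S_le: "\<And>t a. t \<le> s \<Longrightarrow> a \<in> carrier_vec N \<Longrightarrow> \<sigma> t * (a \<bullet> (S t *v a)) \<le> a \<bullet> (V *v a)"
    and \<sigma>: "\<And>t. t \<le> s \<Longrightarrow> \<sigma> t > 0"
    and K: "0 \<le> K" "\<And>a. a \<in> A \<Longrightarrow> \<kappa> a \<le> K * (v a)\<^sup>2"
begin

definition uvec :: "'a \<Rightarrow> real vec" where "uvec z = vec N (\<lambda>i. lin (w i) z)"

lemma uvec [simp]: "uvec z \<in> carrier_vec N" "i < N \<Longrightarrow> uvec z $ i = lin (w i) z" by (auto simp: uvec_def)

definition coefs :: "real vec \<Rightarrow> 'i \<Rightarrow> real" where "coefs a x = (\<Sum>i<N. a $ i * w i x)"

lemma scalar_prod_uvec: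
  assumes "a \<in> carrier_vec N"
  shows "a \<bullet> uvec z = lin (coefs a) z"
proof -
  have "a \<bullet> uvec z = (\<Sum>i<N. a $ i * lin (w i) z)" by (simp add: scalar_prod_lessThan uvec_def)
  also have "\<dots> = (\<Sum>i<N. \<Sum>x\<in>A. a $ i * w i x * \<xi> x z)" by (simp add: lin_def sum_distrib_left mult.assoc)
  also have "\<dots> = lin (coefs a) z" by (subst sum.swap) (simp add: lin_def coefs_def sum_distrib_right)
  finally show ?thesis .
qed

lemma cov_coefs:
  assumes "a \<in> carrier_vec N" "b \<in> carrier_vec N"
  shows "cov (coefs a) (coefs b) = a \<bullet> (V *v b)"
proof -
  have "a \<bullet> (V *v b) = (\<Sum>i<N. \<Sum>j<N. a $ i * cov (w i) (w j) * b $ j)"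
    unfolding quad_form_sum[OF V assms] by (simp add: V_cov)
  also have "\<dots> = (\<Sum>i<N. \<Sum>j<N. \<Sum>x\<in>A. v x * (a $ i * w i x) * (b $ j * w j x))"
    unfolding cov_def sum_distrib_left sum_distrib_right by (simp add: mult_ac)
  also have "\<dots> = (\<Sum>x\<in>A. \<Sum>i<N. \<Sum>j<N. v x * (a $ i * w i x) * (b $ j * w j x))"
  proof -
    have "(\<Sum>i<N. \<Sum>j<N. \<Sum>x\<in>A. v x * (a $ i * w i x) * (b $ j * w j x)) =
        (\<Sum>i<N. \<Sum>x\<in>A. \<Sum>j<N. v x * (a $ i * w i x) * (b $ j * w j x))" by (rule sum.cong[OF refl], rule sum.swap)
    also have "\<dots> = (\<Sum>x\<in>A. \<Sum>i<N. \<Sum>j<N. v x * (a $ i * w i x) * (b $ j * w j x))" by (rule sum.swap)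
    finally show ?thesis .
  qed
  also have "\<dots> = cov (coefs a) (coefs b)"
    unfolding cov_def coefs_def mult.assoc sum_product by (simp add: sum_distrib_left mult.assoc)
  finally show ?thesis by simp
qed

lemma scalar_prod_uvec_fourth:
  assumes a: "a \<in> carrier_vec N"
  shows "integrable M (\<lambda>z. (a \<bullet> uvec z) ^ 4)" "(\<integral>z. (a \<bullet> uvec z) ^ 4 \<partial>M) \<le> (K + 3) * (a \<bullet> (V *v a))\<^sup>2"
  unfolding scalar_prod_uvec[OF a] cov_coefs[OF a a, symmetric] using lin_power4[OF K(2,1)] by auto

lemma scalar_prod_uvec_measurable:
  "a \<in> carrier_vec N \<Longrightarrow> (\<lambda>z. a \<bullet> uvec z) \<in> borel_measurable M"
  unfolding scalar_prod_uvec by measurable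

text \<open>Only finiteness is wanted: the value may grow with N and is beaten in
  \<open>leverage_bound\<close> by the number of iterations.\<close>

lemma uvec_norm4: "integrable M (\<lambda>z. vec_norm2 (uvec z) ^ 4)"
proof -
  have "vec_norm2 (uvec z) ^ 4 = (\<Sum>i<N. \<Sum>j<N. lin (w i) z * lin (w i) z * lin (w j) z * lin (w j) z)" for z
  proof -
    have "vec_norm2 (uvec z) ^ 4 = ((vec_norm2 (uvec z))\<^sup>2)\<^sup>2" by simp
    also have "\<dots> = (\<Sum>i<N. lin (w i) z * lin (w i) z) * (\<Sum>j<N. lin (w j) z * lin (w j) z)"
      unfolding vec_norm2_power2 by (simp add: power2_eq_square scalar_prod_lessThan uvec_def)
    finally show ?thesis by (simp add: sum_product mult.assoc)
  qed
  then show ?thesis by (simp add: lin4_moment)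
qed

lemma uvec_norm_measurable [measurable]: "(\<lambda>z. vec_norm2 (uvec z)) \<in> borel_measurable M"
proof -
  have "vec_norm2 (uvec z) = sqrt (\<Sum>i<N. lin (w i) z * lin (w i) z)" for z by (simp add: vec_norm2_def scalar_prod_lessThan uvec_def)
  then show ?thesis by simp
qed

lemma V_quad_nonneg: "a \<in> carrier_vec N \<Longrightarrow> 0 \<le> a \<bullet> (V *v a)" by (rule positive_definite_nonneg[OF V pd])

text \<open>Symmetry and \<open>P V P = P\<close> give \<open>b' V b = a' S b\<close>.
  Cauchy-Schwarz in the S-form and the domination of S by V bound the square of this by
  \<open>\<sigma>\<^sup>-\<^sup>2 (a' V a) (b' V b)\<close>, and one factor cancels. The bound is
  free of N.\<close>

lemma PS_contraction:
  assumes t: "t \<le> s" and a: "a \<in> carrier_vec N"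
  defines "b \<equiv> P *v (S t *v a)"
  shows "b \<in> carrier_vec N" "b \<bullet> (V *v b) \<le> (1 / \<sigma> t)\<^sup>2 * (a \<bullet> (V *v a))"
proof -
  have Sa: "S t *v a \<in> carrier_vec N" using S[OF t] a by simp
  show b: "b \<in> carrier_vec N" unfolding b_def using P Sa by simp
  have bVb: "b \<bullet> (V *v b) = a \<bullet> (S t *v b)"
  proof -
    have "b \<bullet> (V *v b) = (S t *v a) \<bullet> b" unfolding b_def using P_psd[OF Sa] by simp
    also have "\<dots> = a \<bullet> (S t *v b)" by (rule sym_mat_scalar_prod[OF S[OF t] a b])
    finally show ?thesis .
  qed
  define x where "x = b \<bullet> (V *v b)"
  define y where "y = a \<bullet> (V *v a)"
  have xy: "0 \<le> x" "0 \<le> y" using V_quad_nonneg a b by (auto simp: x_def y_def)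
  have "x\<^sup>2 \<le> (a \<bullet> (S t *v a)) * (b \<bullet> (S t *v b))"
    unfolding x_def bVb by (rule psd_cauchy_schwarz[OF S[OF t] S_psd[OF t] a b])
  also have "\<dots> \<le> (y / \<sigma> t) * (x / \<sigma> t)" using S_le[OF t a] S_le[OF t b] \<sigma>[OF t] S_psd[OF t] a b xy
    by (intro mult_mono) (auto simp: x_def y_def field_simps)
  finally have "x * x \<le> ((1 / \<sigma> t)\<^sup>2 * y) * x" by (simp add: power2_eq_square mult_ac)
  then show "x \<le> (1 / \<sigma> t)\<^sup>2 * y" using xy \<sigma>[OF t] by (cases "x = 0") (auto simp: mult_le_cancel_right)
qed

text \<open>A recursion for a linear form of the modified data, unrolled m times with absolute
  values: each step leaves a linear form in u and new coefficient vectors \<open>P S a\<close>, and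
  the innermost level is Cauchy-Schwarz. The perturbed V' does not occur, so one variable bounds all
  admissible V' at once.\<close>

fun lev :: "real \<Rightarrow> real \<Rightarrow> nat \<Rightarrow> real vec \<Rightarrow> 'a \<Rightarrow> real" where
  "lev c \<eta> 0 a z = c * sqrt (a \<bullet> (V *v a)) * vec_norm2 (uvec z)"
| "lev c \<eta> (Suc m) a z = \<bar>a \<bullet> uvec z\<bar> + \<eta> * (\<Sum>t\<le>s. lev c \<eta> m (P *v (S t *v a)) z)"

text \<open>Admissible perturbations V' of V: the quantities l and r are crude bounds that may depend on N.\<close>

definition near :: "real \<Rightarrow> real \<Rightarrow> real mat \<Rightarrow> bool" where
  "near \<eta> l V' \<longleftrightarrow> V' \<in> carrier_mat N N \<and> positive_definite V' \<and>
    (\<forall>a\<in>carrier_vec N. l * (a \<bullet> a) \<le> a \<bullet> (V' *v a)) \<and>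
    (\<exists>\<delta>. (\<forall>t\<le>s. \<bar>\<delta> t\<bar> \<le> \<eta>) \<and>
      (\<forall>a\<in>carrier_vec N. \<forall>b\<in>carrier_vec N. a \<bullet> ((V' - V) *v b) = (\<Sum>t\<le>s. \<delta> t * (a \<bullet> (S t *v b)))))"

text \<open>With q for the modified data, \<open>q = u - (V' - V) P q\<close>, so a' q is a' u minus
  the sum over t of \<open>\<delta> t\<close> times \<open>(P S\<^sub>t a)' q\<close>; induction on
  m does the rest. The constant c is chosen before m, which allows m to be adapted to c
  afterwards.\<close>

lemma lev_bound:
  assumes l: "0 < l" "\<And>a. a \<in> carrier_vec N \<Longrightarrow> l * (a \<bullet> a) \<le> a \<bullet> (V *v a)" and \<eta>: "0 \<le> \<eta>"
  shows "\<exists>c\<ge>0. \<forall>m. \<forall>a\<in>carrier_vec N. \<forall>V' z. near \<eta> l V' \<longrightarrow>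
    \<bar>a \<bullet> (uvec z - (V' - V) *v (gls_P X V' *v uvec z))\<bar> \<le> lev c \<eta> m a z"
proof -
  have "\<exists>r. \<forall>t. 0 < r t \<and> opbound (S t) (r t)" by (rule choice) (use opbound_exists in blast)
  then obtain r where r: "\<And>t. 0 < r t" "\<And>t. opbound (S t) (r t)" by blast
  \<comment> \<open>From the product of \<open>|q| \<le> (1 + \<eta> (\<Sum> r) / l) |u|\<close> and
    \<open>|a| \<le> sqrt (a' V a) / sqrt l\<close>.\<close>
  define c where "c = (1 + \<eta> * (\<Sum>t\<le>s. r t) * (1 / l)) / sqrt l"
  have r_sum: "0 \<le> (\<Sum>t\<le>s. r t)" by (intro sum_nonneg less_imp_le r)
  then have c: "0 \<le> c" unfolding c_def using l(1) \<eta> by (intro divide_nonneg_nonneg add_nonneg_nonneg mult_nonneg_nonneg) auto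
  have "\<bar>a \<bullet> (uvec z - (V' - V) *v (gls_P X V' *v uvec z))\<bar> \<le> lev c \<eta> m a z"
    if a: "a \<in> carrier_vec N" and near: "near \<eta> l V'" for m a V' z
  proof -
    have V': "V' \<in> carrier_mat N N" "positive_definite V'"
      and l': "\<And>a. a \<in> carrier_vec N \<Longrightarrow> l * (a \<bullet> a) \<le> a \<bullet> (V' *v a)"
      using near unfolding near_def by auto
    obtain \<delta> where \<delta>: "\<And>t. t \<le> s \<Longrightarrow> \<bar>\<delta> t\<bar> \<le> \<eta>"
      "\<And>a b. a \<in> carrier_vec N \<Longrightarrow> b \<in> carrier_vec N \<Longrightarrow> a \<bullet> ((V' - V) *v b) = (\<Sum>t\<le>s. \<delta> t * (a \<bullet> (S t *v b)))"
      using near unfolding near_def by blast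
    interpret G: gls2 N p X V V' by unfold_locales (use X inj V' in auto)
    define u where "u = uvec z"
    have u: "u \<in> carrier_vec N" by (simp add: u_def)
    define q where "q = u - (V' - V) *v (gls_P X V' *v u)"
    note P'_def = G.B.P_def
    have D: "V' - V \<in> carrier_mat N N" by (rule minus_carrier_mat[OF V])
    have P'u: "gls_P X V' *v u \<in> carrier_vec N" using G.B.P u unfolding P'_def by simp
    have q: "q \<in> carrier_vec N" unfolding q_def using D P'u u by simp
    have zeq: "q = u - (V' - V) *v (P *v q)" using G.fit_eq(3)[OF u] unfolding q_def P'_def by simp
    have Pz: "P *v q \<in> carrier_vec N" using P q by simp
    have step: "\<bar>b \<bullet> q\<bar> \<le> \<bar>b \<bullet> u\<bar> + \<eta> * (\<Sum>t\<le>s. \<bar>(P *v (S t *v b)) \<bullet> q\<bar>)" if b: "b \<in> carrier_vec N" for b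
    proof -
      have "b \<bullet> q = b \<bullet> u - b \<bullet> ((V' - V) *v (P *v q))"
        by (subst zeq, rule scalar_prod_minus_distrib[of _ N]) (use b u D Pz in auto)
      also have "b \<bullet> ((V' - V) *v (P *v q)) = (\<Sum>t\<le>s. \<delta> t * ((P *v (S t *v b)) \<bullet> q))"
        unfolding \<delta>(2)[OF b Pz]
      proof (intro sum.cong refl)
        fix t assume "t \<in> {..s}"
        then have t: "t \<le> s" by simp
        have Sb: "S t *v b \<in> carrier_vec N" using S[OF t] b by simp
        have "b \<bullet> (S t *v (P *v q)) = (S t *v b) \<bullet> (P *v q)" by (rule sym_mat_scalar_prod[OF S[OF t] b Pz, symmetric])
        also have "\<dots> = (P *v (S t *v b)) \<bullet> q" by (rule sym_mat_scalar_prod[OF P P_sym Sb q, symmetric])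
        finally show "\<delta> t * (b \<bullet> (S t *v (P *v q))) = \<delta> t * ((P *v (S t *v b)) \<bullet> q)" by simp
      qed
      finally have "\<bar>b \<bullet> q\<bar> \<le> \<bar>b \<bullet> u\<bar> + \<bar>\<Sum>t\<le>s. \<delta> t * ((P *v (S t *v b)) \<bullet> q)\<bar>" by linarith
      also have "\<bar>\<Sum>t\<le>s. \<delta> t * ((P *v (S t *v b)) \<bullet> q)\<bar> \<le> (\<Sum>t\<le>s. \<eta> * \<bar>(P *v (S t *v b)) \<bullet> q\<bar>)"
        by (rule order_trans[OF sum_abs]) (auto simp: abs_mult intro!: sum_mono mult_right_mono \<delta>)
      finally show ?thesis by (simp add: sum_distrib_left)
    qed
    have "\<bar>b \<bullet> q\<bar> \<le> lev c \<eta> m b z" if b: "b \<in> carrier_vec N" for b using b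
    proof (induction m arbitrary: b)
      case 0
      have "vec_norm2 ((V' - V) *v y) \<le> \<eta> * (\<Sum>t\<le>s. r t) * vec_norm2 y" if y: "y \<in> carrier_vec N" for y
      proof -
        let ?d = "(V' - V) *v y"
        have d: "?d \<in> carrier_vec N" using D y by simp
        \<comment> \<open>V' - V is known only through its bilinear form, so the norm is found by
          testing with d itself.\<close>
        have "vec_norm2 ?d * vec_norm2 ?d = (\<Sum>t\<le>s. \<delta> t * (?d \<bullet> (S t *v y)))" using \<delta>(2)[OF d y] by (simp add: vec_norm2_sq)
        also have "\<dots> \<le> (\<Sum>t\<le>s. \<eta> * (vec_norm2 ?d * (r t * vec_norm2 y)))"
        proof (rule sum_mono)
          fix t assume "t \<in> {..s}"
          then have t: "t \<le> s" by simp
          have "\<delta> t * (?d \<bullet> (S t *v y)) \<le> \<bar>\<delta> t\<bar> * \<bar>?d \<bullet> (S t *v y)\<bar>" by (metis abs_ge_self abs_mult)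
          also have "\<dots> \<le> \<eta> * (vec_norm2 ?d * vec_norm2 (S t *v y))"
            by (intro mult_mono \<delta> t scalar_prod_le_norm[of _ N]) (use d y S[OF t] \<eta> in auto)
          also have "\<dots> \<le> \<eta> * (vec_norm2 ?d * (r t * vec_norm2 y))"
            by (intro mult_left_mono opboundD[OF r(2) S(1)[OF t] y] \<eta>) simp
          finally show "\<delta> t * (?d \<bullet> (S t *v y)) \<le> \<eta> * (vec_norm2 ?d * (r t * vec_norm2 y))" .
        qed
        also have "\<dots> = (\<eta> * (\<Sum>t\<le>s. r t) * vec_norm2 y) * vec_norm2 ?d"
          by (simp add: sum_distrib_left sum_distrib_right mult_ac)
        finally show ?thesis using \<eta> r(1)
          by (cases "vec_norm2 ?d = 0") (auto simp: mult_le_cancel_right order.strict_iff_order sum_nonneg intro!: mult_nonneg_nonneg)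
      qed
      from this[OF P'u] have 1: "vec_norm2 ((V' - V) *v (gls_P X V' *v u)) \<le> \<eta> * (\<Sum>t\<le>s. r t) * vec_norm2 (gls_P X V' *v u)" .
      have 2: "vec_norm2 (gls_P X V' *v u) \<le> 1 / l * vec_norm2 u"
        using opboundD[OF G.B.P_opbound[OF l(1) l'] G.B.P u] unfolding P'_def by simp
      have "vec_norm2 q \<le> vec_norm2 u + vec_norm2 ((V' - V) *v (gls_P X V' *v u))"
        unfolding q_def by (rule vec_norm2_diff_triangle[of _ N]) (use u D P'u in auto)
      also have "\<dots> \<le> vec_norm2 u + \<eta> * (\<Sum>t\<le>s. r t) * (1 / l * vec_norm2 u)"
        using 1 mult_left_mono[OF 2 mult_nonneg_nonneg[OF \<eta> r_sum]] by linarith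
      finally have zn: "vec_norm2 q \<le> (1 + \<eta> * (\<Sum>t\<le>s. r t) * (1 / l)) * vec_norm2 u" by (simp add: algebra_simps)
      have bn: "vec_norm2 b \<le> sqrt (b \<bullet> (V *v b)) / sqrt l"
      proof -
        have "sqrt l * vec_norm2 b = sqrt (l * (b \<bullet> b))" by (simp add: vec_norm2_def real_sqrt_mult)
        also have "\<dots> \<le> sqrt (b \<bullet> (V *v b))" by (rule real_sqrt_le_mono[OF l(2)[OF 0]])
        finally show ?thesis using l(1) by (simp add: field_simps)
      qed
      have "\<bar>b \<bullet> q\<bar> \<le> vec_norm2 b * vec_norm2 q" by (rule scalar_prod_le_norm[OF 0 q])
      also have "\<dots> \<le> (sqrt (b \<bullet> (V *v b)) / sqrt l) * ((1 + \<eta> * (\<Sum>t\<le>s. r t) * (1 / l)) * vec_norm2 u)"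
        by (intro mult_mono bn zn) (use l V_quad_nonneg[OF 0] in auto)
      also have "\<dots> = lev c \<eta> 0 b z" by (simp add: c_def u_def)
      finally show ?case .
    next
      case (Suc m)
      have "\<bar>b \<bullet> q\<bar> \<le> \<bar>b \<bullet> u\<bar> + \<eta> * (\<Sum>t\<le>s. \<bar>(P *v (S t *v b)) \<bullet> q\<bar>)" by (rule step[OF Suc.prems])
      also have "\<dots> \<le> \<bar>b \<bullet> u\<bar> + \<eta> * (\<Sum>t\<le>s. lev c \<eta> m (P *v (S t *v b)) z)"
        by (intro add_left_mono mult_left_mono sum_mono Suc.IH PS_contraction(1) \<eta> Suc.prems) auto
      finally show ?case by (simp add: u_def)
    qed
    from this[OF a] show ?thesis by (simp add: q_def u_def)
  qed
  then show ?thesis using c by blast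
qed

lemma lev_measurable: "a \<in> carrier_vec N \<Longrightarrow> lev c \<eta> m a \<in> borel_measurable M"
proof (induction m arbitrary: a)
  case 0
  then show ?case by (simp cong: measurable_cong)
next
  case (Suc m)
  have "lev c \<eta> m (P *v (S t *v a)) \<in> borel_measurable M" if "t \<le> s" for t
    by (rule Suc.IH) (rule PS_contraction(1)[OF that Suc.prems])
  then show ?case using scalar_prod_uvec_measurable[OF Suc.prems] by (simp cong: measurable_cong)
qed

text \<open>The condition on \<eta> makes the recursion contract: the 8 of
  \<open>sum2_power4_le\<close> times
  \<open>(\<eta> (s + 1) / \<sigma>\<^sub>t) ^ 4 \<le> 1/16\<close> is at most 1/2. The constant
  \<open>16 * (K + 3)\<close> solves \<open>x = 8 * (K + 3) + x / 2\<close>, while the crude initial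
  bound E is halved at every step.\<close>

lemma lev_fourth:
  assumes \<eta>: "0 \<le> \<eta>" "\<And>t. t \<le> s \<Longrightarrow> 2 * real (s + 1) * \<eta> \<le> \<sigma> t" and c: "0 \<le> c"
    and E0: "(\<integral>z. (c * vec_norm2 (uvec z)) ^ 4 \<partial>M) \<le> E"
  shows "a \<in> carrier_vec N \<Longrightarrow> integrable M (\<lambda>z. lev c \<eta> m a z ^ 4) \<and>
    (\<integral>z. lev c \<eta> m a z ^ 4 \<partial>M) \<le> (16 * (K + 3) + E / 2 ^ m) * (a \<bullet> (V *v a))\<^sup>2"
proof (induction m arbitrary: a)
  case 0
  have "lev c \<eta> 0 a z ^ 4 = (a \<bullet> (V *v a))\<^sup>2 * (c * vec_norm2 (uvec z)) ^ 4" for z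
  proof -
    have "(sqrt x) ^ 4 = x\<^sup>2" if "0 \<le> x" for x using that power_mult[of "sqrt x" 2 2] by simp
    then show ?thesis using V_quad_nonneg[OF 0] by (simp add: power_mult_distrib)
  qed
  then have "integrable M (\<lambda>z. lev c \<eta> 0 a z ^ 4)"
    "(\<integral>z. lev c \<eta> 0 a z ^ 4 \<partial>M) = (a \<bullet> (V *v a))\<^sup>2 * (\<integral>z. (c * vec_norm2 (uvec z)) ^ 4 \<partial>M)"
    using uvec_norm4 by (auto simp: power_mult_distrib simp del: lev.simps)
  moreover have "(a \<bullet> (V *v a))\<^sup>2 * (\<integral>z. (c * vec_norm2 (uvec z)) ^ 4 \<partial>M) \<le> (a \<bullet> (V *v a))\<^sup>2 * (16 * (K + 3) + E)"
    using E0 K(1) by (intro mult_left_mono) auto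
  ultimately show ?case by (simp add: mult.commute del: lev.simps)
next
  case (Suc m)
  let ?q = "a \<bullet> (V *v a)"
  let ?b = "\<lambda>t. P *v (S t *v a)"
  let ?Cm = "16 * (K + 3) + E / 2 ^ m"
  have E: "0 \<le> E" by (rule order_trans[OF _ E0]) (auto intro!: integral_nonneg_AE)
  have Cm: "0 \<le> ?Cm" using K(1) E by simp
  have b: "?b t \<in> carrier_vec N" if "t \<le> s" for t by (rule PS_contraction(1)[OF that Suc.prems])
  have pw: "lev c \<eta> (Suc m) a z ^ 4 \<le> 8 * ((a \<bullet> uvec z) ^ 4 + \<eta> ^ 4 * (real (s + 1) ^ 3 * (\<Sum>t\<le>s. lev c \<eta> m (?b t) z ^ 4)))" for z
  proof -
    have "lev c \<eta> (Suc m) a z ^ 4 \<le> 8 * (\<bar>a \<bullet> uvec z\<bar> ^ 4 + (\<eta> * (\<Sum>t\<le>s. lev c \<eta> m (?b t) z)) ^ 4)"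
      unfolding lev.simps by (rule sum2_power4_le)
    also have "(\<eta> * (\<Sum>t\<le>s. lev c \<eta> m (?b t) z)) ^ 4 = \<eta> ^ 4 * (\<Sum>t\<le>s. 1 * lev c \<eta> m (?b t) z) ^ 4"
      by (simp add: power_mult_distrib)
    also have "(\<Sum>t\<le>s. 1 * lev c \<eta> m (?b t) z) ^ 4 \<le> (\<Sum>t\<le>s. 1) ^ 3 * (\<Sum>t\<le>s. 1 * lev c \<eta> m (?b t) z ^ 4)"
      by (rule weighted_sum_power4_le) simp
    finally show ?thesis using \<eta>(1) by (simp add: power_even_abs mult_left_mono)
  qed
  have int: "integrable M (\<lambda>z. 8 * ((a \<bullet> uvec z) ^ 4 + \<eta> ^ 4 * (real (s + 1) ^ 3 * (\<Sum>t\<le>s. lev c \<eta> m (?b t) z ^ 4))))"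
    using scalar_prod_uvec_fourth(1)[OF Suc.prems] Suc.IH[OF b]
    by (intro integrable_mult_right Bochner_Integration.integrable_add Bochner_Integration.integrable_sum) auto
  have int': "integrable M (\<lambda>z. lev c \<eta> (Suc m) a z ^ 4)"
  proof (rule Bochner_Integration.integrable_bound[OF int])
    show "(\<lambda>z. lev c \<eta> (Suc m) a z ^ 4) \<in> borel_measurable M"
      using lev_measurable[OF Suc.prems, of c \<eta> "Suc m"] by measurable
    show "AE z in M. norm (lev c \<eta> (Suc m) a z ^ 4) \<le> norm (8 * ((a \<bullet> uvec z) ^ 4 + \<eta> ^ 4 * (real (s + 1) ^ 3 * (\<Sum>t\<le>s. lev c \<eta> m (?b t) z ^ 4))))"
    proof (rule AE_I2)
      fix z
      have "norm (lev c \<eta> (Suc m) a z ^ 4) = lev c \<eta> (Suc m) a z ^ 4" by (simp del: lev.simps)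
      then show "norm (lev c \<eta> (Suc m) a z ^ 4) \<le> norm (8 * ((a \<bullet> uvec z) ^ 4 + \<eta> ^ 4 * (real (s + 1) ^ 3 * (\<Sum>t\<le>s. lev c \<eta> m (?b t) z ^ 4))))"
        using pw[of z] by (simp only: real_norm_def)
    qed
  qed
  have "(\<integral>z. lev c \<eta> (Suc m) a z ^ 4 \<partial>M) \<le> (\<integral>z. 8 * ((a \<bullet> uvec z) ^ 4 + \<eta> ^ 4 * (real (s + 1) ^ 3 * (\<Sum>t\<le>s. lev c \<eta> m (?b t) z ^ 4))) \<partial>M)"
    by (rule integral_mono[OF int' int pw])
  also have "\<dots> = 8 * ((\<integral>z. (a \<bullet> uvec z) ^ 4 \<partial>M) + \<eta> ^ 4 * (real (s + 1) ^ 3 * (\<Sum>t\<le>s. \<integral>z. lev c \<eta> m (?b t) z ^ 4 \<partial>M)))"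
  proof -
    have i: "integrable M (\<lambda>z. lev c \<eta> m (?b t) z ^ 4)" if "t \<in> {..s}" for t using Suc.IH[OF b] that by auto
    have "(\<integral>z. (\<Sum>t\<le>s. lev c \<eta> m (?b t) z ^ 4) \<partial>M) = (\<Sum>t\<le>s. \<integral>z. lev c \<eta> m (?b t) z ^ 4 \<partial>M)"
      by (rule Bochner_Integration.integral_sum) (rule i)
    moreover have "integrable M (\<lambda>z. \<Sum>t\<le>s. lev c \<eta> m (?b t) z ^ 4)" by (intro Bochner_Integration.integrable_sum i)
    ultimately show ?thesis using scalar_prod_uvec_fourth(1)[OF Suc.prems] by simp
  qed
  also have "\<dots> \<le> 8 * ((K + 3) * ?q\<^sup>2 + \<eta> ^ 4 * (real (s + 1) ^ 3 * (\<Sum>t\<le>s. ?Cm * ((1 / \<sigma> t)\<^sup>2 * ?q)\<^sup>2)))"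
  proof (intro mult_left_mono add_mono sum_mono scalar_prod_uvec_fourth(2) Suc.prems)
    fix t assume "t \<in> {..s}"
    then have t: "t \<le> s" by simp
    have "(\<integral>z. lev c \<eta> m (?b t) z ^ 4 \<partial>M) \<le> ?Cm * (?b t \<bullet> (V *v ?b t))\<^sup>2" using Suc.IH[OF b[OF t]] by simp
    also have "\<dots> \<le> ?Cm * ((1 / \<sigma> t)\<^sup>2 * ?q)\<^sup>2"
      by (intro mult_left_mono power_mono PS_contraction(2) t Suc.prems V_quad_nonneg b Cm)
    finally show "(\<integral>z. lev c \<eta> m (?b t) z ^ 4 \<partial>M) \<le> ?Cm * ((1 / \<sigma> t)\<^sup>2 * ?q)\<^sup>2" .
  qed (use \<eta>(1) in auto)
  also have "\<dots> \<le> 8 * ((K + 3) * ?q\<^sup>2 + ?Cm * ?q\<^sup>2 / 16)"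
  proof -
    have each: "\<eta> ^ 4 * real (s + 1) ^ 4 * ((1 / \<sigma> t)\<^sup>2)\<^sup>2 \<le> 1 / 16" if t: "t \<le> s" for t
    proof -
      have "\<eta> * real (s + 1) * (1 / \<sigma> t) \<le> 1 / 2" using \<eta>(2)[OF t] \<sigma>[OF t] by (simp add: field_simps)
      moreover have "0 \<le> \<eta> * real (s + 1) * (1 / \<sigma> t)" using \<eta>(1) \<sigma>[OF t] by simp
      ultimately have "(\<eta> * real (s + 1) * (1 / \<sigma> t)) ^ 4 \<le> (1 / 2) ^ 4" by (intro power_mono)
      then show ?thesis by (simp add: power_mult_distrib power_divide)
    qed
    have "\<eta> ^ 4 * (real (s + 1) ^ 3 * (\<Sum>t\<le>s. ?Cm * ((1 / \<sigma> t)\<^sup>2 * ?q)\<^sup>2)) =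
      (\<Sum>t\<le>s. (\<eta> ^ 4 * real (s + 1) ^ 4 * ((1 / \<sigma> t)\<^sup>2)\<^sup>2) * (?Cm * ?q\<^sup>2 / real (s + 1)))"
    proof -
      have "x * (y ^ 3 * (C * (k * q)\<^sup>2)) = (x * y ^ 4 * k\<^sup>2) * (C * q\<^sup>2 / y)" if "y \<noteq> 0" for x y C k q :: real
        using that by (simp add: power_mult_distrib field_simps numeral_eq_Suc)
      from this[of "real (s + 1)"] show ?thesis by (simp only: sum_distrib_left)
    qed
    also have "\<dots> \<le> (\<Sum>t\<le>s. (1 / 16) * (?Cm * ?q\<^sup>2 / real (s + 1)))"
      by (intro sum_mono mult_right_mono each) (use Cm in auto)
    also have "\<dots> = ?Cm * ?q\<^sup>2 / 16"
    proof -
      have "(\<Sum>t\<le>s. (1 / 16) * (x / real (s + 1))) = x / 16" for x :: real by (simp add: field_simps)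
      then show ?thesis .
    qed
    finally have f: "\<eta> ^ 4 * (real (s + 1) ^ 3 * (\<Sum>t\<le>s. ?Cm * ((1 / \<sigma> t)\<^sup>2 * ?q)\<^sup>2)) \<le> ?Cm * ?q\<^sup>2 / 16" .
    show ?thesis by (intro mult_left_mono add_left_mono f) simp
  qed
  also have "\<dots> = (16 * (K + 3) + E / 2 ^ Suc m) * ?q\<^sup>2" by (simp add: field_simps)
  finally show ?case using int' by simp
qed

text \<open>The parameters of a fixed model being fixed, m can be chosen so large that the crude starting bound
  no longer matters.\<close>

lemma leverage_bound:
  assumes l: "0 < l" "\<And>a. a \<in> carrier_vec N \<Longrightarrow> l * (a \<bullet> a) \<le> a \<bullet> (V *v a)"
    and \<eta>: "0 \<le> \<eta>" "\<And>t. t \<le> s \<Longrightarrow> 2 * real (s + 1) * \<eta> \<le> \<sigma> t"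
  shows "\<exists>R. \<forall>i<N. R i \<in> borel_measurable M \<and> integrable M (\<lambda>z. R i z ^ 4) \<and>
    (\<integral>z. R i z ^ 4 \<partial>M) \<le> (16 * (K + 3) + 1) * (row X i \<bullet> (H *v row X i))\<^sup>2 \<and>
    (\<forall>V' z. near \<eta> l V' \<longrightarrow> \<bar>(gls_proj X V' *v (mat_inv V' *v uvec z)) $ i\<bar> \<le> R i z)"
proof -
  obtain c where c: "0 \<le> c" "\<And>m a V' z. a \<in> carrier_vec N \<Longrightarrow> near \<eta> l V' \<Longrightarrow>
    \<bar>a \<bullet> (uvec z - (V' - V) *v (gls_P X V' *v uvec z))\<bar> \<le> lev c \<eta> m a z" using lev_bound[OF l \<eta>(1)] by blast
  define E where "E = (\<integral>z. (c * vec_norm2 (uvec z)) ^ 4 \<partial>M)"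
  obtain m where m: "E < 2 ^ m" using real_arch_pow[of 2 E] by auto
  \<comment> \<open>The i-th GLS fit of q is the linear form \<open>a i \<bullet> q\<close>. Applied
    to u this form has variance \<open>a' V a = x' H x\<close>, with x the i-th row of X.\<close>
  define a where "a i = Vi *v (J *v unit_vec N i)" for i
  have a: "a i \<in> carrier_vec N" for i unfolding a_def using Vi J by simp
  have aVa: "a i \<bullet> (V *v a i) = row X i \<bullet> (H *v row X i)" if i: "i < N" for i
  proof -
    let ?e = "unit_vec N i"
    have e: "J *v ?e \<in> carrier_vec N" "?e \<in> carrier_vec N" using J by auto
    have "V *v a i = J *v ?e" unfolding a_def using V Vi V_Vi e by (simp flip: assoc_mult_mat_vec)
    then have "a i \<bullet> (V *v a i) = (J *v ?e) \<bullet> a i" using comm_scalar_prod[OF a e(1)] by simp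
    also have "\<dots> = ?e \<bullet> (J *v (Vi *v (J *v ?e)))" unfolding a_def
      by (rule sym_mat_scalar_prod[OF J J_sym e(2)]) (use Vi e in simp)
    also have "J *v (Vi *v (J *v ?e)) = J *v ?e" using arg_cong[OF J_Vi_J, of "\<lambda>M. M *v ?e"] J Vi by (simp add: mat_vec_assoc)
    also have "J *v ?e = X *v (H *v (X\<^sup>T *v ?e))" unfolding J_eq using X H by (simp add: mat_vec_assoc)
    also have "X\<^sup>T *v ?e = row X i" using X i by (intro eq_vecI) (auto simp: scalar_prod_right_unit)
    also have "?e \<bullet> (X *v (H *v row X i)) = row X i \<bullet> (H *v row X i)"
      using X H i scalar_prod_left_unit[of "X *v (H *v row X i)" N i] by simp
    finally show ?thesis .
  qed
  have "lev c \<eta> m (a i) \<in> borel_measurable M \<and> integrable M (\<lambda>z. lev c \<eta> m (a i) z ^ 4) \<and>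
    (\<integral>z. lev c \<eta> m (a i) z ^ 4 \<partial>M) \<le> (16 * (K + 3) + 1) * (row X i \<bullet> (H *v row X i))\<^sup>2 \<and>
    (\<forall>V' z. near \<eta> l V' \<longrightarrow> \<bar>(gls_proj X V' *v (mat_inv V' *v uvec z)) $ i\<bar> \<le> lev c \<eta> m (a i) z)" if i: "i < N" for i
  proof (intro conjI allI impI lev_measurable a)
    note f = lev_fourth[OF \<eta> c(1) _ a, of E m i]
    show "integrable M (\<lambda>z. lev c \<eta> m (a i) z ^ 4)" using f by (simp add: E_def)
    have "(\<integral>z. lev c \<eta> m (a i) z ^ 4 \<partial>M) \<le> (16 * (K + 3) + E / 2 ^ m) * (row X i \<bullet> (H *v row X i))\<^sup>2"
      using f unfolding aVa[OF i] by (simp add: E_def)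
    also have "\<dots> \<le> (16 * (K + 3) + 1) * (row X i \<bullet> (H *v row X i))\<^sup>2"
      by (intro mult_right_mono add_left_mono) (use m in auto)
    finally show "(\<integral>z. lev c \<eta> m (a i) z ^ 4 \<partial>M) \<le> (16 * (K + 3) + 1) * (row X i \<bullet> (H *v row X i))\<^sup>2" .
    fix V' z assume near: "near \<eta> l V'"
    then have V': "V' \<in> carrier_mat N N" "positive_definite V'" unfolding near_def by auto
    interpret G: gls2 N p X V V' by unfold_locales (use X inj V' in auto)
    define q where "q = uvec z - (V' - V) *v (gls_P X V' *v uvec z)"
    have q: "q \<in> carrier_vec N" unfolding q_def using minus_carrier_mat[OF V, of V'] G.B.P unfolding G.B.P_def by simp
    have "gls_proj X V' *v (mat_inv V' *v uvec z) = J *v (Vi *v q)"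
      using G.fit_eq(2)[of "uvec z"] unfolding G.B.J_def G.B.Vi_def G.B.P_def q_def by simp
    moreover have "(J *v (Vi *v q)) $ i = a i \<bullet> q"
    proof -
      have e: "unit_vec N i \<in> carrier_vec N" by simp
      have Vz: "Vi *v q \<in> carrier_vec N" using Vi q by simp
      have "(J *v (Vi *v q)) $ i = unit_vec N i \<bullet> (J *v (Vi *v q))"
        using scalar_prod_left_unit[of "J *v (Vi *v q)" N i] J Vz i by simp
      also have "\<dots> = (J *v unit_vec N i) \<bullet> (Vi *v q)" by (rule sym_mat_scalar_prod[OF J J_sym e Vz, symmetric])
      also have "\<dots> = a i \<bullet> q" unfolding a_def by (rule sym_mat_scalar_prod[OF Vi Vi_sym _ q, symmetric]) (use J in simp)
      finally show ?thesis .
    qed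
    ultimately show "\<bar>(gls_proj X V' *v (mat_inv V' *v uvec z)) $ i\<bar> \<le> lev c \<eta> m (a i) z"
      using c(2)[OF a near] unfolding q_def by simp
  qed
  then show ?thesis by (intro exI[of _ "\<lambda>i. lev c \<eta> m (a i)"]) blast
qed

end

section \<open>The mixed linear model\<close>

text \<open>The variance components. V is linear in them, but in the parameter itself only affine in
  each coordinate separately.\<close>

definition tau :: "real vec \<Rightarrow> nat \<Rightarrow> real" where "tau \<theta> t = \<theta> $ 0 * gam \<theta> t"

definition Smat :: "lmm_design \<Rightarrow> nat \<Rightarrow> real mat" where
  "Smat d t = Zmat d t * transpose_mat (Zmat d t)"

definition sig :: "(nat \<Rightarrow> real measure) \<Rightarrow> nat \<Rightarrow> real" where
  "sig D t = variance_of (D t) (\<lambda>x. x)"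

definition kap :: "(nat \<Rightarrow> real measure) \<Rightarrow> nat \<Rightarrow> real" where
  "kap D t = (\<integral>x. x ^ 4 \<partial>D t) - 3 * (sig D t)\<^sup>2"

text \<open>The sum stands in for a maximum: an upper bound for each standardized kurtosis is all
  that is wanted.\<close>

definition Kmax :: "nat \<Rightarrow> (nat \<Rightarrow> real measure) \<Rightarrow> real" where
  "Kmax s D = (\<Sum>t\<le>s. \<bar>kap D t\<bar> / (sig D t)\<^sup>2)"

lemma scalar_prod_self_gt_0:
  assumes "(v :: real vec) \<in> carrier_vec n" "v \<noteq> 0\<^sub>v n"
  shows "v \<bullet> v > 0" using scalar_prod_self_nonneg[of v] scalar_prod_self_eq_0[OF assms(1)] assms(2) by linarith

locale lmm_design_loc =
  fixes d :: lmm_design and s :: nat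
  assumes nranef: "nranef d = s" and valid: "valid_design d"
begin

abbreviation "N \<equiv> nobs d"
abbreviation "p \<equiv> nfix d"
abbreviation "X \<equiv> Xmat d"
abbreviation "Z \<equiv> Zmat d"
abbreviation "S \<equiv> Smat d"

lemma X: "X \<in> carrier_mat N p" by (auto simp: nobs_def nfix_def)

lemma X_inj: "injective_mat X" using full_rank_injective[OF X] valid by (simp add: valid_design_def)

lemma p_pos: "0 < p" using valid by (simp add: valid_design_def)

text \<open>If X had more columns than rows, padding it with zero rows would give an injective,
  hence invertible, square matrix with a zero row.\<close>

lemma p_le_N: "p \<le> N"
proof (rule ccontr)
  assume "\<not> p \<le> N"
  then have "p > N" by simp
  define Y where "Y = mat p p (\<lambda>(i, j). if i < N then X $$ (i, j) else 0)"
  have Y: "Y \<in> carrier_mat p p" by (simp add: Y_def)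
  have row0: "row Y N = 0\<^sub>v p" unfolding Y_def using \<open>p > N\<close> by (intro eq_vecI) auto
  have "invertible_mat Y"
  proof (rule invertible_matI_inj[OF Y])
    fix v assume v: "v \<in> carrier_vec p" "Y *v v = 0\<^sub>v p"
    have "X *v v = 0\<^sub>v N"
    proof (rule eq_vecI)
      fix i assume "i < dim_vec (0\<^sub>v N)"
      then have i: "i < N" by simp
      have "row X i = row Y i" using i \<open>p > N\<close> X by (intro eq_vecI) (auto simp: Y_def)
      then have "(X *v v) $ i = (Y *v v) $ i" using i \<open>p > N\<close> X Y by simp
      then show "(X *v v) $ i = 0\<^sub>v N $ i" using v(2) i \<open>p > N\<close> by simp
    qed (use X in auto)
    then show "v = 0\<^sub>v p" by (rule injective_matD[OF X_inj X v(1)])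
  qed
  then obtain B where B: "B \<in> carrier_mat p p" "Y * B = 1\<^sub>m p" using invertible_mat_iff[OF Y] by blast
  have "(Y * B) $$ (N, N) = row Y N \<bullet> col B N" using \<open>p > N\<close> Y B(1) by simp
  also have "\<dots> = 0" unfolding row0 using B(1) by (intro scalar_prod_left_zero carrier_vecI) simp
  finally show False using B(2) \<open>p > N\<close> by simp
qed

lemma N_pos: "0 < N" using p_pos p_le_N by simp

lemma Z: "t \<le> s \<Longrightarrow> Z t \<in> carrier_mat N (nlev d t)"
  using valid nranef by (auto simp: valid_design_def Zmat_def nlev_def)

lemma nlev_0: "nlev d 0 = N" by (simp add: nlev_def Zmat_def)

lemma S: "t \<le> s \<Longrightarrow> S t \<in> carrier_mat N N" "t \<le> s \<Longrightarrow> transpose_mat (S t) = S t"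
  using Z[of t] by (auto simp: Smat_def transpose_mult[of _ N "nlev d t"])

lemma S_0: "S 0 = 1\<^sub>m N" by (simp add: Smat_def Zmat_def)

lemma S_quad: "t \<le> s \<Longrightarrow> a \<in> carrier_vec N \<Longrightarrow> a \<bullet> (S t *v a) = (transpose_mat (Z t) *v a) \<bullet> (transpose_mat (Z t) *v a)"
  using quad_transpose_mult[of "transpose_mat (Z t)" "nlev d t" N "1\<^sub>m (nlev d t)" a] Z[of t] by (simp add: Smat_def)

lemma S_psd: "t \<le> s \<Longrightarrow> a \<in> carrier_vec N \<Longrightarrow> 0 \<le> a \<bullet> (S t *v a)"
  by (simp add: S_quad scalar_prod_self_nonneg)

lemma S_index: "t \<le> s \<Longrightarrow> i < N \<Longrightarrow> j < N \<Longrightarrow> S t $$ (i, j) = (\<Sum>l<nlev d t. Z t $$ (i, l) * Z t $$ (j, l))"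
  using Z[of t] by (simp add: Smat_def scalar_prod_lessThan)

lemma Vmat: "Vmat d \<theta> \<in> carrier_mat N N" by (simp add: Vmat_def)

lemma Vmat_index: "i < N \<Longrightarrow> j < N \<Longrightarrow> Vmat d \<theta> $$ (i, j) = (\<Sum>t\<le>s. tau \<theta> t * S t $$ (i, j))"
proof -
  assume ij: "i < N" "j < N"
  have "(\<Sum>t\<le>s. tau \<theta> t * S t $$ (i, j)) = tau \<theta> 0 * S 0 $$ (i, j) + (\<Sum>t=1..s. tau \<theta> t * S t $$ (i, j))"
    by (simp add: atMost_atLeast0 sum.atLeast_Suc_atMost)
  also have "(\<Sum>t=1..s. tau \<theta> t * S t $$ (i, j)) = \<theta> $ 0 * (\<Sum>t=1..s. \<theta> $ t * S t $$ (i, j))"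
    unfolding sum_distrib_left by (intro sum.cong refl) (auto simp: tau_def gam_def)
  finally show ?thesis using ij by (simp add: Vmat_def nranef S_0 tau_def gam_def distrib_left flip: Smat_def)
qed

text \<open>With the factor \<open>(\<theta> $ 0)\<^sup>2\<close>, the products of
  \<open>Gamma_fn\<close> in \<open>I12_hat\<close> are therefore products of entries of V.\<close>

lemma Gamma_fn_eq:
  assumes ij: "i < N" "j < N"
  shows "\<theta> $ 0 * Gamma_fn d \<theta> i j = Vmat d \<theta> $$ (i, j)"
  unfolding Vmat_index[OF ij] Gamma_fn_def nranef sum_distrib_left
proof (intro sum.cong refl)
  fix t assume "t \<in> {..s}"
  then have t: "t \<le> s" by simp
  have "row (Z t) i \<bullet> row (Z t) j = S t $$ (i, j)" using Z[OF t] ij t by (simp add: S_index scalar_prod_lessThan)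
  then show "\<theta> $ 0 * (gam \<theta> t * (row (Z t) i \<bullet> row (Z t) j)) = tau \<theta> t * S t $$ (i, j)" by (simp add: tau_def)
qed

lemma Vmat_sym: "transpose_mat (Vmat d \<theta>) = Vmat d \<theta>"
proof (rule eq_matI)
  fix i j assume "i < dim_row (Vmat d \<theta>)" "j < dim_col (Vmat d \<theta>)"
  then have ij: "i < N" "j < N" using Vmat[of \<theta>] by auto
  have "Vmat d \<theta> $$ (j, i) = Vmat d \<theta> $$ (i, j)" unfolding Vmat_index[OF ij] Vmat_index[OF ij(2,1)]
    by (intro sum.cong refl arg_cong2[of _ _ _ _ "(*)"] sym_mat_index[OF S(2) S(1) ij]) auto
  then show "transpose_mat (Vmat d \<theta>) $$ (i, j) = Vmat d \<theta> $$ (i, j)" using ij Vmat[of \<theta>] by simp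
qed (use Vmat[of \<theta>] in auto)

lemma Vmat_bilinear:
  assumes a: "a \<in> carrier_vec N" and b: "b \<in> carrier_vec N"
  shows "a \<bullet> (Vmat d \<theta> *v b) = (\<Sum>t\<le>s. tau \<theta> t * (a \<bullet> (S t *v b)))"
proof -
  have "a \<bullet> (Vmat d \<theta> *v b) = (\<Sum>i<N. \<Sum>j<N. \<Sum>t\<le>s. tau \<theta> t * (a $ i * S t $$ (i, j) * b $ j))"
    unfolding quad_form_sum[OF Vmat a b] by (intro sum.cong refl) (simp add: Vmat_index sum_distrib_left sum_distrib_right mult_ac)
  also have "\<dots> = (\<Sum>i<N. \<Sum>t\<le>s. \<Sum>j<N. tau \<theta> t * (a $ i * S t $$ (i, j) * b $ j))"
    by (rule sum.cong[OF refl], rule sum.swap)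
  also have "\<dots> = (\<Sum>t\<le>s. \<Sum>i<N. \<Sum>j<N. tau \<theta> t * (a $ i * S t $$ (i, j) * b $ j))" by (rule sum.swap)
  also have "\<dots> = (\<Sum>t\<le>s. tau \<theta> t * (a \<bullet> (S t *v b)))"
    by (intro sum.cong refl) (use quad_form_sum[OF S(1) a b] in \<open>auto simp: sum_distrib_left\<close>)
  finally show ?thesis .
qed

lemma tau_nonneg: "\<theta> \<in> param_space s \<Longrightarrow> t \<le> s \<Longrightarrow> 0 \<le> tau \<theta> t"
  by (auto simp: param_space_def tau_def gam_def intro!: mult_nonneg_nonneg less_imp_le)

lemma Vmat_ge_S:
  assumes "\<theta> \<in> param_space s" "t \<le> s" "a \<in> carrier_vec N"
  shows "tau \<theta> t * (a \<bullet> (S t *v a)) \<le> a \<bullet> (Vmat d \<theta> *v a)" unfolding Vmat_bilinear[OF assms(3,3)]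
  using member_le_sum[of t "{..s}" "\<lambda>t. tau \<theta> t * (a \<bullet> (S t *v a))"] assms tau_nonneg S_psd by auto

lemma Vmat_ge:
  assumes "\<theta> \<in> param_space s" "a \<in> carrier_vec N"
  shows "\<theta> $ 0 * (a \<bullet> a) \<le> a \<bullet> (Vmat d \<theta> *v a)"
  using Vmat_ge_S[OF assms(1) _ assms(2), of 0] assms(2) by (simp add: S_0 tau_def gam_def)

lemma param_pos: "\<theta> \<in> param_space s \<Longrightarrow> \<theta> $ 0 > 0" by (simp add: param_space_def)

lemma Vmat_pd: assumes "\<theta> \<in> param_space s" shows "positive_definite (Vmat d \<theta>)" unfolding positive_definite_iff[OF Vmat]
proof (intro conjI Vmat_sym ballI impI)
  fix v :: "real vec" assume v: "v \<in> carrier_vec N" "v \<noteq> 0\<^sub>v N"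
  have "0 < \<theta> $ 0 * (v \<bullet> v)" using scalar_prod_self_gt_0[OF v] param_pos[OF assms] by simp
  then show "0 < v \<bullet> (Vmat d \<theta> *v v)" using Vmat_ge[OF assms v(1)] by linarith
qed

lemma gls_loc: "\<theta> \<in> param_space s \<Longrightarrow> gls N p X (Vmat d \<theta>)"
  by unfold_locales (auto simp: X X_inj Vmat Vmat_pd)

lemma Pmat_eq: "Pmat d \<theta> = gls_P X (Vmat d \<theta>)" by (simp add: Pmat_def gls_P_def Let_def)

lemma Pmat:
  assumes "\<theta> \<in> param_space s"
  shows "Pmat d \<theta> \<in> carrier_mat N N" "transpose_mat (Pmat d \<theta>) = Pmat d \<theta>"
    "Pmat d \<theta> * (Vmat d \<theta> * Pmat d \<theta>) = Pmat d \<theta>" "Pmat d \<theta> * X = 0\<^sub>m N p"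
    "opbound (Pmat d \<theta>) (1 / \<theta> $ 0)"
proof -
  interpret gls N p X "Vmat d \<theta>" by (rule gls_loc[OF assms])
  show "Pmat d \<theta> \<in> carrier_mat N N" "transpose_mat (Pmat d \<theta>) = Pmat d \<theta>"
    "Pmat d \<theta> * (Vmat d \<theta> * Pmat d \<theta>) = Pmat d \<theta>" "Pmat d \<theta> * X = 0\<^sub>m N p"
    "opbound (Pmat d \<theta>) (1 / \<theta> $ 0)" unfolding Pmat_eq P_def[symmetric]
    using P P_sym P_V_P P_X P_opbound[OF param_pos[OF assms] Vmat_ge[OF assms]] by auto
qed

text \<open>The fit reproduces the fixed effects exactly, so the residuals depend on the data only
  through u.\<close>

lemma residual_eq:
  assumes \<theta>: "\<theta> \<in> param_space s" and b: "b \<in> carrier_vec p" and u: "u \<in> carrier_vec N"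
  shows "residual d \<theta> (X *v b + u) = u - gls_proj X (Vmat d \<theta>) *v (mat_inv (Vmat d \<theta>) *v u)"
proof -
  interpret gls N p X "Vmat d \<theta>" by (rule gls_loc[OF \<theta>])
  let ?y = "X *v b + u"
  have Xb: "X *v b \<in> carrier_vec N" using X b by simp
  then have y: "?y \<in> carrier_vec N" using u by simp
  have beta: "X *v beta_gls d \<theta> ?y = J *v (Vi *v ?y)"
    unfolding beta_gls_def Let_def J_def gls_proj_def Vi_def[symmetric] H_def[symmetric]
    using X H Vi y u by (simp add: mat_vec_assoc mat_assoc)
  have "Vi *v ?y = Vi *v (X *v b) + Vi *v u" by (rule mult_add_distrib_mat_vec[OF Vi Xb u])
  then have "J *v (Vi *v ?y) = J *v (Vi *v (X *v b)) + J *v (Vi *v u)"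
    using mult_add_distrib_mat_vec[OF J, of "Vi *v (X *v b)" "Vi *v u"] Vi Xb u by simp
  also have "J *v (Vi *v (X *v b)) = X *v b" using arg_cong[OF J_Vi_X, of "\<lambda>A. A *v b"] J Vi X b by (simp add: mat_vec_assoc)
  finally have "X *v beta_gls d \<theta> ?y = X *v b + J *v (Vi *v u)" using beta by simp
  then have "residual d \<theta> ?y = (X *v b + u) - (X *v b + J *v (Vi *v u))" by (simp add: residual_def)
  also have "\<dots> = u - J *v (Vi *v u)" using Xb u J Vi by (intro eq_vecI) auto
  finally show ?thesis by (simp add: J_def Vi_def)
qed

end

text \<open>The model states independence in two layers, between the vectors and within each of
  them. Over a finite index set it suffices to factor intersections over all indices, and these are
  intersections of rectangles, one for each block. Block 0, the errors, makes the index set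
  nonempty.\<close>

lemma (in prob_space) indep_vars_two_level:
  fixes \<alpha> :: "nat \<Rightarrow> nat \<Rightarrow> 'a \<Rightarrow> real"
  assumes outer: "indep_vars (\<lambda>t. \<Pi>\<^sub>M l\<in>{..<n t}. borel) (\<lambda>t z. \<lambda>l\<in>{..<n t}. \<alpha> t l z) {..s}"
    and inner: "\<And>t. t \<le> s \<Longrightarrow> indep_vars (\<lambda>l. borel) (\<alpha> t) {..<n t}" and ne: "0 < n 0"
  shows "indep_vars (\<lambda>_. borel) (\<lambda>a. \<alpha> (fst a) (snd a)) (Sigma {..s} (\<lambda>t. {..<n t}))"
proof -
  let ?A = "Sigma {..s} (\<lambda>t. {..<n t})"
  let ?X = "\<lambda>a. \<alpha> (fst a) (snd a)"
  have A: "?A \<noteq> {}" "finite ?A" using ne by auto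
  have rv: "?X a \<in> borel_measurable M" if "a \<in> ?A" for a using inner that by (auto simp: indep_vars_def)
  have "indep_sets (\<lambda>a. {?X a -` B \<inter> space M |B. B \<in> sets borel}) ?A"
  proof (subst indep_sets_finite[OF A])
    show "{?X a -` B \<inter> space M |B. B \<in> sets borel} \<subseteq> events" if "a \<in> ?A" for a
      using rv[OF that] by (auto intro: measurable_sets)
    show "space M \<in> {?X a -` B \<inter> space M |B. B \<in> sets borel}" if "a \<in> ?A" for a
      by (rule CollectI, rule exI[of _ UNIV]) auto
    show "\<forall>B\<in>Pi ?A (\<lambda>a. {?X a -` B \<inter> space M |B. B \<in> sets borel}). prob (\<Inter>j\<in>?A. B j) = (\<Prod>j\<in>?A. prob (B j))"
    proof
      fix B assume B: "B \<in> Pi ?A (\<lambda>a. {?X a -` B \<inter> space M |B. B \<in> sets borel})"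
      have "\<forall>a\<in>?A. \<exists>E. E \<in> sets borel \<and> B a = ?X a -` E \<inter> space M"
      proof
        fix a assume "a \<in> ?A"
        from Pi_mem[OF B this] show "\<exists>E. E \<in> sets borel \<and> B a = ?X a -` E \<inter> space M" by blast
      qed
      then obtain E where E: "\<And>a. a \<in> ?A \<Longrightarrow> E a \<in> sets borel" "\<And>a. a \<in> ?A \<Longrightarrow> B a = ?X a -` E a \<inter> space M"
        by metis
      let ?Y = "\<lambda>t z. \<lambda>l\<in>{..<n t}. \<alpha> t l z"
      define F where "F t = (\<Pi>\<^sub>E l\<in>{..<n t}. E (t, l))" for t
      have F: "F t \<in> sets (\<Pi>\<^sub>M l\<in>{..<n t}. borel)" if "t \<le> s" for t
        unfolding F_def using that E(1) by (intro sets_PiM_I_finite) auto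
      have pre: "?Y t -` F t \<inter> space M = (\<Inter>l\<in>{..<n t}. \<alpha> t l -` E (t, l) \<inter> space M) \<inter> space M" if "t \<le> s" for t
        by (auto simp: F_def PiE_iff extensional_def)
      have probF: "prob (?Y t -` F t \<inter> space M) = (\<Prod>l<n t. prob (B (t, l)))" if t: "t \<le> s" for t
      \<comment> \<open>A random effect without levels: its rectangle is the whole space and the
        product over it is empty.\<close>
      proof (cases "n t = 0")
        case True
        then show ?thesis unfolding pre[OF t] by (simp add: prob_space)
      next
        case False
        have "(\<Inter>l\<in>{..<n t}. \<alpha> t l -` E (t, l) \<inter> space M) \<inter> space M = (\<Inter>l\<in>{..<n t}. \<alpha> t l -` E (t, l) \<inter> space M)"
          using False by auto
        then have "prob (?Y t -` F t \<inter> space M) = prob (\<Inter>l\<in>{..<n t}. \<alpha> t l -` E (t, l) \<inter> space M)"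
          unfolding pre[OF t] by simp
        also have "\<dots> = (\<Prod>l<n t. prob (\<alpha> t l -` E (t, l) \<inter> space M))"
          by (rule indep_varsD_finite[OF inner[OF t]]) (use False t E(1) in auto)
        also have "\<dots> = (\<Prod>l<n t. prob (B (t, l)))" using t by (intro prod.cong refl) (simp add: E(2))
        finally show ?thesis .
      qed
      have "(\<Inter>j\<in>?A. B j) = (\<Inter>t\<in>{..s}. ?Y t -` F t \<inter> space M)"
      proof -
        have "(\<Inter>j\<in>?A. B j) = (\<Inter>j\<in>?A. ?X j -` E j \<inter> space M)" using E(2) by auto
        also have "\<dots> = (\<Inter>t\<in>{..s}. (\<Inter>l\<in>{..<n t}. \<alpha> t l -` E (t, l) \<inter> space M) \<inter> space M)"
        proof (intro equalityI subsetI)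
          fix x assume x: "x \<in> (\<Inter>j\<in>?A. ?X j -` E j \<inter> space M)"
          have "(0, 0) \<in> ?A" using ne by auto
          then have "x \<in> space M" using x by blast
          moreover have "x \<in> \<alpha> t l -` E (t, l) \<inter> space M" if "t \<le> s" "l < n t" for t l
          proof -
            have "(t, l) \<in> ?A" using that by simp
            then have "x \<in> ?X (t, l) -` E (t, l) \<inter> space M" using x by blast
            then show ?thesis by simp
          qed
          ultimately show "x \<in> (\<Inter>t\<in>{..s}. (\<Inter>l\<in>{..<n t}. \<alpha> t l -` E (t, l) \<inter> space M) \<inter> space M)" by blast
        next
          fix x assume x: "x \<in> (\<Inter>t\<in>{..s}. (\<Inter>l\<in>{..<n t}. \<alpha> t l -` E (t, l) \<inter> space M) \<inter> space M)"
          show "x \<in> (\<Inter>j\<in>?A. ?X j -` E j \<inter> space M)"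
          proof
            fix j assume "j \<in> ?A"
            then obtain t l where j: "j = (t, l)" "t \<le> s" "l < n t" by auto
            have "x \<in> (\<Inter>l\<in>{..<n t}. \<alpha> t l -` E (t, l) \<inter> space M) \<inter> space M" using x j(2) by blast
            then have "x \<in> \<alpha> t l -` E (t, l) \<inter> space M" using j(3) by blast
            then show "x \<in> ?X j -` E j \<inter> space M" by (simp add: j(1))
          qed
        qed
        also have "\<dots> = (\<Inter>t\<in>{..s}. ?Y t -` F t \<inter> space M)" by (rule INF_cong) (simp_all only: pre atMost_iff)
        finally show ?thesis .
      qed
      also have "prob \<dots> = (\<Prod>t\<le>s. prob (?Y t -` F t \<inter> space M))"
        by (rule indep_varsD_finite[OF outer]) (use F in auto)
      also have "\<dots> = (\<Prod>t\<le>s. \<Prod>l<n t. prob (B (t, l)))" by (intro prod.cong refl probF) simp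
      also have "\<dots> = (\<Prod>j\<in>?A. prob (B j))" by (subst prod.Sigma) auto
      finally show "prob (\<Inter>j\<in>?A. B j) = (\<Prod>j\<in>?A. prob (B j))" .
    qed
  qed
  then show ?thesis unfolding indep_vars_def2 using rv by auto
qed

section \<open>A single model at the true parameter\<close>

locale lmm = lmm_design_loc d s for d s +
  fixes M :: "'a measure" and D :: "nat \<Rightarrow> real measure" and \<alpha> :: "nat \<Rightarrow> nat \<Rightarrow> 'a \<Rightarrow> real"
    and \<beta> :: "real vec" and y :: "'a \<Rightarrow> real vec" and \<theta> :: "real vec"
  assumes csi: "\<And>t. t \<le> s \<Longrightarrow> centred_square_integrable (D t)"
    and ranef: "random_effects M d D \<alpha>"
    and \<beta>: "\<beta> \<in> carrier_vec p"
    and y: "\<And>z. z \<in> space M \<Longrightarrow> y z = response d \<beta> (\<lambda>t l. \<alpha> t l z)"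
    and \<theta>: "\<theta> = true_theta s D"
    and sig_pos': "\<And>t. t \<le> s \<Longrightarrow> 0 < variance_of (D t) (\<lambda>x. x)"
    and fv: "\<And>t. t \<le> s \<Longrightarrow> finite_variance (D t) (\<lambda>x. x\<^sup>2)"
    and var_sq: "\<And>t. t \<le> s \<Longrightarrow> 0 < variance_of (D t) (\<lambda>x. x\<^sup>2)"
begin

abbreviation "Bt \<equiv> Bmat d \<theta>"
abbreviation "Vt \<equiv> Vmat d \<theta>"

text \<open>All components of all random vectors, the errors included as t = 0, in one finite index
  set of pairs; \<open>ww i\<close> is then the coefficient vector of the i-th observation.\<close>

abbreviation "I \<equiv> Sigma {..s} (\<lambda>t. {..<nlev d t})"
abbreviation "xi \<equiv> (\<lambda>a. \<alpha> (fst a) (snd a))"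
abbreviation "vv \<equiv> (\<lambda>a. sig D (fst a))"
abbreviation "kk \<equiv> (\<lambda>a. kap D (fst a))"
abbreviation "ww \<equiv> (\<lambda>i a. Z (fst a) $$ (i, snd a))"

lemma sig_pos: "t \<le> s \<Longrightarrow> 0 < sig D t" using sig_pos' by (simp add: sig_def)

lemma prob_space_M: "prob_space M" using ranef by (simp add: random_effects_def)

text \<open>The fourth moment exists because the square has finite variance, and that variance is
  \<open>kap D t + 2 * (sig D t)\<^sup>2\<close>, whose positivity later bounds the information from
  below.\<close>

lemma D_moments:
  assumes t: "t \<le> s"
  shows "prob_space (D t)" "sets (D t) = sets borel" "(\<integral>x. x \<partial>D t) = 0"
    "(\<integral>x. x\<^sup>2 \<partial>D t) = sig D t" "integrable (D t) (\<lambda>x. x ^ 4)" "(\<integral>x. x ^ 4 \<partial>D t) = kap D t + 3 * (sig D t)\<^sup>2"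
    "kap D t + 2 * (sig D t)\<^sup>2 > 0"
proof -
  have c: "prob_space (D t)" "sets (D t) = sets borel" "integrable (D t) (\<lambda>x. x)" "integrable (D t) (\<lambda>x. x\<^sup>2)" "(\<integral>x. x \<partial>D t) = 0"
    using csi[OF t] by (auto simp: centred_square_integrable_def)
  interpret D: prob_space "D t" by (rule c(1))
  show "prob_space (D t)" "sets (D t) = sets borel" "(\<integral>x. x \<partial>D t) = 0" by (fact c)+
  show s2: "(\<integral>x. x\<^sup>2 \<partial>D t) = sig D t" using c(5) by (simp add: sig_def variance_of_def)
  have fv': "integrable (D t) (\<lambda>x. (x\<^sup>2 - sig D t)\<^sup>2)" using fv[OF t] s2 by (simp add: finite_variance_def)
  have "integrable (D t) (\<lambda>x. (x\<^sup>2 - sig D t)\<^sup>2 + 2 * sig D t * x\<^sup>2 - (sig D t)\<^sup>2)" using fv' c(4) by simp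
  moreover have e: "(x\<^sup>2 - sig D t)\<^sup>2 + 2 * sig D t * x\<^sup>2 - (sig D t)\<^sup>2 = x ^ 4" for x :: real
    by (simp add: power2_diff)
  ultimately show i4: "integrable (D t) (\<lambda>x. x ^ 4)" by simp
  show "(\<integral>x. x ^ 4 \<partial>D t) = kap D t + 3 * (sig D t)\<^sup>2" by (simp add: kap_def)
  have "variance_of (D t) (\<lambda>x. x\<^sup>2) = (\<integral>x. x ^ 4 - 2 * sig D t * x\<^sup>2 + (sig D t)\<^sup>2 \<partial>D t)"
    unfolding variance_of_def s2 by (intro Bochner_Integration.integral_cong refl) (simp add: power2_diff)
  also have "\<dots> = (\<integral>x. x ^ 4 \<partial>D t) - 2 * sig D t * (\<integral>x. x\<^sup>2 \<partial>D t) + (sig D t)\<^sup>2"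
    using i4 c(4) by (simp add: D.prob_space)
  also have "\<dots> = kap D t + 2 * (sig D t)\<^sup>2" unfolding s2 by (simp add: kap_def power2_eq_square)
  finally show "kap D t + 2 * (sig D t)\<^sup>2 > 0" using var_sq[OF t] by simp
qed

lemma alpha_distr: "t \<le> s \<Longrightarrow> l < nlev d t \<Longrightarrow> \<alpha> t l \<in> borel_measurable M \<and> distr M borel (\<alpha> t l) = D t"
proof -
  interpret prob_space M by (rule prob_space_M)
  assume "t \<le> s" "l < nlev d t"
  then show ?thesis using ranef nranef by (auto simp: random_effects_def indep_vars_def)
qed

lemma alpha_integral:
  assumes "t \<le> s" "l < nlev d t" and f: "f \<in> borel_measurable borel"
  shows "(\<integral>z. (f (\<alpha> t l z) :: real) \<partial>M) = (\<integral>x. f x \<partial>D t)"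
    "integrable M (\<lambda>z. f (\<alpha> t l z)) = integrable (D t) f" using alpha_distr[OF assms(1,2)] f
    integral_distr[of "\<alpha> t l" M borel f] integrable_distr_eq[of "\<alpha> t l" M borel f] by auto

lemma theta_index: "t \<le> s \<Longrightarrow> tau \<theta> t = sig D t"
  using sig_pos[of 0] by (auto simp: \<theta> true_theta_def tau_def gam_def sig_def)

lemma theta_pos: "t \<le> s \<Longrightarrow> \<theta> $ t > 0"
  using sig_pos[of 0] sig_pos[of t] by (auto simp: \<theta> true_theta_def sig_def)

lemma theta_carrier: "\<theta> \<in> carrier_vec (s + 1)" by (simp add: \<theta> true_theta_def)

lemma theta_param: "\<theta> \<in> param_space s" using theta_carrier theta_pos by (auto simp: param_space_def less_imp_le)

lemma Kmax_nonneg: "0 \<le> Kmax s D" unfolding Kmax_def by (intro sum_nonneg) simp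

lemma kap_le: "t \<le> s \<Longrightarrow> \<bar>kap D t\<bar> \<le> Kmax s D * (sig D t)\<^sup>2"
proof -
  assume t: "t \<le> s"
  have "\<bar>kap D t\<bar> / (sig D t)\<^sup>2 \<le> Kmax s D" unfolding Kmax_def
    by (rule member_le_sum[of t "{..s}" "\<lambda>t. \<bar>kap D t\<bar> / (sig D t)\<^sup>2"]) (use t in auto)
  then show ?thesis using sig_pos[OF t] by (simp add: field_simps)
qed

sublocale indep_effects M I xi vv kk
proof -
  interpret prob_space M by (rule prob_space_M)
  show "indep_effects M I xi vv kk"
  proof unfold_locales
    show "finite I" by auto
    show "indep_vars (\<lambda>_. borel) xi I"
      using ranef nranef N_pos by (intro indep_vars_two_level) (auto simp: random_effects_def nlev_0)
    fix a assume "a \<in> I"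
    then have t: "fst a \<le> s" "snd a < nlev d (fst a)" by auto
    show "integrable M (\<lambda>z. xi a z ^ 4)" "(\<integral>z. xi a z \<partial>M) = 0" "(\<integral>z. (xi a z)\<^sup>2 \<partial>M) = vv a"
      "(\<integral>z. xi a z ^ 4 \<partial>M) = kk a + 3 * (vv a)\<^sup>2"
      using alpha_integral[OF t, of "\<lambda>x. x"] alpha_integral[OF t, of "\<lambda>x. x\<^sup>2"] alpha_integral[OF t, of "\<lambda>x. x ^ 4"] D_moments[OF t(1)]
      by auto
  qed
qed

lemma V_cov': "i < N \<Longrightarrow> j < N \<Longrightarrow> Vt $$ (i, j) = cov (ww i) (ww j)"
proof -
  assume ij: "i < N" "j < N"
  have "cov (ww i) (ww j) = (\<Sum>(t, l)\<in>I. sig D t * Z t $$ (i, l) * Z t $$ (j, l))" unfolding cov_def by (intro sum.cong refl) auto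
  also have "\<dots> = (\<Sum>t\<le>s. \<Sum>l<nlev d t. sig D t * Z t $$ (i, l) * Z t $$ (j, l))" by (subst sum.Sigma) auto
  also have "\<dots> = (\<Sum>t\<le>s. tau \<theta> t * S t $$ (i, j))"
    by (intro sum.cong refl) (use ij in \<open>auto simp: theta_index S_index sum_distrib_left mult.assoc\<close>)
  finally show ?thesis using ij by (simp add: Vmat_index)
qed

sublocale mixed M I xi vv kk N p X "Vt" ww s S "sig D" "Kmax s D"
proof (intro mixed.intro gls_loc theta_param indep_effects_axioms)
  show "mixed_axioms I vv kk N Vt ww s S (sig D) (Kmax s D)"
  proof unfold_locales
    show "a \<in> I \<Longrightarrow> kk a \<le> Kmax s D * (vv a)\<^sup>2" for a using kap_le[of "fst a"] by auto
    show "t \<le> s \<Longrightarrow> a \<in> carrier_vec N \<Longrightarrow> sig D t * (a \<bullet> (S t *v a)) \<le> a \<bullet> (Vt *v a)" for t a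
      using Vmat_ge_S[OF theta_param] by (simp add: theta_index)
  qed (use V_cov' S S_psd sig_pos Kmax_nonneg in auto)
qed

lemma y_eq: assumes "z \<in> space M" shows "y z = X *v \<beta> + uvec z"
proof (rule eq_vecI)
  fix i assume "i < dim_vec (X *v \<beta> + uvec z)"
  then have i: "i < N" by (simp add: uvec_def)
  have "lin (ww i) z = (\<Sum>(t, l)\<in>I. Z t $$ (i, l) * \<alpha> t l z)" unfolding lin_def by (intro sum.cong refl) auto
  also have "\<dots> = (\<Sum>t\<le>s. \<Sum>l<nlev d t. Z t $$ (i, l) * \<alpha> t l z)" by (subst sum.Sigma) auto
  also have "\<dots> = (\<Sum>t\<le>nranef d. (Z t *v vec (nlev d t) (\<lambda>l. \<alpha> t l z)) $ i)" unfolding nranef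
  proof (intro sum.cong refl)
    fix t assume "t \<in> {..s}"
    then have "Z t \<in> carrier_mat N (nlev d t)" using Z by simp
    then show "(\<Sum>l<nlev d t. Z t $$ (i, l) * \<alpha> t l z) = (Z t *v vec (nlev d t) (\<lambda>l. \<alpha> t l z)) $ i"
      using i by (simp add: scalar_prod_lessThan)
  qed
  finally show "y z $ i = (X *v \<beta> + uvec z) $ i" using i X unfolding y[OF assms] response_def by (simp add: uvec_def)
qed (use assms y in \<open>simp add: response_def uvec_def\<close>)

lemma tau_diff:
  assumes \<theta>': "\<theta>' \<in> param_nbhd s \<theta> \<delta>" and \<delta>: "\<delta> \<le> 1" and t: "t \<le> s"
  shows "\<bar>tau \<theta>' t - tau \<theta> t\<bar> \<le> (\<theta> $ 0 + 1 + (\<Sum>t\<le>s. gam \<theta> t)) * \<delta>"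
    and "\<bar>\<theta>' $ 0 - \<theta> $ 0\<bar> \<le> \<delta>"
proof -
  have c: "\<theta>' \<in> carrier_vec (s + 1)" and n: "vec_norm2 (\<theta>' - \<theta>) \<le> \<delta>" using \<theta>' by (auto simp: param_nbhd_def param_space_def)
  have diff: "\<bar>\<theta>' $ i - \<theta> $ i\<bar> \<le> \<delta>" if "i \<le> s" for i
    using abs_index_le_vec_norm2[of i "\<theta>' - \<theta>"] that c theta_carrier n by simp
  show d0: "\<bar>\<theta>' $ 0 - \<theta> $ 0\<bar> \<le> \<delta>" by (rule diff) simp
  have \<delta>0: "0 \<le> \<delta>" using d0 by simp
  have g: "\<bar>gam \<theta>' t - gam \<theta> t\<bar> \<le> \<delta>" using diff[OF t] \<delta>0 by (simp add: gam_def)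
  have gnn: "0 \<le> gam \<theta> t" if "t \<le> s" for t using theta_pos[OF that] by (simp add: gam_def)
  have gs: "gam \<theta> t \<le> (\<Sum>t\<le>s. gam \<theta> t)" by (rule member_le_sum) (use t gnn in auto)
  \<comment> \<open>Product rule with the perturbed value in front of the first difference; \<delta>
    \<le> 1 bounds it by \<open>\<theta> $ 0 + 1\<close>.\<close>
  have "tau \<theta>' t - tau \<theta> t = \<theta>' $ 0 * (gam \<theta>' t - gam \<theta> t) + (\<theta>' $ 0 - \<theta> $ 0) * gam \<theta> t"
    by (simp add: tau_def algebra_simps)
  also have "\<bar>\<dots>\<bar> \<le> \<bar>\<theta>' $ 0\<bar> * \<bar>gam \<theta>' t - gam \<theta> t\<bar> + \<bar>\<theta>' $ 0 - \<theta> $ 0\<bar> * gam \<theta> t"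
    using gnn[OF t] by (intro order_trans[OF abs_triangle_ineq]) (simp add: abs_mult)
  also have "\<dots> \<le> (\<theta> $ 0 + 1) * \<delta> + \<delta> * (\<Sum>t\<le>s. gam \<theta> t)"
    by (intro add_mono mult_mono g d0 gs) (use d0 \<delta> \<delta>0 theta_pos[of 0] gnn t in auto)
  finally show "\<bar>tau \<theta>' t - tau \<theta> t\<bar> \<le> (\<theta> $ 0 + 1 + (\<Sum>t\<le>s. gam \<theta> t)) * \<delta>" by (simp add: algebra_simps)
qed

text \<open>The condition \<open>\<delta> \<le> \<theta> $ 0 / 2\<close> keeps the error variance
  above half its true value, which gives a common lower bound for the forms.\<close>

lemma near_Vmat:
  assumes \<theta>': "\<theta>' \<in> param_nbhd s \<theta> \<delta>" and \<delta>: "\<delta> \<le> 1" "\<delta> \<le> \<theta> $ 0 / 2"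
  shows "near ((\<theta> $ 0 + 1 + (\<Sum>t\<le>s. gam \<theta> t)) * \<delta>) (\<theta> $ 0 / 2) (Vmat d \<theta>')" unfolding near_def
proof (intro conjI Vmat ballI)
  have p: "\<theta>' \<in> param_space s" using \<theta>' by (simp add: param_nbhd_def)
  show "positive_definite (Vmat d \<theta>')" by (rule Vmat_pd[OF p])
  have t0: "\<theta> $ 0 / 2 \<le> \<theta>' $ 0" using tau_diff(2)[OF \<theta>' \<delta>(1), of 0] \<delta>(2) by linarith
  show "\<theta> $ 0 / 2 * (a \<bullet> a) \<le> a \<bullet> (Vmat d \<theta>' *v a)" if a: "a \<in> carrier_vec N" for a
    by (rule order_trans[OF mult_right_mono[OF t0 scalar_prod_self_nonneg] Vmat_ge[OF p a]])
  show "\<exists>\<delta>'. (\<forall>t\<le>s. \<bar>\<delta>' t\<bar> \<le> (\<theta> $ 0 + 1 + (\<Sum>t\<le>s. gam \<theta> t)) * \<delta>) \<and>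
      (\<forall>a\<in>carrier_vec N. \<forall>b\<in>carrier_vec N. a \<bullet> ((Vmat d \<theta>' - Vt) *v b) = (\<Sum>t\<le>s. \<delta>' t * (a \<bullet> (S t *v b))))"
  proof (intro exI[of _ "\<lambda>t. tau \<theta>' t - tau \<theta> t"] conjI allI impI ballI tau_diff(1)[OF \<theta>' \<delta>(1)])
    fix a b :: "real vec" assume ab: "a \<in> carrier_vec N" "b \<in> carrier_vec N"
    have "(Vmat d \<theta>' - Vt) *v b = Vmat d \<theta>' *v b - Vt *v b" by (rule minus_mult_distrib_mat_vec[OF Vmat Vmat ab(2)])
    then have "a \<bullet> ((Vmat d \<theta>' - Vt) *v b) = a \<bullet> (Vmat d \<theta>' *v b) - a \<bullet> (Vt *v b)"
      using ab mult_mat_vec_carrier[OF Vmat ab(2)] by (simp add: scalar_prod_minus_distrib[of _ N])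
    then show "a \<bullet> ((Vmat d \<theta>' - Vt) *v b) = (\<Sum>t\<le>s. (tau \<theta>' t - tau \<theta> t) * (a \<bullet> (S t *v b)))"
      by (simp add: Vmat_bilinear[OF ab] left_diff_distrib sum_subtractf)
  qed
qed

end

section \<open>Score and expected Hessian\<close>

lemma smult_mat_vec: "v \<in> carrier_vec (dim_col A) \<Longrightarrow> (k \<cdot>\<^sub>m A) *v v = k \<cdot>\<^sub>v (A *v (v :: real vec))"
  by (intro eq_vecI) (auto simp: row_smult)

context lmm_design_loc begin

text \<open>The first partial derivatives of V; \<open>Vdd\<close> holds the second ones. Index 0 is
  the scale, so \<open>Vd \<theta> 0\<close> is V divided by \<open>\<theta> $ 0\<close>.\<close>

definition Vd :: "real vec \<Rightarrow> nat \<Rightarrow> real mat" where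
  "Vd \<theta> k = (if k = 0 then mat N N (\<lambda>ij. \<Sum>t\<le>s. gam \<theta> t * S t $$ ij) else \<theta> $ 0 \<cdot>\<^sub>m S k)"

definition Vdd :: "nat \<Rightarrow> nat \<Rightarrow> real mat" where
  "Vdd j k = (if j = 0 \<and> k = 0 then 0\<^sub>m N N else if j = 0 then S k else if k = 0 then S j else 0\<^sub>m N N)"

lemma Vd: "k \<le> s \<Longrightarrow> Vd \<theta> k \<in> carrier_mat N N" using S by (simp add: Vd_def)
lemma Vdd: "j \<le> s \<Longrightarrow> k \<le> s \<Longrightarrow> Vdd j k \<in> carrier_mat N N" using S by (simp add: Vdd_def)

lemma gam_update:
  assumes "\<theta> \<in> carrier_vec (s + 1)" "j \<le> s" "t \<le> s"
  shows "gam (\<theta> |\<^sub>v j \<mapsto> x) t = (if t = j \<and> t \<noteq> 0 then x else gam \<theta> t)"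
  using assms by (auto simp: gam_def)

text \<open>V is affine in each coordinate separately, so this is an identity without
  remainder.\<close>

lemma Vmat_update:
  assumes \<theta>: "\<theta> \<in> carrier_vec (s + 1)" and j: "j \<le> s"
  shows "Vmat d (\<theta> |\<^sub>v j \<mapsto> x) = Vmat d \<theta> + (x - \<theta> $ j) \<cdot>\<^sub>m Vd \<theta> j"
proof (rule eq_matI)
  fix a b assume "a < dim_row (Vmat d \<theta> + (x - \<theta> $ j) \<cdot>\<^sub>m Vd \<theta> j)" "b < dim_col (Vmat d \<theta> + (x - \<theta> $ j) \<cdot>\<^sub>m Vd \<theta> j)"
  then have ab: "a < N" "b < N" using Vd[OF j, of \<theta>] by auto
  have rhs: "(Vmat d \<theta> + (x - \<theta> $ j) \<cdot>\<^sub>m Vd \<theta> j) $$ (a, b) = Vmat d \<theta> $$ (a, b) + (x - \<theta> $ j) * Vd \<theta> j $$ (a, b)"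
    using ab Vd[OF j, of \<theta>] by simp
  show "Vmat d (\<theta> |\<^sub>v j \<mapsto> x) $$ (a, b) = (Vmat d \<theta> + (x - \<theta> $ j) \<cdot>\<^sub>m Vd \<theta> j) $$ (a, b)"
  proof (cases "j = 0")
    case True
    have "Vmat d (\<theta> |\<^sub>v j \<mapsto> x) $$ (a, b) = (\<Sum>t\<le>s. tau \<theta> t * S t $$ (a, b) + (x - \<theta> $ 0) * (gam \<theta> t * S t $$ (a, b)))"
      unfolding Vmat_index[OF ab]
    proof (intro sum.cong refl)
      fix t assume "t \<in> {..s}"
      then have "tau (\<theta> |\<^sub>v j \<mapsto> x) t = tau \<theta> t + (x - \<theta> $ 0) * gam \<theta> t"
        using gam_update[OF \<theta> j, of t x] True \<theta> by (auto simp: tau_def algebra_simps)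
      then show "tau (\<theta> |\<^sub>v j \<mapsto> x) t * S t $$ (a, b) = tau \<theta> t * S t $$ (a, b) + (x - \<theta> $ 0) * (gam \<theta> t * S t $$ (a, b))"
        by (simp add: distrib_right mult.assoc)
    qed
    then show ?thesis unfolding rhs using True ab by (simp add: Vmat_index[OF ab] Vd_def sum.distrib sum_distrib_left)
  next
    case False
    have "Vmat d (\<theta> |\<^sub>v j \<mapsto> x) $$ (a, b) = (\<Sum>t\<le>s. tau \<theta> t * S t $$ (a, b) + (if t = j then (x - \<theta> $ j) * (\<theta> $ 0 * S j $$ (a, b)) else 0))"
      unfolding Vmat_index[OF ab]
    proof (intro sum.cong refl)
      fix t assume t: "t \<in> {..s}"
      have "tau (\<theta> |\<^sub>v j \<mapsto> x) t = tau \<theta> t + (if t = j then (x - \<theta> $ j) * \<theta> $ 0 else 0)"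
        using gam_update[OF \<theta> j, of t x] t False \<theta> by (auto simp: tau_def gam_def algebra_simps)
      then show "tau (\<theta> |\<^sub>v j \<mapsto> x) t * S t $$ (a, b) = tau \<theta> t * S t $$ (a, b) + (if t = j then (x - \<theta> $ j) * (\<theta> $ 0 * S j $$ (a, b)) else 0)"
        by (simp add: distrib_right mult.assoc)
    qed
    also have "\<dots> = Vmat d \<theta> $$ (a, b) + (x - \<theta> $ j) * (\<theta> $ 0 * S j $$ (a, b))"
      using j by (simp add: Vmat_index[OF ab] sum.distrib)
    finally show ?thesis unfolding rhs using False ab S(1)[OF j] by (simp add: Vd_def)
  qed
qed (use Vd[OF j, of \<theta>] Vmat[of "\<theta> |\<^sub>v j \<mapsto> x"] in auto)

lemma Vd_update:
  assumes \<theta>: "\<theta> \<in> carrier_vec (s + 1)" and j: "j \<le> s" and k: "k \<le> s"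
  shows "Vd (\<theta> |\<^sub>v j \<mapsto> x) k = Vd \<theta> k + (x - \<theta> $ j) \<cdot>\<^sub>m Vdd j k"
proof (cases "k = 0")
  case False
  then show ?thesis using \<theta> S(1)[OF k] by (intro eq_matI) (auto simp: Vd_def Vdd_def algebra_simps)
next
  case True
  show ?thesis
  proof (rule eq_matI)
    fix a b assume "a < dim_row (Vd \<theta> k + (x - \<theta> $ j) \<cdot>\<^sub>m Vdd j k)" "b < dim_col (Vd \<theta> k + (x - \<theta> $ j) \<cdot>\<^sub>m Vdd j k)"
    then have ab: "a < N" "b < N" using Vdd[OF j k] by auto
    have "(\<Sum>t\<le>s. gam (\<theta> |\<^sub>v j \<mapsto> x) t * S t $$ (a, b)) =
        (\<Sum>t\<le>s. gam \<theta> t * S t $$ (a, b) + (if t = j then if j = 0 then 0 else (x - \<theta> $ j) * S j $$ (a, b) else 0))"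
    proof (intro sum.cong refl)
      fix t assume t: "t \<in> {..s}"
      have "gam (\<theta> |\<^sub>v j \<mapsto> x) t = gam \<theta> t + (if t = j then if j = 0 then 0 else x - \<theta> $ j else 0)"
        using gam_update[OF \<theta> j, of t x] t by (auto simp: gam_def)
      then show "gam (\<theta> |\<^sub>v j \<mapsto> x) t * S t $$ (a, b) = gam \<theta> t * S t $$ (a, b) + (if t = j then if j = 0 then 0 else (x - \<theta> $ j) * S j $$ (a, b) else 0)"
        by (simp add: distrib_right)
    qed
    also have "\<dots> = (\<Sum>t\<le>s. gam \<theta> t * S t $$ (a, b)) + (if j = 0 then 0 else (x - \<theta> $ j) * S j $$ (a, b))"
      using j by (simp add: sum.distrib)
    finally show "Vd (\<theta> |\<^sub>v j \<mapsto> x) k $$ (a, b) = (Vd \<theta> k + (x - \<theta> $ j) \<cdot>\<^sub>m Vdd j k) $$ (a, b)"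
      using True ab S(1)[OF j] by (auto simp: Vd_def Vdd_def)
  qed (use Vd[OF k] Vdd[OF j k] in auto)
qed

text \<open>The interior of the parameter space, where two-sided derivatives make sense; the true
  parameter lies there because all variances are positive.\<close>

definition pos_param :: "real vec \<Rightarrow> bool" where
  "pos_param \<theta> \<longleftrightarrow> \<theta> \<in> carrier_vec (s + 1) \<and> (\<forall>t\<le>s. \<theta> $ t > 0)"

lemma pos_param: "pos_param \<theta> \<Longrightarrow> \<theta> \<in> param_space s" "pos_param \<theta> \<Longrightarrow> \<theta> \<in> carrier_vec (s + 1)"
  by (auto simp: pos_param_def param_space_def less_imp_le)

lemma pos_param_update:
  assumes \<theta>: "pos_param \<theta>" and j: "j \<le> s"
  shows "\<forall>\<^sub>F x in nhds (\<theta> $ j). pos_param (\<theta> |\<^sub>v j \<mapsto> x) \<and> \<theta> $ 0 / 2 \<le> (\<theta> |\<^sub>v j \<mapsto> x) $ 0"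
proof -
  have "\<theta> $ j > 0" "\<theta> $ 0 > 0" using \<theta> j by (auto simp: pos_param_def)
  then have "\<forall>\<^sub>F x in nhds (\<theta> $ j). \<theta> $ j / 2 < x"
    using eventually_nhds_in_open[of "{\<theta> $ j / 2<..}" "\<theta> $ j"] by simp
  then show ?thesis
  proof eventually_elim
    case (elim x)
    have "0 < x" using elim \<open>\<theta> $ j > 0\<close> by linarith
    moreover have "\<theta> $ 0 / 2 \<le> (\<theta> |\<^sub>v j \<mapsto> x) $ 0"
      using elim \<theta> \<open>\<theta> $ 0 > 0\<close> by (cases "j = 0") (auto simp: pos_param_def)
    moreover have "(\<theta> |\<^sub>v j \<mapsto> x) $ t > 0" if t: "t \<le> s" for t
    proof -
      have "dim_vec \<theta> = s + 1" "\<theta> $ t > 0" using \<theta> t by (auto simp: pos_param_def)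
      then show ?thesis using t \<open>0 < x\<close> by (simp add: update_vec_def)
    qed
    moreover have "(\<theta> |\<^sub>v j \<mapsto> x) \<in> carrier_vec (s + 1)" using \<theta> by (intro carrier_vecI) (simp add: pos_param_def)
    ultimately show ?case by (simp add: pos_param_def)
  qed
qed

lemma Pmat_DERIV:
  assumes \<theta>: "pos_param \<theta>" and j: "j \<le> s"
  shows "mat_DERIV N N (\<lambda>x. Pmat d (\<theta> |\<^sub>v j \<mapsto> x)) (- (Pmat d \<theta> * Vd \<theta> j * Pmat d \<theta>)) (\<theta> $ j)"
proof -
  have "mat_DERIV N N (\<lambda>x. gls_P X (Vmat d \<theta> + (x - \<theta> $ j) \<cdot>\<^sub>m Vd \<theta> j)) (- (gls_P X (Vmat d \<theta>) * Vd \<theta> j * gls_P X (Vmat d \<theta>))) (\<theta> $ j)"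
  proof (rule gls_P_DERIV[OF X X_inj Vmat Vmat_pd[OF pos_param(1)[OF \<theta>]] Vd[OF j], where l = "\<theta> $ 0 / 2"])
    show "\<forall>\<^sub>F x in nhds (\<theta> $ j). positive_definite (Vmat d \<theta> + (x - \<theta> $ j) \<cdot>\<^sub>m Vd \<theta> j) \<and>
      (\<forall>w\<in>carrier_vec N. \<theta> $ 0 / 2 * (w \<bullet> w) \<le> w \<bullet> ((Vmat d \<theta> + (x - \<theta> $ j) \<cdot>\<^sub>m Vd \<theta> j) *v w))"
      using pos_param_update[OF \<theta> j]
    proof eventually_elim
      case (elim x)
      have "\<theta> $ 0 / 2 * (w \<bullet> w) \<le> w \<bullet> (Vmat d (\<theta> |\<^sub>v j \<mapsto> x) *v w)" if "w \<in> carrier_vec N" for w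
        using elim mult_right_mono[OF _ scalar_prod_self_nonneg[of w], of "\<theta> $ 0 / 2" "(\<theta> |\<^sub>v j \<mapsto> x) $ 0"]
          Vmat_ge[OF pos_param(1) that, of "\<theta> |\<^sub>v j \<mapsto> x"] by linarith
      then show ?case unfolding Vmat_update[OF pos_param(2)[OF \<theta>] j, symmetric] using Vmat_pd[OF pos_param(1)] elim by blast
    qed
    show "0 < \<theta> $ 0 / 2" using \<theta> by (simp add: pos_param_def)
  qed
  then show ?thesis unfolding Pmat_eq Vmat_update[OF pos_param(2)[OF \<theta>] j] .
qed

text \<open>The log determinant contributes the trace of
  \<open>(T' V T)\<^sup>-\<^sup>1 T' V\<^sub>j T\<close>. Moving T around the trace and using
  \<open>P_contrast\<close> makes it the trace of \<open>P V\<^sub>j\<close>, from which T has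
  disappeared.\<close>

lemma score:
  assumes \<theta>: "pos_param \<theta>" and j: "j \<le> s" and T: "reml_contrast d T" and y: "y \<in> carrier_vec N"
  shows "partial_deriv j (reml_loglik d c T y) \<theta> =
    - 1/2 * (mat_trace (Pmat d \<theta> * Vd \<theta> j) - y \<bullet> (Pmat d \<theta> * Vd \<theta> j * Pmat d \<theta> *v y))"
proof -
  let ?V = "Vmat d \<theta>" and ?P = "Pmat d \<theta>" and ?W = "Vd \<theta> j"
  interpret gls N p X ?V by (rule gls_loc[OF pos_param(1)[OF \<theta>]])
  have Tc: "T \<in> carrier_mat N (N - p)" and Ti: "injective_mat T" and TX: "T\<^sup>T * X = 0\<^sub>m (N - p) p"
    using T full_rank_injective[of T N "N - p"] by (auto simp: reml_contrast_def)
  note P = Pmat(1)[OF pos_param(1)[OF \<theta>]] and W = Vd[OF j, of \<theta>]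
  let ?K = "T\<^sup>T * ?V * T"
  have Kpd: "positive_definite ?K" by (rule positive_definite_congruence[OF Tc Vmat Vmat_pd[OF pos_param(1)[OF \<theta>]] Ti])
  have K: "?K \<in> carrier_mat (N - p) (N - p)" using Tc Vmat[of \<theta>] by simp
  note Ki = positive_definite_invertible[OF K Kpd]
  note I = mat_inv_carrier[OF K Ki]
  let ?B = "T\<^sup>T * ?W * T"
  have B: "?B \<in> carrier_mat (N - p) (N - p)" using Tc W by simp
  have TVT: "T\<^sup>T * (?V + h \<cdot>\<^sub>m ?W) * T = ?K + h \<cdot>\<^sub>m ?B" for h
  proof -
    have "T\<^sup>T * (?V + h \<cdot>\<^sub>m ?W) = T\<^sup>T * ?V + T\<^sup>T * (h \<cdot>\<^sub>m ?W)"
      by (rule mult_add_distrib_mat) (use Tc Vmat W in auto)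
    also have "T\<^sup>T * (h \<cdot>\<^sub>m ?W) = h \<cdot>\<^sub>m (T\<^sup>T * ?W)" using Tc W by (simp add: mult_smult_mat)
    finally have "T\<^sup>T * (?V + h \<cdot>\<^sub>m ?W) * T = (T\<^sup>T * ?V + h \<cdot>\<^sub>m (T\<^sup>T * ?W)) * T" by simp
    also have "\<dots> = ?K + h \<cdot>\<^sub>m (T\<^sup>T * ?W) * T" by (rule add_mult_distrib_mat) (use Tc Vmat W in auto)
    also have "h \<cdot>\<^sub>m (T\<^sup>T * ?W) * T = h \<cdot>\<^sub>m ?B" using Tc W by (simp add: smult_mult_mat)
    finally show ?thesis .
  qed
  have Peq: "?P = T * (mat_inv ?K * T\<^sup>T)" using P_contrast[OF Tc p_le_N Ti TX] by (simp add: P_def Pmat_eq)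
  have tr: "mat_trace (mat_inv ?K * ?B) = mat_trace (?P * ?W)"
  proof -
    have "mat_trace (mat_inv ?K * ?B) = mat_trace ((mat_inv ?K * T\<^sup>T * ?W) * T)" using I Tc W by (simp add: mat_assoc)
    also have "\<dots> = mat_trace (T * (mat_inv ?K * T\<^sup>T * ?W))" by (rule mat_trace_mult_comm) (use I Tc W in auto)
    also have "T * (mat_inv ?K * T\<^sup>T * ?W) = ?P * ?W" unfolding Peq using I Tc W by (simp add: mat_assoc)
    finally show ?thesis .
  qed
  have D1: "((\<lambda>x. ln (det (T\<^sup>T * Vmat d (\<theta> |\<^sub>v j \<mapsto> x) * T))) has_field_derivative mat_trace (?P * ?W)) (at (\<theta> $ j))"
    unfolding Vmat_update[OF pos_param(2)[OF \<theta>] j] TVT tr[symmetric]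
    by (rule DERIV_ln_det[OF K Ki positive_definite_det_pos[OF K Kpd] B])
  have D2: "((\<lambda>x. y \<bullet> (Pmat d (\<theta> |\<^sub>v j \<mapsto> x) *v y)) has_field_derivative y \<bullet> (- (?P * ?W * ?P) *v y)) (at (\<theta> $ j))"
    by (rule mat_DERIV_quad[OF Pmat_DERIV[OF \<theta> j] y])
  have neg: "y \<bullet> (- (?P * ?W * ?P) *v y) = - (y \<bullet> (?P * ?W * ?P *v y))"
  proof -
    have c: "?P * ?W * ?P \<in> carrier_mat N N" using P W by simp
    have "- (?P * ?W * ?P) *v y = - (?P * ?W * ?P *v y)" by (rule uminus_mult_mat_vec) (use c y in auto)
    then show ?thesis using c y P by (simp del: assoc_mult_mat)
  qed
  have "((\<lambda>x. reml_loglik d c T y (\<theta> |\<^sub>v j \<mapsto> x)) has_field_derivative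
     - (1/2 * (mat_trace (?P * ?W) + y \<bullet> (- (?P * ?W * ?P) *v y)))) (at (\<theta> $ j))"
    unfolding reml_loglik_def by (rule derivative_eq_intros D1 D2 refl | simp)+
  then show ?thesis unfolding partial_deriv_def neg by (simp add: DERIV_imp_deriv)
qed

text \<open>The score formula holds in a neighbourhood along coordinate j, so it can be
  differentiated once more, with derivative \<open>- P V\<^sub>j P\<close> for P.\<close>

lemma hessian:
  assumes \<theta>: "pos_param \<theta>" and j: "j \<le> s" and k: "k \<le> s" and T: "reml_contrast d T" and y: "y \<in> carrier_vec N"
  defines "P \<equiv> Pmat d \<theta>" and "Vj \<equiv> Vd \<theta> j" and "Vk \<equiv> Vd \<theta> k"
  shows "partial_deriv j (partial_deriv k (reml_loglik d c T y)) \<theta> =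
    - 1/2 * (mat_trace (P * (Vdd j k - Vj * P * Vk)) - (P *v y) \<bullet> ((Vdd j k - Vj * P * Vk - Vk * P * Vj) *v (P *v y)))"
proof -
  have P: "P \<in> carrier_mat N N" unfolding P_def by (rule Pmat(1)[OF pos_param(1)[OF \<theta>]])
  have Ps: "P\<^sup>T = P" unfolding P_def by (rule Pmat(2)[OF pos_param(1)[OF \<theta>]])
  have Vj: "Vj \<in> carrier_mat N N" and Vk: "Vk \<in> carrier_mat N N" and W: "Vdd j k \<in> carrier_mat N N"
    using Vd Vdd j k by (auto simp: Vj_def Vk_def)
  let ?P = "\<lambda>x. Pmat d (\<theta> |\<^sub>v j \<mapsto> x)" and ?V = "\<lambda>x. Vd (\<theta> |\<^sub>v j \<mapsto> x) k"
  let ?P' = "- (P * Vj * P)"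
  have P': "?P' \<in> carrier_mat N N" using P Vj by simp
  have upd: "\<theta> |\<^sub>v j \<mapsto> \<theta> $ j = \<theta>" using pos_param(2)[OF \<theta>] by (intro eq_vecI) (auto simp: update_vec_def)
  have DP: "mat_DERIV N N ?P ?P' (\<theta> $ j)" using Pmat_DERIV[OF \<theta> j] by (simp add: P_def Vj_def)
  have DV: "mat_DERIV N N ?V (Vdd j k) (\<theta> $ j)"
    unfolding Vd_update[OF pos_param(2)[OF \<theta>] j k] by (rule mat_DERIV_affine) (use Vk W in \<open>auto simp: Vk_def\<close>)
  have DPV: "mat_DERIV N N (\<lambda>x. ?P x * ?V x) (?P' * Vk + P * Vdd j k) (\<theta> $ j)"
    using mat_DERIV_mult[OF DP DV] unfolding upd by (simp add: P_def Vk_def)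
  have DPVP: "mat_DERIV N N (\<lambda>x. ?P x * ?V x * ?P x) ((?P' * Vk + P * Vdd j k) * P + (P * Vk) * ?P') (\<theta> $ j)"
    using mat_DERIV_mult[OF DPV DP] unfolding upd by (simp add: P_def Vk_def)
  have "((\<lambda>x. - 1/2 * (mat_trace (?P x * ?V x) - y \<bullet> (?P x * ?V x * ?P x *v y))) has_field_derivative
      - 1/2 * (mat_trace (?P' * Vk + P * Vdd j k) - y \<bullet> (((?P' * Vk + P * Vdd j k) * P + (P * Vk) * ?P') *v y))) (at (\<theta> $ j))"
    by (rule DERIV_cmult DERIV_diff mat_DERIV_trace[OF DPV] mat_DERIV_quad[OF DPVP y])+
  moreover have "\<forall>\<^sub>F x in nhds (\<theta> $ j). partial_deriv k (reml_loglik d c T y) (\<theta> |\<^sub>v j \<mapsto> x) =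
      - 1/2 * (mat_trace (?P x * ?V x) - y \<bullet> (?P x * ?V x * ?P x *v y))"
    using pos_param_update[OF \<theta> j] by eventually_elim (rule score[OF _ k T y], blast)
  ultimately have "((\<lambda>x. partial_deriv k (reml_loglik d c T y) (\<theta> |\<^sub>v j \<mapsto> x)) has_field_derivative
      - 1/2 * (mat_trace (?P' * Vk + P * Vdd j k) - y \<bullet> (((?P' * Vk + P * Vdd j k) * P + (P * Vk) * ?P') *v y))) (at (\<theta> $ j))"
    by (subst DERIV_cong_ev[OF refl _ refl])
  then have main: "partial_deriv j (partial_deriv k (reml_loglik d c T y)) \<theta> =
     - 1/2 * (mat_trace (?P' * Vk + P * Vdd j k) - y \<bullet> (((?P' * Vk + P * Vdd j k) * P + (P * Vk) * ?P') *v y))"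
    unfolding partial_deriv_def[of j] by (rule DERIV_imp_deriv)
  let ?VPV = "Vj * P * Vk" and ?VPV' = "Vk * P * Vj"
  have c: "?VPV \<in> carrier_mat N N" "?VPV' \<in> carrier_mat N N" using P Vj Vk by auto
  let ?A = "Vdd j k - ?VPV"
  have A: "?A \<in> carrier_mat N N" by (rule minus_carrier_mat[OF c(1)])
  have e1: "?P' * Vk + P * Vdd j k = P * ?A"
  proof -
    have "P * ?A = P * Vdd j k - P * ?VPV" by (rule mult_minus_distrib_mat[OF P W c(1)])
    moreover have "?P' * Vk = - (P * ?VPV)" using P Vj Vk by (simp add: mat_assoc)
    ultimately show ?thesis using P W c by (intro eq_matI) auto
  qed
  let ?AA = "Vdd j k - ?VPV - ?VPV'"
  have AA: "?AA \<in> carrier_mat N N" by (rule minus_carrier_mat[OF c(2)])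
  have e2: "(?P' * Vk + P * Vdd j k) * P + (P * Vk) * ?P' = P * (?AA * P)"
  proof -
    have "?AA * P = ?A * P - ?VPV' * P" by (rule minus_mult_distrib_mat[OF A c(2) P])
    moreover have "P * (?A * P - ?VPV' * P) = P * (?A * P) - P * (?VPV' * P)"
      by (rule mult_minus_distrib_mat[OF P mult_carrier_mat[OF A P] mult_carrier_mat[OF c(2) P]])
    ultimately have "P * (?AA * P) = P * (?A * P) - P * (?VPV' * P)" by simp
    moreover have "(P * Vk) * ?P' = - (P * (?VPV' * P))" using P Vj Vk by (simp add: mat_assoc)
    moreover have "(P * ?A) * P = P * (?A * P)" using P A by simp
    ultimately show ?thesis unfolding e1 using P A c by (intro eq_matI) auto
  qed
  have Py: "P *v y \<in> carrier_vec N" using P y by simp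
  have "P * (?AA * P) *v y = P *v (?AA *v (P *v y))"
    using P AA y by (simp add: assoc_mult_mat_vec[of P N N "?AA * P" N] assoc_mult_mat_vec[of ?AA N N P N])
  then have "y \<bullet> (P * (?AA * P) *v y) = (P *v y) \<bullet> (?AA *v (P *v y))"
    using sym_mat_scalar_prod[OF P Ps y, of "?AA *v (P *v y)"] AA Py by simp
  then show ?thesis using main unfolding e2 unfolding e1 by simp
qed

text \<open>One formula for both cases of the definition: for j = 0 the middle factor is V divided
  by \<open>\<theta> $ 0\<close>, and \<open>P V P = P\<close> absorbs it.\<close>

lemma Bmat_eq:
  assumes \<theta>: "pos_param \<theta>" and j: "j \<le> s"
  shows "Bmat d \<theta> j = (1/2) \<cdot>\<^sub>m (Pmat d \<theta> * Vd \<theta> j * Pmat d \<theta>)"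
proof (cases "j = 0")
  case True
  note P = Pmat[OF pos_param(1)[OF \<theta>]]
  have p: "\<theta> $ 0 > 0" using \<theta> by (simp add: pos_param_def)
  have "Vmat d \<theta> = \<theta> $ 0 \<cdot>\<^sub>m Vd \<theta> 0"
    by (rule eq_matI) (use Vmat[of \<theta>] in \<open>auto simp: Vmat_index Vd_def tau_def sum_distrib_left mult.assoc\<close>)
  then have "Vd \<theta> 0 = (1 / \<theta> $ 0) \<cdot>\<^sub>m Vmat d \<theta>" using p Vd[of 0 \<theta>] by (intro eq_matI) auto
  then have "Pmat d \<theta> * Vd \<theta> 0 * Pmat d \<theta> = (1 / \<theta> $ 0) \<cdot>\<^sub>m (Pmat d \<theta> * (Vmat d \<theta> * Pmat d \<theta>))"
    using P(1) Vmat[of \<theta>] by (simp add: mult_smult_mat smult_mult_mat mat_assoc)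
  then show ?thesis unfolding P(3) using True p P(1) by (intro eq_matI) (auto simp: Bmat_def)
next
  case False
  then show ?thesis using Pmat(1)[OF pos_param(1)[OF \<theta>]] S(1)[OF j] Z[OF j]
    by (intro eq_matI) (auto simp: Bmat_def Vd_def Smat_def mult_smult_mat smult_mult_mat mat_assoc)
qed

lemma Bmat:
  assumes \<theta>: "\<theta> \<in> param_space s" and j: "j \<le> s"
  shows "Bmat d \<theta> j \<in> carrier_mat N N" "transpose_mat (Bmat d \<theta> j) = Bmat d \<theta> j" "Bmat d \<theta> j * X = 0\<^sub>m N p"
proof -
  note P = Pmat[OF \<theta>] and S' = S[OF j]
  have eq: "Bmat d \<theta> j = (if j = 0 then (1 / (2 * \<theta> $ 0)) \<cdot>\<^sub>m Pmat d \<theta> else (\<theta> $ 0 / 2) \<cdot>\<^sub>m (Pmat d \<theta> * (S j * Pmat d \<theta>)))"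
    using P(1) Z[OF j] by (simp add: Bmat_def Smat_def mat_assoc)
  show "Bmat d \<theta> j \<in> carrier_mat N N" unfolding eq using P(1) S'(1) by simp
  have smt: "transpose_mat (k \<cdot>\<^sub>m A) = k \<cdot>\<^sub>m A\<^sup>T" for k and A :: "real mat" by (intro eq_matI) auto
  have "transpose_mat (Pmat d \<theta> * (S j * Pmat d \<theta>)) = Pmat d \<theta> * (S j * Pmat d \<theta>)"
    using transpose_mult[of "Pmat d \<theta>" N N "S j * Pmat d \<theta>" N] transpose_mult[OF S'(1) P(1)] P S' by simp
  then show "transpose_mat (Bmat d \<theta> j) = Bmat d \<theta> j" unfolding eq using P(2) by (simp add: smt)
  have "Pmat d \<theta> * (S j * Pmat d \<theta>) * X = Pmat d \<theta> * (S j * (Pmat d \<theta> * X))"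
    using P(1) S'(1) X by (simp add: mat_assoc)
  also have "\<dots> = 0\<^sub>m N p" unfolding P(4) using P(1) S'(1) by simp
  finally show "Bmat d \<theta> j * X = 0\<^sub>m N p" unfolding eq using P(1,4) S'(1) X by (simp add: smult_mult_mat)
qed

lemma Gmat_eq:
  assumes \<theta>: "pos_param \<theta>" and j: "j \<le> s" and k: "k \<le> s"
  shows "Gmat d \<theta> $$ (j, k) = 1/2 * mat_trace (Pmat d \<theta> * (Vd \<theta> j * Pmat d \<theta> * Vd \<theta> k))"
proof -
  let ?P = "Pmat d \<theta>" and ?V = "Vmat d \<theta>" and ?Vj = "Vd \<theta> j" and ?Vk = "Vd \<theta> k"
  note P = Pmat[OF pos_param(1)[OF \<theta>]] and Vj = Vd[OF j, of \<theta>] and Vk = Vd[OF k, of \<theta>]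
  have V: "?V \<in> carrier_mat N N" by (rule Vmat)
  have "Bmat d \<theta> j * ?V * Bmat d \<theta> k * ?V = (1/4) \<cdot>\<^sub>m (?P * (?Vj * ((?P * (?V * ?P)) * (?Vk * (?P * ?V)))))"
    unfolding Bmat_eq[OF \<theta> j] Bmat_eq[OF \<theta> k] using P(1) Vj Vk V
    by (simp add: mult_smult_mat smult_mult_mat mat_assoc) (intro eq_matI; simp)
  also have "\<dots> = (1/4) \<cdot>\<^sub>m ((?P * (?Vj * (?P * ?Vk))) * (?P * ?V))"
    unfolding P(3) using P(1) Vj Vk V by (simp add: mat_assoc)
  finally have BVBV: "Bmat d \<theta> j * ?V * Bmat d \<theta> k * ?V = (1/4) \<cdot>\<^sub>m ((?P * (?Vj * (?P * ?Vk))) * (?P * ?V))" .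
  have "mat_trace (Bmat d \<theta> j * ?V * Bmat d \<theta> k * ?V) = 1/4 * mat_trace ((?P * (?Vj * (?P * ?Vk))) * (?P * ?V))"
  proof -
    have "(?P * (?Vj * (?P * ?Vk))) * (?P * ?V) \<in> carrier_mat N N" using P(1) Vj Vk V by (intro mult_carrier_mat)
    from mat_trace_smult[OF this, of "1/4"] show ?thesis unfolding BVBV .
  qed
  also have "mat_trace ((?P * (?Vj * (?P * ?Vk))) * (?P * ?V)) = mat_trace ((?P * ?V) * (?P * (?Vj * (?P * ?Vk))))"
    by (rule mat_trace_mult_comm[of _ N N]) (use P(1) Vj Vk V in auto)
  also have "(?P * ?V) * (?P * (?Vj * (?P * ?Vk))) = (?P * (?V * ?P)) * (?Vj * (?P * ?Vk))" using P(1) Vj Vk V by (simp add: mat_assoc)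
  also have "\<dots> = ?P * (?Vj * ?P * ?Vk)" unfolding P(3) using P(1) Vj Vk by (simp add: mat_assoc)
  finally show ?thesis using j k by (simp add: Gmat_def nranef)
qed

end

context lmm begin

lemma theta_pos_param: "pos_param \<theta>" using theta_carrier theta_pos by (simp add: pos_param_def)

lemma uvec_quad_integral:
  assumes A: "A \<in> carrier_mat N N"
  shows "integrable M (\<lambda>z. uvec z \<bullet> (A *v uvec z))"
    "(\<integral>z. uvec z \<bullet> (A *v uvec z) \<partial>M) = mat_trace (A * Vt)"
proof -
  have e: "uvec z \<bullet> (A *v uvec z) = (\<Sum>i<N. \<Sum>j<N. A $$ (i, j) * (lin (ww i) z * lin (ww j) z))" for z
    unfolding quad_form_sum[OF A uvec(1) uvec(1)] by (intro sum.cong refl) simp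
  show "integrable M (\<lambda>z. uvec z \<bullet> (A *v uvec z))"
    unfolding e by (intro Bochner_Integration.integrable_sum integrable_mult_right lin2_moment)
  have "(\<integral>z. uvec z \<bullet> (A *v uvec z) \<partial>M) = (\<Sum>i<N. \<Sum>j<N. A $$ (i, j) * cov (ww i) (ww j))"
    unfolding e by (simp add: lin2_moment)
  also have "\<dots> = (\<Sum>i<N. \<Sum>j<N. A $$ (i, j) * Vt $$ (j, i))" by (intro sum.cong refl) (simp add: V_cov' cov_def mult_ac)
  also have "\<dots> = mat_trace (A * Vt)" using A Vmat[of \<theta>] by (simp add: mat_trace_def scalar_prod_lessThan)
  finally show "(\<integral>z. uvec z \<bullet> (A *v uvec z) \<partial>M) = mat_trace (A * Vt)" .
qed

lemma P_y: "z \<in> space M \<Longrightarrow> Pmat d \<theta> *v y z = Pmat d \<theta> *v uvec z"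
proof -
  assume z: "z \<in> space M"
  note P = Pmat[OF theta_param]
  have Xb: "X *v \<beta> \<in> carrier_vec N" using X \<beta> by simp
  have "Pmat d \<theta> *v y z = Pmat d \<theta> *v (X *v \<beta>) + Pmat d \<theta> *v uvec z"
    unfolding y_eq[OF z] by (rule mult_add_distrib_mat_vec[OF P(1) Xb uvec(1)])
  also have "Pmat d \<theta> *v (X *v \<beta>) = 0\<^sub>m N p *v \<beta>" unfolding P(4)[symmetric] using P(1) X \<beta> by simp
  also have "\<dots> = 0\<^sub>v N" by (rule zero_mat_mult_vec[OF \<beta>])
  finally show ?thesis using P(1) by simp
qed

lemma y_carrier: "z \<in> space M \<Longrightarrow> y z \<in> carrier_vec N" unfolding y_eq using X \<beta> by simp

text \<open>Only second moments of u enter, so the distributions of the effects matter only through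
  their variances. By \<open>P V P = P\<close> the expected quadratic form becomes a trace, in which
  the second derivative of V cancels against the log determinant and one of two equal traces of
  \<open>P V\<^sub>j P V\<^sub>k\<close> remains.\<close>

lemma expected_hessian_eq:
  assumes T: "reml_contrast d T"
  shows "expected_hessian M s (\<lambda>z. reml_loglik d c T (y z)) \<theta> = - Gmat d \<theta>"
proof (rule eq_matI)
  fix j k assume "j < dim_row (- Gmat d \<theta>)" "k < dim_col (- Gmat d \<theta>)"
  then have j: "j \<le> s" and k: "k \<le> s" by (auto simp: Gmat_def nranef)
  let ?P = "Pmat d \<theta>" and ?V = "Vt" and ?Vj = "Vd \<theta> j" and ?Vk = "Vd \<theta> k"
  note P = Pmat[OF theta_param] and Vj = Vd[OF j, of \<theta>] and Vk = Vd[OF k, of \<theta>] and W = Vdd[OF j k]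
  let ?VPV = "?Vj * ?P * ?Vk" and ?VPV' = "?Vk * ?P * ?Vj"
  have cV: "?VPV \<in> carrier_mat N N" "?VPV' \<in> carrier_mat N N" using P(1) Vj Vk by auto
  let ?AA = "Vdd j k - ?VPV - ?VPV'"
  have A: "Vdd j k - ?VPV \<in> carrier_mat N N" by (rule minus_carrier_mat[OF cV(1)])
  have AA: "?AA \<in> carrier_mat N N" by (rule minus_carrier_mat[OF cV(2)])
  define t where "t = mat_trace (?P * (Vdd j k - ?VPV))"
  have PAAP: "?P * (?AA * ?P) \<in> carrier_mat N N" using P(1) AA by simp
  have pw: "partial_deriv j (partial_deriv k (reml_loglik d c T (y z))) \<theta> =
      - 1/2 * (t - uvec z \<bullet> (?P * (?AA * ?P) *v uvec z))" if z: "z \<in> space M" for z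
  proof -
    have "(?P *v uvec z) \<bullet> (?AA *v (?P *v uvec z)) = uvec z \<bullet> (?P *v (?AA *v (?P *v uvec z)))"
      by (rule sym_mat_scalar_prod[OF P(1,2) uvec(1)]) (use AA P(1) in auto)
    also have "?P *v (?AA *v (?P *v uvec z)) = ?P * (?AA * ?P) *v uvec z"
      using P(1) AA by (simp add: assoc_mult_mat_vec[of ?P N N "?AA * ?P" N] assoc_mult_mat_vec[of ?AA N N ?P N])
    finally show ?thesis using hessian[OF theta_pos_param j k T y_carrier[OF z], of c] P_y[OF z] by (simp add: t_def)
  qed
  have "(\<integral>z. partial_deriv j (partial_deriv k (reml_loglik d c T (y z))) \<theta> \<partial>M) =
      (\<integral>z. - 1/2 * (t - uvec z \<bullet> (?P * (?AA * ?P) *v uvec z)) \<partial>M)"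
    by (intro Bochner_Integration.integral_cong refl pw)
  also have "\<dots> = - 1/2 * (t - mat_trace (?P * (?AA * ?P) * ?V))"
    using uvec_quad_integral[OF PAAP] by (simp add: prob_space del: assoc_mult_mat)
  also have "mat_trace (?P * (?AA * ?P) * ?V) = mat_trace (?P * ?AA)"
  proof -
    have "mat_trace (?P * (A * ?P) * ?V) = mat_trace (?P * A)" if A: "A \<in> carrier_mat N N" for A
    proof -
      have "mat_trace (?P * (A * ?P) * ?V) = mat_trace ((?P * A) * (?P * ?V))" using P(1) A Vmat[of \<theta>] by (simp add: mat_assoc)
      also have "\<dots> = mat_trace ((?P * ?V) * (?P * A))" by (rule mat_trace_mult_comm[of _ N N]) (use P(1) A Vmat[of \<theta>] in auto)
      also have "(?P * ?V) * (?P * A) = (?P * (?V * ?P)) * A" using P(1) A Vmat[of \<theta>] by (simp add: mat_assoc)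
      finally show ?thesis unfolding P(3) .
    qed
    from this[OF AA] show ?thesis .
  qed
  also have "mat_trace (?P * ?AA) = t - mat_trace (?P * ?VPV')"
  proof -
    have "?P * ?AA = ?P * (Vdd j k - ?VPV) - ?P * ?VPV'" by (rule mult_minus_distrib_mat[OF P(1) A cV(2)])
    then show ?thesis unfolding t_def using P(1) A cV by (simp add: mat_trace_minus[of _ N])
  qed
  also have "mat_trace (?P * ?VPV') = mat_trace (?P * ?VPV)"
  proof -
    have "mat_trace (?P * ?VPV') = mat_trace ((?P * ?Vk) * (?P * ?Vj))" using P(1) Vj Vk by (simp add: mat_assoc)
    also have "\<dots> = mat_trace ((?P * ?Vj) * (?P * ?Vk))" by (rule mat_trace_mult_comm[of _ N N]) (use P(1) Vj Vk in auto)
    finally show ?thesis using P(1) Vj Vk by (simp add: mat_assoc)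
  qed
  finally show "expected_hessian M s (\<lambda>z. reml_loglik d c T (y z)) \<theta> $$ (j, k) = (- Gmat d \<theta>) $$ (j, k)"
    using j k Gmat_eq[OF theta_pos_param j k] by (simp add: expected_hessian_def Gmat_def nranef)
qed (auto simp: expected_hessian_def Gmat_def nranef)

definition Qf :: "nat \<Rightarrow> 'a \<Rightarrow> real" where
  "Qf j z = uvec z \<bullet> (Bt j *v uvec z)"

text \<open>The score differs from \<open>u' B\<^sub>j u\<close> by a constant only, since
  \<open>P X = 0\<close> removes the fixed effects.\<close>

lemma score_variance_eq:
  assumes T: "reml_contrast d T" and j: "j \<le> s" and k: "k \<le> s"
  shows "score_variance M s (\<lambda>z. reml_loglik d c T (y z)) \<theta> $$ (j, k) =
    (\<integral>z. (Qf j z - (\<integral>z. Qf j z \<partial>M)) * (Qf k z - (\<integral>z. Qf k z \<partial>M)) \<partial>M)"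
proof -
  note P = Pmat[OF theta_param]
  have int: "integrable M (Qf j)" if "j \<le> s" for j
    unfolding Qf_def[abs_def] by (rule uvec_quad_integral(1)[OF Bmat(1)[OF theta_param that]])
  define t where "t j = - 1/2 * mat_trace (Pmat d \<theta> * Vd \<theta> j)" for j
  have pw: "partial_deriv j (reml_loglik d c T (y z)) \<theta> = t j + Qf j z" if z: "z \<in> space M" and j: "j \<le> s" for j z
  proof -
    have PVP: "Pmat d \<theta> * Vd \<theta> j * Pmat d \<theta> \<in> carrier_mat N N" using P(1) Vd[OF j, of \<theta>] by simp
    have e: "f \<bullet> (Pmat d \<theta> * Vd \<theta> j * Pmat d \<theta> *v f) = (Pmat d \<theta> *v f) \<bullet> (Vd \<theta> j *v (Pmat d \<theta> *v f))" if f: "f \<in> carrier_vec N" for f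
    proof -
      have "Pmat d \<theta> * Vd \<theta> j * Pmat d \<theta> *v f = Pmat d \<theta> *v (Vd \<theta> j *v (Pmat d \<theta> *v f))"
        using P(1) Vd[OF j, of \<theta>] f by (simp add: mat_vec_assoc)
      then show ?thesis using sym_mat_scalar_prod[OF P(1,2) f, of "Vd \<theta> j *v (Pmat d \<theta> *v f)"] P(1) Vd[OF j, of \<theta>] f by simp
    qed
    have "Bt j *v uvec z = (1/2) \<cdot>\<^sub>v (Pmat d \<theta> * Vd \<theta> j * Pmat d \<theta> *v uvec z)"
      unfolding Bmat_eq[OF theta_pos_param j] using PVP P(1) uvec(1)[of z] by (intro smult_mat_vec) simp
    then have Qf: "Qf j z = 1/2 * (uvec z \<bullet> (Pmat d \<theta> * Vd \<theta> j * Pmat d \<theta> *v uvec z))"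
      unfolding Qf_def using PVP P(1) uvec(1)[of z] by (simp del: assoc_mult_mat)
    have yu: "y z \<bullet> (Pmat d \<theta> * Vd \<theta> j * Pmat d \<theta> *v y z) = uvec z \<bullet> (Pmat d \<theta> * Vd \<theta> j * Pmat d \<theta> *v uvec z)"
      unfolding e[OF uvec(1)] e[OF y_carrier[OF z]] P_y[OF z] by (rule refl)
    have "a = - 1/2 * m + q" if "a = - 1/2 * (m - b)" "b = b'" "q = 1/2 * b'" for a b b' m q :: real using that by (simp add: field_simps)
    from this[OF score[OF theta_pos_param j T y_carrier[OF z], of c] yu Qf] show ?thesis unfolding t_def .
  qed
  have E: "(\<integral>z. partial_deriv j (reml_loglik d c T (y z)) \<theta> \<partial>M) = t j + (\<integral>z. Qf j z \<partial>M)" if j: "j \<le> s" for j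
  proof -
    have "(\<integral>z. partial_deriv j (reml_loglik d c T (y z)) \<theta> \<partial>M) = (\<integral>z. t j + Qf j z \<partial>M)"
      by (intro Bochner_Integration.integral_cong refl pw j)
    then show ?thesis using int[OF j] by (simp add: prob_space)
  qed
  have "score_variance M s (\<lambda>z. reml_loglik d c T (y z)) \<theta> $$ (j, k) =
    covariance_of M (\<lambda>z. partial_deriv j (reml_loglik d c T (y z)) \<theta>) (\<lambda>z. partial_deriv k (reml_loglik d c T (y z)) \<theta>)"
    using j k by (simp add: score_variance_def)
  also have "\<dots> = (\<integral>z. (Qf j z - (\<integral>z. Qf j z \<partial>M)) * (Qf k z - (\<integral>z. Qf k z \<partial>M)) \<partial>M)"
    unfolding covariance_of_def E[OF j] E[OF k] by (intro Bochner_Integration.integral_cong refl) (simp add: pw j k)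
  finally show ?thesis .
qed

end

section \<open>The information matrix and its estimator\<close>

lemma sum_swap3:
  "(\<Sum>j\<in>A. \<Sum>k\<in>B. \<Sum>a\<in>C. f j k a) = (\<Sum>a\<in>C. \<Sum>j\<in>A. \<Sum>k\<in>B. (f j k a :: real))"
proof -
  have "(\<Sum>j\<in>A. \<Sum>k\<in>B. \<Sum>a\<in>C. f j k a) = (\<Sum>j\<in>A. \<Sum>a\<in>C. \<Sum>k\<in>B. f j k a)"
    by (rule sum.cong[OF refl], rule sum.swap)
  also have "\<dots> = (\<Sum>a\<in>C. \<Sum>j\<in>A. \<Sum>k\<in>B. f j k a)" by (rule sum.swap)
  finally show ?thesis .
qed

fun qprod :: "real mat \<Rightarrow> real mat \<Rightarrow> quad \<Rightarrow> real" where
  "qprod A B (i1, i2, i3, i4) = A $$ (i1, i2) * B $$ (i3, i4)"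

text \<open>The pairing (13)(24) of the four indices; the next two functions are (14)(23) and
  (12)(34). Together they make up the Gaussian part of the fourth moments.\<close>

fun qcov :: "real mat \<Rightarrow> quad \<Rightarrow> real" where
  "qcov V (i1, i2, i3, i4) = V $$ (i1, i3) * V $$ (i2, i4)"

fun qcov' :: "real mat \<Rightarrow> quad \<Rightarrow> real" where
  "qcov' V (i1, i2, i3, i4) = V $$ (i1, i4) * V $$ (i2, i3)"

fun qcov'' :: "real mat \<Rightarrow> quad \<Rightarrow> real" where
  "qcov'' V (i1, i2, i3, i4) = V $$ (i1, i2) * V $$ (i3, i4)"

context lmm_design_loc begin

lemma finite_quads [simp]: "finite (quads d)" by (simp add: quads_def)
lemma finite_nonzero_quads [simp]: "finite (nonzero_quads d)" by (simp add: nonzero_quads_def)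
lemma finite_fclass [simp]: "finite (fclass d \<phi>)" by (simp add: fclass_def)
lemma finite_fvals [simp]: "finite (fvals d)" by (simp add: fvals_def)

lemma sum_quads: "(\<Sum>q\<in>quads d. F q) = (\<Sum>i1<N. \<Sum>i2<N. \<Sum>i3<N. \<Sum>i4<N. F (i1, i2, i3, i4))"
  unfolding quads_def by (simp add: sum.cartesian_product' case_prod_unfold)

lemma nonzero_quads_vals: "q \<in> nonzero_quads d \<Longrightarrow> fcoef d q \<in> fvals d"
  by (auto simp: nonzero_quads_def fvals_def nranef)

lemma fvals_not_0: "\<phi> \<in> fvals d \<Longrightarrow> \<phi> \<noteq> 0\<^sub>v (nranef d + 1)" by (simp add: fvals_def)

section \<open>Grouping the quadruples by the value of f\<close>

lemma sum_by_class: "(\<Sum>q\<in>nonzero_quads d. F q) = (\<Sum>\<phi>\<in>fvals d. \<Sum>q\<in>fclass d \<phi>. F q)"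
proof -
  have "(\<Sum>\<phi>\<in>fvals d. \<Sum>q\<in>{q\<in>nonzero_quads d. fcoef d q = \<phi>}. F q) = (\<Sum>q\<in>nonzero_quads d. F q)"
    by (rule sum.group) (use nonzero_quads_vals in auto)
  moreover have "{q\<in>nonzero_quads d. fcoef d q = \<phi>} = fclass d \<phi>" if "\<phi> \<in> fvals d" for \<phi>
    using fvals_not_0[OF that] by (auto simp: nonzero_quads_def fclass_def)
  ultimately show ?thesis by simp
qed

lemma sum_class_const: "(\<Sum>q\<in>nonzero_quads d. F (fcoef d q)) = (\<Sum>\<phi>\<in>fvals d. real (hcount d \<phi>) * F \<phi>)"
  unfolding sum_by_class by (intro sum.cong refl) (simp add: fclass_def hcount_def)

lemma hcount_pos:
  assumes "\<phi> \<in> fvals d"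
  shows "0 < hcount d \<phi>"
proof -
  have "\<phi> \<in> fcoef d ` quads d" using assms unfolding fvals_def by blast
  then obtain q where "q \<in> fclass d \<phi>" unfolding fclass_def by blast
  then show ?thesis unfolding hcount_def by (auto simp: card_gt_0_iff)
qed

text \<open>A factor that depends on a quadruple only through f sees the products of entries of the
  B matrices only through their averages over the classes. This is why the coefficients of the
  POQUIM are such averages.\<close>

lemma class_average:
  "(\<Sum>q\<in>nonzero_quads d. qprod (Bmat d \<theta> j) (Bmat d \<theta> k) q * F (fcoef d q)) =
   (\<Sum>q\<in>nonzero_quads d. ccoef d \<theta> j k (fcoef d q) * F (fcoef d q))"
proof -
  have "(\<Sum>q\<in>nonzero_quads d. qprod (Bmat d \<theta> j) (Bmat d \<theta> k) q * F (fcoef d q)) =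
     (\<Sum>\<phi>\<in>fvals d. (\<Sum>q\<in>fclass d \<phi>. qprod (Bmat d \<theta> j) (Bmat d \<theta> k) q) * F \<phi>)"
    unfolding sum_by_class sum_distrib_right by (intro sum.cong refl) (simp add: fclass_def)
  also have "\<dots> = (\<Sum>\<phi>\<in>fvals d. real (hcount d \<phi>) * (ccoef d \<theta> j k \<phi> * F \<phi>))"
  proof (intro sum.cong refl)
    fix \<phi> assume "\<phi> \<in> fvals d"
    moreover have "(\<Sum>(i1, i2, i3, i4)\<in>fclass d \<phi>. Bmat d \<theta> j $$ (i1, i2) * Bmat d \<theta> k $$ (i3, i4)) = (\<Sum>q\<in>fclass d \<phi>. qprod (Bmat d \<theta> j) (Bmat d \<theta> k) q)"
      by (intro sum.cong refl) auto
    ultimately show "(\<Sum>q\<in>fclass d \<phi>. qprod (Bmat d \<theta> j) (Bmat d \<theta> k) q) * F \<phi> = real (hcount d \<phi>) * (ccoef d \<theta> j k \<phi> * F \<phi>)"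
      using hcount_pos[of \<phi>] by (simp add: ccoef_def)
  qed
  also have "\<dots> = (\<Sum>q\<in>nonzero_quads d. ccoef d \<theta> j k (fcoef d q) * F (fcoef d q))" by (rule sum_class_const[symmetric])
  finally show ?thesis .
qed

lemma fcoef_perm:
  "fcoef d (i1, i2, i3, i4) = fcoef d (i1, i3, i2, i4)" "fcoef d (i1, i2, i3, i4) = fcoef d (i1, i2, i4, i3)" by (auto simp: mult_ac)

text \<open>f is symmetric in its four arguments and the coefficient depends on f alone, so
  permuting indices exchanges the three pairings. This is the origin of the factor 3 in
  \<open>I12_hat\<close>.\<close>

lemma sum_perm_quads:
  assumes V: "V\<^sup>T = V" "V \<in> carrier_mat N N"
  shows "(\<Sum>q\<in>nonzero_quads d. c (fcoef d q) * qcov'' V q) = (\<Sum>q\<in>nonzero_quads d. c (fcoef d q) * qcov V q)"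
    and "(\<Sum>q\<in>nonzero_quads d. c (fcoef d q) * qcov' V q) = (\<Sum>q\<in>nonzero_quads d. c (fcoef d q) * qcov V q)"
proof -
  let ?p1 = "\<lambda>(i1, i2, i3, i4). (i1, i3, i2, i4) :: quad" and ?p2 = "\<lambda>(i1, i2, i3, i4). (i1, i2, i4, i3) :: quad"
  have f: "fcoef d (?p1 q) = fcoef d q" "fcoef d (?p2 q) = fcoef d q" for q
    by (cases q, simp only: prod.case, rule fcoef_perm(1)[symmetric] fcoef_perm(2)[symmetric])+
  have qd: "?p1 q \<in> quads d \<longleftrightarrow> q \<in> quads d" "?p2 q \<in> quads d \<longleftrightarrow> q \<in> quads d" for q
    by (cases q; auto simp: quads_def)+
  have nz: "?p1 q \<in> nonzero_quads d \<longleftrightarrow> q \<in> nonzero_quads d" "?p2 q \<in> nonzero_quads d \<longleftrightarrow> q \<in> nonzero_quads d" for q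
    unfolding nonzero_quads_def mem_Collect_eq f qd by (rule refl)+
  have inv: "?p1 (?p1 q) = q" "?p2 (?p2 q) = q" for q by (cases q; simp)+
  show "(\<Sum>q\<in>nonzero_quads d. c (fcoef d q) * qcov'' V q) = (\<Sum>q\<in>nonzero_quads d. c (fcoef d q) * qcov V q)"
  proof (rule sum.reindex_bij_witness[of _ ?p1 ?p1])
    fix q assume "q \<in> nonzero_quads d"
    then show "?p1 q \<in> nonzero_quads d" by (simp only: nz)
    then show "?p1 q \<in> nonzero_quads d" .
    show "c (fcoef d (?p1 q)) * qcov V (?p1 q) = c (fcoef d q) * qcov'' V q" unfolding f by (cases q) simp
  qed (simp_all only: inv)
  show "(\<Sum>q\<in>nonzero_quads d. c (fcoef d q) * qcov' V q) = (\<Sum>q\<in>nonzero_quads d. c (fcoef d q) * qcov V q)"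
  proof (rule sum.reindex_bij_witness[of _ ?p2 ?p2])
    fix q assume "q \<in> nonzero_quads d"
    then show "?p2 q \<in> nonzero_quads d" by (simp only: nz)
    then show "?p2 q \<in> nonzero_quads d" .
    show "c (fcoef d (?p2 q)) * qcov V (?p2 q) = c (fcoef d q) * qcov' V q" unfolding f by (cases q) simp
  qed (simp_all only: inv)
qed

text \<open>By symmetry of B and V the two pairings across the quadratic forms give the same trace;
  their sum is the Gaussian information.\<close>

lemma trace_qcov:
  assumes A: "A \<in> carrier_mat N N" and B: "B \<in> carrier_mat N N" "B\<^sup>T = B"
    and V: "V \<in> carrier_mat N N" "V\<^sup>T = V"
  shows "(\<Sum>q\<in>quads d. qprod A B q * qcov V q) = mat_trace (A * V * B * V)"
    and "(\<Sum>q\<in>quads d. qprod A B q * qcov' V q) = mat_trace (A * V * B * V)"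
proof -
  have Bs: "B $$ (j, i) = B $$ (i, j)" and Vs: "V $$ (j, i) = V $$ (i, j)" if "i < N" "j < N" for i j
    using sym_mat_index[OF B(2,1) that] sym_mat_index[OF V(2,1) that] by auto
  have "mat_trace (A * V * B * V) = mat_trace (A * (V * (B * V)))" using A B(1) V(1) by (simp add: mat_assoc)
  also have "\<dots> = (\<Sum>i1<N. \<Sum>i2<N. \<Sum>i4<N. \<Sum>i3<N. A $$ (i1, i2) * (V $$ (i2, i4) * (B $$ (i4, i3) * V $$ (i3, i1))))"
    using A B(1) V(1) by (simp add: mat_trace_def scalar_prod_lessThan sum_distrib_left del: assoc_mult_mat)
  finally have e: "mat_trace (A * V * B * V) = (\<Sum>i1<N. \<Sum>i2<N. \<Sum>i4<N. \<Sum>i3<N. A $$ (i1, i2) * (V $$ (i2, i4) * (B $$ (i4, i3) * V $$ (i3, i1))))" .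
  have "(\<Sum>q\<in>quads d. qprod A B q * qcov' V q) = (\<Sum>i1<N. \<Sum>i2<N. \<Sum>i4<N. \<Sum>i3<N. A $$ (i1, i2) * (V $$ (i2, i4) * (B $$ (i4, i3) * V $$ (i3, i1))))"
    unfolding sum_quads
  proof (intro sum.cong refl)
    fix i1 i2 i3 i4 assume "i1 \<in> {..<N}" "i2 \<in> {..<N}" "i3 \<in> {..<N}" "i4 \<in> {..<N}"
    then show "qprod A B (i1, i2, i3, i4) * qcov' V (i1, i2, i3, i4) = A $$ (i1, i2) * (V $$ (i2, i3) * (B $$ (i3, i4) * V $$ (i4, i1)))"
      using Vs[of i1 i4] by simp
  qed
  then show "(\<Sum>q\<in>quads d. qprod A B q * qcov' V q) = mat_trace (A * V * B * V)" using e by simp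
  have "(\<Sum>q\<in>quads d. qprod A B q * qcov V q) = (\<Sum>i1<N. \<Sum>i2<N. \<Sum>i3<N. \<Sum>i4<N. A $$ (i1, i2) * (V $$ (i2, i4) * (B $$ (i4, i3) * V $$ (i3, i1))))"
    unfolding sum_quads
  proof (intro sum.cong refl)
    fix i1 i2 i3 i4 assume "i1 \<in> {..<N}" "i2 \<in> {..<N}" "i3 \<in> {..<N}" "i4 \<in> {..<N}"
    then show "qprod A B (i1, i2, i3, i4) * qcov V (i1, i2, i3, i4) = A $$ (i1, i2) * (V $$ (i2, i4) * (B $$ (i4, i3) * V $$ (i3, i1)))"
      using Vs[of i1 i3] Bs[of i3 i4] by simp
  qed
  also have "\<dots> = mat_trace (A * V * B * V)" unfolding e by (rule sum.cong[OF refl], rule sum.cong[OF refl], rule sum.swap)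
  finally show "(\<Sum>q\<in>quads d. qprod A B q * qcov V q) = mat_trace (A * V * B * V)" .
qed

lemma Gmat_index: "j \<le> s \<Longrightarrow> k \<le> s \<Longrightarrow>
    Gmat d \<theta> $$ (j, k) = 2 * mat_trace (Bmat d \<theta> j * Vmat d \<theta> * Bmat d \<theta> k * Vmat d \<theta>)"
  by (simp add: Gmat_def nranef)

lemma Gmat: "Gmat d \<theta> \<in> carrier_mat (s + 1) (s + 1)" by (simp add: Gmat_def nranef)

lemma I12_hat_eq:
  assumes j: "j \<le> s" and k: "k \<le> s"
  shows "I12_hat d \<theta> j k = Gmat d \<theta> $$ (j, k) - 3 * (\<Sum>q\<in>nonzero_quads d. ccoef d \<theta> j k (fcoef d q) * qcov (Vmat d \<theta>) q)"
proof -
  have "3 * (\<theta> $ 0)\<^sup>2 * (\<Sum>(i1, i2, i3, i4)\<in>nonzero_quads d.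
       ccoef d \<theta> j k (fcoef d (i1, i2, i3, i4)) * Gamma_fn d \<theta> i1 i3 * Gamma_fn d \<theta> i2 i4) =
     3 * (\<Sum>q\<in>nonzero_quads d. ccoef d \<theta> j k (fcoef d q) * qcov (Vmat d \<theta>) q)"
    unfolding mult.assoc[of 3] sum_distrib_left[of "(\<theta> $ 0)\<^sup>2"]
  proof (intro arg_cong[of _ _ "(*) 3"] sum.cong refl)
    fix q assume q: "q \<in> nonzero_quads d"
    obtain i1 i2 i3 i4 where q4: "q = (i1, i2, i3, i4)" by (cases q) auto
    have "i1 < N" "i2 < N" "i3 < N" "i4 < N" using q by (auto simp: q4 nonzero_quads_def quads_def)
    then show "(\<theta> $ 0)\<^sup>2 * (case q of (i1, i2, i3, i4) \<Rightarrow> ccoef d \<theta> j k (fcoef d (i1, i2, i3, i4)) * Gamma_fn d \<theta> i1 i3 * Gamma_fn d \<theta> i2 i4) =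
        ccoef d \<theta> j k (fcoef d q) * qcov (Vmat d \<theta>) q"
      by (simp only: q4 prod.case qcov.simps Gamma_fn_eq[symmetric]) (simp add: power2_eq_square mult_ac del: fcoef.simps)
  qed
  then show ?thesis by (simp add: I12_hat_def Gmat_index[OF j k] del: fcoef.simps)
qed

lemma poquim_index:
  assumes j: "j \<le> s" and k: "k \<le> s"
  shows "poquim d \<theta> y $$ (j, k) = (\<Sum>q\<in>nonzero_quads d. ccoef d \<theta> j k (fcoef d q) * prod4 (\<lambda>i _. residual d \<theta> y $ i) q ()) +
     (Gmat d \<theta> $$ (j, k) - 3 * (\<Sum>q\<in>nonzero_quads d. ccoef d \<theta> j k (fcoef d q) * qcov (Vmat d \<theta>) q))"
proof -
  have "I11_hat d \<theta> y j k = (\<Sum>q\<in>nonzero_quads d. ccoef d \<theta> j k (fcoef d q) * prod4 (\<lambda>i _. residual d \<theta> y $ i) q ())"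
    unfolding I11_hat_def Let_def by (intro sum.cong refl) (auto simp del: fcoef.simps)
  then show ?thesis using j k by (simp add: poquim_def nranef I12_hat_eq[OF j k])
qed

end

context lmm begin

definition U :: "quad \<Rightarrow> 'a \<Rightarrow> real" where "U = prod4 (\<lambda>i. lin (ww i))"

definition Fk :: "real vec \<Rightarrow> real" where "Fk \<phi> = (\<Sum>t\<le>s. kap D t * \<phi> $ t)"

lemma U_moment:
  assumes q: "q \<in> quads d"
  shows "integrable M (U q)"
    "(\<integral>z. U q z \<partial>M) = Fk (fcoef d q) + qcov'' Vt q + qcov Vt q + qcov' Vt q"
proof -
  obtain i1 i2 i3 i4 where q4: "q = (i1, i2, i3, i4)" by (cases q) auto
  have i: "i1 < N" "i2 < N" "i3 < N" "i4 < N" using q by (auto simp: q4 quads_def)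
  have U: "U q = (\<lambda>z. lin (ww i1) z * lin (ww i2) z * lin (ww i3) z * lin (ww i4) z)" by (rule ext) (simp add: U_def q4)
  show "integrable M (U q)" unfolding U by (rule lin4_moment)
  have "(\<Sum>a\<in>I. kk a * ww i1 a * ww i2 a * ww i3 a * ww i4 a) = (\<Sum>(t, l)\<in>I. kap D t * (Z t $$ (i1, l) * Z t $$ (i2, l) * Z t $$ (i3, l) * Z t $$ (i4, l)))"
    by (intro sum.cong refl) (auto simp: mult.assoc)
  also have "\<dots> = (\<Sum>t\<le>s. \<Sum>l<nlev d t. kap D t * (Z t $$ (i1, l) * Z t $$ (i2, l) * Z t $$ (i3, l) * Z t $$ (i4, l)))"
    by (subst sum.Sigma) auto
  also have "\<dots> = Fk (fcoef d q)" unfolding Fk_def q4 by (intro sum.cong refl) (simp add: nranef sum_distrib_left)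
  finally show "(\<integral>z. U q z \<partial>M) = Fk (fcoef d q) + qcov'' Vt q + qcov Vt q + qcov' Vt q"
    unfolding U lin4_moment using i by (simp add: q4 V_cov')
qed

definition I1e :: "nat \<Rightarrow> nat \<Rightarrow> real" where
  "I1e j k = (\<integral>z. (Qf j z - (\<integral>z. Qf j z \<partial>M)) * (Qf k z - (\<integral>z. Qf k z \<partial>M)) \<partial>M)"

text \<open>The pairing within the quadratic forms is the product of their means and cancels in the
  covariance. The other two pairings give \<open>Gmat\<close>, and the fourth cumulants give the
  remaining sum.\<close>

lemma I1e_quads:
  assumes j: "j \<le> s" and k: "k \<le> s"
  shows "I1e j k = (\<Sum>q\<in>quads d. qprod (Bt j) (Bt k) q * Fk (fcoef d q)) + Gmat d \<theta> $$ (j, k)"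
proof -
  let ?A = "Bt j" and ?B = "Bt k" and ?V = "Vt"
  note A = Bmat[OF theta_param j] and B = Bmat[OF theta_param k]
  have int: "integrable M (Qf j)" if "j \<le> s" for j
    unfolding Qf_def[abs_def] by (rule uvec_quad_integral(1)[OF Bmat(1)[OF theta_param that]])
  have Q: "Qf j z = (\<Sum>i1<N. \<Sum>i2<N. Bt j $$ (i1, i2) * (lin (ww i1) z * lin (ww i2) z))" if "j \<le> s" for j z
    unfolding Qf_def quad_form_sum[OF Bmat(1)[OF theta_param that] uvec(1) uvec(1)] by (intro sum.cong refl) simp
  have QQ: "Qf j z * Qf k z = (\<Sum>q\<in>quads d. qprod ?A ?B q * U q z)" for z
    unfolding Q[OF j] Q[OF k] sum_quads sum_distrib_right unfolding sum_distrib_left by (intro sum.cong refl) (simp add: U_def)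
  have QQ_int: "integrable M (\<lambda>z. Qf j z * Qf k z)" unfolding QQ
    by (intro Bochner_Integration.integrable_sum integrable_mult_right U_moment)
  have E: "(\<integral>z. Qf j z \<partial>M) = (\<Sum>i1<N. \<Sum>i2<N. Bt j $$ (i1, i2) * ?V $$ (i1, i2))" if "j \<le> s" for j
  proof -
    have "(\<integral>z. Qf j z \<partial>M) = (\<Sum>i1<N. \<Sum>i2<N. Bt j $$ (i1, i2) * cov (ww i1) (ww i2))"
      unfolding Q[OF that] by (simp add: lin2_moment)
    then show ?thesis by (simp add: V_cov')
  qed
  have EE: "(\<integral>z. Qf j z \<partial>M) * (\<integral>z. Qf k z \<partial>M) = (\<Sum>q\<in>quads d. qprod ?A ?B q * qcov'' ?V q)"
    unfolding E[OF j] E[OF k] sum_quads sum_distrib_right unfolding sum_distrib_left by (intro sum.cong refl) simp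
  have "I1e j k = (\<integral>z. Qf j z * Qf k z - (\<integral>z. Qf j z \<partial>M) * Qf k z - (\<integral>z. Qf k z \<partial>M) * Qf j z
      + (\<integral>z. Qf j z \<partial>M) * (\<integral>z. Qf k z \<partial>M) \<partial>M)"
    unfolding I1e_def by (intro Bochner_Integration.integral_cong refl) (simp add: algebra_simps)
  also have "\<dots> = (\<integral>z. Qf j z * Qf k z \<partial>M) - (\<integral>z. Qf j z \<partial>M) * (\<integral>z. Qf k z \<partial>M)"
    using QQ_int int[OF j] int[OF k] by (simp add: prob_space)
  also have "(\<integral>z. Qf j z * Qf k z \<partial>M) = (\<Sum>q\<in>quads d. qprod ?A ?B q * (\<integral>z. U q z \<partial>M))"
    unfolding QQ using U_moment(1) by (simp add: Bochner_Integration.integral_sum)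
  also have "\<dots> = (\<Sum>q\<in>quads d. qprod ?A ?B q * Fk (fcoef d q) + qprod ?A ?B q * qcov'' ?V q + qprod ?A ?B q * qcov ?V q + qprod ?A ?B q * qcov' ?V q)"
    by (intro sum.cong refl) (simp add: U_moment(2) distrib_left)
  also have "\<dots> = (\<Sum>q\<in>quads d. qprod ?A ?B q * Fk (fcoef d q)) + (\<Sum>q\<in>quads d. qprod ?A ?B q * qcov'' ?V q) + Gmat d \<theta> $$ (j, k)"
    using trace_qcov[OF A(1) B(1,2) Vmat Vmat_sym] by (simp add: sum.distrib Gmat_index[OF j k])
  finally show ?thesis unfolding EE by simp
qed

text \<open>The unknown kurtoses are eliminated: the cumulant part is the expected product of four
  components of u minus the three pairings. The expectation can then be estimated by observed
  products, and the pairings depend on the parameter only.\<close>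

lemma I1e_eq:
  assumes j: "j \<le> s" and k: "k \<le> s"
  shows "I1e j k = (\<Sum>q\<in>nonzero_quads d. ccoef d \<theta> j k (fcoef d q) * (\<integral>z. U q z \<partial>M)) +
    (Gmat d \<theta> $$ (j, k) - 3 * (\<Sum>q\<in>nonzero_quads d. ccoef d \<theta> j k (fcoef d q) * qcov Vt q))"
proof -
  let ?V = "Vt" and ?c = "ccoef d \<theta> j k"
  \<comment> \<open>Quadruples with f = 0 drop out, since \<open>Fk\<close> is linear in f.\<close>
  have "(\<Sum>q\<in>quads d. qprod (Bt j) (Bt k) q * Fk (fcoef d q)) = (\<Sum>q\<in>nonzero_quads d. qprod (Bt j) (Bt k) q * Fk (fcoef d q))"
    by (rule sum.mono_neutral_right) (auto simp: nonzero_quads_def Fk_def nranef simp del: fcoef.simps)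
  also have "\<dots> = (\<Sum>q\<in>nonzero_quads d. ?c (fcoef d q) * Fk (fcoef d q))" by (rule class_average)
  also have "\<dots> = (\<Sum>q\<in>nonzero_quads d. ?c (fcoef d q) * (\<integral>z. U q z \<partial>M) - ?c (fcoef d q) * qcov'' ?V q - ?c (fcoef d q) * qcov ?V q - ?c (fcoef d q) * qcov' ?V q)"
  proof (intro sum.cong refl)
    fix q assume "q \<in> nonzero_quads d"
    then have "q \<in> quads d" by (simp add: nonzero_quads_def)
    from U_moment(2)[OF this] show "?c (fcoef d q) * Fk (fcoef d q) = ?c (fcoef d q) * (\<integral>z. U q z \<partial>M) - ?c (fcoef d q) * qcov'' ?V q - ?c (fcoef d q) * qcov ?V q - ?c (fcoef d q) * qcov' ?V q"
      by (simp add: algebra_simps)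
  qed
  also have "\<dots> = (\<Sum>q\<in>nonzero_quads d. ?c (fcoef d q) * (\<integral>z. U q z \<partial>M)) - 3 * (\<Sum>q\<in>nonzero_quads d. ?c (fcoef d q) * qcov ?V q)"
    using sum_perm_quads[OF Vmat_sym Vmat, of ?c \<theta>] by (simp add: sum_subtractf)
  finally show ?thesis unfolding I1e_quads[OF j k] by simp
qed

section \<open>Comparison with the Gaussian information\<close>

text \<open>The matrix \<open>B\<^sub>j\<close> in the coordinates of the random effects: its
  bilinear form at the columns of the Z matrices that belong to the effects a and b.\<close>

definition kf :: "nat \<Rightarrow> (nat \<times> nat) \<Rightarrow> (nat \<times> nat) \<Rightarrow> real" where
  "kf j a b = (\<Sum>i1<N. \<Sum>i2<N. Bt j $$ (i1, i2) * (ww i1 a * ww i2 b))"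

lemma G_kf:
  assumes j: "j \<le> s" and k: "k \<le> s"
  shows "Gmat d \<theta> $$ (j, k) = 2 * (\<Sum>a\<in>I. \<Sum>b\<in>I. vv a * vv b * kf j a b * kf k a b)"
proof -
  note A = Bmat[OF theta_param j] and B = Bmat[OF theta_param k]
  have "Gmat d \<theta> $$ (j, k) = 2 * (\<Sum>q\<in>quads d. qprod (Bt j) (Bt k) q * qcov Vt q)"
    using trace_qcov(1)[OF A(1) B(1,2) Vmat Vmat_sym] by (simp add: Gmat_index[OF j k])
  also have "(\<Sum>q\<in>quads d. qprod (Bt j) (Bt k) q * qcov Vt q) =
    (\<Sum>q\<in>quads d. \<Sum>a\<in>I. \<Sum>b\<in>I. vv a * vv b * (case q of (i1, i2, i3, i4) \<Rightarrow>
      (Bt j $$ (i1, i2) * (ww i1 a * ww i2 b)) * (Bt k $$ (i3, i4) * (ww i3 a * ww i4 b))))"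
  proof (intro sum.cong refl)
    fix q assume q: "q \<in> quads d"
    obtain i1 i2 i3 i4 where q4: "q = (i1, i2, i3, i4)" by (cases q) auto
    have i: "i1 < N" "i2 < N" "i3 < N" "i4 < N" using q by (auto simp: q4 quads_def)
    show "qprod (Bt j) (Bt k) q * qcov Vt q = (\<Sum>a\<in>I. \<Sum>b\<in>I. vv a * vv b * (case q of (i1, i2, i3, i4) \<Rightarrow>
      (Bt j $$ (i1, i2) * (ww i1 a * ww i2 b)) * (Bt k $$ (i3, i4) * (ww i3 a * ww i4 b))))"
      unfolding q4 prod.case qprod.simps qcov.simps V_cov'[OF i(1,3)] V_cov'[OF i(2,4)] cov_def sum_product
      unfolding sum_distrib_left by (intro sum.cong refl) (simp add: mult_ac)
  qed
  also have "\<dots> = (\<Sum>a\<in>I. \<Sum>b\<in>I. \<Sum>q\<in>quads d. vv a * vv b * (case q of (i1, i2, i3, i4) \<Rightarrow>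
      (Bt j $$ (i1, i2) * (ww i1 a * ww i2 b)) * (Bt k $$ (i3, i4) * (ww i3 a * ww i4 b))))"
  proof -
    have "(\<Sum>q\<in>Q. \<Sum>a\<in>J. \<Sum>b\<in>J. f q a b) = (\<Sum>a\<in>J. \<Sum>b\<in>J. \<Sum>q\<in>Q. f q a b)" for Q :: "quad set" and J :: "(nat \<times> nat) set" and f :: "_ \<Rightarrow> _ \<Rightarrow> _ \<Rightarrow> real"
      by (subst sum.swap) (rule sum.cong[OF refl], rule sum.swap)
    then show ?thesis .
  qed
  also have "\<dots> = (\<Sum>a\<in>I. \<Sum>b\<in>I. vv a * vv b * kf j a b * kf k a b)"
  proof (intro sum.cong refl)
    fix a b
    have "(\<Sum>q\<in>quads d. case q of (i1, i2, i3, i4) \<Rightarrow> (Bt j $$ (i1, i2) * (ww i1 a * ww i2 b)) * (Bt k $$ (i3, i4) * (ww i3 a * ww i4 b))) = kf j a b * kf k a b"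
      unfolding sum_quads kf_def sum_distrib_right unfolding sum_distrib_left prod.case by (rule refl)
    then show "(\<Sum>q\<in>quads d. vv a * vv b * (case q of (i1, i2, i3, i4) \<Rightarrow>
      (Bt j $$ (i1, i2) * (ww i1 a * ww i2 b)) * (Bt k $$ (i3, i4) * (ww i3 a * ww i4 b)))) = vv a * vv b * kf j a b * kf k a b"
      by (simp add: sum_distrib_left[symmetric] mult.assoc)
  qed
  finally show ?thesis .
qed

text \<open>In effect coordinates the fourth cumulants see only the diagonal, whereas
  \<open>G_kf\<close> sums over all pairs. This is what makes the two informations
  comparable.\<close>

lemma I1e_kf:
  assumes j: "j \<le> s" and k: "k \<le> s"
  shows "I1e j k = (\<Sum>a\<in>I. kk a * kf j a a * kf k a a) + Gmat d \<theta> $$ (j, k)"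
proof -
  have "(\<Sum>q\<in>quads d. qprod (Bt j) (Bt k) q * Fk (fcoef d q)) =
    (\<Sum>q\<in>quads d. \<Sum>a\<in>I. kk a * (case q of (i1, i2, i3, i4) \<Rightarrow>
      (Bt j $$ (i1, i2) * (ww i1 a * ww i2 a)) * (Bt k $$ (i3, i4) * (ww i3 a * ww i4 a))))"
  proof (intro sum.cong refl)
    fix q :: quad
    obtain i1 i2 i3 i4 where q4: "q = (i1, i2, i3, i4)" by (cases q) auto
    have "Fk (fcoef d q) = (\<Sum>t\<le>s. \<Sum>l<nlev d t. kap D t * (Z t $$ (i1, l) * Z t $$ (i2, l) * Z t $$ (i3, l) * Z t $$ (i4, l)))"
      unfolding Fk_def q4 by (intro sum.cong refl) (simp add: nranef sum_distrib_left)
    also have "\<dots> = (\<Sum>(t, l)\<in>I. kap D t * (Z t $$ (i1, l) * Z t $$ (i2, l) * Z t $$ (i3, l) * Z t $$ (i4, l)))"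
      by (subst sum.Sigma) auto
    finally have "qprod (Bt j) (Bt k) q * Fk (fcoef d q) = (\<Sum>a\<in>I. (Bt j $$ (i1, i2) * Bt k $$ (i3, i4)) * (kk a * (ww i1 a * ww i2 a * ww i3 a * ww i4 a)))"
      by (simp add: q4 sum_distrib_left case_prod_unfold)
    also have "\<dots> = (\<Sum>a\<in>I. kk a * (case q of (i1, i2, i3, i4) \<Rightarrow>
      (Bt j $$ (i1, i2) * (ww i1 a * ww i2 a)) * (Bt k $$ (i3, i4) * (ww i3 a * ww i4 a))))"
      unfolding q4 prod.case by (intro sum.cong refl) (simp add: mult_ac)
    finally show "qprod (Bt j) (Bt k) q * Fk (fcoef d q) = (\<Sum>a\<in>I. kk a * (case q of (i1, i2, i3, i4) \<Rightarrow>
      (Bt j $$ (i1, i2) * (ww i1 a * ww i2 a)) * (Bt k $$ (i3, i4) * (ww i3 a * ww i4 a))))" .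
  qed
  also have "\<dots> = (\<Sum>a\<in>I. kk a * (\<Sum>q\<in>quads d. case q of (i1, i2, i3, i4) \<Rightarrow>
      (Bt j $$ (i1, i2) * (ww i1 a * ww i2 a)) * (Bt k $$ (i3, i4) * (ww i3 a * ww i4 a))))"
    by (subst sum.swap) (simp add: sum_distrib_left)
  also have "\<dots> = (\<Sum>a\<in>I. kk a * kf j a a * kf k a a)"
  proof (intro sum.cong refl)
    fix a
    have "(\<Sum>q\<in>quads d. case q of (i1, i2, i3, i4) \<Rightarrow> (Bt j $$ (i1, i2) * (ww i1 a * ww i2 a)) * (Bt k $$ (i3, i4) * (ww i3 a * ww i4 a))) = kf j a a * kf k a a"
      unfolding sum_quads kf_def sum_distrib_right unfolding sum_distrib_left prod.case by (rule refl)
    then show "kk a * (\<Sum>q\<in>quads d. case q of (i1, i2, i3, i4) \<Rightarrow> (Bt j $$ (i1, i2) * (ww i1 a * ww i2 a)) * (Bt k $$ (i3, i4) * (ww i3 a * ww i4 a))) = kk a * kf j a a * kf k a a"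
      by (simp add: mult.assoc)
  qed
  finally show ?thesis unfolding I1e_quads[OF j k] by simp
qed

definition mixed_kf :: "(nat \<Rightarrow> real) \<Rightarrow> (nat \<times> nat) \<Rightarrow> (nat \<times> nat) \<Rightarrow> real" where
  "mixed_kf x a b = (\<Sum>j\<le>s. x j * kf j a b)"

lemma mixed_kf_sq: "(mixed_kf x a b)\<^sup>2 = (\<Sum>j\<le>s. \<Sum>k\<le>s. (x j * kf j a b) * (x k * kf k a b))"
  unfolding mixed_kf_def power2_eq_square by (rule sum_product)

lemma G_quad: "(\<Sum>j\<le>s. \<Sum>k\<le>s. x j * Gmat d \<theta> $$ (j, k) * x k) = 2 * (\<Sum>a\<in>I. \<Sum>b\<in>I. vv a * vv b * (mixed_kf x a b)\<^sup>2)"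
proof -
  have "(\<Sum>j\<le>s. \<Sum>k\<le>s. x j * Gmat d \<theta> $$ (j, k) * x k) = (\<Sum>j\<le>s. \<Sum>k\<le>s. \<Sum>a\<in>I. \<Sum>b\<in>I. 2 * (vv a * vv b * ((x j * kf j a b) * (x k * kf k a b))))"
    by (intro sum.cong refl) (simp add: G_kf sum_distrib_left sum_distrib_right mult_ac)
  also have "\<dots> = (\<Sum>a\<in>I. \<Sum>b\<in>I. \<Sum>j\<le>s. \<Sum>k\<le>s. 2 * (vv a * vv b * ((x j * kf j a b) * (x k * kf k a b))))"
  proof -
    have "(\<Sum>j\<le>s. \<Sum>k\<le>s. \<Sum>a\<in>J. \<Sum>b\<in>J. f j k a b) = (\<Sum>a\<in>J. \<Sum>b\<in>J. \<Sum>j\<le>s. \<Sum>k\<le>s. f j k a b)" for J :: "(nat \<times> nat) set" and f :: "nat \<Rightarrow> nat \<Rightarrow> _ \<Rightarrow> _ \<Rightarrow> real"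
      unfolding sum_swap3[where C = J] by (rule refl)
    then show ?thesis .
  qed
  also have "\<dots> = (\<Sum>a\<in>I. \<Sum>b\<in>I. 2 * (vv a * vv b * (mixed_kf x a b)\<^sup>2))"
    by (intro sum.cong refl) (simp only: mixed_kf_sq sum_distrib_left)
  finally show ?thesis by (simp add: sum_distrib_left)
qed

lemma I1e_quad: "(\<Sum>j\<le>s. \<Sum>k\<le>s. x j * I1e j k * x k) =
   (\<Sum>a\<in>I. kk a * (mixed_kf x a a)\<^sup>2) + (\<Sum>j\<le>s. \<Sum>k\<le>s. x j * Gmat d \<theta> $$ (j, k) * x k)"
proof -
  have "(\<Sum>j\<le>s. \<Sum>k\<le>s. x j * I1e j k * x k) = (\<Sum>j\<le>s. \<Sum>k\<le>s. (\<Sum>a\<in>I. kk a * ((x j * kf j a a) * (x k * kf k a a))) + x j * Gmat d \<theta> $$ (j, k) * x k)"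
    by (intro sum.cong refl) (simp add: I1e_kf distrib_left distrib_right sum_distrib_left sum_distrib_right mult_ac)
  also have "\<dots> = (\<Sum>j\<le>s. \<Sum>k\<le>s. \<Sum>a\<in>I. kk a * ((x j * kf j a a) * (x k * kf k a a))) + (\<Sum>j\<le>s. \<Sum>k\<le>s. x j * Gmat d \<theta> $$ (j, k) * x k)"
    by (simp add: sum.distrib)
  also have "(\<Sum>j\<le>s. \<Sum>k\<le>s. \<Sum>a\<in>I. kk a * ((x j * kf j a a) * (x k * kf k a a))) = (\<Sum>a\<in>I. \<Sum>j\<le>s. \<Sum>k\<le>s. kk a * ((x j * kf j a a) * (x k * kf k a a)))"
    by (rule sum_swap3)
  also have "\<dots> = (\<Sum>a\<in>I. kk a * (mixed_kf x a a)\<^sup>2)" by (intro sum.cong refl) (simp only: mixed_kf_sq sum_distrib_left)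
  finally show ?thesis .
qed

lemma vv_pos: "a \<in> I \<Longrightarrow> 0 < vv a" using sig_pos by auto

lemma diag_le: "(\<Sum>a\<in>I. (vv a * mixed_kf x a a)\<^sup>2) \<le> (\<Sum>a\<in>I. \<Sum>b\<in>I. vv a * vv b * (mixed_kf x a b)\<^sup>2)"
proof (rule sum_mono)
  fix a assume a: "a \<in> I"
  have "(vv a * mixed_kf x a a)\<^sup>2 = vv a * vv a * (mixed_kf x a a)\<^sup>2" by (simp add: power_mult_distrib power2_eq_square)
  also have "\<dots> \<le> (\<Sum>b\<in>I. vv a * vv b * (mixed_kf x a b)\<^sup>2)"
  proof (rule member_le_sum[OF a _ finite_A])
    fix b assume "b \<in> I - {a}"
    then show "0 \<le> vv a * vv b * (mixed_kf x a b)\<^sup>2" using vv_pos[OF a] vv_pos[of b] by simp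
  qed
  finally show "(vv a * mixed_kf x a a)\<^sup>2 \<le> (\<Sum>b\<in>I. vv a * vv b * (mixed_kf x a b)\<^sup>2)" .
qed

lemma G_quad_nonneg: "0 \<le> (\<Sum>j\<le>s. \<Sum>k\<le>s. x j * Gmat d \<theta> $$ (j, k) * x k)"
  unfolding G_quad by (intro mult_nonneg_nonneg sum_nonneg) (use vv_pos in \<open>auto intro!: less_imp_le\<close>)

lemma I1e_quad_upper:
  "(\<Sum>j\<le>s. \<Sum>k\<le>s. x j * I1e j k * x k) \<le> (1 + Kmax s D) * (\<Sum>j\<le>s. \<Sum>k\<le>s. x j * Gmat d \<theta> $$ (j, k) * x k)"
proof -
  let ?G = "\<Sum>j\<le>s. \<Sum>k\<le>s. x j * Gmat d \<theta> $$ (j, k) * x k"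
  have "(\<Sum>a\<in>I. kk a * (mixed_kf x a a)\<^sup>2) \<le> (\<Sum>a\<in>I. Kmax s D * (vv a * mixed_kf x a a)\<^sup>2)"
  proof (rule sum_mono)
    fix a assume "a \<in> I"
    then have "kk a \<le> Kmax s D * (vv a)\<^sup>2" using kap_le[of "fst a"] by auto
    then have "kk a * (mixed_kf x a a)\<^sup>2 \<le> Kmax s D * (vv a)\<^sup>2 * (mixed_kf x a a)\<^sup>2" by (intro mult_right_mono) auto
    then show "kk a * (mixed_kf x a a)\<^sup>2 \<le> Kmax s D * (vv a * mixed_kf x a a)\<^sup>2" by (simp add: power_mult_distrib)
  qed
  also have "\<dots> = Kmax s D * (\<Sum>a\<in>I. (vv a * mixed_kf x a a)\<^sup>2)" by (simp add: sum_distrib_left)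
  also have "\<dots> \<le> Kmax s D * (\<Sum>a\<in>I. \<Sum>b\<in>I. vv a * vv b * (mixed_kf x a b)\<^sup>2)"
    by (intro mult_left_mono diag_le Kmax_nonneg)
  also have "\<dots> \<le> Kmax s D * ?G" using G_quad_nonneg[of x] unfolding G_quad by (intro mult_left_mono Kmax_nonneg) auto
  finally show ?thesis unfolding I1e_quad by (simp add: algebra_simps)
qed

text \<open>Write D for the diagonal part and F for the full sum, so that D \<le> F and the Gaussian
  form is 2 F. The kurtosis condition gives at least \<open>(2 r - 2) D + 2 F\<close>; as
  \<open>r \<le> 1\<close>, replacing D by F only lowers this, to 2 r F.\<close>

lemma I1e_quad_lower:
  assumes r: "0 < r" "r \<le> 1" "\<And>t. t \<le> s \<Longrightarrow> 2 * r * (sig D t)\<^sup>2 \<le> kap D t + 2 * (sig D t)\<^sup>2"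
  shows "r * (\<Sum>j\<le>s. \<Sum>k\<le>s. x j * Gmat d \<theta> $$ (j, k) * x k) \<le> (\<Sum>j\<le>s. \<Sum>k\<le>s. x j * I1e j k * x k)"
proof -
  let ?D = "\<Sum>a\<in>I. (vv a * mixed_kf x a a)\<^sup>2" and ?F = "\<Sum>a\<in>I. \<Sum>b\<in>I. vv a * vv b * (mixed_kf x a b)\<^sup>2"
  have "(2 * r - 2) * ?D \<le> (\<Sum>a\<in>I. kk a * (mixed_kf x a a)\<^sup>2)" unfolding sum_distrib_left
  proof (rule sum_mono)
    fix a assume "a \<in> I"
    then have "(2 * r - 2) * (vv a)\<^sup>2 \<le> kk a" using r(3)[of "fst a"] by (auto simp: left_diff_distrib)
    then have "(2 * r - 2) * (vv a)\<^sup>2 * (mixed_kf x a a)\<^sup>2 \<le> kk a * (mixed_kf x a a)\<^sup>2" by (intro mult_right_mono) auto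
    then show "(2 * r - 2) * (vv a * mixed_kf x a a)\<^sup>2 \<le> kk a * (mixed_kf x a a)\<^sup>2" by (simp add: power_mult_distrib mult.assoc)
  qed
  moreover have "(2 * r - 2) * ?F \<le> (2 * r - 2) * ?D" by (rule mult_left_mono_neg[OF diag_le]) (use r in simp)
  ultimately show ?thesis unfolding I1e_quad G_quad by (simp add: algebra_simps)
qed

end

section \<open>The error of the estimator near the true parameter\<close>

lemma mat_trace_le:
  assumes "A \<in> carrier_mat n n" "opbound A r"
  shows "\<bar>mat_trace A\<bar> \<le> real n * r"
proof -
  have "\<bar>mat_trace A\<bar> \<le> (\<Sum>i<n. \<bar>A $$ (i, i)\<bar>)" using assms(1) by (simp add: mat_trace_def sum_abs)
  also have "\<dots> \<le> (\<Sum>i<n. r)" by (intro sum_mono opbound_entry[OF assms]) auto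
  finally show ?thesis by simp
qed

lemma abs_mult_diff_le:
  fixes a b a' b' :: real
  assumes "\<bar>a\<bar> \<le> K" "\<bar>b'\<bar> \<le> K" "\<bar>a - a'\<bar> \<le> e" "\<bar>b - b'\<bar> \<le> e"
  shows "\<bar>a * b - a' * b'\<bar> \<le> 2 * K * e"
proof -
  have "a * b - a' * b' = a * (b - b') + (a - a') * b'" by (simp add: algebra_simps)
  also have "\<bar>\<dots>\<bar> \<le> \<bar>a\<bar> * \<bar>b - b'\<bar> + \<bar>a - a'\<bar> * \<bar>b'\<bar>" by (rule order_trans[OF abs_triangle_ineq]) (simp add: abs_mult)
  also have "\<dots> \<le> K * e + e * K" using assms by (intro add_mono mult_mono) (auto intro: order_trans[OF abs_ge_zero])
  finally show ?thesis by simp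
qed

lemma abs_error_sum:
  fixes g l :: real
  assumes "\<bar>g\<bar> \<le> a" "\<bar>x1\<bar> \<le> b1" "\<bar>x2\<bar> \<le> b2" "\<bar>x3\<bar> \<le> b3" "\<bar>x4\<bar> \<le> b4"
  shows "\<bar>g + (l + x1 + x2) - 3 * (x3 + x4)\<bar> \<le> a + \<bar>l\<bar> + b1 + b2 + 3 * b3 + 3 * b4"
proof -
  have "g \<le> a" "- g \<le> a" "x1 \<le> b1" "- x1 \<le> b1" "x2 \<le> b2" "- x2 \<le> b2" "x3 \<le> b3" "- x3 \<le> b3" "x4 \<le> b4" "- x4 \<le> b4" "l \<le> \<bar>l\<bar>" "- l \<le> \<bar>l\<bar>"
    using assms by (auto simp: abs_le_iff)
  then show ?thesis unfolding distrib_left by (intro abs_leI) linarith+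
qed

locale lmm_bounded = lmm d s M D \<alpha> \<beta> y \<theta> for d s M D \<alpha> \<beta> y \<theta> +
  fixes C :: real
  assumes X_row: "\<And>i. i < nobs d \<Longrightarrow> vec_norm2 (row (Xmat d) i) \<le> C"
    and Z_row: "\<And>i t. i < nobs d \<Longrightarrow> t \<in> {1..s} \<Longrightarrow> vec_norm1 (row (Zmat d t) i) \<le> C"
begin

text \<open>These constants depend only on s, C, the distributions and the true parameter, so they
  are common to all sample sizes. \<open>CW\<close> bounds the l1 norm of the coefficients of one
  observation, the 1 coming from its error; \<open>CV\<close> bounds the entries of V near the true
  parameter.\<close>

definition "CW = 1 + real s * C"
definition "c1 = \<theta> $ 0 + 1 + (\<Sum>t\<le>s. gam \<theta> t)"
definition "Fm = (\<Sum>t\<le>s. \<integral>x. x ^ 4 \<partial>D t)"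
definition "CV = (\<Sum>t\<le>s. sig D t + c1) * CW\<^sup>2"

lemma C_nonneg: "0 \<le> C" using X_row[OF N_pos] vec_norm2_nonneg order_trans by blast

lemma CW: "1 \<le> CW" using C_nonneg by (simp add: CW_def)

lemma c1_pos: "0 < c1" unfolding c1_def using theta_pos
  by (intro add_pos_nonneg sum_nonneg) (auto simp: gam_def intro: less_imp_le add_pos_pos)

lemma ww_row: assumes i: "i < N" shows "(\<Sum>a\<in>I. \<bar>ww i a\<bar>) \<le> CW"
proof -
  have "(\<Sum>a\<in>I. \<bar>ww i a\<bar>) = (\<Sum>(t, l)\<in>I. \<bar>Z t $$ (i, l)\<bar>)" by (intro sum.cong refl) auto
  also have "\<dots> = (\<Sum>t\<le>s. \<Sum>l<nlev d t. \<bar>Z t $$ (i, l)\<bar>)" by (subst sum.Sigma) auto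
  also have "\<dots> \<le> (\<Sum>t\<le>s. if t = 0 then 1 else C)"
  proof (rule sum_mono)
    fix t assume "t \<in> {..s}"
    then have t: "t \<le> s" by simp
    show "(\<Sum>l<nlev d t. \<bar>Z t $$ (i, l)\<bar>) \<le> (if t = 0 then 1 else C)"
    proof (cases "t = 0")
      case True
      have "(\<Sum>l<N. \<bar>1\<^sub>m N $$ (i, l) :: real\<bar>) = (\<Sum>l<N. if l = i then 1 else 0)"
        using i by (intro sum.cong refl) auto
      then show ?thesis using True i by (simp add: nlev_0) (simp add: Zmat_def)
    next
      case False
      have "vec_norm1 (row (Z t) i) = (\<Sum>l<nlev d t. \<bar>Z t $$ (i, l)\<bar>)" unfolding vec_norm1_def using Z[OF t] i by simp
      then show ?thesis using False t Z_row[OF i, of t] by simp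
    qed
  qed
  also have "\<dots> = CW" by (simp add: CW_def sum.atMost_shift)
  finally show ?thesis .
qed

lemma S_entry: assumes t: "t \<le> s" and ij: "i < N" "j < N" shows "\<bar>S t $$ (i, j)\<bar> \<le> CW\<^sup>2"
proof -
  have row: "(\<Sum>l<nlev d t. \<bar>Z t $$ (i, l)\<bar>) \<le> CW" if i: "i < N" for i
  proof -
    have "(\<Sum>l<nlev d t. \<bar>Z t $$ (i, l)\<bar>) = (\<Sum>a\<in>{t} \<times> {..<nlev d t}. \<bar>ww i a\<bar>)" by (simp add: sum.cartesian_product')
    also have "\<dots> \<le> (\<Sum>a\<in>I. \<bar>ww i a\<bar>)" by (rule sum_mono2) (use t finite_A in auto)
    finally show ?thesis using ww_row[OF i] by simp
  qed
  have "\<bar>S t $$ (i, j)\<bar> \<le> (\<Sum>l<nlev d t. \<bar>Z t $$ (i, l)\<bar> * \<bar>Z t $$ (j, l)\<bar>)"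
    unfolding S_index[OF t ij] by (auto simp: abs_mult[symmetric] intro: sum_abs)
  also have "\<dots> \<le> (\<Sum>l<nlev d t. \<bar>Z t $$ (i, l)\<bar> * CW)"
  proof (intro sum_mono mult_left_mono)
    fix l assume "l \<in> {..<nlev d t}"
    then have "\<bar>Z t $$ (j, l)\<bar> \<le> (\<Sum>l<nlev d t. \<bar>Z t $$ (j, l)\<bar>)" by (intro member_le_sum) auto
    then show "\<bar>Z t $$ (j, l)\<bar> \<le> CW" using row[OF ij(2)] by simp
  qed auto
  also have "\<dots> = (\<Sum>l<nlev d t. \<bar>Z t $$ (i, l)\<bar>) * CW" by (simp add: sum_distrib_right)
  also have "\<dots> \<le> CW * CW" by (rule mult_right_mono[OF row[OF ij(1)]]) (use CW in simp)
  finally show ?thesis by (simp add: power2_eq_square)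
qed

lemma V_entry:
  assumes \<theta>': "\<theta>' \<in> param_nbhd s \<theta> \<delta>" and \<delta>: "\<delta> \<le> 1" and ij: "i < N" "j < N"
  shows "\<bar>Vmat d \<theta>' $$ (i, j)\<bar> \<le> CV" "\<bar>Vmat d \<theta>' $$ (i, j) - Vt $$ (i, j)\<bar> \<le> real (s + 1) * c1 * CW\<^sup>2 * \<delta>"
proof -
  have td: "\<bar>tau \<theta>' t - tau \<theta> t\<bar> \<le> c1 * \<delta>" if "t \<le> s" for t
    using tau_diff(1)[OF \<theta>' \<delta> that] by (simp add: c1_def)
  have \<delta>0: "0 \<le> \<delta>" using tau_diff(2)[OF \<theta>' \<delta>, of 0] by simp
  have t_le: "\<bar>tau \<theta>' t\<bar> \<le> sig D t + c1" if t: "t \<le> s" for t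
  proof -
    have "\<bar>tau \<theta>' t\<bar> \<le> tau \<theta> t + c1 * \<delta>" using td[OF t] theta_index[OF t] sig_pos[OF t] by linarith
    also have "c1 * \<delta> \<le> c1" using c1_pos \<delta> by simp
    finally show ?thesis using theta_index[OF t] by simp
  qed
  have "\<bar>Vmat d \<theta>' $$ (i, j)\<bar> \<le> (\<Sum>t\<le>s. \<bar>tau \<theta>' t\<bar> * \<bar>S t $$ (i, j)\<bar>)"
    unfolding Vmat_index[OF ij] by (auto simp: abs_mult[symmetric] intro: sum_abs)
  also have "\<dots> \<le> (\<Sum>t\<le>s. (sig D t + c1) * CW\<^sup>2)"
    by (intro sum_mono mult_mono t_le S_entry ij) (use less_imp_le[OF add_pos_pos[OF sig_pos c1_pos]] in auto)
  finally show "\<bar>Vmat d \<theta>' $$ (i, j)\<bar> \<le> CV" unfolding CV_def sum_distrib_right .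
  have "\<bar>Vmat d \<theta>' $$ (i, j) - Vt $$ (i, j)\<bar> \<le> (\<Sum>t\<le>s. \<bar>tau \<theta>' t - tau \<theta> t\<bar> * \<bar>S t $$ (i, j)\<bar>)"
    unfolding Vmat_index[OF ij] sum_subtractf[symmetric] left_diff_distrib[symmetric] by (auto simp: abs_mult[symmetric] intro: sum_abs)
  also have "\<dots> \<le> (\<Sum>t\<le>s. (c1 * \<delta>) * CW\<^sup>2)"
    by (intro sum_mono mult_mono td S_entry ij) (use c1_pos \<delta>0 in auto)
  finally show "\<bar>Vmat d \<theta>' $$ (i, j) - Vt $$ (i, j)\<bar> \<le> real (s + 1) * c1 * CW\<^sup>2 * \<delta>" by (simp add: mult_ac)
qed

lemma theta_nbhd: "0 \<le> \<delta> \<Longrightarrow> \<theta> \<in> param_nbhd s \<theta> \<delta>"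
proof -
  assume "0 \<le> \<delta>"
  moreover have "\<theta> - \<theta> = 0\<^sub>v (s + 1)" using theta_carrier by auto
  ultimately show ?thesis using theta_param by (simp add: param_nbhd_def)
qed

text \<open>The bound may depend on the design; it only serves to show that the suprema in
  \<open>gdev\<close> and \<open>cdev\<close> are finite.\<close>

lemma Bmat_bounded:
  assumes \<delta>: "\<delta> \<le> 1" "\<delta> \<le> \<theta> $ 0 / 2"
  shows "\<exists>b\<ge>0. \<forall>\<theta>'\<in>param_nbhd s \<theta> \<delta>. \<forall>j\<le>s. opbound (Bmat d \<theta>' j) b"
proof -
  define l where "l = \<theta> $ 0 / 2"
  have l: "0 < l" using theta_pos[of 0] by (simp add: l_def)
  have "\<exists>r. \<forall>t. 0 < r t \<and> opbound (S t) (r t)" by (rule choice) (use opbound_exists in blast)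
  then obtain r where r: "\<And>t. 0 < r t" "\<And>t. opbound (S t) (r t)" by blast
  define b where "b = 1 / (2 * l) * (1 / l) + (\<theta> $ 0 + 1) / 2 * (1 / l * ((\<Sum>t\<le>s. r t) * (1 / l)))"
  have rs: "0 \<le> (\<Sum>t\<le>s. r t)" by (intro sum_nonneg less_imp_le r)
  have parts: "0 \<le> 1 / (2 * l) * (1 / l)" "0 \<le> (\<theta> $ 0 + 1) / 2 * (1 / l * ((\<Sum>t\<le>s. r t) * (1 / l)))"
    using l rs theta_pos[of 0] by auto
  then have b_ge: "1 / (2 * l) * (1 / l) \<le> b" "(\<theta> $ 0 + 1) / 2 * (1 / l * ((\<Sum>t\<le>s. r t) * (1 / l))) \<le> b"
    unfolding b_def by linarith+
  have "opbound (Bmat d \<theta>' j) b" if \<theta>': "\<theta>' \<in> param_nbhd s \<theta> \<delta>" and j: "j \<le> s" for \<theta>' j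
  proof -
    have p: "\<theta>' \<in> param_space s" using \<theta>' by (simp add: param_nbhd_def)
    have d0: "\<bar>\<theta>' $ 0 - \<theta> $ 0\<bar> \<le> \<delta>" by (rule tau_diff(2)[OF \<theta>' \<delta>(1), of 0]) simp
    have tl: "l \<le> \<theta>' $ 0" "\<theta>' $ 0 \<le> \<theta> $ 0 + 1" using d0 \<delta> unfolding l_def by linarith+
    note P = Pmat[OF p]
    have "1 / \<theta>' $ 0 \<le> 1 / l" using tl l by (simp add: field_simps)
    then have Pb: "opbound (Pmat d \<theta>') (1 / l)" by (rule opbound_mono[OF P(5)])
    show ?thesis
    proof (cases "j = 0")
      case True
      have "opbound (Bmat d \<theta>' j) (\<bar>1 / (2 * \<theta>' $ 0)\<bar> * (1 / l))"
        unfolding Bmat_def if_P[OF True] by (rule opbound_smult[OF Pb])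
      moreover have "\<bar>1 / (2 * \<theta>' $ 0)\<bar> * (1 / l) \<le> 1 / (2 * l) * (1 / l)"
        using tl l by (intro mult_right_mono) (auto simp: field_simps)
      ultimately show ?thesis by (rule opbound_mono[OF _ order_trans[OF _ b_ge(1)]])
    next
      case False
      have "r j \<le> (\<Sum>t\<le>s. r t)" using j r by (intro member_le_sum) (auto intro: less_imp_le)
      then have "opbound (S j) (\<Sum>t\<le>s. r t)" by (rule opbound_mono[OF r(2)])
      then have "opbound (Pmat d \<theta>' * (S j * Pmat d \<theta>')) (1 / l * ((\<Sum>t\<le>s. r t) * (1 / l)))"
        by (intro opbound_mult[OF P(1) mult_carrier_mat[OF S(1)[OF j] P(1)] Pb] opbound_mult[OF S(1)[OF j] P(1) _ Pb])
      from opbound_smult[OF this, of "\<theta>' $ 0 / 2"]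
      have "opbound (Bmat d \<theta>' j) (\<bar>\<theta>' $ 0 / 2\<bar> * (1 / l * ((\<Sum>t\<le>s. r t) * (1 / l))))"
        using False P(1) Z[OF j] by (simp add: Bmat_def Smat_def mat_assoc)
      moreover have "\<bar>\<theta>' $ 0 / 2\<bar> * (1 / l * ((\<Sum>t\<le>s. r t) * (1 / l))) \<le> (\<theta> $ 0 + 1) / 2 * (1 / l * ((\<Sum>t\<le>s. r t) * (1 / l)))"
        using tl l rs by (intro mult_right_mono) auto
      ultimately show ?thesis by (rule opbound_mono[OF _ order_trans[OF _ b_ge(2)]])
    qed
  qed
  then show ?thesis using parts by (intro exI[of _ b]) (auto simp: b_def)
qed

text \<open>The suprema defining gdev and cdev are over bounded sets, hence genuine.\<close>

lemma dev_bounds: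
  assumes \<delta>: "0 \<le> \<delta>" "\<delta> \<le> 1" "\<delta> \<le> \<theta> $ 0 / 2" and j: "j \<le> s" and k: "k \<le> s" and \<theta>': "\<theta>' \<in> param_nbhd s \<theta> \<delta>"
  shows gdev_ge: "\<bar>Gmat d \<theta>' $$ (j, k) - Gmat d \<theta> $$ (j, k)\<bar> \<le> gdev d \<theta> j k \<delta>"
    and cdev_ge: "\<phi> \<in> fvals d \<Longrightarrow> \<bar>ccoef d \<theta>' j k \<phi> - ccoef d \<theta> j k \<phi>\<bar> \<le> cdev d \<theta> j k \<phi> \<delta>"
proof -
  obtain b where b: "0 \<le> b" "\<And>\<theta>' j. \<theta>' \<in> param_nbhd s \<theta> \<delta> \<Longrightarrow> j \<le> s \<Longrightarrow> opbound (Bmat d \<theta>' j) b"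
    using Bmat_bounded[OF \<delta>(2,3)] by blast
  have p: "\<theta>' \<in> param_space s" if "\<theta>' \<in> param_nbhd s \<theta> \<delta>" for \<theta>' using that by (simp add: param_nbhd_def)
  note th = theta_nbhd[OF \<delta>(1)]
  define K where "K = real N * real N * CV"
  have CV0: "0 \<le> CV" using V_entry(1)[OF th \<delta>(2) N_pos N_pos] by linarith
  have Vb: "opbound (Vmat d \<theta>') K" if "\<theta>' \<in> param_nbhd s \<theta> \<delta>" for \<theta>'
    unfolding K_def by (rule opbound_of_entries[OF Vmat V_entry(1)[OF that \<delta>(2)] CV0])
  have G: "\<bar>Gmat d \<theta>' $$ (j, k)\<bar> \<le> 2 * (real N * (b * K * b * K))" if \<theta>': "\<theta>' \<in> param_nbhd s \<theta> \<delta>" for \<theta>'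
  proof -
    note B = Bmat(1)[OF p[OF \<theta>']]
    have c: "Bmat d \<theta>' j * Vmat d \<theta>' \<in> carrier_mat N N" "Bmat d \<theta>' j * Vmat d \<theta>' * Bmat d \<theta>' k \<in> carrier_mat N N"
      "Bmat d \<theta>' j * Vmat d \<theta>' * Bmat d \<theta>' k * Vmat d \<theta>' \<in> carrier_mat N N"
      by (intro mult_carrier_mat[of _ N N] B j k Vmat)+
    have "opbound (Bmat d \<theta>' j * Vmat d \<theta>' * Bmat d \<theta>' k * Vmat d \<theta>') (b * K * b * K)"
      by (intro opbound_mult[OF c(2) Vmat] opbound_mult[OF c(1) B[OF k]] opbound_mult[OF B[OF j] Vmat] b(2) Vb \<theta>' j k)
    from mat_trace_le[OF c(3) this] show ?thesis unfolding Gmat_index[OF j k] by (simp add: abs_mult)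
  qed
  show "\<bar>Gmat d \<theta>' $$ (j, k) - Gmat d \<theta> $$ (j, k)\<bar> \<le> gdev d \<theta> j k \<delta>" unfolding gdev_def nranef
  proof (rule cSUP_upper[OF \<theta>'], rule bdd_aboveI2)
    fix \<theta>'' assume "\<theta>'' \<in> param_nbhd s \<theta> \<delta>"
    from G[OF this] G[OF th] show "\<bar>Gmat d \<theta>'' $$ (j, k) - Gmat d \<theta> $$ (j, k)\<bar> \<le> 2 * (2 * (real N * (b * K * b * K)))"
      by linarith
  qed
  show "\<bar>ccoef d \<theta>' j k \<phi> - ccoef d \<theta> j k \<phi>\<bar> \<le> cdev d \<theta> j k \<phi> \<delta>" if \<phi>: "\<phi> \<in> fvals d"
  proof -
    have c: "\<bar>ccoef d \<theta>' j k \<phi>\<bar> \<le> b * b" if \<theta>': "\<theta>' \<in> param_nbhd s \<theta> \<delta>" for \<theta>'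
    proof -
      have "\<bar>\<Sum>(i1, i2, i3, i4)\<in>fclass d \<phi>. Bmat d \<theta>' j $$ (i1, i2) * Bmat d \<theta>' k $$ (i3, i4)\<bar> \<le> (\<Sum>q\<in>fclass d \<phi>. b * b)"
      proof (rule order_trans[OF sum_abs], rule sum_mono)
        fix q assume q: "q \<in> fclass d \<phi>"
        obtain i1 i2 i3 i4 where q4: "q = (i1, i2, i3, i4)" by (cases q) auto
        have i: "i1 < N" "i2 < N" "i3 < N" "i4 < N" using q by (auto simp: q4 fclass_def quads_def)
        have "\<bar>Bmat d \<theta>' j $$ (i1, i2)\<bar> * \<bar>Bmat d \<theta>' k $$ (i3, i4)\<bar> \<le> b * b"
          by (intro mult_mono opbound_entry[OF Bmat(1)[OF p[OF \<theta>']] b(2)[OF \<theta>']] j k i b(1)) auto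
        then show "\<bar>case q of (i1, i2, i3, i4) \<Rightarrow> Bmat d \<theta>' j $$ (i1, i2) * Bmat d \<theta>' k $$ (i3, i4)\<bar> \<le> b * b"
          by (simp add: q4 abs_mult)
      qed
      then show ?thesis using hcount_pos[OF \<phi>] by (simp add: ccoef_def abs_mult hcount_def[symmetric] field_simps)
    qed
    show ?thesis unfolding cdev_def nranef
    proof (rule cSUP_upper[OF \<theta>'], rule bdd_aboveI2)
      fix \<theta>'' assume "\<theta>'' \<in> param_nbhd s \<theta> \<delta>"
      from c[OF this] c[OF th] show "\<bar>ccoef d \<theta>'' j k \<phi> - ccoef d \<theta> j k \<phi>\<bar> \<le> 2 * (b * b)" by linarith
    qed
  qed
qed

section \<open>Pairs of quadruples that share a random effect\<close>

definition overlap :: "(quad \<times> quad) set" where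
  "overlap = {(q1, q2). (\<Sum>t\<le>nranef d. \<Sum>l<nlev d t. dsum d q1 t l * dsum d q2 t l) \<noteq> 0}"

text \<open>Sorting both quadruples into classes turns the indicator of overlap into the count
  \<open>hcount2\<close>, the quantity controlled by condition (iv).\<close>

lemma overlap_sum:
  "(\<Sum>(q, q')\<in>(nonzero_quads d \<times> nonzero_quads d) \<inter> overlap. \<bar>c (fcoef d q)\<bar> * \<bar>c (fcoef d q')\<bar>) =
   (\<Sum>\<phi>1\<in>fvals d. \<Sum>\<phi>2\<in>fvals d. real (hcount2 d \<phi>1 \<phi>2) * \<bar>c \<phi>1 * c \<phi>2\<bar>)"
proof -
  define ind where "ind q q' = (if (q, q') \<in> overlap then 1 else (0::real))" for q q'
  have "(\<Sum>(q, q')\<in>(nonzero_quads d \<times> nonzero_quads d) \<inter> overlap. \<bar>c (fcoef d q)\<bar> * \<bar>c (fcoef d q')\<bar>) =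
     (\<Sum>x\<in>nonzero_quads d \<times> nonzero_quads d. if x \<in> overlap then (case x of (q, q') \<Rightarrow> \<bar>c (fcoef d q)\<bar> * \<bar>c (fcoef d q')\<bar>) else 0)"
    by (rule sum.inter_restrict) simp
  also have "\<dots> = (\<Sum>q\<in>nonzero_quads d. \<Sum>q'\<in>nonzero_quads d. ind q q' * (\<bar>c (fcoef d q)\<bar> * \<bar>c (fcoef d q')\<bar>))"
    unfolding sum.cartesian_product by (intro sum.cong refl) (auto simp: ind_def simp del: fcoef.simps)
  also have "\<dots> = (\<Sum>\<phi>1\<in>fvals d. \<Sum>q\<in>fclass d \<phi>1. \<Sum>\<phi>2\<in>fvals d. \<Sum>q'\<in>fclass d \<phi>2. ind q q' * (\<bar>c \<phi>1\<bar> * \<bar>c \<phi>2\<bar>))"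
    unfolding sum_by_class by (intro sum.cong refl) (simp add: fclass_def)
  also have "\<dots> = (\<Sum>\<phi>1\<in>fvals d. \<Sum>\<phi>2\<in>fvals d. \<Sum>q\<in>fclass d \<phi>1. \<Sum>q'\<in>fclass d \<phi>2. ind q q' * (\<bar>c \<phi>1\<bar> * \<bar>c \<phi>2\<bar>))"
    by (rule sum.cong[OF refl], rule sum.swap)
  also have "\<dots> = (\<Sum>\<phi>1\<in>fvals d. \<Sum>\<phi>2\<in>fvals d. real (hcount2 d \<phi>1 \<phi>2) * \<bar>c \<phi>1 * c \<phi>2\<bar>)"
  proof (intro sum.cong refl)
    fix \<phi>1 \<phi>2
    have "(\<Sum>q\<in>fclass d \<phi>1. \<Sum>q'\<in>fclass d \<phi>2. ind q q') = (\<Sum>x\<in>fclass d \<phi>1 \<times> fclass d \<phi>2. if x \<in> overlap then 1 else 0)"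
      unfolding sum.cartesian_product by (intro sum.cong refl) (auto simp: ind_def)
    also have "\<dots> = (\<Sum>x\<in>(fclass d \<phi>1 \<times> fclass d \<phi>2) \<inter> overlap. 1)"
      by (rule sum.inter_restrict[symmetric]) simp
    also have "\<dots> = real (card ((fclass d \<phi>1 \<times> fclass d \<phi>2) \<inter> overlap))" by simp
    also have "(fclass d \<phi>1 \<times> fclass d \<phi>2) \<inter> overlap = {(q1, q2) \<in> fclass d \<phi>1 \<times> fclass d \<phi>2. (\<Sum>t\<le>nranef d. \<Sum>l<nlev d t. dsum d q1 t l * dsum d q2 t l) \<noteq> 0}"
      unfolding overlap_def by blast
    finally have "(\<Sum>q\<in>fclass d \<phi>1. \<Sum>q'\<in>fclass d \<phi>2. ind q q') = real (hcount2 d \<phi>1 \<phi>2)" by (simp only: hcount2_def)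
    then show "(\<Sum>q\<in>fclass d \<phi>1. \<Sum>q'\<in>fclass d \<phi>2. ind q q' * (\<bar>c \<phi>1\<bar> * \<bar>c \<phi>2\<bar>)) = real (hcount2 d \<phi>1 \<phi>2) * \<bar>c \<phi>1 * c \<phi>2\<bar>"
      by (simp add: sum_distrib_right[symmetric] abs_mult)
  qed
  finally show ?thesis .
qed

text \<open>The sum in \<open>overlap\<close> is over products of natural numbers, so if it vanishes
  then each product does, and in each product one of the two factors.\<close>

lemma not_overlap:
  assumes "(q, q') \<notin> overlap" and a: "a \<in> I"
  shows "(\<forall>i\<in>quad_set q. ww i a = 0) \<or> (\<forall>i\<in>quad_set q'. ww i a = 0)"
proof -
  obtain t l where tl: "a = (t, l)" "t \<le> s" "l < nlev d t" using a by auto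
  have "(\<Sum>t\<le>nranef d. \<Sum>l<nlev d t. dsum d q t l * dsum d q' t l) = 0" using assms(1) by (simp add: overlap_def)
  then have "dsum d q t l * dsum d q' t l = 0" using tl by (simp add: nranef)
  then have z: "dsum d q t l = 0 \<or> dsum d q' t l = 0" by simp
  have *: "\<forall>i\<in>quad_set q. ww i a = 0" if "dsum d q t l = 0" for q
  proof -
    obtain i1 i2 i3 i4 where q4: "q = (i1, i2, i3, i4)" by (cases q) auto
    show ?thesis
    proof
      fix i assume "i \<in> quad_set q"
      then have "dind d i t l = 0" using \<open>dsum d q t l = 0\<close> by (auto simp: q4)
      then have "Z t $$ (i, l) = 0" unfolding dind_def by (rule contrapos_pp) simp
      then show "ww i a = 0" by (simp add: tl)
    qed
  qed
  show ?thesis using z *[of q] *[of q'] by blast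
qed

fun quad_sum :: "(nat \<Rightarrow> real) \<Rightarrow> quad \<Rightarrow> real" where
  "quad_sum f (i, j, k, l) = f i + f j + f k + f l"

lemma quad_sum_integral:
  assumes q: "q \<in> quads d" and f: "\<And>i. i < N \<Longrightarrow> integrable M (\<lambda>z. f i z)" "\<And>i. i < N \<Longrightarrow> (\<integral>z. f i z \<partial>M) \<le> b"
  shows "integrable M (\<lambda>z. quad_sum (\<lambda>i. f i z) q)" "(\<integral>z. quad_sum (\<lambda>i. f i z) q \<partial>M) \<le> 4 * b"
proof -
  obtain i1 i2 i3 i4 where q4: "q = (i1, i2, i3, i4)" by (cases q) auto
  have i: "i1 < N" "i2 < N" "i3 < N" "i4 < N" using q by (auto simp: q4 quads_def)
  show "integrable M (\<lambda>z. quad_sum (\<lambda>i. f i z) q)" using f(1) i by (simp add: q4)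
  show "(\<integral>z. quad_sum (\<lambda>i. f i z) q \<partial>M) \<le> 4 * b"
    using f(1) i f(2)[OF i(1)] f(2)[OF i(2)] f(2)[OF i(3)] f(2)[OF i(4)] by (simp add: q4)
qed

lemma xi_fourth: "a \<in> I \<Longrightarrow> (\<integral>z. xi a z ^ 4 \<partial>M) \<le> Fm" "0 \<le> Fm"
proof -
  have nn: "0 \<le> (\<integral>x. x ^ 4 \<partial>D t)" for t by (rule integral_nonneg_AE) simp
  show "0 \<le> Fm" unfolding Fm_def by (intro sum_nonneg nn)
  assume "a \<in> I"
  then have t: "fst a \<le> s" "snd a < nlev d (fst a)" by auto
  have "(\<integral>z. xi a z ^ 4 \<partial>M) = (\<integral>x. x ^ 4 \<partial>D (fst a))" by (rule alpha_integral(1)[OF t]) simp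
  also have "\<dots> \<le> Fm" unfolding Fm_def using t nn by (intro member_le_sum) auto
  finally show "(\<integral>z. xi a z ^ 4 \<partial>M) \<le> Fm" .
qed

lemma u_fourth:
  assumes "i < N"
  shows "integrable M (\<lambda>z. lin (ww i) z ^ 4)" "(\<integral>z. lin (ww i) z ^ 4 \<partial>M) \<le> CW ^ 4 * Fm"
  unfolding lin_def using weighted_sum_fourth_moment[OF finite_A \<xi>_measurable int4 xi_fourth ww_row[OF assms]] by auto

text \<open>The bound Y has to hold for all nearby parameters at once. The error splits into a
  change of the Gaussian information, the centred products of u, residuals in place of u, a change
  of coefficients, and a change of the covariance terms. The random parts are integrated one by one;
  scaling is left to the application.\<close>

lemma poquim_error:
  assumes j: "j \<le> s" and k: "k \<le> s"
    and \<delta>: "0 \<le> \<delta>" "\<delta> \<le> 1" "\<delta> \<le> \<theta> $ 0 / 2" "\<And>t. t \<le> s \<Longrightarrow> 2 * real (s + 1) * (c1 * \<delta>) \<le> sig D t"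
    and L: "0 < L" "\<And>w. w \<in> carrier_vec p \<Longrightarrow> L * (w \<bullet> w) \<le> w \<bullet> ((X\<^sup>T * mat_inv Vt * X) *v w)"
    and e: "0 < e" and h: "0 < h" and B: "0 \<le> B"
    and tr: "\<And>t. t \<le> s \<Longrightarrow> (\<integral>x. (x - trunc B x) ^ 4 \<partial>D t) \<le> t0" "0 \<le> t0"
  defines "\<rho> \<equiv> (16 * (Kmax s D + 3) + 1) * (C\<^sup>2 / L)\<^sup>2"
    and "SC \<equiv> \<Sum>\<phi>\<in>fvals d. real (hcount d \<phi>) * \<bar>ccoef d \<theta> j k \<phi>\<bar>"
    and "SD \<equiv> \<Sum>\<phi>\<in>fvals d. real (hcount d \<phi>) * cdev d \<theta> j k \<phi> \<delta>"
    and "SR \<equiv> \<Sum>\<phi>1\<in>fvals d. \<Sum>\<phi>2\<in>fvals d. real (hcount2 d \<phi>1 \<phi>2) * \<bar>ccoef d \<theta> j k \<phi>1 * ccoef d \<theta> j k \<phi>2\<bar>"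
  shows "\<exists>Y. integrable M Y \<and> (\<forall>z. 0 \<le> Y z) \<and>
    (\<integral>z. Y z \<partial>M) \<le> gdev d \<theta> j k \<delta> +
       (2 * SC * (4 * (CW ^ 4 * t0 / e ^ 12 + 2 * e ^ 4 * (CW ^ 4 * Fm))) + (h + 4 * (CW * B) ^ 8 * SR / h)) +
       SC * (4 * (\<rho> / e ^ 12 + e ^ 4 * (9 * (CW ^ 4 * Fm) + 8 * \<rho>))) +
       SD * (4 * (2 * (CW ^ 4 * Fm + \<rho>))) + 3 * (CV\<^sup>2 * SD) + 3 * (2 * CV * (real (s + 1) * c1 * CW\<^sup>2 * \<delta>) * SC) \<and>
    (\<forall>z\<in>space M. \<forall>\<theta>'\<in>param_nbhd s \<theta> \<delta>. \<bar>poquim d \<theta>' (y z) $$ (j, k) - I1e j k\<bar> \<le> Y z)"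
proof -
  let ?nz = "nonzero_quads d"
  define c where "c q = ccoef d \<theta> j k (fcoef d q)" for q
  define cd where "cd q = cdev d \<theta> j k (fcoef d q) \<delta>" for q
  have SC: "(\<Sum>q\<in>?nz. \<bar>c q\<bar>) = SC" unfolding c_def SC_def by (rule sum_class_const)
  have SD: "(\<Sum>q\<in>?nz. cd q) = SD" unfolding cd_def SD_def by (rule sum_class_const)
  have SR: "(\<Sum>(q, q')\<in>(?nz \<times> ?nz) \<inter> overlap. \<bar>c q\<bar> * \<bar>c q'\<bar>) = SR" unfolding c_def SR_def by (rule overlap_sum)
  have nzq: "q \<in> quads d" if "q \<in> ?nz" for q using that by (simp add: nonzero_quads_def)
  have cd: "\<bar>ccoef d \<theta>' j k (fcoef d q) - c q\<bar> \<le> cd q" if "q \<in> ?nz" "\<theta>' \<in> param_nbhd s \<theta> \<delta>" for q \<theta>'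
    unfolding c_def cd_def by (rule cdev_ge[OF \<delta>(1,2,3) j k that(2) nonzero_quads_vals[OF that(1)]])
  have th: "\<theta> \<in> param_nbhd s \<theta> \<delta>" by (rule theta_nbhd[OF \<delta>(1)])
  have cd0: "0 \<le> cd q" if "q \<in> ?nz" for q using cd[OF that th] by (simp add: c_def del: fcoef.simps)
  have g0: "0 \<le> gdev d \<theta> j k \<delta>" using gdev_ge[OF \<delta>(1,2,3) j k th] by simp
  have CV0: "0 \<le> CV" using V_entry(1)[OF th \<delta>(2) N_pos N_pos] by linarith
  define eV where "eV = real (s + 1) * c1 * CW\<^sup>2 * \<delta>"
  have eV0: "0 \<le> eV" unfolding eV_def using c1_pos \<delta>(1) by simp
  have l: "0 < \<theta> $ 0 / 2" "\<And>a. a \<in> carrier_vec N \<Longrightarrow> \<theta> $ 0 / 2 * (a \<bullet> a) \<le> a \<bullet> (Vt *v a)"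
  proof -
    show "0 < \<theta> $ 0 / 2" using theta_pos[of 0] by simp
    fix a :: "real vec" assume a: "a \<in> carrier_vec N"
    have "\<theta> $ 0 / 2 * (a \<bullet> a) \<le> \<theta> $ 0 * (a \<bullet> a)" using theta_pos[of 0] by (intro mult_right_mono scalar_prod_self_nonneg) simp
    then show "\<theta> $ 0 / 2 * (a \<bullet> a) \<le> a \<bullet> (Vt *v a)" using Vmat_ge[OF theta_param a] by (rule order_trans)
  qed
  have c1\<delta>: "0 \<le> c1 * \<delta>" using c1_pos \<delta>(1) by simp
  obtain R where R: "\<And>i. i < N \<Longrightarrow> integrable M (\<lambda>z. R i z ^ 4)"
    "\<And>i. i < N \<Longrightarrow> (\<integral>z. R i z ^ 4 \<partial>M) \<le> (16 * (Kmax s D + 3) + 1) * (row X i \<bullet> (H *v row X i))\<^sup>2"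
    "\<And>i V' z. i < N \<Longrightarrow> near (c1 * \<delta>) (\<theta> $ 0 / 2) V' \<Longrightarrow> \<bar>(gls_proj X V' *v (mat_inv V' *v uvec z)) $ i\<bar> \<le> R i z"
    using leverage_bound[OF l c1\<delta> \<delta>(4)] by blast
  have R2: "(\<integral>z. R i z ^ 4 \<partial>M) \<le> \<rho>" if i: "i < N" for i
  proof -
    have xr: "row X i \<in> carrier_vec p" using X i by auto
    have "row X i \<bullet> (H *v row X i) \<le> (row X i \<bullet> row X i) / L"
      by (rule H_quad_le[OF xr L(1)]) (use L(2) in \<open>simp add: Vi_def\<close>)
    also have "row X i \<bullet> row X i \<le> C\<^sup>2" unfolding vec_norm2_power2[symmetric] by (intro power_mono X_row i) simp
    finally have "row X i \<bullet> (H *v row X i) \<le> C\<^sup>2 / L" using L(1) by (simp add: divide_right_mono)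
    moreover have "0 \<le> row X i \<bullet> (H *v row X i)"
    proof -
      have "positive_definite H" unfolding H_def by (rule positive_definite_mat_inv[OF information_carrier information_pd])
      then show ?thesis by (rule positive_definite_nonneg[OF H _ xr])
    qed
    ultimately have "(row X i \<bullet> (H *v row X i))\<^sup>2 \<le> (C\<^sup>2 / L)\<^sup>2" by (intro power_mono)
    then have "(16 * (Kmax s D + 3) + 1) * (row X i \<bullet> (H *v row X i))\<^sup>2 \<le> \<rho>"
      unfolding \<rho>_def using Kmax_nonneg by (intro mult_left_mono) auto
    then show ?thesis using R(2)[OF i] by simp
  qed
  define u where "u i z = lin (ww i) z" for i z
  note u4 = u_fourth[folded u_def]
  \<comment> \<open>The bound of \<open>prod4_perturbation\<close> for one index, with the fourth
    power of the residual replaced by \<open>8 * (u ^ 4 + R ^ 4)\<close>; the numbers 9 and 8 in the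
    final bound come from here.\<close>
  define T1 where "T1 i z = R i z ^ 4 / e ^ 12 + e ^ 4 * (8 * (u i z ^ 4 + R i z ^ 4) + u i z ^ 4)" for i z
  \<comment> \<open>The 2 is the 8 of \<open>sum2_power4_le\<close> over the 4 of
    \<open>prod4_le\<close>.\<close>
  define T2 where "T2 i z = 2 * (u i z ^ 4 + R i z ^ 4)" for i z
  have T1: "integrable M (\<lambda>z. T1 i z)" "(\<integral>z. T1 i z \<partial>M) \<le> \<rho> / e ^ 12 + e ^ 4 * (9 * (CW ^ 4 * Fm) + 8 * \<rho>)" if i: "i < N" for i
  proof -
    have ints: "integrable M (\<lambda>z. R i z ^ 4 / e ^ 12)" "integrable M (\<lambda>z. e ^ 4 * (8 * (u i z ^ 4 + R i z ^ 4) + u i z ^ 4))"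
      using R(1)[OF i] u4(1)[OF i] by auto
    show "integrable M (\<lambda>z. T1 i z)" unfolding T1_def by (rule Bochner_Integration.integrable_add[OF ints])
    have "(\<integral>z. T1 i z \<partial>M) = (\<integral>z. R i z ^ 4 \<partial>M) / e ^ 12 + e ^ 4 * (8 * ((\<integral>z. u i z ^ 4 \<partial>M) + (\<integral>z. R i z ^ 4 \<partial>M)) + (\<integral>z. u i z ^ 4 \<partial>M))"
      unfolding T1_def Bochner_Integration.integral_add[OF ints] using R(1)[OF i] u4(1)[OF i] by simp
    also have "\<dots> \<le> \<rho> / e ^ 12 + e ^ 4 * (8 * (CW ^ 4 * Fm + \<rho>) + CW ^ 4 * Fm)"
      by (intro add_mono divide_right_mono mult_left_mono R2 i u4(2)) (use e in auto)
    finally show "(\<integral>z. T1 i z \<partial>M) \<le> \<rho> / e ^ 12 + e ^ 4 * (9 * (CW ^ 4 * Fm) + 8 * \<rho>)" by (simp add: algebra_simps)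
  qed
  have T2: "integrable M (\<lambda>z. T2 i z)" "(\<integral>z. T2 i z \<partial>M) \<le> 2 * (CW ^ 4 * Fm + \<rho>)" if i: "i < N" for i
    unfolding T2_def using R(1)[OF i] u4(1)[OF i] R2[OF i] u4(2)[OF i] by auto
  define LL where "LL z = (\<Sum>q\<in>?nz. c q * (U q z - (\<integral>z. U q z \<partial>M)))" for z
  have LL: "integrable M LL" "(\<integral>z. \<bar>LL z\<bar> \<partial>M) \<le> 2 * SC * (4 * (CW ^ 4 * t0 / e ^ 12 + 2 * e ^ 4 * (CW ^ 4 * Fm))) + (h + 4 * (CW * B) ^ 8 * SR / h)"
  proof -
    have W: "(\<Sum>a\<in>I. \<bar>ww i a\<bar>) \<le> CW" if "q \<in> ?nz" "i \<in> quad_set q" for q i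
      by (rule ww_row) (use nzq[OF that(1)] that(2) in \<open>cases q, auto simp: quads_def\<close>)
    have CW0: "0 \<le> CW" using CW by simp
    have t: "(\<integral>z. (xi a z - trunc B (xi a z)) ^ 4 \<partial>M) \<le> t0" if "a \<in> I" for a
    proof -
      have t: "fst a \<le> s" "snd a < nlev d (fst a)" using that by auto
      have "(\<integral>z. (xi a z - trunc B (xi a z)) ^ 4 \<partial>M) = (\<integral>x. (x - trunc B x) ^ 4 \<partial>D (fst a))"
        by (rule alpha_integral(1)[OF t]) measurable
      then show ?thesis using tr(1)[OF t(1)] by simp
    qed
    have ov: "\<forall>a\<in>I. (\<forall>i\<in>quad_set q. ww i a = 0) \<or> (\<forall>i\<in>quad_set q'. ww i a = 0)" if "(q, q') \<notin> overlap" for q q'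
      using not_overlap[OF that] by blast
    note wl = weak_law[where w = ww and Q = ?nz and C = CW and F = Fm and t = t0 and B = B and e = e and h = h and R = overlap and c = c]
    show "integrable M LL" unfolding LL_def[abs_def] U_def
      by (rule wl(1)) (rule finite_nonzero_quads CW0 xi_fourth tr(2) B e h W t ov; assumption?)+
    show "(\<integral>z. \<bar>LL z\<bar> \<partial>M) \<le> 2 * SC * (4 * (CW ^ 4 * t0 / e ^ 12 + 2 * e ^ 4 * (CW ^ 4 * Fm))) + (h + 4 * (CW * B) ^ 8 * SR / h)"
      unfolding LL_def U_def SC[symmetric] SR[symmetric]
      by (rule wl(2)) (rule finite_nonzero_quads CW0 xi_fourth tr(2) B e h W t ov; assumption?)+
  qed
  define Y where "Y z = gdev d \<theta> j k \<delta> + \<bar>LL z\<bar> + (\<Sum>q\<in>?nz. \<bar>c q\<bar> * quad_sum (\<lambda>i. T1 i z) q) + (\<Sum>q\<in>?nz. cd q * quad_sum (\<lambda>i. T2 i z) q)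
      + 3 * (CV\<^sup>2 * SD) + 3 * (2 * CV * eV * SC)" for z
  have SC0: "0 \<le> SC" unfolding SC[symmetric] by (intro sum_nonneg) simp
  have SD0: "0 \<le> SD" unfolding SD[symmetric] by (intro sum_nonneg cd0)
  have qs0: "0 \<le> quad_sum (\<lambda>i. T1 i z) q" "0 \<le> quad_sum (\<lambda>i. T2 i z) q" for z q
    using e by (cases q; auto simp: T1_def T2_def intro!: add_nonneg_nonneg)+
  have Y0: "0 \<le> Y z" for z
    unfolding Y_def using g0 SC0 SD0 CV0 eV0 by (intro add_nonneg_nonneg sum_nonneg mult_nonneg_nonneg qs0 cd0) auto
  have S1: "integrable M (\<lambda>z. \<Sum>q\<in>?nz. \<bar>c q\<bar> * quad_sum (\<lambda>i. T1 i z) q)"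
    "(\<integral>z. (\<Sum>q\<in>?nz. \<bar>c q\<bar> * quad_sum (\<lambda>i. T1 i z) q) \<partial>M) \<le> SC * (4 * (\<rho> / e ^ 12 + e ^ 4 * (9 * (CW ^ 4 * Fm) + 8 * \<rho>)))"
  proof -
    note qi = quad_sum_integral[OF nzq T1]
    show "integrable M (\<lambda>z. \<Sum>q\<in>?nz. \<bar>c q\<bar> * quad_sum (\<lambda>i. T1 i z) q)"
      by (intro Bochner_Integration.integrable_sum integrable_mult_right qi(1))
    have "(\<integral>z. (\<Sum>q\<in>?nz. \<bar>c q\<bar> * quad_sum (\<lambda>i. T1 i z) q) \<partial>M) = (\<Sum>q\<in>?nz. \<bar>c q\<bar> * (\<integral>z. quad_sum (\<lambda>i. T1 i z) q \<partial>M))"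
      by (subst Bochner_Integration.integral_sum) (auto intro!: qi(1))
    also have "\<dots> \<le> (\<Sum>q\<in>?nz. \<bar>c q\<bar> * (4 * (\<rho> / e ^ 12 + e ^ 4 * (9 * (CW ^ 4 * Fm) + 8 * \<rho>))))"
      by (intro sum_mono mult_left_mono qi(2)) auto
    finally show "(\<integral>z. (\<Sum>q\<in>?nz. \<bar>c q\<bar> * quad_sum (\<lambda>i. T1 i z) q) \<partial>M) \<le> SC * (4 * (\<rho> / e ^ 12 + e ^ 4 * (9 * (CW ^ 4 * Fm) + 8 * \<rho>)))"
      unfolding sum_distrib_right[symmetric] SC .
  qed
  have S2: "integrable M (\<lambda>z. \<Sum>q\<in>?nz. cd q * quad_sum (\<lambda>i. T2 i z) q)"
    "(\<integral>z. (\<Sum>q\<in>?nz. cd q * quad_sum (\<lambda>i. T2 i z) q) \<partial>M) \<le> SD * (4 * (2 * (CW ^ 4 * Fm + \<rho>)))"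
  proof -
    note qi = quad_sum_integral[OF nzq T2]
    show "integrable M (\<lambda>z. \<Sum>q\<in>?nz. cd q * quad_sum (\<lambda>i. T2 i z) q)"
      by (intro Bochner_Integration.integrable_sum integrable_mult_right qi(1))
    have "(\<integral>z. (\<Sum>q\<in>?nz. cd q * quad_sum (\<lambda>i. T2 i z) q) \<partial>M) = (\<Sum>q\<in>?nz. cd q * (\<integral>z. quad_sum (\<lambda>i. T2 i z) q \<partial>M))"
      by (subst Bochner_Integration.integral_sum) (auto intro!: qi(1))
    also have "\<dots> \<le> (\<Sum>q\<in>?nz. cd q * (4 * (2 * (CW ^ 4 * Fm + \<rho>))))" by (intro sum_mono mult_left_mono qi(2) cd0) auto
    finally show "(\<integral>z. (\<Sum>q\<in>?nz. cd q * quad_sum (\<lambda>i. T2 i z) q) \<partial>M) \<le> SD * (4 * (2 * (CW ^ 4 * Fm + \<rho>)))"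
      unfolding sum_distrib_right[symmetric] SD .
  qed
  have Y_int: "integrable M Y" unfolding Y_def[abs_def] by (intro Bochner_Integration.integrable_add S1(1) S2(1) integrable_abs LL(1)) auto
  have Y_E: "(\<integral>z. Y z \<partial>M) = gdev d \<theta> j k \<delta> + (\<integral>z. \<bar>LL z\<bar> \<partial>M) + (\<integral>z. (\<Sum>q\<in>?nz. \<bar>c q\<bar> * quad_sum (\<lambda>i. T1 i z) q) \<partial>M)
      + (\<integral>z. (\<Sum>q\<in>?nz. cd q * quad_sum (\<lambda>i. T2 i z) q) \<partial>M) + 3 * (CV\<^sup>2 * SD) + 3 * (2 * CV * eV * SC)"
    unfolding Y_def using S1(1) S2(1) integrable_abs[OF LL(1)] by (simp add: prob_space)
  have pw: "\<bar>poquim d \<theta>' (y z) $$ (j, k) - I1e j k\<bar> \<le> Y z" if z: "z \<in> space M" and \<theta>': "\<theta>' \<in> param_nbhd s \<theta> \<delta>" for z \<theta>'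
  proof -
    have p: "\<theta>' \<in> param_space s" using \<theta>' by (simp add: param_nbhd_def)
    define c' where "c' q = ccoef d \<theta>' j k (fcoef d q)" for q
    define uh where "uh i = residual d \<theta>' (y z) $ i" for i
    have near: "near (c1 * \<delta>) (\<theta> $ 0 / 2) (Vmat d \<theta>')" using near_Vmat[OF \<theta>' \<delta>(2,3)] by (simp add: c1_def)
    have uh: "\<bar>uh i - u i z\<bar> \<le> R i z" if i: "i < N" for i
    proof -
      let ?r = "gls_proj X (Vmat d \<theta>') *v (mat_inv (Vmat d \<theta>') *v uvec z)"
      have r: "dim_vec ?r = N" using X by (simp add: gls_proj_def)
      have "uh i = u i z - ?r $ i" unfolding uh_def y_eq[OF z] residual_eq[OF p \<beta> uvec(1)] using i r by (simp add: u_def)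
      then show ?thesis using R(3)[OF i near, of z] by simp
    qed
    have quad4: "x ^ 4 \<le> 8 * (u i z ^ 4 + R i z ^ 4)" if "\<bar>x - u i z\<bar> \<le> R i z" for x i
    proof -
      have "x ^ 4 = (u i z + (x - u i z)) ^ 4" by simp
      also have "\<dots> \<le> 8 * (u i z ^ 4 + (x - u i z) ^ 4)" by (rule sum2_power4_le)
      also have "(x - u i z) ^ 4 \<le> R i z ^ 4" using power_mono[OF that, of 4] by (simp add: power_even_abs)
      finally show ?thesis by simp
    qed
    define Uh where "Uh q = prod4 (\<lambda>i _. uh i) q ()" for q
    have prod: "\<bar>Uh q - U q z\<bar> \<le> quad_sum (\<lambda>i. T1 i z) q" "\<bar>Uh q\<bar> \<le> quad_sum (\<lambda>i. T2 i z) q" if q: "q \<in> ?nz" for q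
    proof -
      obtain i1 i2 i3 i4 where q4: "q = (i1, i2, i3, i4)" by (cases q) auto
      have i: "i1 < N" "i2 < N" "i3 < N" "i4 < N" using nzq[OF q] by (auto simp: q4 quads_def)
      have T1_ge: "R i z ^ 4 / e ^ 12 + e ^ 4 * (uh i ^ 4 + u i z ^ 4) \<le> T1 i z" if "i < N" for i
        unfolding T1_def using quad4[OF uh[OF that]] e by (intro add_left_mono mult_left_mono) auto
      have "\<bar>uh i1 * uh i2 * uh i3 * uh i4 - u i1 z * u i2 z * u i3 z * u i4 z\<bar> \<le>
        (R i1 z ^ 4 / e ^ 12 + e ^ 4 * (uh i1 ^ 4 + u i1 z ^ 4)) + (R i2 z ^ 4 / e ^ 12 + e ^ 4 * (uh i2 ^ 4 + u i2 z ^ 4)) +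
        (R i3 z ^ 4 / e ^ 12 + e ^ 4 * (uh i3 ^ 4 + u i3 z ^ 4)) + (R i4 z ^ 4 / e ^ 12 + e ^ 4 * (uh i4 ^ 4 + u i4 z ^ 4))"
        by (rule prod4_perturbation[OF e]) (intro uh i)+
      also have "\<dots> \<le> T1 i1 z + T1 i2 z + T1 i3 z + T1 i4 z" by (intro add_mono T1_ge i)
      finally show "\<bar>Uh q - U q z\<bar> \<le> quad_sum (\<lambda>i. T1 i z) q" by (simp add: Uh_def U_def q4 u_def)
      have "\<bar>uh i1 * uh i2 * uh i3 * uh i4\<bar> \<le> (uh i1 ^ 4 + uh i2 ^ 4 + uh i3 ^ 4 + uh i4 ^ 4) / 4" by (rule prod4_le)
      also have "\<dots> \<le> T2 i1 z + T2 i2 z + T2 i3 z + T2 i4 z"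
        unfolding T2_def using quad4[OF uh[OF i(1)]] quad4[OF uh[OF i(2)]] quad4[OF uh[OF i(3)]] quad4[OF uh[OF i(4)]] by (simp add: field_simps)
      finally show "\<bar>Uh q\<bar> \<le> quad_sum (\<lambda>i. T2 i z) q" by (simp add: Uh_def q4)
    qed
    have qc: "\<bar>qcov (Vmat d \<theta>') q\<bar> \<le> CV\<^sup>2" "\<bar>qcov (Vmat d \<theta>') q - qcov Vt q\<bar> \<le> 2 * CV * eV" if q: "q \<in> ?nz" for q
    proof -
      obtain i1 i2 i3 i4 where q4: "q = (i1, i2, i3, i4)" by (cases q) auto
      have i: "i1 < N" "i2 < N" "i3 < N" "i4 < N" using nzq[OF q] by (auto simp: q4 quads_def)
      show "\<bar>qcov (Vmat d \<theta>') q\<bar> \<le> CV\<^sup>2"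
        unfolding q4 qcov.simps abs_mult power2_eq_square by (intro mult_mono V_entry(1)[OF \<theta>' \<delta>(2)] i CV0) auto
      show "\<bar>qcov (Vmat d \<theta>') q - qcov Vt q\<bar> \<le> 2 * CV * eV"
        unfolding q4 qcov.simps by (rule abs_mult_diff_le; (rule V_entry(1)[OF \<theta>' \<delta>(2)] V_entry(1)[OF th \<delta>(2)] V_entry(2)[OF \<theta>' \<delta>(2), folded eV_def])?; (rule i)?)
    qed
    \<comment> \<open>Both sums are telescoped so that the coefficient differences multiply
      quantities at the nearby parameter, while the true coefficients multiply differences.\<close>
    have "poquim d \<theta>' (y z) $$ (j, k) - I1e j k = (Gmat d \<theta>' $$ (j, k) - Gmat d \<theta> $$ (j, k)) +
       ((\<Sum>q\<in>?nz. c' q * Uh q) - (\<Sum>q\<in>?nz. c q * (\<integral>z. U q z \<partial>M))) - 3 * ((\<Sum>q\<in>?nz. c' q * qcov (Vmat d \<theta>') q) - (\<Sum>q\<in>?nz. c q * qcov Vt q))"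
      unfolding poquim_index[OF j k] I1e_eq[OF j k] c_def c'_def Uh_def uh_def by simp
    also have "(\<Sum>q\<in>?nz. c' q * Uh q) - (\<Sum>q\<in>?nz. c q * (\<integral>z. U q z \<partial>M)) =
       LL z + (\<Sum>q\<in>?nz. c q * (Uh q - U q z)) + (\<Sum>q\<in>?nz. (c' q - c q) * Uh q)"
      unfolding LL_def sum.distrib[symmetric] sum_subtractf[symmetric] by (intro sum.cong refl) (simp add: algebra_simps)
    also have "(\<Sum>q\<in>?nz. c' q * qcov (Vmat d \<theta>') q) - (\<Sum>q\<in>?nz. c q * qcov Vt q) =
       (\<Sum>q\<in>?nz. (c' q - c q) * qcov (Vmat d \<theta>') q) + (\<Sum>q\<in>?nz. c q * (qcov (Vmat d \<theta>') q - qcov Vt q))"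
      unfolding sum.distrib[symmetric] sum_subtractf[symmetric] by (intro sum.cong refl) (simp add: algebra_simps)
    finally have split: "poquim d \<theta>' (y z) $$ (j, k) - I1e j k = (Gmat d \<theta>' $$ (j, k) - Gmat d \<theta> $$ (j, k)) +
       (LL z + (\<Sum>q\<in>?nz. c q * (Uh q - U q z)) + (\<Sum>q\<in>?nz. (c' q - c q) * Uh q)) -
       3 * ((\<Sum>q\<in>?nz. (c' q - c q) * qcov (Vmat d \<theta>') q) + (\<Sum>q\<in>?nz. c q * (qcov (Vmat d \<theta>') q - qcov Vt q)))" .
    have b1: "\<bar>Gmat d \<theta>' $$ (j, k) - Gmat d \<theta> $$ (j, k)\<bar> \<le> gdev d \<theta> j k \<delta>" by (rule gdev_ge[OF \<delta>(1,2,3) j k \<theta>'])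
    have b2: "\<bar>\<Sum>q\<in>?nz. c q * (Uh q - U q z)\<bar> \<le> (\<Sum>q\<in>?nz. \<bar>c q\<bar> * quad_sum (\<lambda>i. T1 i z) q)"
      by (rule order_trans[OF sum_abs]) (auto simp: abs_mult intro!: sum_mono mult_left_mono prod)
    have cc: "\<bar>c' q - c q\<bar> \<le> cd q" if "q \<in> ?nz" for q using cd[OF that \<theta>'] by (simp add: c'_def)
    have b3: "\<bar>\<Sum>q\<in>?nz. (c' q - c q) * Uh q\<bar> \<le> (\<Sum>q\<in>?nz. cd q * quad_sum (\<lambda>i. T2 i z) q)"
    proof (rule order_trans[OF sum_abs], rule sum_mono)
      fix q assume q: "q \<in> ?nz"
      show "\<bar>(c' q - c q) * Uh q\<bar> \<le> cd q * quad_sum (\<lambda>i. T2 i z) q"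
        unfolding abs_mult by (rule mult_mono[OF cc[OF q] prod(2)[OF q] cd0[OF q]]) simp
    qed
    have b4: "\<bar>\<Sum>q\<in>?nz. (c' q - c q) * qcov (Vmat d \<theta>') q\<bar> \<le> CV\<^sup>2 * SD"
    proof -
      have "\<bar>\<Sum>q\<in>?nz. (c' q - c q) * qcov (Vmat d \<theta>') q\<bar> \<le> (\<Sum>q\<in>?nz. cd q * CV\<^sup>2)"
      proof (rule order_trans[OF sum_abs], rule sum_mono)
        fix q assume q: "q \<in> ?nz"
        show "\<bar>(c' q - c q) * qcov (Vmat d \<theta>') q\<bar> \<le> cd q * CV\<^sup>2"
          unfolding abs_mult by (rule mult_mono[OF cc[OF q] qc(1)[OF q] cd0[OF q]]) simp
      qed
      then show ?thesis unfolding sum_distrib_right[symmetric] SD by (simp add: mult.commute)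
    qed
    have b5: "\<bar>\<Sum>q\<in>?nz. c q * (qcov (Vmat d \<theta>') q - qcov Vt q)\<bar> \<le> 2 * CV * eV * SC"
    proof -
      have "\<bar>\<Sum>q\<in>?nz. c q * (qcov (Vmat d \<theta>') q - qcov Vt q)\<bar> \<le> (\<Sum>q\<in>?nz. \<bar>c q\<bar> * (2 * CV * eV))"
      proof (rule order_trans[OF sum_abs], rule sum_mono)
        fix q assume q: "q \<in> ?nz"
        show "\<bar>c q * (qcov (Vmat d \<theta>') q - qcov Vt q)\<bar> \<le> \<bar>c q\<bar> * (2 * CV * eV)"
          unfolding abs_mult by (rule mult_left_mono[OF qc(2)[OF q]]) simp
      qed
      then show ?thesis unfolding sum_distrib_right[symmetric] SC by (simp add: mult.commute)
    qed
    show ?thesis unfolding split Y_def by (rule abs_error_sum[OF b1 b2 b3 b4 b5])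
  qed
  show ?thesis
  proof (intro exI[of _ Y] conjI Y_int allI Y0 ballI pw)
    show "(\<integral>z. Y z \<partial>M) \<le> gdev d \<theta> j k \<delta> +
       (2 * SC * (4 * (CW ^ 4 * t0 / e ^ 12 + 2 * e ^ 4 * (CW ^ 4 * Fm))) + (h + 4 * (CW * B) ^ 8 * SR / h)) +
       SC * (4 * (\<rho> / e ^ 12 + e ^ 4 * (9 * (CW ^ 4 * Fm) + 8 * \<rho>))) +
       SD * (4 * (2 * (CW ^ 4 * Fm + \<rho>))) + 3 * (CV\<^sup>2 * SD) + 3 * (2 * CV * (real (s + 1) * c1 * CW\<^sup>2 * \<delta>) * SC)"
      unfolding Y_E eV_def by (intro add_mono add_right_mono LL(2) S1(2) S2(2) order_refl)
  qed
qed

end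

section \<open>Convergence in probability\<close>

text \<open>Each set has a measurable hull with the same outer measure, and measure is subadditive
  on the hulls.\<close>

lemma outer_measure_of_Un_le:
  assumes "A \<subseteq> space M" "B \<subseteq> space M"
  shows "outer_measure_of M (A \<union> B) \<le> outer_measure_of M A + outer_measure_of M B"
proof -
  obtain E where E: "E \<in> sets M" "A \<subseteq> E" "outer_measure_of M A = emeasure M E" using outer_measure_of_attain[OF assms(1)] by blast
  obtain F where F: "F \<in> sets M" "B \<subseteq> F" "outer_measure_of M B = emeasure M F" using outer_measure_of_attain[OF assms(2)] by blast
  have "outer_measure_of M (A \<union> B) \<le> outer_measure_of M (E \<union> F)" using E(2) F(2) by (intro outer_measure_of_mono) blast
  also have "\<dots> = emeasure M (E \<union> F)" by (rule outer_measure_of_eq) (use E F in auto)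
  also have "\<dots> \<le> emeasure M E + emeasure M F" by (rule emeasure_subadditive[OF E(1) F(1)])
  finally show ?thesis by (simp add: E F)
qed

lemma prob_tends_to_0_iff:
  "prob_tends_to_0 M E \<longleftrightarrow> (\<forall>\<zeta>>0. eventually (\<lambda>n. outer_measure_of (M n) {z \<in> space (M n). E n z} \<le> ennreal \<zeta>) sequentially)"
  (is "_ \<longleftrightarrow> (\<forall>\<zeta>>0. eventually (\<lambda>n. ?m n \<le> ennreal \<zeta>) sequentially)")
proof
  assume "prob_tends_to_0 M E"
  then have lim: "?m \<longlonglongrightarrow> 0" by (simp add: prob_tends_to_0_def)
  show "\<forall>\<zeta>>0. eventually (\<lambda>n. ?m n \<le> ennreal \<zeta>) sequentially"
  proof (intro allI impI)
    fix \<zeta> :: real assume "0 < \<zeta>"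
    then have "0 < ennreal \<zeta>" by simp
    from order_tendstoD(2)[OF lim this] show "eventually (\<lambda>n. ?m n \<le> ennreal \<zeta>) sequentially" by (rule eventually_mono) (rule less_imp_le)
  qed
next
  assume ev: "\<forall>\<zeta>>0. eventually (\<lambda>n. ?m n \<le> ennreal \<zeta>) sequentially"
  have "?m \<longlonglongrightarrow> 0"
  proof (rule order_tendstoI)
    fix a :: ennreal assume a: "0 < a"
    then obtain b where b: "0 < b" "b < a" using dense by blast
    obtain r where r: "b = ennreal r" "0 \<le> r" using b(2) by (cases b rule: ennreal_cases) auto
    have "0 < r" using b(1) r by (simp add: ennreal_eq_0_iff less_le)
    with ev have "eventually (\<lambda>n. ?m n \<le> ennreal r) sequentially" by blast
    then show "eventually (\<lambda>n. ?m n < a) sequentially" by (rule eventually_mono) (use b r in \<open>auto intro: le_less_trans\<close>)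
  qed simp
  then show "prob_tends_to_0 M E" by (simp add: prob_tends_to_0_def)
qed

lemma prob_tends_to_0_mono:
  assumes "prob_tends_to_0 M E" "eventually (\<lambda>n. \<forall>z\<in>space (M n). F n z \<longrightarrow> E n z) sequentially"
  shows "prob_tends_to_0 M F" unfolding prob_tends_to_0_iff
proof (intro allI impI)
  fix \<zeta> :: real assume \<zeta>: "0 < \<zeta>"
  have "eventually (\<lambda>n. outer_measure_of (M n) {z \<in> space (M n). E n z} \<le> ennreal \<zeta>) sequentially"
    using assms(1) \<zeta> unfolding prob_tends_to_0_iff by blast
  then show "eventually (\<lambda>n. outer_measure_of (M n) {z \<in> space (M n). F n z} \<le> ennreal \<zeta>) sequentially" using assms(2)
  proof eventually_elim
    case (elim n)
    have "{z \<in> space (M n). F n z} \<subseteq> {z \<in> space (M n). E n z}" using elim(2) by blast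
    from outer_measure_of_mono[OF this] elim(1) show ?case by (rule order_trans)
  qed
qed

lemma prob_tends_to_0_disj:
  assumes "prob_tends_to_0 M E" "prob_tends_to_0 M F"
  shows "prob_tends_to_0 M (\<lambda>n z. E n z \<or> F n z)" unfolding prob_tends_to_0_iff
proof (intro allI impI)
  fix \<zeta> :: real assume \<zeta>: "0 < \<zeta>"
  then have \<zeta>2: "0 < \<zeta> / 2" by simp
  have "eventually (\<lambda>n. outer_measure_of (M n) {z \<in> space (M n). E n z} \<le> ennreal (\<zeta> / 2)) sequentially"
    "eventually (\<lambda>n. outer_measure_of (M n) {z \<in> space (M n). F n z} \<le> ennreal (\<zeta> / 2)) sequentially"
    using assms \<zeta>2 unfolding prob_tends_to_0_iff by blast+
  then show "eventually (\<lambda>n. outer_measure_of (M n) {z \<in> space (M n). E n z \<or> F n z} \<le> ennreal \<zeta>) sequentially"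
  proof eventually_elim
    case (elim n)
    have "{z \<in> space (M n). E n z \<or> F n z} = {z \<in> space (M n). E n z} \<union> {z \<in> space (M n). F n z}" by blast
    then have "outer_measure_of (M n) {z \<in> space (M n). E n z \<or> F n z} \<le>
        outer_measure_of (M n) {z \<in> space (M n). E n z} + outer_measure_of (M n) {z \<in> space (M n). F n z}"
      by (simp add: outer_measure_of_Un_le)
    also have "\<dots> \<le> ennreal (\<zeta> / 2) + ennreal (\<zeta> / 2)" by (rule add_mono[OF elim])
    also have "\<dots> = ennreal \<zeta>" using \<zeta> by (subst ennreal_plus[symmetric]) auto
    finally show ?case .
  qed
qed

lemma prob_tends_to_0_Bex:
  assumes "finite K" "\<And>i. i \<in> K \<Longrightarrow> prob_tends_to_0 M (\<lambda>n z. E i n z)"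
  shows "prob_tends_to_0 M (\<lambda>n z. \<exists>i\<in>K. E i n z)" using assms
proof (induction K rule: finite_induct)
  case empty
  show ?case by (simp add: prob_tends_to_0_iff)
next
  case (insert i K)
  have "prob_tends_to_0 M (\<lambda>n z. E i n z \<or> (\<exists>i\<in>K. E i n z))" by (rule prob_tends_to_0_disj) (use insert in auto)
  then show ?case by simp
qed

text \<open>A deterministic continuity statement, uniform in n and in the sample point, carries
  convergence of finitely many entries over to a function of them.\<close>

lemma tends_to_0_in_prob_by_finitely_many:
  assumes K: "finite K" and R: "\<And>i. i \<in> K \<Longrightarrow> tends_to_0_in_prob M (R i)"
    and small: "\<And>\<epsilon>. 0 < \<epsilon> \<Longrightarrow> \<exists>\<eta>>0. \<forall>n. \<forall>z\<in>space (M n). (\<forall>i\<in>K. \<bar>R i n z\<bar> \<le> \<eta>) \<longrightarrow> \<bar>Q n z\<bar> \<le> \<epsilon>"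
  shows "tends_to_0_in_prob M Q" unfolding tends_to_0_in_prob_def
proof (intro allI impI)
  fix \<epsilon> :: real assume "0 < \<epsilon>"
  from small[OF this] obtain \<eta> where \<eta>: "0 < \<eta>" "\<And>n z. z \<in> space (M n) \<Longrightarrow> (\<forall>i\<in>K. \<bar>R i n z\<bar> \<le> \<eta>) \<Longrightarrow> \<bar>Q n z\<bar> \<le> \<epsilon>" by blast
  have "prob_tends_to_0 M (\<lambda>n z. \<exists>i\<in>K. \<bar>R i n z\<bar> > \<eta>)"
    by (rule prob_tends_to_0_Bex[OF K]) (use R \<eta>(1) in \<open>auto simp: tends_to_0_in_prob_def\<close>)
  then show "prob_tends_to_0 M (\<lambda>n z. \<epsilon> < \<bar>Q n z\<bar>)"
  proof (rule prob_tends_to_0_mono, intro always_eventually allI ballI impI)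
    fix n z assume z: "z \<in> space (M n)" "\<epsilon> < \<bar>Q n z\<bar>"
    then have "\<not> (\<forall>i\<in>K. \<bar>R i n z\<bar> \<le> \<eta>)" using \<eta>(2)[OF z(1)] by linarith
    then show "\<exists>i\<in>K. \<eta> < \<bar>R i n z\<bar>" by (simp add: not_le)
  qed
qed

text \<open>This removes the estimator: near the truth the error is below a measurable Y with small
  mean, and the event of being away from the truth has small outer probability. The error itself may
  be nonmeasurable.\<close>

lemma tends_to_0_in_prob_dominated:
  assumes T: "tends_to_0_in_prob M T"
    and dom: "\<And>\<eta>. 0 < \<eta> \<Longrightarrow> \<exists>\<delta>>0. eventually (\<lambda>n. \<exists>Y. integrable (M n) Y \<and> (\<forall>z. 0 \<le> Y z) \<and> (\<integral>z. Y z \<partial>M n) \<le> \<eta> \<and>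
      (\<forall>z\<in>space (M n). T n z \<le> \<delta> \<longrightarrow> \<bar>R n z\<bar> \<le> Y z)) sequentially"
  shows "tends_to_0_in_prob M R" unfolding tends_to_0_in_prob_def prob_tends_to_0_iff
proof (intro allI impI)
  fix \<epsilon> \<zeta> :: real assume \<epsilon>: "0 < \<epsilon>" and \<zeta>: "0 < \<zeta>"
  \<comment> \<open>Markov's inequality at level \<epsilon> spends one half of \<zeta>; the other
    half pays for the event that T exceeds \<delta>.\<close>
  then have "0 < \<epsilon> * (\<zeta> / 2)" by simp
  from dom[OF this] obtain \<delta> where \<delta>: "0 < \<delta>" "eventually (\<lambda>n. \<exists>Y. integrable (M n) Y \<and> (\<forall>z. 0 \<le> Y z) \<and> (\<integral>z. Y z \<partial>M n) \<le> \<epsilon> * (\<zeta> / 2) \<and>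
      (\<forall>z\<in>space (M n). T n z \<le> \<delta> \<longrightarrow> \<bar>R n z\<bar> \<le> Y z)) sequentially" by blast
  have \<zeta>2: "0 < \<zeta> / 2" using \<zeta> by simp
  have "eventually (\<lambda>n. outer_measure_of (M n) {z \<in> space (M n). \<delta> < \<bar>T n z\<bar>} \<le> ennreal (\<zeta> / 2)) sequentially"
    using T \<delta>(1) \<zeta>2 unfolding tends_to_0_in_prob_def prob_tends_to_0_iff by blast
  with \<delta>(2) show "eventually (\<lambda>n. outer_measure_of (M n) {z \<in> space (M n). \<epsilon> < \<bar>R n z\<bar>} \<le> ennreal \<zeta>) sequentially"
  proof eventually_elim
    case (elim n)
    obtain Y where Y: "integrable (M n) Y" "\<And>z. 0 \<le> Y z" "(\<integral>z. Y z \<partial>M n) \<le> \<epsilon> * (\<zeta> / 2)"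
      "\<And>z. z \<in> space (M n) \<Longrightarrow> T n z \<le> \<delta> \<Longrightarrow> \<bar>R n z\<bar> \<le> Y z"
      using elim(1) by blast
    let ?A = "{z \<in> space (M n). \<delta> < \<bar>T n z\<bar>}" and ?B = "{z \<in> space (M n). \<epsilon> \<le> Y z}"
    have meas [measurable]: "Y \<in> borel_measurable (M n)" using Y(1) by simp
    have B: "?B \<in> sets (M n)" by measurable
    have "{z \<in> space (M n). \<epsilon> < \<bar>R n z\<bar>} \<subseteq> ?A \<union> ?B"
    proof
      fix z assume "z \<in> {z \<in> space (M n). \<epsilon> < \<bar>R n z\<bar>}"
      then have z: "z \<in> space (M n)" "\<epsilon> < \<bar>R n z\<bar>" by auto
      show "z \<in> ?A \<union> ?B"
      proof (cases "T n z \<le> \<delta>")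
        case True
        then show ?thesis using Y(4)[OF z(1) True] z by simp
      next
        case False
        then have "\<delta> < \<bar>T n z\<bar>" by linarith
        then show ?thesis using z(1) by simp
      qed
    qed
    then have "outer_measure_of (M n) {z \<in> space (M n). \<epsilon> < \<bar>R n z\<bar>} \<le> outer_measure_of (M n) (?A \<union> ?B)" by (rule outer_measure_of_mono)
    also have "\<dots> \<le> outer_measure_of (M n) ?A + outer_measure_of (M n) ?B" by (rule outer_measure_of_Un_le) auto
    also have "outer_measure_of (M n) ?B = emeasure (M n) ?B" by (rule outer_measure_of_eq[OF B])
    also have "\<dots> \<le> ennreal ((1 / \<epsilon>) * (\<integral>z. Y z \<partial>M n))" by (rule integral_Markov_inequality[OF Y(1) _ \<epsilon>]) (use Y(2) in simp)
    also have "\<dots> \<le> ennreal (\<zeta> / 2)" using Y(3) \<epsilon> by (intro ennreal_leI) (simp add: field_simps)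
    finally have "outer_measure_of (M n) {z \<in> space (M n). \<epsilon> < \<bar>R n z\<bar>} \<le> outer_measure_of (M n) ?A + ennreal (\<zeta> / 2)"
      by (simp add: add_left_mono)
    also have "\<dots> \<le> ennreal (\<zeta> / 2) + ennreal (\<zeta> / 2)" by (rule add_right_mono[OF elim(2)])
    also have "\<dots> = ennreal \<zeta>" using \<zeta> by (subst ennreal_plus[symmetric]) auto
    finally show ?case .
  qed
qed

text \<open>Dominated convergence with the bound \<open>x ^ 4\<close>. As the distributions do not
  change with the sample size, one truncation level serves the whole sequence.\<close>

lemma truncation_error_small:
  assumes M: "prob_space M" "sets M = sets borel" "integrable M (\<lambda>x. x ^ 4 :: real)" and \<eta>: "0 < \<eta>"
  shows "eventually (\<lambda>B::nat. (\<integral>x. (x - trunc (real B) x) ^ 4 \<partial>M) \<le> \<eta>) sequentially"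
proof -
  have [measurable_cong]: "sets M = sets borel" by (rule M(2))
  have "(\<lambda>B::nat. \<integral>x. (x - trunc (real B) x) ^ 4 \<partial>M) \<longlonglongrightarrow> (\<integral>x. 0 \<partial>M)"
  proof (rule integral_dominated_convergence[where w = "\<lambda>x. x ^ 4"])
    show "AE x in M. (\<lambda>B::nat. (x - trunc (real B) x) ^ 4) \<longlonglongrightarrow> 0"
    proof (rule AE_I2)
      fix x :: real
      obtain n :: nat where n: "\<bar>x\<bar> \<le> real n" using real_arch_simple by blast
      have "eventually (\<lambda>B::nat. (x - trunc (real B) x) ^ 4 = 0) sequentially"
        unfolding eventually_sequentially by (rule exI[of _ n]) (use n in \<open>auto simp: trunc_def\<close>)
      then show "(\<lambda>B::nat. (x - trunc (real B) x) ^ 4) \<longlonglongrightarrow> 0" by (rule tendsto_eventually)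
    qed
    show "AE x in M. norm ((x - trunc (real B) x) ^ 4) \<le> x ^ 4" for B :: nat by (rule AE_I2) (simp add: trunc_def)
    show "integrable M (\<lambda>x. x ^ 4)" by (rule M(3))
  qed measurable
  then have "(\<lambda>B::nat. \<integral>x. (x - trunc (real B) x) ^ 4 \<partial>M) \<longlonglongrightarrow> 0" by simp
  from order_tendstoD(2)[OF this \<eta>] show ?thesis by (rule eventually_mono) simp
qed

text \<open>There are eight error terms, each made at most \<eta>. The terms with
  \<open>e ^ 4\<close> from the weak law and from the residuals are collected: 52 = 16 + 36 with 36
  = 4 * 9, and 32 = 4 * 8.\<close>

lemma error_budget:
  fixes gd K W t0 e A h Q sr \<rho> sd CV2 R sc \<eta> :: real
  assumes sc: "0 \<le> sc" "sc \<le> K" and \<rho>: "0 \<le> \<rho>" "\<rho> \<le> 1" and A: "0 \<le> A" and e: "0 < e" and sd: "0 \<le> sd" and nn: "0 \<le> W" "0 \<le> t0" "0 \<le> R"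
    and b: "gd \<le> \<eta>" "8 * K * W * (t0 / e ^ 12) \<le> \<eta>" "(52 * A + 32) * K * e ^ 4 \<le> \<eta>" "h \<le> \<eta>" "4 * Q * (sr / h) \<le> \<eta>"
      "4 * K / e ^ 12 * \<rho> \<le> \<eta>" "(8 * (A + 1) + 3 * CV2) * sd \<le> \<eta>" "R * K \<le> \<eta>"
  shows "gd + (2 * sc * (4 * (W * t0 / e ^ 12 + 2 * e ^ 4 * A)) + (h + 4 * Q * sr / h)) +
       sc * (4 * (\<rho> / e ^ 12 + e ^ 4 * (9 * A + 8 * \<rho>))) + sd * (4 * (2 * (A + \<rho>))) + 3 * (CV2 * sd) + R * sc \<le> 8 * \<eta>"
proof -
  have "2 * sc * (4 * (W * t0 / e ^ 12 + 2 * e ^ 4 * A)) \<le> 2 * K * (4 * (W * t0 / e ^ 12 + 2 * e ^ 4 * A))"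
    using sc e A nn by (intro mult_right_mono) auto
  also have "\<dots> = 8 * K * W * (t0 / e ^ 12) + 16 * A * K * e ^ 4" by (simp add: algebra_simps)
  finally have 1: "2 * sc * (4 * (W * t0 / e ^ 12 + 2 * e ^ 4 * A)) \<le> 8 * K * W * (t0 / e ^ 12) + 16 * A * K * e ^ 4" .
  have "e ^ 4 * (9 * A + 8 * \<rho>) \<le> e ^ 4 * (9 * A + 8)" using e \<rho> by (intro mult_left_mono) auto
  then have "sc * (4 * (\<rho> / e ^ 12 + e ^ 4 * (9 * A + 8 * \<rho>))) \<le> K * (4 * (\<rho> / e ^ 12 + e ^ 4 * (9 * A + 8)))"
    using sc e A \<rho> by (intro mult_mono) auto
  also have "\<dots> = 4 * K / e ^ 12 * \<rho> + (36 * A + 32) * K * e ^ 4" by (simp add: algebra_simps)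
  finally have 2: "sc * (4 * (\<rho> / e ^ 12 + e ^ 4 * (9 * A + 8 * \<rho>))) \<le> 4 * K / e ^ 12 * \<rho> + (36 * A + 32) * K * e ^ 4" .
  have 3: "(52 * A + 32) * K * e ^ 4 = 16 * A * K * e ^ 4 + (36 * A + 32) * K * e ^ 4" by (simp add: algebra_simps)
  have "sd * (4 * (2 * (A + \<rho>))) \<le> sd * (4 * (2 * (A + 1)))" using sd \<rho> by (intro mult_left_mono) auto
  moreover have "sd * (4 * (2 * (A + 1))) + 3 * (CV2 * sd) = (8 * (A + 1) + 3 * CV2) * sd" by (simp add: algebra_simps)
  ultimately have 4: "sd * (4 * (2 * (A + \<rho>))) + 3 * (CV2 * sd) \<le> \<eta>" using b(7) by linarith
  have 5: "R * sc \<le> \<eta>" using mult_left_mono[OF sc(2) nn(3)] b(8) by linarith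
  have 6: "4 * Q * sr / h \<le> \<eta>" using b(5) by simp
  show ?thesis using 1 2 3 4 5 6 b(1) b(2) b(3) b(4) b(6) by linarith
qed

lemma small_power4:
  fixes K \<eta> :: real
  assumes "0 \<le> K" "0 < \<eta>"
  shows "\<exists>e>0. K * e ^ 4 \<le> \<eta>"
proof -
  define e where "e = min 1 (\<eta> / (K + 1))"
  have e: "0 < e" "e \<le> 1" using assms by (auto simp: e_def)
  have "e ^ 4 \<le> e ^ 1" using e by (intro power_decreasing) auto
  then have "K * e ^ 4 \<le> K * e" using assms(1) by (simp add: mult_left_mono)
  also have "\<dots> \<le> (K + 1) * (\<eta> / (K + 1))" using assms e by (intro mult_mono) (auto simp: e_def)
  also have "\<dots> = \<eta>" using assms(1) by simp
  finally show ?thesis using e by blast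
qed

section \<open>Scaled matrices\<close>

lemma opbound_transpose:
  assumes A: "(A :: real mat) \<in> carrier_mat m n" and r: "opbound A r"
  shows "opbound (A\<^sup>T) r" unfolding opbound_def
proof (intro conjI ballI)
  show r0: "0 \<le> r" using r by (simp add: opbound_def)
  fix w :: "real vec" assume "w \<in> carrier_vec (dim_col (A\<^sup>T))"
  then have w: "w \<in> carrier_vec m" using A by simp
  let ?x = "A\<^sup>T *v w"
  have x: "?x \<in> carrier_vec n" using A w by simp
  have "(vec_norm2 ?x)\<^sup>2 = ?x \<bullet> ?x" by (rule vec_norm2_power2)
  also have "\<dots> = w \<bullet> (A *v ?x)" by (rule transpose_vec_mult_scalar[OF A x w])
  also have "\<dots> \<le> vec_norm2 w * vec_norm2 (A *v ?x)" using scalar_prod_le_norm[of w m "A *v ?x"] A x w by simp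
  also have "\<dots> \<le> vec_norm2 w * (r * vec_norm2 ?x)" by (intro mult_left_mono opboundD[OF r A x]) simp
  finally have sq: "vec_norm2 ?x * vec_norm2 ?x \<le> (r * vec_norm2 w) * vec_norm2 ?x" by (simp add: power2_eq_square mult_ac)
  show "vec_norm2 ?x \<le> r * vec_norm2 w"
  proof (cases "vec_norm2 ?x = 0")
    case True
    then show ?thesis using r0 by simp
  next
    case False
    then have "0 < vec_norm2 ?x" by (simp add: less_le)
    with sq show ?thesis by (rule mult_right_le_imp_le)
  qed
qed

lemma psd_opbound:
  assumes A: "(A :: real mat) \<in> carrier_mat n n" "A\<^sup>T = A"
    and psd: "\<And>v. v \<in> carrier_vec n \<Longrightarrow> 0 \<le> v \<bullet> (A *v v)"
    and K: "0 \<le> K" "\<And>v. v \<in> carrier_vec n \<Longrightarrow> v \<bullet> (A *v v) \<le> K * (v \<bullet> v)"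
  shows "opbound A K" unfolding opbound_def
proof (intro conjI ballI K(1))
  fix v :: "real vec" assume "v \<in> carrier_vec (dim_col A)"
  then have v: "v \<in> carrier_vec n" using A by simp
  have "(vec_norm2 (A *v v))\<^sup>2 \<le> K * (v \<bullet> (A *v v))" unfolding vec_norm2_power2 by (rule psd_norm_sq_le[OF A psd K(2) v])
  also have "\<dots> \<le> K * (K * (v \<bullet> v))" by (rule mult_left_mono[OF K(2)[OF v] K(1)])
  also have "\<dots> = (K * vec_norm2 v)\<^sup>2" by (simp only: power_mult_distrib vec_norm2_power2) (simp add: power2_eq_square)
  finally show "vec_norm2 (A *v v) \<le> K * vec_norm2 v" by (rule power2_le_imp_le) (use K(1) in simp)
qed

lemma mat_inv_sqrt_conj:
  assumes Q: "Q \<in> carrier_mat n n" and pd: "positive_definite Q"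
  shows "mat_inv_sqrt Q * Q * mat_inv_sqrt Q = 1\<^sub>m n"
proof -
  let ?R = "mat_inv_sqrt Q"
  note R = mat_inv_sqrt_carrier[OF Q pd]
  have "?R * (?R * Q) = (?R * ?R) * Q" using R Q by (simp add: mat_assoc)
  also have "\<dots> = 1\<^sub>m n" unfolding mat_inv_sqrt_mult[OF Q pd] by (rule mat_inv_left[OF Q positive_definite_invertible[OF Q pd]])
  finally show ?thesis by (rule mat_mult_left_right_inverse[OF R mult_carrier_mat[OF R Q]])
qed

text \<open>With \<open>W\<close> the inverse of the scaling \<open>D\<close>, a lower bound for \<open>W Q W\<close> says that
  \<open>D Q\<^sup>-\<^sup>1\<^sup>/\<^sup>2\<close> is bounded, and the error is \<open>(D Q\<^sup>-\<^sup>1\<^sup>/\<^sup>2)'(W Qh W - W Q W) D Q\<^sup>-\<^sup>1\<^sup>/\<^sup>2\<close>.\<close>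

lemma scaled_consistency_bound:
  assumes n: "0 < n" and Q: "Q \<in> carrier_mat n n" "positive_definite Q" and Qh: "Qh \<in> carrier_mat n n"
    and W: "W \<in> carrier_mat n n" "W\<^sup>T = W" and D: "D \<in> carrier_mat n n" "D\<^sup>T = D" and WD: "W * D = 1\<^sub>m n"
    and c: "0 < c" "\<And>v. v \<in> carrier_vec n \<Longrightarrow> c * (v \<bullet> v) \<le> v \<bullet> ((W * Q * W) *v v)"
    and r: "opbound (W * Qh * W - W * Q * W) r"
  shows "mat_norm (mat_inv_sqrt Q * Qh * mat_inv_sqrt Q - 1\<^sub>m n) \<le> r / c"
proof -
  let ?R = "mat_inv_sqrt Q"
  note R = mat_inv_sqrt_carrier[OF Q]
  have Rs: "?R\<^sup>T = ?R" using mat_inv_sqrt_pd[OF Q] unfolding positive_definite_iff[OF R] by blast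
  have DW: "D * W = 1\<^sub>m n" by (rule mat_mult_left_right_inverse[OF W(1) D(1) WD])
  define F where "F = D * ?R"
  have F: "F \<in> carrier_mat n n" unfolding F_def by (rule mult_carrier_mat[OF D(1) R])
  have FT: "F\<^sup>T = ?R * D" unfolding F_def by (simp add: transpose_mult[OF D(1) R] D(2) Rs)
  have cancel: "?R * D * (W * A * W) * F = ?R * A * ?R" if A: "A \<in> carrier_mat n n" for A
  proof -
    have "?R * D * (W * A * W) * F = ?R * ((D * W) * A * (W * D)) * ?R" using A R W(1) D(1) unfolding F_def by (simp add: mat_assoc)
    then show ?thesis unfolding DW WD using A by simp
  qed
  have Fb: "opbound F (1 / sqrt c)" unfolding opbound_def
  proof (intro conjI ballI)
    show "0 \<le> 1 / sqrt c" using c by simp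
    fix v :: "real vec" assume "v \<in> carrier_vec (dim_col F)"
    then have v: "v \<in> carrier_vec n" using F by simp
    have "c * ((F *v v) \<bullet> (F *v v)) \<le> (F *v v) \<bullet> ((W * Q * W) *v (F *v v))" by (rule c(2)) (use F v in simp)
    also have "\<dots> = v \<bullet> ((F\<^sup>T * (W * Q * W) * F) *v v)"
      by (rule quad_transpose_mult[symmetric, OF F _ v]) (use W Q in auto)
    also have "\<dots> = v \<bullet> v" unfolding FT cancel[OF Q(1)] mat_inv_sqrt_conj[OF Q] using v by simp
    finally have "(vec_norm2 (F *v v))\<^sup>2 \<le> (1 / sqrt c * vec_norm2 v)\<^sup>2"
      using c(1) by (simp add: power_mult_distrib vec_norm2_power2 power_divide field_simps)
    then show "vec_norm2 (F *v v) \<le> 1 / sqrt c * vec_norm2 v" by (rule power2_le_imp_le) (use c(1) in simp)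
  qed
  have E: "W * Qh * W - W * Q * W \<in> carrier_mat n n" using W Qh Q by auto
  have RD: "?R * D \<in> carrier_mat n n" by (rule mult_carrier_mat[OF R D(1)])
  have "opbound (?R * D * (W * Qh * W - W * Q * W) * F) (1 / sqrt c * r * (1 / sqrt c))"
    by (intro opbound_mult[OF mult_carrier_mat[OF RD E] F _ Fb] opbound_mult[OF RD E _ r]
        opbound_transpose[OF F Fb, unfolded FT])
  also have "?R * D * (W * Qh * W - W * Q * W) * F = ?R * D * (W * Qh * W) * F - ?R * D * (W * Q * W) * F"
    using RD F W Q Qh by (simp add: mult_minus_distrib_mat[of _ n n _ n] minus_mult_distrib_mat[of _ n n _ _ n])
  also have "\<dots> = ?R * Qh * ?R - 1\<^sub>m n" unfolding cancel[OF Q(1)] cancel[OF Qh] mat_inv_sqrt_conj[OF Q] ..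
  also have "1 / sqrt c * r * (1 / sqrt c) = r / c" using c(1) by simp
  finally show ?thesis by (rule mat_norm_le[rotated 2]) (use n R Qh in auto)
qed

lemma opbound_inverse:
  assumes A: "(A :: real mat) \<in> carrier_mat n n" "invertible_mat A" and a: "0 \<le> a" "\<And>v. v \<in> carrier_vec n \<Longrightarrow> vec_norm2 v \<le> a * vec_norm2 (A *v v)"
  shows "opbound (mat_inv A) a" unfolding opbound_def
proof (intro conjI ballI a(1))
  note I = mat_inv_carrier[OF A]
  fix v :: "real vec" assume "v \<in> carrier_vec (dim_col (mat_inv A))"
  then have v: "v \<in> carrier_vec n" using I by simp
  have "A *v (mat_inv A *v v) = v" using A(1) I v by (simp add: mat_inv_right[OF A] flip: assoc_mult_mat_vec)
  then show "vec_norm2 (mat_inv A *v v) \<le> a * vec_norm2 v" using a(2)[of "mat_inv A *v v"] I v by simp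
qed

lemma vec_norm2_le_imp_invertible:
  assumes A: "(A :: real mat) \<in> carrier_mat n n" and a: "\<And>v. v \<in> carrier_vec n \<Longrightarrow> vec_norm2 v \<le> a * vec_norm2 (A *v v)"
  shows "invertible_mat A"
proof (rule invertible_matI_inj[OF A])
  fix v assume v: "v \<in> carrier_vec n" "A *v v = 0\<^sub>v n"
  have "vec_norm2 v \<le> 0" using a[OF v(1)] v(2) by simp
  then show "v = 0\<^sub>v n" using vec_norm2_eq_0[OF v(1)] vec_norm2_nonneg[of v] by linarith
qed

text \<open>The lower bound for A survives for Ah with \<open>2 * a\<close>, since
  \<open>a * \<epsilon> \<le> 1 / 2\<close> absorbs the perturbation. The difference of the inverses
  is \<open>mat_inv Ah * (Ah - A) * mat_inv A\<close>, and the sandwich is changed one factor at a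
  time. The factor \<epsilon> is kept explicit so that the bound tends to 0 with it.\<close>

lemma sandwich_perturbation:
  assumes A: "A \<in> carrier_mat n n" and a: "0 \<le> a" "\<And>v. v \<in> carrier_vec n \<Longrightarrow> vec_norm2 v \<le> a * vec_norm2 (A *v v)"
    and B: "B \<in> carrier_mat n n" and b: "opbound B b"
    and Ah: "Ah \<in> carrier_mat n n" "opbound (Ah - A) \<epsilon>" and Bh: "Bh \<in> carrier_mat n n" "opbound (Bh - B) \<epsilon>"
    and small: "a * \<epsilon> \<le> 1 / 2"
  shows "invertible_mat Ah"
    and "opbound (mat_inv Ah * Bh * mat_inv Ah - mat_inv A * B * mat_inv A) (\<epsilon> * (2 * a\<^sup>2 * (2 * a * (b + \<epsilon>) + 1 + a * b)))"
proof -
  have \<epsilon>: "0 \<le> \<epsilon>" using Ah by (simp add: opbound_def)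
  have b0: "0 \<le> b" using b by (simp add: opbound_def)
  have lower: "vec_norm2 v \<le> (2 * a) * vec_norm2 (Ah *v v)" if v: "v \<in> carrier_vec n" for v
  proof -
    have "A *v v = Ah *v v - (Ah - A) *v v" using A Ah(1) v by (intro eq_vecI) (auto simp: minus_mult_distrib_mat_vec[of _ n n] algebra_simps)
    then have "vec_norm2 (A *v v) \<le> vec_norm2 (Ah *v v) + vec_norm2 ((Ah - A) *v v)"
      using vec_norm2_diff_triangle[OF mult_mat_vec_carrier[OF Ah(1) v] mult_mat_vec_carrier[OF minus_carrier_mat[OF A] v]] by simp
    also have "vec_norm2 ((Ah - A) *v v) \<le> \<epsilon> * vec_norm2 v" by (rule opboundD[OF Ah(2) _ v]) (use A Ah in auto)
    finally have "a * vec_norm2 (A *v v) \<le> a * (vec_norm2 (Ah *v v) + \<epsilon> * vec_norm2 v)" using a(1) by (simp add: mult_left_mono)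
    then have "vec_norm2 v \<le> a * vec_norm2 (Ah *v v) + (a * \<epsilon>) * vec_norm2 v" using a(2)[OF v] by (simp add: algebra_simps)
    also have "(a * \<epsilon>) * vec_norm2 v \<le> 1 / 2 * vec_norm2 v" by (rule mult_right_mono[OF small]) simp
    finally show ?thesis by simp
  qed
  show invh: "invertible_mat Ah" by (rule vec_norm2_le_imp_invertible[OF Ah(1) lower])
  have inv: "invertible_mat A" by (rule vec_norm2_le_imp_invertible[OF A a(2)])
  let ?I = "mat_inv A" and ?J = "mat_inv Ah"
  note I = mat_inv_carrier[OF A inv] and J = mat_inv_carrier[OF Ah(1) invh]
  have Ib: "opbound ?I a" by (rule opbound_inverse[OF A inv a])
  have Jb: "opbound ?J (2 * a)" by (rule opbound_inverse[OF Ah(1) invh _ lower]) (use a in simp_all)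
  have dA: "Ah - A \<in> carrier_mat n n" and dB: "Bh - B \<in> carrier_mat n n" using A Ah B Bh by auto
  define X where "X = ?J * (Ah - A) * ?I"
  have X: "X \<in> carrier_mat n n" unfolding X_def by (intro mult_carrier_mat[of _ n n] J dA I)
  have X_eq: "X = ?I - ?J"
  proof -
    have "X = (?J * Ah) * ?I - ?J * (A * ?I)" unfolding X_def
      using I J A Ah by (simp add: mult_minus_distrib_mat[of _ n n _ n] minus_mult_distrib_mat[of _ n n _ _ n] mat_assoc)
    then show ?thesis unfolding mat_inv_left[OF Ah(1) invh] mat_inv_right[OF A inv] using I J by simp
  qed
  have Xb: "opbound X (2 * a * \<epsilon> * a)" unfolding X_def
    by (intro opbound_mult[OF mult_carrier_mat[OF J dA] I] opbound_mult[OF J dA] Jb Ib Ah(2))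
  have Bhb: "opbound Bh (b + \<epsilon>)"
  proof -
    have "B + (Bh - B) = Bh" using B Bh by (intro eq_matI) auto
    then show ?thesis using opbound_add[OF B dB b Bh(2)] by simp
  qed
  have J_eq: "?J = ?I - X" unfolding X_eq using I J by (intro eq_matI) auto
  have BJ: "Bh * ?J \<in> carrier_mat n n" "?I * (Bh - B) * ?J \<in> carrier_mat n n" "X * (Bh * ?J) \<in> carrier_mat n n"  "?I * B * X \<in> carrier_mat n n"
    by (intro mult_carrier_mat[of _ n n] Bh(1) J I dB B X)+
  have t1: "opbound (- 1 \<cdot>\<^sub>m (X * (Bh * ?J))) (\<bar>- 1\<bar> * (2 * a * \<epsilon> * a * ((b + \<epsilon>) * (2 * a))))"
    by (intro opbound_smult opbound_mult[OF X BJ(1) Xb] opbound_mult[OF Bh(1) J Bhb Jb])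
  have t2: "opbound (?I * (Bh - B) * ?J) (a * \<epsilon> * (2 * a))"
    by (intro opbound_mult[OF mult_carrier_mat[OF I dB] J _ Jb] opbound_mult[OF I dB Ib Bh(2)])
  have t3: "opbound (- 1 \<cdot>\<^sub>m (?I * B * X)) (\<bar>- 1\<bar> * (a * b * (2 * a * \<epsilon> * a)))"
    by (intro opbound_smult opbound_mult[OF mult_carrier_mat[OF I B] X _ Xb] opbound_mult[OF I B Ib b])
  have "?J * Bh * ?J - ?I * B * ?I = - 1 \<cdot>\<^sub>m (X * (Bh * ?J)) + ?I * (Bh - B) * ?J + - 1 \<cdot>\<^sub>m (?I * B * X)"
  proof -
    have 1: "X * (Bh * ?J) = ?I * Bh * ?J - ?J * Bh * ?J"
      unfolding X_eq using I J Bh(1) by (simp add: minus_mult_distrib_mat[of _ n n _ _ n] mat_assoc)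
    have 2: "?I * (Bh - B) * ?J = ?I * Bh * ?J - ?I * B * ?J"
      using I J Bh(1) B by (simp add: mult_minus_distrib_mat[of _ n n _ n] minus_mult_distrib_mat[of _ n n _ _ n])
    have 3: "?I * B * X = ?I * B * ?I - ?I * B * ?J" unfolding X_eq using I J B by (simp add: mult_minus_distrib_mat[of _ n n _ n])
    show ?thesis unfolding 1 2 3 using I J B Bh(1) by (intro eq_matI) auto
  qed
  moreover have "opbound \<dots> (\<bar>- 1\<bar> * (2 * a * \<epsilon> * a * ((b + \<epsilon>) * (2 * a))) + a * \<epsilon> * (2 * a) + \<bar>- 1\<bar> * (a * b * (2 * a * \<epsilon> * a)))"
    by (intro opbound_add[of _ n n] t1 t2 t3 add_carrier_mat smult_carrier_mat BJ)
  moreover have "\<bar>- 1\<bar> * (2 * a * \<epsilon> * a * ((b + \<epsilon>) * (2 * a))) + a * \<epsilon> * (2 * a) + \<bar>- 1\<bar> * (a * b * (2 * a * \<epsilon> * a)) =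
      \<epsilon> * (2 * a\<^sup>2 * (2 * a * (b + \<epsilon>) + 1 + a * b))" by (simp add: power2_eq_square algebra_simps)
  ultimately show "opbound (?J * Bh * ?J - ?I * B * ?I) (\<epsilon> * (2 * a\<^sup>2 * (2 * a * (b + \<epsilon>) + 1 + a * b)))" by simp
qed

lemma scaled_inverse:
  assumes A: "A \<in> carrier_mat n n" and W: "W \<in> carrier_mat n n" and D: "D \<in> carrier_mat n n" and WD: "W * D = 1\<^sub>m n"
    and inv: "invertible_mat (W * A * W)"
  shows "invertible_mat A" "mat_inv A = W * mat_inv (W * A * W) * W"
proof -
  have S: "W * A * W \<in> carrier_mat n n" using A W by auto
  let ?K = "mat_inv (W * A * W)"
  note K = mat_inv_carrier[OF S inv]
  have DW: "D * W = 1\<^sub>m n" by (rule mat_mult_left_right_inverse[OF W D WD])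
  have WKW: "W * ?K * W \<in> carrier_mat n n" using W K by auto
  have "A * (W * ?K * W) = (D * W) * (A * (W * ?K * W))" unfolding DW using A W K by simp
  also have "\<dots> = D * ((W * A * W) * ?K) * W" using A W K D by (simp add: mat_assoc)
  also have "\<dots> = 1\<^sub>m n" unfolding mat_inv_right[OF S inv] using D DW by simp
  finally have AB: "A * (W * ?K * W) = 1\<^sub>m n" .
  then show "invertible_mat A" unfolding invertible_mat_iff[OF A] using WKW by blast
  show "mat_inv A = W * ?K * W" by (rule mat_inv_eqI[OF A WKW AB])
qed

text \<open>Scaling the sandwich from outside by D is scaling its inner matrices by W, the inverse
  of D. So the covariance matrix is normalized by the inverse of what normalizes the
  information.\<close>

lemma scaled_sandwich:
  assumes A: "A \<in> carrier_mat n n" and B: "B \<in> carrier_mat n n" and W: "W \<in> carrier_mat n n" and D: "D \<in> carrier_mat n n" and WD: "W * D = 1\<^sub>m n"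
    and inv: "invertible_mat (W * A * W)"
  shows "D * (mat_inv A * B * mat_inv A) * D = mat_inv (W * A * W) * (W * B * W) * mat_inv (W * A * W)"
proof -
  have S: "W * A * W \<in> carrier_mat n n" using A W by auto
  let ?K = "mat_inv (W * A * W)"
  note K = mat_inv_carrier[OF S inv]
  have DW: "D * W = 1\<^sub>m n" by (rule mat_mult_left_right_inverse[OF W D WD])
  have "D * ((W * ?K * W) * B * (W * ?K * W)) * D = (D * W) * (?K * (W * B * W) * ?K) * (W * D)" using B W K D by (simp add: mat_assoc)
  also have "\<dots> = ?K * (W * B * W) * ?K" unfolding DW WD using K B W by simp
  finally show ?thesis unfolding scaled_inverse(2)[OF A W D WD inv] .
qed

section \<open>Entrywise consistency\<close>

lemma eventually_linear_small:
  fixes a b :: real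
  assumes "0 < b"
  shows "eventually (\<lambda>\<delta>. a * \<delta> < b) (at_right 0)"
proof -
  have "((\<lambda>\<delta>. a * \<delta>) \<longlongrightarrow> a * 0) (at_right 0)" by (intro tendsto_intros)
  then have "((\<lambda>\<delta>. a * \<delta>) \<longlongrightarrow> 0) (at_right 0)" by simp
  from order_tendstoD(2)[OF this assms] show ?thesis .
qed

lemma abs_pos_mult_le: "0 \<le> a \<Longrightarrow> \<bar>x\<bar> \<le> b \<Longrightarrow> \<bar>a * x\<bar> \<le> a * (b :: real)"
  by (simp add: abs_mult mult_left_mono)

lemma mult_inverse_cancel: "0 < a \<Longrightarrow> x = a * (inverse a * (x :: real))" by simp

lemma mult_divide_Suc_le:
  fixes x \<eta> :: real
  assumes "0 \<le> x" "0 \<le> \<eta>"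
  shows "x * (\<eta> / (x + 1)) \<le> \<eta>" using assms by (simp add: field_simps)

context lmm_bounded
begin

lemma score_variance_I1e:
  "reml_contrast d T \<Longrightarrow> j \<le> s \<Longrightarrow> k \<le> s \<Longrightarrow> score_variance M s (\<lambda>z. reml_loglik d c T (y z)) \<theta> $$ (j, k) = I1e j k"
  by (simp add: score_variance_eq I1e_def)

lemma information_lower:
  assumes w: "w \<in> carrier_vec p"
  shows "lambda_min (X\<^sup>T * mat_inv Vt * X) * (w \<bullet> w) \<le> w \<bullet> ((X\<^sup>T * mat_inv Vt * X) *v w)"
proof -
  have "transpose_mat (X\<^sup>T * Vi * X) = X\<^sup>T * Vi * X"
    using information_pd unfolding positive_definite_iff[OF information_carrier] by blast
  from lambda_min_ge[OF information_carrier this p_pos w] show ?thesis by (simp add: Vi_def)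
qed

lemma dev_nonneg:
  assumes "0 \<le> \<delta>" "\<delta> \<le> 1" "\<delta> \<le> \<theta> $ 0 / 2" "j \<le> s" "k \<le> s"
  shows gdev_nonneg: "0 \<le> gdev d \<theta> j k \<delta>"
    and cdev_sum_nonneg: "0 \<le> (\<Sum>\<phi>\<in>fvals d. real (hcount d \<phi>) * cdev d \<theta> j k \<phi> \<delta>)"
proof -
  note th = theta_nbhd[OF assms(1)]
  show "0 \<le> gdev d \<theta> j k \<delta>" using gdev_ge[OF assms th] by simp
  have "0 \<le> cdev d \<theta> j k \<phi> \<delta>" if "\<phi> \<in> fvals d" for \<phi> using cdev_ge[OF assms th that] by simp
  then show "0 \<le> (\<Sum>\<phi>\<in>fvals d. real (hcount d \<phi>) * cdev d \<theta> j k \<phi> \<delta>)" by (intro sum_nonneg mult_nonneg_nonneg) auto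
qed

lemma constants_nonneg: "0 \<le> CV" "0 \<le> c1" "0 \<le> CW" using V_entry(1)[OF theta_nbhd[of 0] _ N_pos N_pos] c1_pos CW by auto

end

text \<open>All models share the number of random effects, the distributions, the true parameter and
  the row bound C; the rest varies with n.\<close>

locale lmm_sequence =
  fixes s :: nat and d :: "nat \<Rightarrow> lmm_design" and M :: "nat \<Rightarrow> 'a measure" and D :: "nat \<Rightarrow> real measure"
    and \<alpha> :: "nat \<Rightarrow> nat \<Rightarrow> nat \<Rightarrow> 'a \<Rightarrow> real" and \<beta> :: "nat \<Rightarrow> real vec" and y :: "nat \<Rightarrow> 'a \<Rightarrow> real vec"
    and \<theta> :: "real vec" and C :: real and c :: "nat \<Rightarrow> real" and T :: "nat \<Rightarrow> real mat" and g :: "nat \<Rightarrow> nat \<Rightarrow> real"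
    and \<theta>hat :: "nat \<Rightarrow> 'a \<Rightarrow> real vec"
  assumes model: "\<And>n. lmm_bounded (d n) s (M n) D (\<alpha> n) (\<beta> n) (y n) \<theta> C"
    and contrast: "\<And>n. reml_contrast (d n) (T n)"
    and g_pos: "\<And>n j. j \<le> s \<Longrightarrow> 0 < g n j"
    and information: "filterlim (\<lambda>n. lambda_min (transpose_mat (Xmat (d n)) * mat_inv (Vmat (d n) \<theta>) * Xmat (d n))) at_top sequentially"
    and c_sum: "\<And>j k. j \<le> s \<Longrightarrow> k \<le> s \<Longrightarrow> Bseq (\<lambda>n. inverse (g n j * g n k) *
        (\<Sum>\<phi>\<in>fvals (d n). real (hcount (d n) \<phi>) * \<bar>ccoef (d n) \<theta> j k \<phi>\<bar>))"
    and c_overlap: "\<And>j k. j \<le> s \<Longrightarrow> k \<le> s \<Longrightarrow> (\<lambda>n. inverse ((g n j * g n k)\<^sup>2) *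
        (\<Sum>\<phi>1\<in>fvals (d n). \<Sum>\<phi>2\<in>fvals (d n). real (hcount2 (d n) \<phi>1 \<phi>2) *
          \<bar>ccoef (d n) \<theta> j k \<phi>1 * ccoef (d n) \<theta> j k \<phi>2\<bar>)) \<longlonglongrightarrow> 0"
    and G_dev: "\<And>j k. j \<le> s \<Longrightarrow> k \<le> s \<Longrightarrow>
        uniform_limit UNIV (\<lambda>\<delta> n. inverse (g n j * g n k) * gdev (d n) \<theta> j k \<delta>) (\<lambda>n. 0) (at_right 0)"
    and c_dev: "\<And>j k. j \<le> s \<Longrightarrow> k \<le> s \<Longrightarrow>
        uniform_limit UNIV (\<lambda>\<delta> n. inverse (g n j * g n k) *
          (\<Sum>\<phi>\<in>fvals (d n). real (hcount (d n) \<phi>) * cdev (d n) \<theta> j k \<phi> \<delta>)) (\<lambda>n. 0) (at_right 0)"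
    and \<theta>hat: "\<And>n z. z \<in> space (M n) \<Longrightarrow> \<theta>hat n z \<in> param_space s"
      "tends_to_0_in_prob M (\<lambda>n z. vec_norm2 (\<theta>hat n z - \<theta>))"
begin

abbreviation "Ph n z \<equiv> poquim (d n) (\<theta>hat n z) (y n z)"
abbreviation "Gh n z \<equiv> Gmat (d n) (\<theta>hat n z)"
abbreviation "Gt n \<equiv> Gmat (d n) \<theta>"
abbreviation "gg n j k \<equiv> inverse (g n j * g n k)"
abbreviation "err n z \<equiv> vec_norm2 (\<theta>hat n z - \<theta>)"

definition I1 :: "nat \<Rightarrow> real mat" where
  "I1 n = score_variance (M n) s (\<lambda>z. reml_loglik (d n) (c n) (T n) (y n z)) \<theta>"

lemma nbhdI: "z \<in> space (M n) \<Longrightarrow> err n z \<le> \<delta> \<Longrightarrow> \<theta>hat n z \<in> param_nbhd s \<theta> \<delta>"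
  using \<theta>hat(1) by (simp add: param_nbhd_def)

lemma theta0_pos: "0 < \<theta> $ 0"
proof -
  interpret lmm_bounded "d 0" s "M 0" D "\<alpha> 0" "\<beta> 0" "y 0" \<theta> C by (rule model)
  show ?thesis by (rule theta_pos) simp
qed

text \<open>The dominating variable is here a constant, the scaled modulus of continuity.\<close>

lemma Gmat_entry_consistent:
  assumes j: "j \<le> s" and k: "k \<le> s"
  shows "tends_to_0_in_prob M (\<lambda>n z. gg n j k * (Gh n z $$ (j, k) - Gt n $$ (j, k)))"
proof (rule tends_to_0_in_prob_dominated[OF \<theta>hat(2)])
  fix \<eta> :: real assume \<eta>: "0 < \<eta>"
  have "eventually (\<lambda>\<delta>. 0 < \<delta> \<and> 1 * \<delta> < 1 \<and> 1 * \<delta> < \<theta> $ 0 / 2 \<and> (\<forall>n\<in>UNIV. dist (gg n j k * gdev (d n) \<theta> j k \<delta>) 0 < \<eta>)) (at_right (0::real))"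
    by (intro eventually_conj eventually_at_right_less eventually_linear_small uniform_limitD[OF G_dev[OF j k]] \<eta>) (use theta0_pos in auto)
  from eventually_happens'[OF trivial_limit_at_right_real this]
  obtain \<delta> where "0 < \<delta> \<and> 1 * \<delta> < 1 \<and> 1 * \<delta> < \<theta> $ 0 / 2 \<and> (\<forall>n\<in>UNIV. dist (gg n j k * gdev (d n) \<theta> j k \<delta>) 0 < \<eta>)"
    by (rule exE)
  then have \<delta>: "0 < \<delta>" "\<delta> \<le> 1" "\<delta> \<le> \<theta> $ 0 / 2" "\<And>n. \<bar>gg n j k * gdev (d n) \<theta> j k \<delta>\<bar> < \<eta>"
    unfolding dist_real_def by auto
  show "\<exists>\<delta>>0. eventually (\<lambda>n. \<exists>Y. integrable (M n) Y \<and> (\<forall>z. 0 \<le> Y z) \<and> (\<integral>z. Y z \<partial>M n) \<le> \<eta> \<and>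
      (\<forall>z\<in>space (M n). err n z \<le> \<delta> \<longrightarrow>
        \<bar>gg n j k * (Gh n z $$ (j, k) - Gt n $$ (j, k))\<bar> \<le> Y z)) sequentially"
  proof (intro exI[of _ \<delta>] conjI \<delta>(1) always_eventually allI)
    fix n
    interpret lmm_bounded "d n" s "M n" D "\<alpha> n" "\<beta> n" "y n" \<theta> C by (rule model)
    have G: "0 < g n j * g n k" using g_pos[OF j, of n] g_pos[OF k, of n] by simp
    define b where "b = gg n j k * gdev (d n) \<theta> j k \<delta>"
    have b: "0 \<le> b" "b \<le> \<eta>" using gdev_nonneg[OF _ \<delta>(2,3) j k] \<delta>(1) \<delta>(4)[of n] G unfolding b_def
      by (auto simp del: inverse_mult_distrib intro!: mult_nonneg_nonneg)
    have "\<bar>gg n j k * (Gh n z $$ (j, k) - Gt n $$ (j, k))\<bar> \<le> b" if "z \<in> space (M n)" "err n z \<le> \<delta>" for z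
      unfolding b_def by (rule abs_pos_mult_le[OF less_imp_le[OF positive_imp_inverse_positive[OF G]]
            gdev_ge[OF less_imp_le[OF \<delta>(1)] \<delta>(2,3) j k nbhdI[OF that]]])
    then show "\<exists>Y. integrable (M n) Y \<and> (\<forall>z. 0 \<le> Y z) \<and> (\<integral>z. Y z \<partial>M n) \<le> \<eta> \<and>
      (\<forall>z\<in>space (M n). err n z \<le> \<delta> \<longrightarrow>
        \<bar>gg n j k * (Gh n z $$ (j, k) - Gt n $$ (j, k))\<bar> \<le> Y z)"
      using b by (intro exI[of _ "\<lambda>_. b"]) (simp add: prob_space)
  qed
qed

text \<open>\<open>poquim_error\<close> divided by \<open>g n j * g n k\<close>, with its free
  constants fixed. What has to be uniform in n is chosen before n: e, the truncation level and
  \<delta>. The fitted values and the overlap sum become small only for large n.\<close>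

lemma poquim_entry_consistent:
  assumes j: "j \<le> s" and k: "k \<le> s"
  shows "tends_to_0_in_prob M (\<lambda>n z. gg n j k * (Ph n z $$ (j, k) - I1 n $$ (j, k)))"
proof (rule tends_to_0_in_prob_dominated[OF \<theta>hat(2)])
  fix \<eta>8 :: real assume \<eta>8: "0 < \<eta>8"
  define \<eta> where "\<eta> = \<eta>8 / 8"
  have \<eta>: "0 < \<eta>" "\<eta>8 = 8 * \<eta>" using \<eta>8 by (auto simp: \<eta>_def)
  \<comment> \<open>Named outside any single model: these locale constants take as arguments at most
    s, C, the distributions and the parameter, hence are the same for all n.\<close>
  define kW where "kW = lmm_bounded.CW s C"
  define kF where "kF = lmm_bounded.Fm s D"
  define kV where "kV = lmm_bounded.CV s D \<theta> C"
  define k1 where "k1 = lmm_bounded.c1 s \<theta>"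
  note fold = kW_def[symmetric] kF_def[symmetric] kV_def[symmetric] k1_def[symmetric]
  define A where "A = kW ^ 4 * kF"
  define Rc where "Rc = 6 * kV * (real (s + 1) * k1 * kW\<^sup>2)"
  define sc where "sc n = gg n j k * (\<Sum>\<phi>\<in>fvals (d n). real (hcount (d n) \<phi>) * \<bar>ccoef (d n) \<theta> j k \<phi>\<bar>)" for n
  define sd where "sd \<delta> n = gg n j k * (\<Sum>\<phi>\<in>fvals (d n). real (hcount (d n) \<phi>) * cdev (d n) \<theta> j k \<phi> \<delta>)" for \<delta> n
  define sr where "sr n = inverse ((g n j * g n k)\<^sup>2) * (\<Sum>\<phi>1\<in>fvals (d n). \<Sum>\<phi>2\<in>fvals (d n). real (hcount2 (d n) \<phi>1 \<phi>2) *
          \<bar>ccoef (d n) \<theta> j k \<phi>1 * ccoef (d n) \<theta> j k \<phi>2\<bar>)" for n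
  define gd where "gd \<delta> n = gg n j k * gdev (d n) \<theta> j k \<delta>" for \<delta> n
  define L where "L n = lambda_min (transpose_mat (Xmat (d n)) * mat_inv (Vmat (d n) \<theta>) * Xmat (d n))" for n
  define \<rho> where "\<rho> n = (16 * (Kmax s D + 3) + 1) * (C\<^sup>2 / L n)\<^sup>2" for n
  have facts: "0 \<le> kV" "0 \<le> k1" "0 \<le> kW" "0 \<le> kF" "\<And>t. t \<le> s \<Longrightarrow> 0 < sig D t" "0 \<le> Kmax s D"
    "\<And>t. t \<le> s \<Longrightarrow> prob_space (D t)" "\<And>t. t \<le> s \<Longrightarrow> sets (D t) = sets borel" "\<And>t. t \<le> s \<Longrightarrow> integrable (D t) (\<lambda>x. x ^ 4)"
  proof -
    interpret lmm_bounded "d 0" s "M 0" D "\<alpha> 0" "\<beta> 0" "y 0" \<theta> C by (rule model)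
    show "0 \<le> kV" "0 \<le> k1" "0 \<le> kW" "0 \<le> kF" unfolding kV_def k1_def kW_def kF_def by (rule constants_nonneg xi_fourth(2))+
    show "\<And>t. t \<le> s \<Longrightarrow> 0 < sig D t" "0 \<le> Kmax s D"
      "\<And>t. t \<le> s \<Longrightarrow> prob_space (D t)" "\<And>t. t \<le> s \<Longrightarrow> sets (D t) = sets borel" "\<And>t. t \<le> s \<Longrightarrow> integrable (D t) (\<lambda>x. x ^ 4)"
      by (rule sig_pos Kmax_nonneg D_moments(1,2,5); assumption)+
  qed
  have A: "0 \<le> A" and Rc: "0 \<le> Rc" using facts by (auto simp: A_def Rc_def)
  obtain K where K: "0 < K" "\<And>n. \<bar>sc n\<bar> \<le> K" using c_sum[OF j k] unfolding Bseq_def sc_def real_norm_def by blast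
  note sc_le = K(2)
  obtain e where e: "0 < e" "(52 * A + 32) * K * e ^ 4 \<le> \<eta>" using small_power4[of "(52 * A + 32) * K" \<eta>] A K \<eta> by auto
  \<comment> \<open>Measured against \<open>e ^ 12\<close>, the price of a small e in the weighted
    product inequality; the added 1 keeps the denominator positive.\<close>
  define t0 where "t0 = e ^ 12 * (\<eta> / (8 * K * kW ^ 4 + 1))"
  have K2: "0 \<le> 8 * K * kW ^ 4" using K by simp
  have t0: "0 < t0" using e K2 \<eta> unfolding t0_def by (intro mult_pos_pos divide_pos_pos zero_less_power) auto
  have t0': "8 * K * kW ^ 4 * (t0 / e ^ 12) \<le> \<eta>"
  proof -
    have "8 * K * kW ^ 4 * (t0 / e ^ 12) = 8 * K * kW ^ 4 * (\<eta> / (8 * K * kW ^ 4 + 1))" using e by (simp add: t0_def)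
    also have "\<dots> \<le> \<eta>" by (rule mult_divide_Suc_le[OF K2]) (use \<eta> in simp)
    finally show ?thesis .
  qed
  have "eventually (\<lambda>B::nat. \<forall>t\<in>{..s}. (\<integral>x. (x - trunc (real B) x) ^ 4 \<partial>D t) \<le> t0) sequentially"
    by (rule eventually_ball_finite) (use truncation_error_small[OF facts(7,8,9) t0] in auto)
  then obtain B' :: nat where B': "\<And>t. t \<le> s \<Longrightarrow> (\<integral>x. (x - trunc (real B') x) ^ 4 \<partial>D t) \<le> t0"
    using eventually_happens'[OF sequentially_bot] by blast
  define B where "B = real B'"
  define Q where "Q = (kW * B) ^ 8"
  have sd_small: "0 < \<eta> / (8 * (A + 1) + 3 * kV\<^sup>2)" using \<eta> A by (intro divide_pos_pos add_pos_nonneg) auto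
  have "eventually (\<lambda>\<delta>. 0 < \<delta> \<and> 1 * \<delta> < 1 \<and> 1 * \<delta> < \<theta> $ 0 / 2 \<and> (\<forall>t\<in>{..s}. (2 * real (s + 1) * k1) * \<delta> < sig D t) \<and> (Rc * K) * \<delta> < \<eta> \<and>
     (\<forall>n\<in>UNIV. dist (gd \<delta> n) 0 < \<eta>) \<and> (\<forall>n\<in>UNIV. dist (sd \<delta> n) 0 < \<eta> / (8 * (A + 1) + 3 * kV\<^sup>2))) (at_right (0::real))"
    by (intro eventually_conj eventually_at_right_less eventually_linear_small uniform_limitD[OF G_dev[OF j k], folded gd_def]
        uniform_limitD[OF c_dev[OF j k], folded sd_def] eventually_ball_finite ballI sd_small \<eta>(1))
      (use theta0_pos facts(5) in auto)
  from eventually_happens'[OF trivial_limit_at_right_real this]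
  obtain \<delta> where "0 < \<delta> \<and> 1 * \<delta> < 1 \<and> 1 * \<delta> < \<theta> $ 0 / 2 \<and> (\<forall>t\<in>{..s}. (2 * real (s + 1) * k1) * \<delta> < sig D t) \<and> (Rc * K) * \<delta> < \<eta> \<and>
     (\<forall>n\<in>UNIV. dist (gd \<delta> n) 0 < \<eta>) \<and> (\<forall>n\<in>UNIV. dist (sd \<delta> n) 0 < \<eta> / (8 * (A + 1) + 3 * kV\<^sup>2))" by (rule exE)
  then have raw: "0 < \<delta>" "1 * \<delta> < 1" "1 * \<delta> < \<theta> $ 0 / 2" "\<And>t. t \<in> {..s} \<Longrightarrow> 2 * real (s + 1) * k1 * \<delta> < sig D t" "Rc * K * \<delta> < \<eta>"
    "\<And>n. dist (gd \<delta> n) 0 < \<eta>" "\<And>n. dist (sd \<delta> n) 0 < \<eta> / (8 * (A + 1) + 3 * kV\<^sup>2)" by blast+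
  note \<delta> = raw(1) raw(2)[unfolded mult_1] raw(3)[unfolded mult_1] raw(4)[unfolded atMost_iff] raw(5)
    raw(6)[unfolded dist_real_def diff_0_right] raw(7)[unfolded dist_real_def diff_0_right]
  have L_lim: "filterlim L at_top sequentially" using information unfolding L_def[abs_def] .
  have "(\<lambda>n. C\<^sup>2 / L n) \<longlonglongrightarrow> 0"
    by (rule tendsto_divide_0[OF tendsto_const filterlim_at_top_imp_at_infinity[OF L_lim]])
  then have "(\<lambda>n. (16 * (Kmax s D + 3) + 1) * (C\<^sup>2 / L n)\<^sup>2) \<longlonglongrightarrow> (16 * (Kmax s D + 3) + 1) * 0\<^sup>2" by (intro tendsto_intros)
  then have \<rho>_lim: "\<rho> \<longlonglongrightarrow> 0" by (simp add: \<rho>_def[abs_def])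
  have "(\<lambda>n. 4 * K / e ^ 12 * \<rho> n) \<longlonglongrightarrow> 4 * K / e ^ 12 * 0" by (intro tendsto_intros \<rho>_lim)
  then have \<rho>'_lim: "(\<lambda>n. 4 * K / e ^ 12 * \<rho> n) \<longlonglongrightarrow> 0" by simp
  have sr_lim: "sr \<longlonglongrightarrow> 0" using c_overlap[OF j k] unfolding sr_def[abs_def] .
  have "(\<lambda>n. 4 * Q * (sr n / \<eta>)) \<longlonglongrightarrow> 4 * Q * (0 / \<eta>)" using \<eta> by (intro tendsto_intros sr_lim) auto
  then have sr'_lim: "(\<lambda>n. 4 * Q * (sr n / \<eta>)) \<longlonglongrightarrow> 0" by simp
  have one_pos: "0 < (1 :: real)" by simp
  have ev: "eventually (\<lambda>n. 0 < L n \<and> \<rho> n < 1 \<and> 4 * K / e ^ 12 * \<rho> n < \<eta> \<and> 4 * Q * (sr n / \<eta>) < \<eta>) sequentially"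
    using filterlim_at_top_dense[THEN iffD1, OF L_lim, THEN spec, of 0] order_tendstoD(2)[OF \<rho>_lim one_pos] order_tendstoD(2)[OF \<rho>'_lim \<eta>(1)]
      order_tendstoD(2)[OF sr'_lim \<eta>(1)] by (intro eventually_conj)
  show "\<exists>\<delta>>0. eventually (\<lambda>n. \<exists>Y. integrable (M n) Y \<and> (\<forall>z. 0 \<le> Y z) \<and> (\<integral>z. Y z \<partial>M n) \<le> \<eta>8 \<and>
      (\<forall>z\<in>space (M n). err n z \<le> \<delta> \<longrightarrow>
        \<bar>gg n j k * (Ph n z $$ (j, k) - I1 n $$ (j, k))\<bar> \<le> Y z)) sequentially"
  proof (intro exI[of _ \<delta>] conjI \<delta>(1) eventually_mono[OF ev])
    fix n assume n: "0 < L n \<and> \<rho> n < 1 \<and> 4 * K / e ^ 12 * \<rho> n < \<eta> \<and> 4 * Q * (sr n / \<eta>) < \<eta>"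
    interpret lmm_bounded "d n" s "M n" D "\<alpha> n" "\<beta> n" "y n" \<theta> C by (rule model)
    define G where "G = g n j * g n k"
    have G: "0 < G" using g_pos[OF j, of n] g_pos[OF k, of n] by (simp add: G_def)
    \<comment> \<open>The free h of the weak law is taken proportional to the scaling, so that the
      overlap term becomes G times \<open>4 * Q * (sr n / \<eta>)\<close>.\<close>
    have h: "0 < G * \<eta>" using G \<eta> by simp
    have Ln: "0 < L n" using n by blast
    have \<delta>_small: "2 * real (s + 1) * (lmm_bounded.c1 s \<theta> * \<delta>) \<le> sig D t" if "t \<le> s" for t
      using \<delta>(4)[OF that] by (simp add: fold mult.assoc)
    have Lw: "L n * (w \<bullet> w) \<le> w \<bullet> ((transpose_mat (Xmat (d n)) * mat_inv (Vmat (d n) \<theta>) * Xmat (d n)) *v w)"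
      if "w \<in> carrier_vec (nfix (d n))" for w using information_lower[OF that] by (simp add: L_def)
    \<comment> \<open>Every sum is written as a power of G times its scaled version, so that G can
      be factored out of the whole bound.\<close>
    have un: "gdev (d n) \<theta> j k \<delta> = G * gd \<delta> n"
      "(\<Sum>\<phi>\<in>fvals (d n). real (hcount (d n) \<phi>) * \<bar>ccoef (d n) \<theta> j k \<phi>\<bar>) = G * sc n"
      "(\<Sum>\<phi>\<in>fvals (d n). real (hcount (d n) \<phi>) * cdev (d n) \<theta> j k \<phi> \<delta>) = G * sd \<delta> n"
      "(\<Sum>\<phi>1\<in>fvals (d n). \<Sum>\<phi>2\<in>fvals (d n). real (hcount2 (d n) \<phi>1 \<phi>2) * \<bar>ccoef (d n) \<theta> j k \<phi>1 * ccoef (d n) \<theta> j k \<phi>2\<bar>) = G\<^sup>2 * sr n"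
      unfolding gd_def sc_def sd_def sr_def G_def[symmetric] using G by (intro mult_inverse_cancel; simp)+
    have B0: "0 \<le> B" by (simp add: B_def)
    obtain Y where Y: "integrable (M n) Y" "\<And>z. 0 \<le> Y z"
      "(\<integral>z. Y z \<partial>M n) \<le> G * gd \<delta> n + (2 * (G * sc n) * (4 * (kW ^ 4 * t0 / e ^ 12 + 2 * e ^ 4 * A)) + (G * \<eta> + 4 * Q * (G\<^sup>2 * sr n) / (G * \<eta>))) +
         (G * sc n) * (4 * (\<rho> n / e ^ 12 + e ^ 4 * (9 * A + 8 * \<rho> n))) + (G * sd \<delta> n) * (4 * (2 * (A + \<rho> n))) + 3 * (kV\<^sup>2 * (G * sd \<delta> n)) +
         3 * (2 * kV * (real (s + 1) * k1 * kW\<^sup>2 * \<delta>) * (G * sc n))"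
      "\<And>z \<theta>'. z \<in> space (M n) \<Longrightarrow> \<theta>' \<in> param_nbhd s \<theta> \<delta> \<Longrightarrow> \<bar>poquim (d n) \<theta>' (y n z) $$ (j, k) - I1e j k\<bar> \<le> Y z"
      using poquim_error[OF j k less_imp_le[OF \<delta>(1)] less_imp_le[OF \<delta>(2)] less_imp_le[OF \<delta>(3)] \<delta>_small Ln Lw e(1) h B0 B'[folded B_def] less_imp_le[OF t0]]
      unfolding un fold A_def[symmetric] Q_def[symmetric] \<rho>_def[symmetric] by blast
    have "(\<integral>z. Y z \<partial>M n) \<le> G * (gd \<delta> n + (2 * sc n * (4 * (kW ^ 4 * t0 / e ^ 12 + 2 * e ^ 4 * A)) + (\<eta> + 4 * Q * sr n / \<eta>)) +
         sc n * (4 * (\<rho> n / e ^ 12 + e ^ 4 * (9 * A + 8 * \<rho> n))) + sd \<delta> n * (4 * (2 * (A + \<rho> n))) + 3 * (kV\<^sup>2 * sd \<delta> n) + (Rc * \<delta>) * sc n)"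
      (is "_ \<le> G * ?b") by (rule order_trans[OF Y(3)]) (use G \<eta> in \<open>simp add: Rc_def power2_eq_square field_simps\<close>)
    also have "\<dots> \<le> G * (8 * \<eta>)"
    proof (rule mult_left_mono[OF error_budget[where K = K]])
      have iG: "0 \<le> gg n j k" unfolding G_def[symmetric] using G by simp
      show "0 \<le> sc n" unfolding sc_def by (intro mult_nonneg_nonneg[OF iG] sum_nonneg) simp
      show "sc n \<le> K" using sc_le[of n] by linarith
      show "0 \<le> \<rho> n" unfolding \<rho>_def using facts(6) by simp
      show "0 \<le> sd \<delta> n" unfolding sd_def
        by (rule mult_nonneg_nonneg[OF iG cdev_sum_nonneg[OF less_imp_le[OF \<delta>(1)] less_imp_le[OF \<delta>(2)] less_imp_le[OF \<delta>(3)] j k]])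
      have "sd \<delta> n \<le> \<eta> / (8 * (A + 1) + 3 * kV\<^sup>2)" using \<delta>(7)[of n] by linarith
      moreover have "0 < 8 * (A + 1) + 3 * kV\<^sup>2" using A by (intro add_pos_nonneg) auto
      ultimately show "(8 * (A + 1) + 3 * kV\<^sup>2) * sd \<delta> n \<le> \<eta>" by (simp add: field_simps)
      show "Rc * \<delta> * K \<le> \<eta>" using \<delta>(5) by (simp add: mult_ac)
      show "0 \<le> Rc * \<delta>" using Rc \<delta>(1) by simp
      show "gd \<delta> n \<le> \<eta>" using \<delta>(6)[of n] by linarith
    qed (use n A e(1,2) t0 t0' facts(3) G in auto)
    finally have Y_le: "(\<integral>z. Y z \<partial>M n) \<le> G * (8 * \<eta>)" .
    show "\<exists>Y. integrable (M n) Y \<and> (\<forall>z. 0 \<le> Y z) \<and> (\<integral>z. Y z \<partial>M n) \<le> \<eta>8 \<and>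
      (\<forall>z\<in>space (M n). err n z \<le> \<delta> \<longrightarrow>
        \<bar>gg n j k * (Ph n z $$ (j, k) - I1 n $$ (j, k))\<bar> \<le> Y z)"
    proof (intro exI[of _ "\<lambda>z. inverse G * Y z"] conjI allI ballI impI)
      show "integrable (M n) (\<lambda>z. inverse G * Y z)" using Y(1) by simp
      show "0 \<le> inverse G * Y z" for z using Y(2)[of z] G by simp
      show "(\<integral>z. inverse G * Y z \<partial>M n) \<le> \<eta>8" using Y_le G by (simp add: \<eta>(2) field_simps)
      fix z assume z: "z \<in> space (M n)" "err n z \<le> \<delta>"
      have "\<bar>Ph n z $$ (j, k) - I1 n $$ (j, k)\<bar> \<le> Y z"
        using Y(4)[OF z(1) nbhdI[OF z]] unfolding I1_def score_variance_I1e[OF contrast j k] .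
      then show "\<bar>gg n j k * (Ph n z $$ (j, k) - I1 n $$ (j, k))\<bar> \<le> inverse G * Y z"
        unfolding G_def[symmetric] by (rule abs_pos_mult_le[OF less_imp_le[OF positive_imp_inverse_positive[OF G]]])
    qed
  qed
qed

end

section \<open>Consistency\<close>

text \<open>The expected Hessian is minus the Gaussian information; in the sandwich the two signs
  cancel.\<close>

lemma neg_sandwich:
  assumes A: "A \<in> carrier_mat n n" "invertible_mat A" and B: "B \<in> carrier_mat n n"
  shows "mat_inv (- A) * B * mat_inv (- A) = mat_inv A * B * mat_inv A"
proof -
  note I = mat_inv_carrier[OF A]
  have "- A * - mat_inv A = 1\<^sub>m n" using mat_inv_right[OF A] A(1) I by simp
  then have "mat_inv (- A) = - mat_inv A" by (intro mat_inv_eqI[of _ n]) (use A I in auto)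
  then show ?thesis using A(1) I B by simp
qed

lemma invertible_uminus:
  assumes A: "(A :: real mat) \<in> carrier_mat n n" "invertible_mat A"
  shows "invertible_mat (- A)"
proof -
  have "- A * - mat_inv A = 1\<^sub>m n" using mat_inv_right[OF A] A(1) mat_inv_carrier[OF A] by simp
  then show ?thesis using A mat_inv_carrier[OF A] by (subst invertible_mat_iff[of _ n]) (auto intro!: bexI[of _ "- mat_inv A"])
qed

lemma transpose_sandwich:
  assumes W: "(W :: real mat) \<in> carrier_mat n n" "W\<^sup>T = W" and A: "A \<in> carrier_mat n n" "A\<^sup>T = A"
  shows "transpose_mat (W * A * W) = W * A * W" using W(1) A(1) by (simp add: transpose_mult[of _ n n _ n] A(2) W(2) mat_assoc)

lemma mat_norm_nonneg: "A \<in> carrier_mat k n \<Longrightarrow> 0 < n \<Longrightarrow> 0 \<le> mat_norm A"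
  using opbound_mat_norm[of A k n] by (simp add: opbound_def)

context lmm_bounded
begin

lemma Gmat_sym: "transpose_mat (Gmat d \<theta>) = Gmat d \<theta>"
proof (rule eq_matI)
  fix j k assume "j < dim_row (Gmat d \<theta>)" "k < dim_col (Gmat d \<theta>)"
  then have jk: "j \<le> s" "k \<le> s" using Gmat[of \<theta>] by auto
  note B = Bmat(1)[OF theta_param]
  have BV: "Bt j * Vt \<in> carrier_mat N N" if "j \<le> s" for j by (rule mult_carrier_mat[OF B[OF that] Vmat])
  have "mat_trace ((Bt j * Vt) * (Bt k * Vt)) = mat_trace ((Bt k * Vt) * (Bt j * Vt))" by (rule mat_trace_mult_comm[OF BV BV]) (rule jk)+
  then show "transpose_mat (Gmat d \<theta>) $$ (j, k) = Gmat d \<theta> $$ (j, k)"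
    using jk Gmat[of \<theta>] B[OF jk(1)] B[OF jk(2)] Vmat[of \<theta>] by (simp add: Gmat_index mat_assoc)
qed (use Gmat[of \<theta>] in auto)

lemma quad_sum_s:
  assumes "A \<in> carrier_mat (s + 1) (s + 1)" "v \<in> carrier_vec (s + 1)"
  shows "v \<bullet> (A *v v) = (\<Sum>j\<le>s. \<Sum>k\<le>s. v $ j * A $$ (j, k) * v $ k)"
  using quad_form_sum[OF assms(1,2,2)] by (simp add: lessThan_Suc_atMost)

text \<open>Finitely many strict inequalities \<open>0 < kap D t + 2 * (sig D t)\<^sup>2\<close>
  hold with a common margin.\<close>

lemma kurtosis_margin: "\<exists>r>0. r \<le> 1 \<and> (\<forall>t\<le>s. 2 * r * (sig D t)\<^sup>2 \<le> kap D t + 2 * (sig D t)\<^sup>2)"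
proof -
  have "eventually (\<lambda>r. 0 < r \<and> 1 * r < 1 \<and> (\<forall>t\<in>{..s}. (2 * (sig D t)\<^sup>2) * r < kap D t + 2 * (sig D t)\<^sup>2)) (at_right (0::real))"
    by (intro eventually_conj eventually_at_right_less eventually_linear_small eventually_ball_finite ballI) (use D_moments(7) in auto)
  from eventually_happens'[OF trivial_limit_at_right_real this]
  obtain r where r: "0 < r \<and> 1 * r < 1 \<and> (\<forall>t\<in>{..s}. (2 * (sig D t)\<^sup>2) * r < kap D t + 2 * (sig D t)\<^sup>2)" by (rule exE)
  show ?thesis
  proof (intro exI[of _ r] conjI allI impI)
    fix t assume "t \<le> s"
    then have "(2 * (sig D t)\<^sup>2) * r < kap D t + 2 * (sig D t)\<^sup>2" using r by blast
    then show "2 * r * (sig D t)\<^sup>2 \<le> kap D t + 2 * (sig D t)\<^sup>2" by (simp add: mult_ac)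
  qed (use r in auto)
qed

end

locale lmm_information = lmm_sequence +
  assumes G_above: "bounded_from_above (\<lambda>n. mat_inv (mat_diag (s + 1) (g n)) * Gmat (d n) \<theta> * mat_inv (mat_diag (s + 1) (g n)))"
    and G_below: "bounded_from_below (\<lambda>n. mat_inv (mat_diag (s + 1) (g n)) * Gmat (d n) \<theta> * mat_inv (mat_diag (s + 1) (g n)))"
begin

abbreviation "m \<equiv> s + 1"
abbreviation "Dg n \<equiv> mat_diag m (g n)"
abbreviation "W n \<equiv> mat_inv (mat_diag m (g n))"

lemma mat_diag_inverse: "mat_diag m (g n) * mat_diag m (\<lambda>j. inverse (g n j)) = 1\<^sub>m m"
proof -
  have g: "g n j \<noteq> 0" if "j \<le> s" for j using g_pos[OF that, of n] by simp
  have "mat_diag m (\<lambda>j. g n j * inverse (g n j)) = mat_diag m (\<lambda>j. 1)"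
    unfolding mat_diag_def by (intro cong_mat) (use g in auto)
  then show ?thesis by simp
qed

lemma W_eq: "W n = mat_diag m (\<lambda>j. inverse (g n j))" by (rule mat_inv_eqI[OF mat_diag_dim mat_diag_dim mat_diag_inverse])

lemma W: "W n \<in> carrier_mat m m" "transpose_mat (W n) = W n"
proof -
  show "W n \<in> carrier_mat m m" unfolding W_eq by (rule mat_diag_dim)
  show "transpose_mat (W n) = W n" unfolding W_eq by (intro eq_matI) (auto simp: mat_diag_def)
qed

lemma Dg: "Dg n \<in> carrier_mat m m" "transpose_mat (Dg n) = Dg n"
proof -
  show "Dg n \<in> carrier_mat m m" by (rule mat_diag_dim)
  show "transpose_mat (Dg n) = Dg n" by (intro eq_matI) (auto simp: mat_diag_def)
qed

lemma Dg_W: "Dg n * W n = 1\<^sub>m m" unfolding W_eq by (rule mat_diag_inverse)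
lemma W_Dg: "W n * Dg n = 1\<^sub>m m" by (rule mat_mult_left_right_inverse[OF Dg(1) W(1) Dg_W])

lemma scaled_index:
  assumes A: "A \<in> carrier_mat m m" and jk: "j \<le> s" "k \<le> s"
  shows "(W n * A * W n) $$ (j, k) = gg n j k * A $$ (j, k)" unfolding W_eq mat_diag_mult_left[OF A] using jk
  by (subst mat_diag_mult_right[of _ m]) (simp_all add: mult_ac)

lemma scaled_quad:
  assumes A: "A \<in> carrier_mat m m" and v: "v \<in> carrier_vec m"
  shows "v \<bullet> ((W n * A * W n) *v v) = (W n *v v) \<bullet> (A *v (W n *v v))"
  using quad_transpose_mult[OF W(1) A v, of n] W(2)[of n] by simp

lemma I1_carrier: "I1 n \<in> carrier_mat m m" by (simp add: I1_def score_variance_def)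

lemma G_carrier: "Gmat (d n) \<theta>' \<in> carrier_mat m m"
proof -
  interpret lmm_bounded "d n" s "M n" D "\<alpha> n" "\<beta> n" "y n" \<theta> C by (rule model)
  show ?thesis by (rule Gmat)
qed

lemma poquim_carrier: "poquim (d n) \<theta>' y' \<in> carrier_mat m m"
proof -
  interpret lmm_bounded "d n" s "M n" D "\<alpha> n" "\<beta> n" "y n" \<theta> C by (rule model)
  show ?thesis by (simp add: poquim_def nranef)
qed

lemma score_variance_sym: "transpose_mat (I1 n) = I1 n"
  by (intro eq_matI) (auto simp: I1_def score_variance_def covariance_of_def mult.commute)

lemma scaled_carrier: "A \<in> carrier_mat m m \<Longrightarrow> W n * A * W n \<in> carrier_mat m m"
  by (intro mult_carrier_mat[of _ m m _ m] W(1))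

lemma scaled_sym:
  assumes A: "A \<in> carrier_mat m m" "A\<^sup>T = A"
  shows "transpose_mat (W n * A * W n) = W n * A * W n" by (rule transpose_sandwich[OF W A])

text \<open>The constants are obtained from one model but involve only s and D, so they serve for
  every n.\<close>

lemma information_bounds:
  "\<exists>r K. 0 < r \<and> 0 \<le> K \<and> (\<forall>n. \<forall>v\<in>carrier_vec m. 0 \<le> v \<bullet> (Gt n *v v) \<and>
     r * (v \<bullet> (Gt n *v v)) \<le> v \<bullet> (I1 n *v v) \<and> v \<bullet> (I1 n *v v) \<le> K * (v \<bullet> (Gt n *v v)))"
proof -
  have "\<exists>r>0. r \<le> 1 \<and> (\<forall>t\<le>s. 2 * r * (sig D t)\<^sup>2 \<le> kap D t + 2 * (sig D t)\<^sup>2)" "0 \<le> Kmax s D"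
  proof -
    interpret lmm_bounded "d 0" s "M 0" D "\<alpha> 0" "\<beta> 0" "y 0" \<theta> C by (rule model)
    show "\<exists>r>0. r \<le> 1 \<and> (\<forall>t\<le>s. 2 * r * (sig D t)\<^sup>2 \<le> kap D t + 2 * (sig D t)\<^sup>2)" by (rule kurtosis_margin)
    show "0 \<le> Kmax s D" by (rule Kmax_nonneg)
  qed
  then obtain r where r: "0 < r" "r \<le> 1" "\<And>t. t \<le> s \<Longrightarrow> 2 * r * (sig D t)\<^sup>2 \<le> kap D t + 2 * (sig D t)\<^sup>2" and K: "0 \<le> 1 + Kmax s D" by auto
  show ?thesis
  proof (rule exI[of _ r], rule exI[of _ "1 + Kmax s D"], intro conjI r(1) K allI ballI)
    fix n and v :: "real vec" assume v: "v \<in> carrier_vec m"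
    interpret lmm_bounded "d n" s "M n" D "\<alpha> n" "\<beta> n" "y n" \<theta> C by (rule model)
    have I: "v \<bullet> (I1 n *v v) = (\<Sum>j\<le>s. \<Sum>k\<le>s. v $ j * I1e j k * v $ k)"
      unfolding quad_sum_s[OF I1_carrier v] by (intro sum.cong refl) (simp add: I1_def score_variance_I1e[OF contrast])
    note G = quad_sum_s[OF G_carrier[of n \<theta>] v]
    show "0 \<le> v \<bullet> (Gt n *v v)" unfolding G by (rule G_quad_nonneg)
    show "r * (v \<bullet> (Gt n *v v)) \<le> v \<bullet> (I1 n *v v)" unfolding G I by (rule I1e_quad_lower[OF r])
    show "v \<bullet> (I1 n *v v) \<le> (1 + Kmax s D) * (v \<bullet> (Gt n *v v))" unfolding G I by (rule I1e_quad_upper)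
  qed
qed

text \<open>Norm bounds for the scaled Gaussian information and its inverse become form bounds, pass
  to the scaled true information by \<open>information_bounds\<close>, and give its norm bound by
  \<open>psd_opbound\<close>.\<close>

lemma scaled_bounds:
  obtains a \<kappa> b l where "0 < a" "0 < \<kappa>" "0 \<le> b" "0 < l"
    "\<And>n. opbound (W n * Gt n * W n) \<kappa>"
    "\<And>n v. v \<in> carrier_vec m \<Longrightarrow> vec_norm2 v \<le> a * vec_norm2 ((W n * Gt n * W n) *v v)"
    "\<And>n. opbound (W n * I1 n * W n) b"
    "\<And>n v. v \<in> carrier_vec m \<Longrightarrow> l * (v \<bullet> v) \<le> v \<bullet> ((W n * I1 n * W n) *v v)"
proof -
  let ?G = "\<lambda>n. W n * Gt n * W n" and ?I = "\<lambda>n. W n * I1 n * W n"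
  have Gc: "?G n \<in> carrier_mat m m" and Ic: "?I n \<in> carrier_mat m m" for n
    by (rule scaled_carrier[OF G_carrier] scaled_carrier[OF I1_carrier])+
  have m: "0 < m" by simp
  obtain \<kappa> where \<kappa>: "0 < \<kappa>" "\<And>n. norm (mat_norm (?G n)) \<le> \<kappa>"
    using G_above unfolding bounded_from_above_def Bseq_def by blast
  have Gb: "opbound (?G n) \<kappa>" for n by (rule opbound_mono[OF opbound_mat_norm[OF Gc m]]) (use \<kappa>(2)[of n] in simp)
  have inv: "invertible_mat (?G n)" for n using G_below unfolding bounded_from_below_def by blast
  obtain a where a: "0 < a" "\<And>n. norm (mat_norm (mat_inv (?G n))) \<le> a"
    using G_below unfolding bounded_from_below_def Bseq_def by blast
  have Gl: "vec_norm2 v \<le> a * vec_norm2 (?G n *v v)" if v: "v \<in> carrier_vec m" for n v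
  proof -
    have "opbound (mat_inv (?G n)) a" by (rule opbound_mono[OF opbound_mat_norm[OF mat_inv_carrier[OF Gc inv] m]]) (use a(2)[of n] in simp)
    from inverse_lower[OF Gc mat_inv_carrier[OF Gc inv] mat_inv_left[OF Gc inv] this v] show ?thesis .
  qed
  obtain r K where r: "0 < r" and K: "0 \<le> K" and rK: "\<And>n v. v \<in> carrier_vec m \<Longrightarrow> 0 \<le> v \<bullet> (Gt n *v v) \<and>
     r * (v \<bullet> (Gt n *v v)) \<le> v \<bullet> (I1 n *v v) \<and> v \<bullet> (I1 n *v v) \<le> K * (v \<bullet> (Gt n *v v))"
    using information_bounds by blast
  have quad: "0 \<le> v \<bullet> (?G n *v v)" "r * (v \<bullet> (?G n *v v)) \<le> v \<bullet> (?I n *v v)" "v \<bullet> (?I n *v v) \<le> K * (v \<bullet> (?G n *v v))"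
    if v: "v \<in> carrier_vec m" for n v
    unfolding scaled_quad[OF G_carrier v] scaled_quad[OF I1_carrier v] using rK[OF mult_mat_vec_carrier[OF W(1) v], of n n] by blast+
  have Gsym: "transpose_mat (?G n) = ?G n" for n
  proof -
    interpret lmm_bounded "d n" s "M n" D "\<alpha> n" "\<beta> n" "y n" \<theta> C by (rule model)
    show ?thesis by (rule scaled_sym[OF G_carrier Gmat_sym])
  qed
  have Gu: "v \<bullet> (?G n *v v) \<le> \<kappa> * (v \<bullet> v)" if v: "v \<in> carrier_vec m" for n v
    using quad_le_opbound[OF Gc Gb v, of n] by linarith
  have G_lower: "v \<bullet> v \<le> a\<^sup>2 * \<kappa> * (v \<bullet> (?G n *v v))" if v: "v \<in> carrier_vec m" for n v
    by (rule psd_invertible_lower[OF Gc Gsym quad(1) \<kappa>(1) Gu a(1) Gl v])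
  have Il: "r / (a\<^sup>2 * \<kappa>) * (v \<bullet> v) \<le> v \<bullet> (?I n *v v)" if v: "v \<in> carrier_vec m" for n v
  proof -
    have pos: "0 < r / (a\<^sup>2 * \<kappa>)" using r a \<kappa> by simp
    have "r / (a\<^sup>2 * \<kappa>) * (v \<bullet> v) \<le> r / (a\<^sup>2 * \<kappa>) * (a\<^sup>2 * \<kappa> * (v \<bullet> (?G n *v v)))"
      by (rule mult_left_mono[OF G_lower[OF v] less_imp_le[OF pos]])
    also have "\<dots> = r * (v \<bullet> (?G n *v v))" using a \<kappa> by simp
    also have "\<dots> \<le> v \<bullet> (?I n *v v)" by (rule quad(2)[OF v])
    finally show ?thesis .
  qed
  have Ib: "opbound (?I n) (K * \<kappa>)" for n
  proof (rule psd_opbound[OF Ic scaled_sym[OF I1_carrier score_variance_sym]])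
    fix v :: "real vec" assume v: "v \<in> carrier_vec m"
    show "0 \<le> v \<bullet> (?I n *v v)" by (rule order_trans[OF mult_nonneg_nonneg[OF less_imp_le[OF r] quad(1)[OF v]] quad(2)[OF v]])
    show "v \<bullet> (?I n *v v) \<le> K * \<kappa> * (v \<bullet> v)"
      using order_trans[OF quad(3)[OF v] mult_left_mono[OF Gu[OF v] K]] by (simp add: mult.assoc)
  qed (use K \<kappa> in simp)
  show ?thesis by (rule that[OF a(1) \<kappa>(1) _ _ Gb Gl Ib Il]) (use K \<kappa> r a in simp_all)
qed

text \<open>Undoing the scaling: x is W applied to \<open>Dg n *v x\<close>, where the form of the
  scaled matrix is bounded below.\<close>

lemma I1_pd: "positive_definite (I1 n)"
proof -
  obtain a \<kappa> b c where c: "0 < c" "\<And>n v. v \<in> carrier_vec m \<Longrightarrow> c * (v \<bullet> v) \<le> v \<bullet> ((W n * I1 n * W n) *v v)"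
    using scaled_bounds by metis
  have "0 < x \<bullet> (I1 n *v x)" if x: "x \<in> carrier_vec m" "x \<noteq> 0\<^sub>v m" for x
  proof -
    let ?v = "Dg n *v x"
    have v: "?v \<in> carrier_vec m" by (rule mult_mat_vec_carrier[OF Dg(1) x(1)])
    have Wv: "W n *v ?v = x"
    proof -
      have "W n *v ?v = (W n * Dg n) *v x" by (rule assoc_mult_mat_vec[symmetric, OF W(1) Dg(1) x(1)])
      then show ?thesis unfolding W_Dg using x by simp
    qed
    have "?v \<noteq> 0\<^sub>v m" using Wv x(2) mult_mat_zero_vec[OF W(1)] by force
    then have "0 < vec_norm2 ?v" using vec_norm2_eq_0[OF v] vec_norm2_nonneg[of ?v] by (simp add: less_le)
    then have "0 < c * (?v \<bullet> ?v)" using c(1) unfolding vec_norm2_power2[symmetric] by simp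
    also have "\<dots> \<le> x \<bullet> (I1 n *v x)" using c(2)[OF v, of n] unfolding scaled_quad[OF I1_carrier v] Wv .
    finally show ?thesis .
  qed
  then show ?thesis unfolding positive_definite_iff[OF I1_carrier] using score_variance_sym by blast
qed

lemma scaled_diff_opbound:
  assumes A: "A \<in> carrier_mat m m" and B: "B \<in> carrier_mat m m" and \<eta>: "0 \<le> \<eta>"
    and diff: "\<And>j k. j \<le> s \<Longrightarrow> k \<le> s \<Longrightarrow> \<bar>gg n j k * (A $$ (j, k) - B $$ (j, k))\<bar> \<le> \<eta>"
  shows "opbound (W n * A * W n - W n * B * W n) (real m * real m * \<eta>)"
proof (rule opbound_of_entries[OF minus_carrier_mat[OF scaled_carrier[OF B]] _ \<eta>])
  fix j k assume "j < m" "k < m"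
  then have jk: "j \<le> s" "k \<le> s" by auto
  have "(W n * A * W n - W n * B * W n) $$ (j, k) = (W n * A * W n) $$ (j, k) - (W n * B * W n) $$ (j, k)"
    by (rule index_minus_mat(1)) (use scaled_carrier[OF B, of n] jk in auto)
  then show "\<bar>(W n * A * W n - W n * B * W n) $$ (j, k)\<bar> \<le> \<eta>"
    unfolding scaled_index[OF A jk] scaled_index[OF B jk] right_diff_distrib[symmetric] using diff[OF jk] by simp
qed

theorem I1_consistent: "consistent_estimator M I1 (\<lambda>n z. Ph n z)" unfolding consistent_estimator_def
proof (intro conjI allI I1_pd)
  define R where "R jk n z = inverse (g n (fst jk) * g n (snd jk)) * (Ph n z $$ jk - I1 n $$ jk)" for jk n z
  obtain a \<kappa> b c where c: "0 < c" "\<And>n v. v \<in> carrier_vec m \<Longrightarrow> c * (v \<bullet> v) \<le> v \<bullet> ((W n * I1 n * W n) *v v)"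
    using scaled_bounds by metis
  have dim: "dim_row (I1 n) = m" for n using I1_carrier[of n] by simp
  show "tends_to_0_in_prob M (\<lambda>n z. mat_norm (mat_inv_sqrt (I1 n) * Ph n z * mat_inv_sqrt (I1 n) - 1\<^sub>m (dim_row (I1 n))))"
    unfolding dim
  proof (rule tends_to_0_in_prob_by_finitely_many[where K = "{..s} \<times> {..s}" and R = R])
    show "tends_to_0_in_prob M (R jk)" if "jk \<in> {..s} \<times> {..s}" for jk
      using poquim_entry_consistent[of "fst jk" "snd jk"] that by (auto simp: R_def[abs_def])
    fix \<epsilon> :: real assume \<epsilon>: "0 < \<epsilon>"
    \<comment> \<open>Entrywise error \<eta> means operator error at most m squared times \<eta>,
      and \<open>scaled_consistency_bound\<close> divides this by c.\<close>
    define \<eta> where "\<eta> = \<epsilon> * c / (real m * real m)"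
    have \<eta>: "0 < \<eta>" "real m * real m * \<eta> / c = \<epsilon>" using \<epsilon> c(1) by (auto simp: \<eta>_def)
    have "\<bar>mat_norm (mat_inv_sqrt (I1 n) * Ph n z * mat_inv_sqrt (I1 n) - 1\<^sub>m m)\<bar> \<le> \<epsilon>"
      if R: "\<forall>jk\<in>{..s} \<times> {..s}. \<bar>R jk n z\<bar> \<le> \<eta>" for n z
    proof -
      let ?P = "Ph n z"
      have "opbound (W n * ?P * W n - W n * I1 n * W n) (real m * real m * \<eta>)"
        by (rule scaled_diff_opbound[OF poquim_carrier I1_carrier less_imp_le[OF \<eta>(1)]]) (use R in \<open>auto simp: R_def\<close>)
      from scaled_consistency_bound[OF _ I1_carrier I1_pd poquim_carrier W Dg W_Dg c this]
      have "mat_norm (mat_inv_sqrt (I1 n) * ?P * mat_inv_sqrt (I1 n) - 1\<^sub>m m) \<le> \<epsilon>" using \<eta>(2) by simp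
      moreover have "0 \<le> mat_norm (mat_inv_sqrt (I1 n) * ?P * mat_inv_sqrt (I1 n) - 1\<^sub>m m)"
        by (rule mat_norm_nonneg[OF minus_carrier_mat[OF one_carrier_mat]]) simp
      ultimately show ?thesis by simp
    qed
    then show "\<exists>\<eta>>0. \<forall>n. \<forall>z\<in>space (M n). (\<forall>jk\<in>{..s} \<times> {..s}. \<bar>R jk n z\<bar> \<le> \<eta>) \<longrightarrow>
        \<bar>mat_norm (mat_inv_sqrt (I1 n) * Ph n z * mat_inv_sqrt (I1 n) - 1\<^sub>m m)\<bar> \<le> \<epsilon>" using \<eta>(1) by blast
  qed simp
qed

lemma G_invertible: "invertible_mat (Gt n)"
  using G_below scaled_inverse(1)[OF G_carrier W(1) Dg(1) W_Dg] unfolding bounded_from_below_def by blast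

definition SigmaR :: "nat \<Rightarrow> real mat" where
  "SigmaR n = mat_inv (Gt n) * I1 n * mat_inv (Gt n)"

text \<open>The sandwich formula is assumed only where the estimated Gaussian information is
  invertible. Once the scaled entries are close this holds by perturbation, so arbitrary values
  elsewhere are confined to an event of vanishing outer probability.\<close>

theorem SigmaR_consistent:
  assumes Sh: "\<And>n z. z \<in> space (M n) \<Longrightarrow> invertible_mat (Gh n z) \<Longrightarrow>
      Sh n z = mat_inv (Gh n z) * Ph n z * mat_inv (Gh n z)"
  shows "consistent_estimator M SigmaR Sh"
proof -
  obtain a \<kappa> b l where pos: "0 < a" "0 < \<kappa>" "0 \<le> b" "0 < l"
    and Gb: "\<And>n. opbound (W n * Gt n * W n) \<kappa>"
    and Gl: "\<And>n v. v \<in> carrier_vec m \<Longrightarrow> vec_norm2 v \<le> a * vec_norm2 ((W n * Gt n * W n) *v v)"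
    and Ib: "\<And>n. opbound (W n * I1 n * W n) b"
    and Il: "\<And>n v. v \<in> carrier_vec m \<Longrightarrow> l * (v \<bullet> v) \<le> v \<bullet> ((W n * I1 n * W n) *v v)"
    using scaled_bounds by blast
  let ?G = "\<lambda>n. W n * Gt n * W n" and ?I = "\<lambda>n. W n * I1 n * W n"
  have Gc: "?G n \<in> carrier_mat m m" and Ic: "?I n \<in> carrier_mat m m" for n
    by (rule scaled_carrier[OF G_carrier] scaled_carrier[OF I1_carrier])+
  have inv: "invertible_mat (?G n)" for n by (rule vec_norm2_le_imp_invertible[OF Gc Gl])
  have Gsym: "transpose_mat (Gt n) = Gt n" for n
  proof -
    interpret lmm_bounded "d n" s "M n" D "\<alpha> n" "\<beta> n" "y n" \<theta> C by (rule model)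
    show ?thesis by (rule Gmat_sym)
  qed
  note Gi = mat_inv_carrier[OF G_carrier G_invertible] and Gis = transpose_mat_inv[OF G_carrier Gsym G_invertible]
  note Ki = mat_inv_carrier[OF Gc inv]
  have Kis: "transpose_mat (mat_inv (?G n)) = mat_inv (?G n)" for n by (rule transpose_mat_inv[OF Gc scaled_sym[OF G_carrier Gsym] inv])
  have Sc: "SigmaR n \<in> carrier_mat m m" for n unfolding SigmaR_def by (rule mult_carrier_mat[OF mult_carrier_mat[OF Gi I1_carrier] Gi])
  have Spd: "positive_definite (SigmaR n)" for n
  proof -
    have "injective_mat (mat_inv (Gt n))" unfolding injective_mat_def
    proof (intro ballI impI)
      fix v assume "v \<in> carrier_vec (dim_col (mat_inv (Gt n)))" "mat_inv (Gt n) *v v = 0\<^sub>v (dim_row (mat_inv (Gt n)))"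
      then have v: "v \<in> carrier_vec m" "mat_inv (Gt n) *v v = 0\<^sub>v m" using Gi[of n] by auto
      have "v = (Gt n * mat_inv (Gt n)) *v v" unfolding mat_inv_right[OF G_carrier G_invertible] using v(1) by simp
      also have "\<dots> = Gt n *v (mat_inv (Gt n) *v v)" by (rule assoc_mult_mat_vec[OF G_carrier Gi v(1)])
      also have "\<dots> = 0\<^sub>v m" unfolding v(2) by (rule mult_mat_zero_vec[OF G_carrier])
      finally show "v = 0\<^sub>v (dim_col (mat_inv (Gt n)))" using Gi[of n] by simp
    qed
    from positive_definite_congruence[OF Gi I1_carrier I1_pd this] show ?thesis unfolding SigmaR_def Gis .
  qed
  have DSD: "Dg n * SigmaR n * Dg n = mat_inv (?G n) * ?I n * mat_inv (?G n)" for n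
    unfolding SigmaR_def by (rule scaled_sandwich[OF G_carrier I1_carrier W(1) Dg(1) W_Dg inv])
  define l' where "l' = l / \<kappa>\<^sup>2"
  have l': "0 < l'" using pos by (simp add: l'_def)
  \<comment> \<open>Substituting \<open>v = G w\<close>, with G the scaled Gaussian information,
    turns the sandwich into the form of the scaled true information at w, and
    \<open>|v| \<le> \<kappa> |w|\<close>.\<close>
  have Sl: "l' * (v \<bullet> v) \<le> v \<bullet> ((Dg n * SigmaR n * Dg n) *v v)" if v: "v \<in> carrier_vec m" for n v
  proof -
    define w where "w = mat_inv (?G n) *v v"
    have w: "w \<in> carrier_vec m" unfolding w_def by (rule mult_mat_vec_carrier[OF Ki v])
    have "?G n *v w = (?G n * mat_inv (?G n)) *v v" unfolding w_def by (rule assoc_mult_mat_vec[symmetric, OF Gc Ki v])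
    then have Gw: "?G n *v w = v" unfolding mat_inv_right[OF Gc inv] using v by simp
    have "v \<bullet> v \<le> (\<kappa> * vec_norm2 w)\<^sup>2"
      unfolding vec_norm2_power2[symmetric] by (rule power_mono) (use opboundD[OF Gb Gc w, of n] Gw in simp_all)
    also have "\<dots> = \<kappa>\<^sup>2 * (w \<bullet> w)" by (simp only: power_mult_distrib vec_norm2_power2)
    finally have "l' * (v \<bullet> v) \<le> l' * (\<kappa>\<^sup>2 * (w \<bullet> w))" using l' by (simp add: mult_left_mono)
    also have "\<dots> = l * (w \<bullet> w)" using pos by (simp add: l'_def)
    also have "\<dots> \<le> w \<bullet> (?I n *v w)" by (rule Il[OF w])
    also have "\<dots> = v \<bullet> ((mat_inv (?G n) * ?I n * mat_inv (?G n)) *v v)"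
      using quad_transpose_mult[OF Ki Ic v, of n n] unfolding Kis w_def by simp
    finally show ?thesis unfolding DSD .
  qed
  show ?thesis unfolding consistent_estimator_def
  proof (intro conjI allI Spd)
    \<comment> \<open>The Boolean component selects the entries of the POQUIM or those of the
      Gaussian information, so that one finite index set covers both.\<close>
    define R where "R i n z = inverse (g n (fst (snd i)) * g n (snd (snd i))) *
      (if fst i then Ph n z $$ snd i - I1 n $$ snd i
       else Gh n z $$ snd i - Gt n $$ snd i)" for i :: "bool \<times> nat \<times> nat" and n z
    have dim: "dim_row (SigmaR n) = m" for n using Sc[of n] by simp
    show "tends_to_0_in_prob M (\<lambda>n z. mat_norm (mat_inv_sqrt (SigmaR n) * Sh n z * mat_inv_sqrt (SigmaR n) - 1\<^sub>m (dim_row (SigmaR n))))"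
      unfolding dim
    proof (rule tends_to_0_in_prob_by_finitely_many[where K = "UNIV \<times> {..s} \<times> {..s}" and R = R])
      show "tends_to_0_in_prob M (R i)" if i: "i \<in> UNIV \<times> {..s} \<times> {..s}" for i
      proof -
        obtain t j k where ijk: "i = (t, j, k)" "j \<le> s" "k \<le> s" using i by auto
        show ?thesis using poquim_entry_consistent[OF ijk(2,3)] Gmat_entry_consistent[OF ijk(2,3)]
          by (cases t) (simp_all add: R_def[abs_def] ijk(1))
      qed
      fix \<epsilon> :: real assume \<epsilon>: "0 < \<epsilon>"
      define K where "K = 2 * a\<^sup>2 * (2 * a * (b + 1) + 1 + a * b)"
      have K: "0 < K" unfolding K_def using pos by (intro mult_pos_pos add_pos_nonneg add_nonneg_pos) auto
      \<comment> \<open>The three bounds serve, in this order, to replace \<open>b + e\<close> by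
        \<open>b + 1\<close>, to make the perturbation of the inverse admissible, and to reach
        \<epsilon>.\<close>
      define e where "e = min 1 (min (1 / (2 * a)) (\<epsilon> * l' / K))"
      have e: "0 < e" "e \<le> 1" "e \<le> 1 / (2 * a)" "e \<le> \<epsilon> * l' / K" using pos \<epsilon> l' K by (auto simp: e_def)
      define \<eta> where "\<eta> = e / (real m * real m)"
      have \<eta>: "0 < \<eta>" "real m * real m * \<eta> = e" using e by (auto simp: \<eta>_def)
      have "\<bar>mat_norm (mat_inv_sqrt (SigmaR n) * Sh n z * mat_inv_sqrt (SigmaR n) - 1\<^sub>m m)\<bar> \<le> \<epsilon>"
        if z: "z \<in> space (M n)" and R: "\<forall>i\<in>UNIV \<times> {..s} \<times> {..s}. \<bar>R i n z\<bar> \<le> \<eta>" for n z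
      proof -
        let ?P = "Ph n z" and ?H = "Gh n z"
        have eI: "\<bar>gg n j k * (?P $$ (j, k) - I1 n $$ (j, k))\<bar> \<le> \<eta>"
          and eG: "\<bar>gg n j k * (?H $$ (j, k) - Gt n $$ (j, k))\<bar> \<le> \<eta>" if "j \<le> s" "k \<le> s" for j k
          using bspec[OF R, of "(True, j, k)"] bspec[OF R, of "(False, j, k)"] that by (simp_all add: R_def)
        note \<eta>0 = less_imp_le[OF \<eta>(1)]
        have dP: "opbound (W n * ?P * W n - ?I n) e"
          unfolding \<eta>(2)[symmetric] by (rule scaled_diff_opbound[OF poquim_carrier I1_carrier \<eta>0 eI])
        have dG: "opbound (W n * ?H * W n - ?G n) e"
          unfolding \<eta>(2)[symmetric] by (rule scaled_diff_opbound[OF G_carrier G_carrier \<eta>0 eG])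
        have small: "a * e \<le> 1 / 2" using mult_left_mono[OF e(3) less_imp_le[OF pos(1)]] pos(1) by simp
        note pert = sandwich_perturbation[OF Gc less_imp_le[OF pos(1)] Gl Ic Ib scaled_carrier[OF G_carrier] dG scaled_carrier[OF poquim_carrier] dP small]
        have invH: "invertible_mat ?H" by (rule scaled_inverse(1)[OF G_carrier W(1) Dg(1) W_Dg pert(1)])
        note Hi = mat_inv_carrier[OF G_carrier invH]
        have Sh_eq: "Sh n z = mat_inv ?H * ?P * mat_inv ?H" by (rule Sh[OF z invH])
        have Shc: "Sh n z \<in> carrier_mat m m" unfolding Sh_eq by (rule mult_carrier_mat[OF mult_carrier_mat[OF Hi poquim_carrier] Hi])
        have DShD: "Dg n * Sh n z * Dg n = mat_inv (W n * ?H * W n) * (W n * ?P * W n) * mat_inv (W n * ?H * W n)"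
          unfolding Sh_eq by (rule scaled_sandwich[OF G_carrier poquim_carrier W(1) Dg(1) W_Dg pert(1)])
        have "opbound (Dg n * Sh n z * Dg n - Dg n * SigmaR n * Dg n) (e * (2 * a\<^sup>2 * (2 * a * (b + e) + 1 + a * b)))"
          unfolding DSD DShD by (rule pert(2))
        moreover have "e * (2 * a\<^sup>2 * (2 * a * (b + e) + 1 + a * b)) \<le> e * K"
          unfolding K_def using e pos by (intro mult_left_mono add_mono) auto
        ultimately have "opbound (Dg n * Sh n z * Dg n - Dg n * SigmaR n * Dg n) (e * K)" by (rule opbound_mono)
        from scaled_consistency_bound[OF _ Sc Spd Shc Dg W Dg_W l' Sl this]
        have "mat_norm (mat_inv_sqrt (SigmaR n) * Sh n z * mat_inv_sqrt (SigmaR n) - 1\<^sub>m m) \<le> e * K / l'" by simp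
        also have "\<dots> \<le> \<epsilon>" using e(4) K l' by (simp add: field_simps)
        finally have "mat_norm (mat_inv_sqrt (SigmaR n) * Sh n z * mat_inv_sqrt (SigmaR n) - 1\<^sub>m m) \<le> \<epsilon>" .
        moreover have "0 \<le> mat_norm (mat_inv_sqrt (SigmaR n) * Sh n z * mat_inv_sqrt (SigmaR n) - 1\<^sub>m m)"
          by (rule mat_norm_nonneg[OF minus_carrier_mat[OF one_carrier_mat]]) simp
        ultimately show ?thesis by simp
      qed
      then show "\<exists>\<eta>>0. \<forall>n. \<forall>z\<in>space (M n). (\<forall>i\<in>UNIV \<times> {..s} \<times> {..s}. \<bar>R i n z\<bar> \<le> \<eta>) \<longrightarrow>
          \<bar>mat_norm (mat_inv_sqrt (SigmaR n) * Sh n z * mat_inv_sqrt (SigmaR n) - 1\<^sub>m m)\<bar> \<le> \<epsilon>"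
        using \<eta>(1) by blast
    qed simp
  qed
qed

end

text \<open>Only values on the sample space matter, since \<open>prob_tends_to_0\<close> measures
  subsets of it.\<close>

lemma consistent_estimator_cong:
  assumes "consistent_estimator M A Bh" and eq: "\<And>n z. z \<in> space (M n) \<Longrightarrow> Ah n z = Bh n z"
  shows "consistent_estimator M A Ah"
proof -
  have cong: "prob_tends_to_0 M (\<lambda>n z. F n (Ah n z)) = prob_tends_to_0 M (\<lambda>n z. F n (Bh n z))" for F
  proof -
    have "{z \<in> space (M n). F n (Ah n z)} = {z \<in> space (M n). F n (Bh n z)}" for n using eq by auto
    then show ?thesis by (simp add: prob_tends_to_0_def)
  qed
  show ?thesis using assms(1) unfolding consistent_estimator_def tends_to_0_in_prob_def
      cong[of "\<lambda>n X. e < \<bar>mat_norm (mat_inv_sqrt (A n) * X * mat_inv_sqrt (A n) - 1\<^sub>m (dim_row (A n)))\<bar>" for e] .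
qed

theorem theorem2:
  fixes s :: nat
    and d :: "nat \<Rightarrow> lmm_design"
    and M :: "nat \<Rightarrow> 'a measure"
    and D :: "nat \<Rightarrow> real measure"
    and \<alpha> :: "nat \<Rightarrow> nat \<Rightarrow> nat \<Rightarrow> 'a \<Rightarrow> real"
    and \<beta> :: "nat \<Rightarrow> real vec"
    and y :: "nat \<Rightarrow> 'a \<Rightarrow> real vec"
    and \<theta> :: "real vec"
    and c :: "nat \<Rightarrow> real"
    and T :: "nat \<Rightarrow> real mat"
    and S :: "nat \<Rightarrow> real vec set"
    and \<theta>hat :: "nat \<Rightarrow> 'a \<Rightarrow> real vec"
    and I1 I2 SigmaR :: "nat \<Rightarrow> real mat"
    and I1hat I2hat SigmaRhat :: "nat \<Rightarrow> 'a \<Rightarrow> real mat"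
    and g :: "nat \<Rightarrow> nat \<Rightarrow> real"
  assumes design: "\<And>n. nranef (d n) = s" "\<And>n. valid_design (d n)"
      "filterlim (\<lambda>n. nobs (d n)) at_top sequentially"
    and effects: "\<And>t. t \<le> s \<Longrightarrow> centred_square_integrable (D t)"
      "\<And>n. random_effects (M n) (d n) D (\<alpha> n)"
    and model: "\<And>n. \<beta> n \<in> carrier_vec (nfix (d n))"
      "\<And>n \<omega>. \<omega> \<in> space (M n) \<Longrightarrow> y n \<omega> = response (d n) (\<beta> n) (\<lambda>t l. \<alpha> n t l \<omega>)"
    and theta: "\<theta> = true_theta s D"
    and contrast: "\<And>n. reml_contrast (d n) (T n)"
    and I1: "\<And>n. I1 n = score_variance (M n) s (\<lambda>\<omega>. reml_loglik (d n) (c n) (T n) (y n \<omega>)) \<theta>"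
    and I2: "\<And>n. I2 n = expected_hessian (M n) s (\<lambda>\<omega>. reml_loglik (d n) (c n) (T n) (y n \<omega>)) \<theta>"
    and SigmaR: "\<And>n. SigmaR n = mat_inv (I2 n) * I1 n * mat_inv (I2 n)"
    and reml: "\<And>n. S n \<subseteq> param_space s"
      "\<And>n \<omega>. \<omega> \<in> space (M n) \<Longrightarrow> \<theta>hat n \<omega> \<in> param_space s"
      "prob_tends_to_0 M (\<lambda>n \<omega>. \<not> is_arg_max (reml_loglik (d n) (c n) (T n) (y n \<omega>))
         (\<lambda>\<theta>'. \<theta>' \<in> S n) (\<theta>hat n \<omega>))"
      "tends_to_0_in_prob M (\<lambda>n \<omega>. vec_norm2 (\<theta>hat n \<omega> - \<theta>))"
    and I1hat: "\<And>n \<omega>. \<omega> \<in> space (M n) \<Longrightarrow> I1hat n \<omega> = poquim (d n) (\<theta>hat n \<omega>) (y n \<omega>)"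
    and I2hat: "\<And>n \<omega>. \<omega> \<in> space (M n) \<Longrightarrow> I2hat n \<omega> = I2_at (d n) (\<theta>hat n \<omega>)"
    and SigmaRhat: "\<And>n \<omega>. \<omega> \<in> space (M n) \<Longrightarrow> invertible_mat (I2hat n \<omega>) \<Longrightarrow>
      SigmaRhat n \<omega> = mat_inv (I2hat n \<omega>) * I1hat n \<omega> * mat_inv (I2hat n \<omega>)"
    and i: "\<And>t. t \<le> s \<Longrightarrow> 0 < variance_of (D t) (\<lambda>x. x)"
      "\<And>t. t \<le> s \<Longrightarrow> finite_variance (D t) (\<lambda>x. x\<^sup>2)"
      "\<And>t. t \<le> s \<Longrightarrow> 0 < variance_of (D t) (\<lambda>x. x\<^sup>2)"
    and ii: "\<exists>C. \<forall>n. \<forall>i<nobs (d n). vec_norm2 (row (Xmat (d n)) i) \<le> C \<and>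
      (\<forall>t\<in>{1..s}. vec_norm1 (row (Zmat (d n) t) i) \<le> C)"
    and iii: "\<And>n j. j \<le> s \<Longrightarrow> 0 < g n j"
      "bounded_from_above (\<lambda>n. mat_inv (mat_diag (s + 1) (g n)) * Gmat (d n) \<theta> *
         mat_inv (mat_diag (s + 1) (g n)))"
      "bounded_from_below (\<lambda>n. mat_inv (mat_diag (s + 1) (g n)) * Gmat (d n) \<theta> *
         mat_inv (mat_diag (s + 1) (g n)))"
      "filterlim (\<lambda>n. lambda_min (transpose_mat (Xmat (d n)) * mat_inv (Vmat (d n) \<theta>) * Xmat (d n)))
         at_top sequentially"
    and iv: "\<And>j k. j \<le> s \<Longrightarrow> k \<le> s \<Longrightarrow> Bseq (\<lambda>n. inverse (g n j * g n k) *
        (\<Sum>\<phi>\<in>fvals (d n). real (hcount (d n) \<phi>) * \<bar>ccoef (d n) \<theta> j k \<phi>\<bar>))"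
      "\<And>j k. j \<le> s \<Longrightarrow> k \<le> s \<Longrightarrow> (\<lambda>n. inverse ((g n j * g n k)\<^sup>2) *
        (\<Sum>\<phi>1\<in>fvals (d n). \<Sum>\<phi>2\<in>fvals (d n). real (hcount2 (d n) \<phi>1 \<phi>2) *
          \<bar>ccoef (d n) \<theta> j k \<phi>1 * ccoef (d n) \<theta> j k \<phi>2\<bar>)) \<longlonglongrightarrow> 0"
    and v: "\<And>j k. j \<le> s \<Longrightarrow> k \<le> s \<Longrightarrow>
        uniform_limit UNIV (\<lambda>\<delta> n. inverse (g n j * g n k) * gdev (d n) \<theta> j k \<delta>) (\<lambda>n. 0) (at_right 0)"
      "\<And>j k. j \<le> s \<Longrightarrow> k \<le> s \<Longrightarrow>
        uniform_limit UNIV (\<lambda>\<delta> n. inverse (g n j * g n k) *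
          (\<Sum>\<phi>\<in>fvals (d n). real (hcount (d n) \<phi>) * cdev (d n) \<theta> j k \<phi> \<delta>)) (\<lambda>n. 0) (at_right 0)"
  shows "consistent_estimator M I1 I1hat \<and> consistent_estimator M SigmaR SigmaRhat"
proof -
  obtain C where C: "\<And>n i. i < nobs (d n) \<Longrightarrow> vec_norm2 (row (Xmat (d n)) i) \<le> C"
    "\<And>n i t. i < nobs (d n) \<Longrightarrow> t \<in> {1..s} \<Longrightarrow> vec_norm1 (row (Zmat (d n) t) i) \<le> C"
    using ii by blast
  have model': "lmm_bounded (d n) s (M n) D (\<alpha> n) (\<beta> n) (y n) \<theta> C" for n
    by unfold_locales (rule design effects model theta i C; assumption)+
  interpret L: lmm_information s d M D \<alpha> \<beta> y \<theta> C c T g \<theta>hat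
    by (intro lmm_information.intro lmm_information_axioms.intro lmm_sequence.intro) (rule model' contrast iii iv v reml(2,4); assumption?)+
  have I1_eq: "I1 = L.I1" by (rule ext) (simp add: I1 L.I1_def)
  have I2_eq: "I2 n = - Gmat (d n) \<theta>" for n
  proof -
    interpret lmm_bounded "d n" s "M n" D "\<alpha> n" "\<beta> n" "y n" \<theta> C by (rule model')
    show ?thesis unfolding I2 by (rule expected_hessian_eq[OF contrast])
  qed
  have Sigma_eq: "SigmaR = L.SigmaR"
    by (rule ext) (simp only: SigmaR L.SigmaR_def I1_eq I2_eq neg_sandwich[OF L.G_carrier L.G_invertible L.I1_carrier])
  have "consistent_estimator M I1 I1hat" unfolding I1_eq by (rule consistent_estimator_cong[OF L.I1_consistent I1hat])
  moreover have "consistent_estimator M SigmaR SigmaRhat" unfolding Sigma_eq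
  proof (rule L.SigmaR_consistent)
    fix n z assume z: "z \<in> space (M n)" and inv: "invertible_mat (Gmat (d n) (\<theta>hat n z))"
    have I2h: "I2hat n z = - Gmat (d n) (\<theta>hat n z)" using I2hat[OF z] by (simp add: I2_at_def)
    have "invertible_mat (I2hat n z)" unfolding I2h by (rule invertible_uminus[OF L.G_carrier inv])
    then show "SigmaRhat n z = mat_inv (Gmat (d n) (\<theta>hat n z)) * poquim (d n) (\<theta>hat n z) (y n z) * mat_inv (Gmat (d n) (\<theta>hat n z))"
      using SigmaRhat[OF z] unfolding I2h I1hat[OF z] neg_sandwich[OF L.G_carrier inv L.poquim_carrier] by simp
  qed
  ultimately show ?thesis ..
qed

end
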